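(* Let $1\le p\le\infty$, $\alpha,\beta,\gamma>0$ and $\rho,\eta\in\mathbb{R}$. Then there exist functions $G_k=G_{k,\gamma,\alpha,\beta},\ H_k=H_{k,\gamma,\alpha,\beta}\in E(\mathbb{C})$, $k=0,\dots,n$, such that $$K_\gamma(w,z)=\sum_{k=0}^n G_{k}(w\overline{z})H_{k}(w\overline{z})\qquad (w,z\in\mathbb{C}^n)$$ and $$\|K_{\gamma,z}\|_{F^1_{\alpha+\beta,\rho+\eta}}\simeq \sum_{k=0}^n\|G_{k}(\cdot\,\overline{z})\|_{F^p_{\alpha,\rho}}\|H_{k}(\cdot\,\overline{z})\|_{F^{p'}_{\beta,\eta}}\simeq (1+|z|)^{\rho+\eta}e^{\frac{\gamma^2|z|^{2\ell}}{2(\alpha+\beta)}}\qquad(z\in\mathbb{C}^n).$$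
   Context: Fix an integer $n\ge 1$ and a real number $\ell\ge 1$. $p'=p/(p-1)$ is the conjugate exponent ($1'=\infty$, $\infty'=1$). $dV$ is Lebesgue measure on $\mathbb{C}^n$ normalized so that the unit ball has measure $1$. For $z,w\in\mathbb{C}^n$, $w\overline z=\sum_{j=1}^n w_j\overline{z}_j\in\mathbb{C}$. For $1\le p<\infty$, $\alpha>0$, $\rho\in\mathbb{R}$, $F^p_{\alpha,\rho}$ is the space of entire functions $f$ on $\mathbb{C}^n$ with $\|f\|_{F^p_{\alpha,\rho}}^p=\int_{\mathbb{C}^n}|f(z)(1+|z|)^{\rho}e^{-\frac{\alpha}{2}|z|^{2\ell}}|^p\,dV(z)<\infty$; $F^\infty_{\alpha,\rho}$ is the space of entire $f$ with $\|f\|_{F^\infty_{\alpha,\rho}}=\sup_{z}|f(z)|(1+|z|)^{\rho}e^{-\frac{\alpha}{2}|z|^{2\ell}}<\infty$. $E(\mathbb{C})$ is the space of entire functions $f$ on $\mathbb{C}$ such that $|f(\lambda)|=O(e^{\tau|\lambda|^\ell})$ for some $\tau>0$. $K_\gamma$ is the Bergman kernel, i.e. the reproducing kernel of the Hilbert space $F^2_\gamma=F^2_{\gamma,0}$ with inner product $\langle f,g\rangle_\gamma=\int_{\mathbb{C}^n}f\overline{g}\,e^{-\gamma|z|^{2\ell}}dV(z)$: $f(z)=\langle f,K_{\gamma,z}\rangle_\gamma$ for $f\in F^2_\gamma$, where $K_{\gamma,z}(w)=K_\gamma(w,z)=\overline{K_\gamma(z,w)}$. $G_k(\cdot\,\overline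 z)$ denotes the function $w\mapsto G_k(w\overline z)$ on $\mathbb{C}^n$, and similarly for $H_k$. The subscripts in $G_{k,\gamma,\alpha,\beta}$, $H_{k,\gamma,\alpha,\beta}$ indicate the parameters (besides the fixed $n,\ell$) on which the functions depend; in particular they do not depend on $p,\rho,\eta$. $\Phi\lesssim\Psi$ means $\Phi\le C\Psi$ with a constant $C>0$ independent of $z$; $\Phi\simeq\Psi$ means $\Phi\lesssim\Psi$ and $\Psi\lesssim\Phi$. *)

theory Defs
  imports "HOL-Analysis.Analysis" "HOL-Library.Landau_Symbols"
begin

text \<open>The space \<open>\<complex>\<^sup>n\<close> is \<open>complex ^ 'n\<close> with \<open>n = CARD('n)\<close>; its library norm is the
  Euclidean norm \<open>\<bar>z\<bar>\<close>.\<close>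

definition cprod :: "complex ^ 'n \<Rightarrow> complex ^ 'n \<Rightarrow> complex" where
  "cprod w z = (\<Sum>j\<in>UNIV. w $ j * cnj (z $ j))"

definition entire :: "(complex ^ 'n \<Rightarrow> complex) \<Rightarrow> bool" where
  "entire f \<longleftrightarrow>
     (\<forall>z. \<exists>D. (f has_derivative D) (at z) \<and> (\<forall>c v. D (c *s v) = c * D v))"

definition dV :: "(complex ^ 'n) measure" where
  "dV = density lborel (\<lambda>_. ennreal (1 / measure lborel (ball (0 :: complex ^ 'n) 1)))"

text \<open>Exponents range over \<open>[1, \<infinity>]\<close> inside \<^typ>\<open>ennreal\<close>.\<close>

definition conj_exponent :: "ennreal \<Rightarrow> ennreal" where
  "conj_exponent p = (if p = 1 then \<infinity> else if p = \<infinity> then 1 else p / (p - 1))"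

definition weighted_abs ::
    "real \<Rightarrow> real \<Rightarrow> real \<Rightarrow> (complex ^ 'n \<Rightarrow> complex) \<Rightarrow> complex ^ 'n \<Rightarrow> real" where
  "weighted_abs l \<alpha> \<rho> f z =
     norm (f z) * (1 + norm z) powr \<rho> * exp (- (\<alpha> / 2) * norm z powr (2 * l))"

definition Fock_space ::
    "real \<Rightarrow> ennreal \<Rightarrow> real \<Rightarrow> real \<Rightarrow> (complex ^ 'n \<Rightarrow> complex) set" where
  "Fock_space l p \<alpha> \<rho> =
     {f. entire f \<and>
         (if p = \<infinity> then bdd_above (range (weighted_abs l \<alpha> \<rho> f))
          else integrable dV (\<lambda>z. weighted_abs l \<alpha> \<rho> f z powr enn2real p))}"

text \<open>Real-valued, hence meaningful only on \<^const>\<open>Fock_space\<close>: off it the value is arbitrary.\<close>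

definition Fock_norm ::
    "real \<Rightarrow> ennreal \<Rightarrow> real \<Rightarrow> real \<Rightarrow> (complex ^ 'n \<Rightarrow> complex) \<Rightarrow> real" where
  "Fock_norm l p \<alpha> \<rho> f =
     (if p = \<infinity> then (SUP z. weighted_abs l \<alpha> \<rho> f z)
      else (\<integral>z. weighted_abs l \<alpha> \<rho> f z powr enn2real p \<partial>dV) powr (1 / enn2real p))"

definition E_class :: "real \<Rightarrow> (complex \<Rightarrow> complex) set" where
  "E_class l =
     {f. f holomorphic_on UNIV \<and>
         (\<exists>\<tau>>0. (\<lambda>x. norm (f x)) \<in> O[at_infinity](\<lambda>x. exp (\<tau> * norm x powr l)))}"

definition Fock_inner ::
    "real \<Rightarrow> real \<Rightarrow> (complex ^ 'n \<Rightarrow> complex) \<Rightarrow> (complex ^ 'n \<Rightarrow> complex) \<Rightarrow> complex" where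
  "Fock_inner l \<gamma> f g =
     (\<integral>z. f z * cnj (g z) * complex_of_real (exp (- \<gamma> * norm z powr (2 * l))) \<partial>dV)"

definition is_reproducing_kernel ::
    "real \<Rightarrow> real \<Rightarrow> (complex ^ 'n \<Rightarrow> complex ^ 'n \<Rightarrow> complex) \<Rightarrow> bool" where
  "is_reproducing_kernel l \<gamma> K \<longleftrightarrow>
     (\<forall>z. (\<lambda>w. K w z) \<in> Fock_space l 2 \<gamma> 0 \<and>
          (\<forall>f \<in> Fock_space l 2 \<gamma> 0. f z = Fock_inner l \<gamma> f (\<lambda>w. K w z)))"

text \<open>The reproducing property determines \<open>K\<close>, and the Hermitian symmetry
  \<open>K w z = cnj (K z w)\<close> follows from it.\<close>

definition Bergman_kernel ::
    "real \<Rightarrow> real \<Rightarrow> complex ^ 'n \<Rightarrow> complex ^ 'n \<Rightarrow> complex" where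
  "Bergman_kernel l \<gamma> = (THE K. is_reproducing_kernel l \<gamma> K)"

definition lesssim :: "('a \<Rightarrow> real) \<Rightarrow> ('a \<Rightarrow> real) \<Rightarrow> bool" (infix "\<lesssim>" 50) where
  "\<Phi> \<lesssim> \<Psi> \<longleftrightarrow> (\<exists>C>0. \<forall>z. \<Phi> z \<le> C * \<Psi> z)"

definition simeq :: "('a \<Rightarrow> real) \<Rightarrow> ('a \<Rightarrow> real) \<Rightarrow> bool" (infix "\<simeq>" 50) where
  "\<Phi> \<simeq> \<Psi> \<longleftrightarrow> \<Phi> \<lesssim> \<Psi> \<and> \<Psi> \<lesssim> \<Phi>"

end

theory Submission
  imports Defs "HOL-Complex_Analysis.Complex_Analysis" "HOL-Probability.Sinc_Integral"
begin

text \<open>Write \<open>n = CARD('n)\<close> and let \<open>M c x = (\<Sum>m. c powr (m/l) * x ^ m / Gamma (m/l + 1))\<close> be the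
Mittag-Leffler function of index \<open>1/l\<close>, rescaled (\<^term>\<open>scaled_ml\<close> below).

The kernel. The weight \<open>exp (- \<gamma> * \<bar>w\<bar> powr (2 * l))\<close> is invariant under rotations, so homogeneous
components of different degrees are orthogonal and the kernel is a power series in \<open>cprod w z\<close>. Its coefficients are the
reciprocals of moments of the weight, which are explicit in terms of the Gamma function; summing the series gives
\<open>K w z = (deriv ^^ n) (M \<gamma>) (cprod w z) / fact n\<close> (lemma \<open>Bergman_kernel_eq\<close>).

The factorization. At \<open>x = p powr (1/l)\<close> with \<open>Re p > 0\<close> one has \<open>M c x = l * exp (c * p)\<close> up to an error of
small exponential type, and away from the corresponding sector \<open>M c x\<close> itself has small type. Since
\<open>exp ((a + b) * p) = exp (a * p) * exp (b * p)\<close>, a multiple of \<open>M a * deriv (M b)\<close> has the same leading term as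
\<open>deriv (M (a + b))\<close>, and the difference has every type exceeding \<open>max a b\<close> although each of the two functions
has type \<open>a + b\<close> (lemma \<open>factor_remainder_bound\<close>). Differentiating \<open>n - 1\<close> more times, Leibniz' rule yields \<open>n\<close>
products of derivatives of \<open>M a\<close> and \<open>M b\<close>; the last pair consists of the differentiated remainder
and the constant 1. The choice that makes the norms match is \<open>a = \<alpha> * \<gamma> / (\<alpha> + \<beta>)\<close> and
\<open>b = \<beta> * \<gamma> / (\<alpha> + \<beta>)\<close>: then \<open>a / \<alpha> = b / \<beta> = \<gamma> / (\<alpha> + \<beta>)\<close>, so that the weighted functions
\<open>w \<mapsto> G (cprod w z)\<close>, \<open>w \<mapsto> H (cprod w z)\<close> and \<open>w \<mapsto> K w z\<close> all concentrate near the same point \<open>t z\<close>,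
where \<open>t powr l = \<gamma> / (\<alpha> + \<beta>)\<close>.

The norms from above. Around \<open>t z\<close> the weighted functions are dominated by Gaussians of width
\<open>(1 + \<bar>z\<bar>) powr (1 - l)\<close>. This bounds their \<open>p\<close>-norms by an explicit power of \<open>1 + \<bar>z\<bar>\<close> times
\<open>exp (a\<^sup>2 * \<bar>z\<bar> powr (2 * l) / (2 * \<alpha>))\<close>, respectively with \<open>b\<close> and \<open>\<beta>\<close>
(lemma \<open>Fock_norm_cprod_growth\<close>). In a product of two such bounds the dependence on \<open>p\<close> cancels because
\<open>1/p + 1/p' = 1\<close>, and \<open>a\<^sup>2 / (2 * \<alpha>) + b\<^sup>2 / (2 * \<beta>) = \<gamma>\<^sup>2 / (2 * (\<alpha> + \<beta>))\<close>. The remainder is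
assigned to the space with the larger of \<open>\<alpha>\<close>, \<open>\<beta>\<close>, where its type is small enough to leave
exponential room (lemma \<open>Fock_norm_product_type\<close>).

Closing the circle. By Hoelder's inequality the norm of the kernel is at most the sum of the products of
norms. For the lower bound on the norm of the kernel, average over the ball of radius comparable to
\<open>(1 + \<bar>z\<bar>) powr (1 - l)\<close> about \<open>t z\<close>. There the weight is comparable to the modulus of the
exponential of a complex linear function, so the mean value property bounds the average below by
the weighted value at the centre, and that value lies on the positive axis, where \<open>(deriv ^^ n) (M \<gamma>)\<close> is at
least a multiple of \<open>(1 + x) powr (n * (l - 1)) * exp (\<gamma> * x powr l)\<close> (lemmas \<open>Fock_norm_1_point_lower\<close> and
\<open>real_profile_lower\<close>).\<close>

section \<open>Integrals along vertical lines\<close>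

lemma integrable_inverse_1_plus_square_line:
  "integrable lborel (\<lambda>t::real. inverse (1 + t\<^sup>2))"
  using integrable_I0i_1_div_plus_square integrable_inverse_1_plus_square
  by (simp add: set_integrable_def)

text \<open>The fundamental theorem of calculus along a vertical line: the factor \<open>\<i>\<close> is the derivative of the
parametrization, and symmetric truncations converge because of absolute integrability.\<close>

lemma integral_line_primitive:
  fixes P g :: "complex \<Rightarrow> complex"
  assumes P: "\<And>t. (P has_field_derivative g (Complex c t)) (at (Complex c t))"
    and cont: "continuous_on UNIV (\<lambda>t. g (Complex c t))"
    and int: "integrable lborel (\<lambda>t. g (Complex c t))"
  shows "(\<lambda>k. P (Complex c (real k)) - P (Complex c (- real k)))
           \<longlonglongrightarrow> \<i> * (\<integral>t. g (Complex c t) \<partial>lborel)"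
proof -
  have lim: "(\<lambda>k. \<integral>t. indicator {- real k .. real k} t *\<^sub>R (\<i> * g (Complex c t)) \<partial>lborel)
      \<longlonglongrightarrow> (\<integral>t. \<i> * g (Complex c t) \<partial>lborel)"
  proof (rule integral_dominated_convergence[where w = "\<lambda>t. norm (g (Complex c t))"])
    show "AE t in lborel. (\<lambda>k. indicator {- real k .. real k} t *\<^sub>R (\<i> * g (Complex c t)))
        \<longlonglongrightarrow> \<i> * g (Complex c t)"
    proof (intro AE_I2)
      fix t :: real
      obtain n where n: "\<bar>t\<bar> \<le> real n" using real_arch_simple by blast
      have "eventually (\<lambda>k. indicator {- real k .. real k} t *\<^sub>R (\<i> * g (Complex c t)) = \<i> * g (Complex c t)) sequentially"
        using eventually_ge_at_top[of n] by eventually_elim (use n in \<open>auto simp: indicator_def\<close>)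
      then show "(\<lambda>k. indicator {- real k .. real k} t *\<^sub>R (\<i> * g (Complex c t))) \<longlonglongrightarrow> \<i> * g (Complex c t)"
        by (rule tendsto_eventually)
    qed
  qed (use int in \<open>auto simp: norm_mult indicator_def intro: borel_measurable_integrable\<close>)
  have eq: "(\<integral>t. indicator {- real k .. real k} t *\<^sub>R (\<i> * g (Complex c t)) \<partial>lborel)
      = P (Complex c (real k)) - P (Complex c (- real k))" for k
  proof -
    have "(\<integral>t. indicator {- real k .. real k} t *\<^sub>R (\<i> * g (Complex c t)) \<partial>lborel)
       = P (Complex c (real k)) - P (Complex c (- real k))"
    proof (rule integral_FTC_Icc)
      fix t :: real assume "- real k \<le> t" "t \<le> real k"
      have "((\<lambda>t. P (Complex c t)) has_vector_derivative \<i> * g (Complex c t)) (at t)"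
      proof -
        have "Complex c = (\<lambda>t. of_real c + \<i> * of_real t)" by (auto simp: complex_eq_iff)
        then have "(Complex c has_vector_derivative \<i>) (at t)"
          by (auto intro!: derivative_eq_intros has_vector_derivative_real_field)
        from field_vector_diff_chain_at[OF this P[of t]] show ?thesis by (simp add: o_def)
      qed
      then show "((\<lambda>t. P (Complex c t)) has_vector_derivative \<i> * g (Complex c t)) (at t within {- real k..real k})"
        by (rule has_vector_derivative_at_within)
    qed (auto intro!: continuous_intros continuous_on_subset[OF cont])
    then show ?thesis by simp
  qed
  show ?thesis using lim unfolding eq by simp
qed

text \<open>A primitive on the half-plane replaces Cauchy's theorem for a rectangle: its increments over the
horizontal sides vanish in the limit by the quadratic decay.\<close>

lemma integral_line_shift:
  fixes g :: "complex \<Rightarrow> complex"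
  assumes hol: "g holomorphic_on {s. Re s > d}" and "d < c1" "c1 \<le> c2"
    and bd: "\<And>s. c1 \<le> Re s \<Longrightarrow> Re s \<le> c2 \<Longrightarrow> norm (g s) \<le> C / (1 + (Im s)\<^sup>2)"
  shows "(\<integral>t. g (Complex c1 t) \<partial>lborel) = (\<integral>t. g (Complex c2 t) \<partial>lborel)"
proof -
  have cv: "convex {s. Re s > d}" and op: "open {s. Re s > d}"
    by (simp_all add: convex_halfspace_Re_gt open_halfspace_Re_gt)
  obtain P where P: "\<And>s. s \<in> {s. Re s > d} \<Longrightarrow> (P has_field_derivative g s) (at s within {s. Re s > d})"
    using holomorphic_convex_primitive'[OF cv op hol] by blast
  have P': "(P has_field_derivative g s) (at s)" if "Re s > d" for s
    using P[of s] that at_within_open[OF _ op, of s] by simp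
  have cont: "continuous_on UNIV (\<lambda>t. g (Complex c t))" if "c > d" for c
    by (rule continuous_on_compose2[OF holomorphic_on_imp_continuous_on[OF hol]])
       (use that in \<open>auto simp: Complex_eq intro!: continuous_intros\<close>)
  have int: "integrable lborel (\<lambda>t. g (Complex c t))" if "c1 \<le> c" "c \<le> c2" for c
  proof (rule Bochner_Integration.integrable_bound)
    show "integrable lborel (\<lambda>t. C * inverse (1 + t\<^sup>2))"
      by (intro integrable_mult_right integrable_inverse_1_plus_square_line)
    show "(\<lambda>t. g (Complex c t)) \<in> borel_measurable lborel"
      using borel_measurable_continuous_onI[OF cont] that assms by simp
    show "AE t in lborel. norm (g (Complex c t)) \<le> norm (C * inverse (1 + t\<^sup>2))"
      using bd[of "Complex c t" for t] that by (intro AE_I2) (auto simp: divide_inverse intro: order_trans[OF _ abs_ge_self])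
  qed
  have lim: "(\<lambda>k. P (Complex c (real k)) - P (Complex c (- real k))) \<longlonglongrightarrow> \<i> * (\<integral>t. g (Complex c t) \<partial>lborel)"
    if "c1 \<le> c" "c \<le> c2" for c
    using that assms by (intro integral_line_primitive P' cont int) auto
  have horiz: "(\<lambda>k. P (Complex c2 (u * real k)) - P (Complex c1 (u * real k))) \<longlonglongrightarrow> 0" if u: "u\<^sup>2 = 1" for u :: real
  proof (rule Lim_null_comparison)
    show "eventually (\<lambda>k. norm (P (Complex c2 (u * real k)) - P (Complex c1 (u * real k)))
        \<le> C / (1 + (real k)\<^sup>2) * (c2 - c1)) sequentially"
    proof (intro always_eventually allI)
      fix k :: nat
      have sub: "closed_segment (Complex c1 (u * real k)) (Complex c2 (u * real k)) \<subseteq> {s. c1 \<le> Re s \<and> Re s \<le> c2 \<and> Im s = u * real k}"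
      proof (rule closed_segment_subset)
        have "{s. c1 \<le> Re s \<and> Re s \<le> c2 \<and> Im s = u * real k} = {s. Re s \<ge> c1} \<inter> {s. Re s \<le> c2} \<inter> {s. Im s \<ge> u * real k} \<inter> {s. Im s \<le> u * real k}" by auto
        then show "convex {s. c1 \<le> Re s \<and> Re s \<le> c2 \<and> Im s = u * real k}"
          by (simp add: convex_Int convex_halfspace_Re_ge convex_halfspace_Re_le convex_halfspace_Im_ge convex_halfspace_Im_le)
      qed (use assms in auto)
      have "norm (P (Complex c2 (u * real k)) - P (Complex c1 (u * real k)))
          \<le> C / (1 + (real k)\<^sup>2) * norm (Complex c2 (u * real k) - Complex c1 (u * real k))"
      proof (rule field_differentiable_bound[where f' = g])
        fix s assume s: "s \<in> closed_segment (Complex c1 (u * real k)) (Complex c2 (u * real k))"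
        then have s': "c1 \<le> Re s" "Re s \<le> c2" "Im s = u * real k" using sub by auto
        show "(P has_field_derivative g s) (at s within closed_segment (Complex c1 (u * real k)) (Complex c2 (u * real k)))"
          by (rule has_field_derivative_at_within, rule P') (use s' assms in auto)
        show "norm (g s) \<le> C / (1 + (real k)\<^sup>2)"
          using bd[of s] s' u by (simp add: power_mult_distrib)
      qed auto
      also have "norm (Complex c2 (u * real k) - Complex c1 (u * real k)) = c2 - c1"
        using assms by (simp add: cmod_def)
      finally show "norm (P (Complex c2 (u * real k)) - P (Complex c1 (u * real k))) \<le> C / (1 + (real k)\<^sup>2) * (c2 - c1)" .
    qed
    have "(\<lambda>k. 1 / (1 + (real k)\<^sup>2)) \<longlonglongrightarrow> 0" by real_asymp
    then have "(\<lambda>k. C * (c2 - c1) * (1 / (1 + (real k)\<^sup>2))) \<longlonglongrightarrow> C * (c2 - c1) * 0"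
      by (intro tendsto_intros)
    then show "(\<lambda>k. C / (1 + (real k)\<^sup>2) * (c2 - c1)) \<longlonglongrightarrow> 0" by (simp add: mult.commute mult.left_commute)
  qed
  have "(\<lambda>k. (P (Complex c2 (real k)) - P (Complex c2 (- real k))) - (P (Complex c1 (real k)) - P (Complex c1 (- real k)))) \<longlonglongrightarrow>
      \<i> * (\<integral>t. g (Complex c2 t) \<partial>lborel) - \<i> * (\<integral>t. g (Complex c1 t) \<partial>lborel)"
    using assms by (intro tendsto_diff lim) auto
  moreover have "(\<lambda>k. (P (Complex c2 (real k)) - P (Complex c2 (- real k))) - (P (Complex c1 (real k)) - P (Complex c1 (- real k)))) \<longlonglongrightarrow> 0"
    using tendsto_diff[OF horiz[of 1] horiz[of "-1"]] by (simp add: algebra_simps)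
  ultimately have "\<i> * (\<integral>t. g (Complex c2 t) \<partial>lborel) - \<i> * (\<integral>t. g (Complex c1 t) \<partial>lborel) = 0"
    using LIMSEQ_unique by blast
  then show ?thesis by simp
qed

section \<open>Hankel's integral for the reciprocal Gamma function\<close>

text \<open>Hankel's integral over the line \<open>Re s = 1\<close> is a constant multiple of \<open>1 / Gamma \<mu>\<close>, and the constant is recorded
as the value at \<open>\<mu> = 2\<close>. The restriction \<open>\<mu> \<ge> 2\<close> in the lemmas gives absolute convergence.\<close>

definition recip_gamma_integrand :: "real \<Rightarrow> complex \<Rightarrow> complex" where
  "recip_gamma_integrand \<mu> s = exp s * s powr (- of_real \<mu>)"

definition recip_gamma_integral :: "real \<Rightarrow> complex" where
  "recip_gamma_integral \<mu> = (\<integral>t. recip_gamma_integrand \<mu> (Complex 1 t) \<partial>lborel)"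

lemma Re_pos_nonneg_Reals: "Re s > 0 \<Longrightarrow> s \<notin> \<real>\<^sub>\<le>\<^sub>0"
  by (auto simp: complex_nonpos_Reals_iff)

lemma inverse_norm_power2_le:
  assumes "0 < c" "c \<le> Re s"
  shows "1 / (norm s)\<^sup>2 \<le> (1 / min 1 (c\<^sup>2)) / (1 + (Im s)\<^sup>2)"
proof -
  have m: "min 1 (c\<^sup>2) > 0" using assms by simp
  have "c\<^sup>2 \<le> (Re s)\<^sup>2" using assms by (intro power_mono) auto
  moreover have "min 1 (c\<^sup>2) * (Im s)\<^sup>2 \<le> 1 * (Im s)\<^sup>2" by (intro mult_right_mono) auto
  ultimately have "min 1 (c\<^sup>2) * (1 + (Im s)\<^sup>2) \<le> (norm s)\<^sup>2"
    unfolding cmod_power2 distrib_left by linarith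
  moreover have "min 1 (c\<^sup>2) * (1 + (Im s)\<^sup>2) > 0" using m by (intro mult_pos_pos) (auto simp: add_pos_nonneg)
  ultimately have "1 / (norm s)\<^sup>2 \<le> 1 / (min 1 (c\<^sup>2) * (1 + (Im s)\<^sup>2))"
    by (intro frac_le) auto
  then show ?thesis by (simp add: field_simps)
qed

lemma norm_powr_minus_le:
  assumes "2 \<le> \<mu>" "0 < c" "c \<le> Re s"
  shows "norm (s powr (- of_real \<mu>)) \<le> c powr (2 - \<mu>) / (norm s)\<^sup>2"
proof -
  have s: "c \<le> norm s" using assms complex_Re_le_cmod[of s] by linarith
  have "norm (s powr (- of_real \<mu>)) = norm s powr (- \<mu>)"
    using norm_powr_real_powr'[of "- of_real \<mu>" s] by simp
  also have "\<dots> = norm s powr (2 - \<mu>) * norm s powr (- 2)"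
    by (simp flip: powr_add)
  also have "norm s powr (- 2) = 1 / (norm s)\<^sup>2"
    using s assms by (simp add: powr_minus powr_numeral field_simps)
  finally have "norm s powr (2 - \<mu>) * (1 / (norm s)\<^sup>2) \<le> c powr (2 - \<mu>) * (1 / (norm s)\<^sup>2) \<Longrightarrow> ?thesis" by simp
  moreover have "norm s powr (2 - \<mu>) \<le> c powr (2 - \<mu>)"
    using s assms by (intro powr_mono2') auto
  ultimately show ?thesis by (meson mult_right_mono divide_nonneg_nonneg zero_le_one zero_le_power2)
qed

lemma recip_gamma_integrand_bound:
  assumes "2 \<le> \<mu>" "0 < c1" "c1 \<le> Re s" "Re s \<le> c2"
  shows "norm (recip_gamma_integrand \<mu> s) \<le> (exp c2 * c1 powr (2 - \<mu>) / min 1 (c1\<^sup>2)) / (1 + (Im s)\<^sup>2)"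
proof -
  have "norm (recip_gamma_integrand \<mu> s) = exp (Re s) * norm (s powr (- of_real \<mu>))"
    by (simp add: recip_gamma_integrand_def norm_mult)
  also have "\<dots> \<le> exp c2 * (c1 powr (2 - \<mu>) * (1 / (norm s)\<^sup>2))"
    using norm_powr_minus_le[of \<mu> c1 s] assms by (intro mult_mono) auto
  also have "\<dots> \<le> exp c2 * (c1 powr (2 - \<mu>) * ((1 / min 1 (c1\<^sup>2)) / (1 + (Im s)\<^sup>2)))"
    using inverse_norm_power2_le[of c1 s] assms by (intro mult_left_mono) auto
  finally show ?thesis by simp
qed

lemma holomorphic_recip_gamma_integrand: "recip_gamma_integrand \<mu> holomorphic_on {s. Re s > 0}"
  unfolding recip_gamma_integrand_def[abs_def]
  by (intro holomorphic_intros) (auto dest: Re_pos_nonneg_Reals)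

lemma continuous_on_line:
  assumes "g holomorphic_on {s. Re s > d}" "c > d"
  shows "continuous_on UNIV (\<lambda>t. g (Complex c t))"
  by (rule continuous_on_compose2[OF holomorphic_on_imp_continuous_on[OF assms(1)]])
     (use assms(2) in \<open>auto simp: Complex_eq intro!: continuous_intros\<close>)

lemma integrable_line:
  fixes g :: "complex \<Rightarrow> complex"
  assumes hol: "g holomorphic_on {s. Re s > d}" and "d < c"
    and bd: "\<And>t. norm (g (Complex c t)) \<le> C / (1 + t\<^sup>2)"
  shows "integrable lborel (\<lambda>t. g (Complex c t))"
proof (rule Bochner_Integration.integrable_bound)
  show "integrable lborel (\<lambda>t. C * inverse (1 + t\<^sup>2))"
    by (intro integrable_mult_right integrable_inverse_1_plus_square_line)
  show "(\<lambda>t. g (Complex c t)) \<in> borel_measurable lborel"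
    using borel_measurable_continuous_onI[OF continuous_on_line[OF assms(1,2)]] by simp
  show "AE t in lborel. norm (g (Complex c t)) \<le> norm (C * inverse (1 + t\<^sup>2))"
    using bd by (intro AE_I2) (auto simp: divide_inverse intro: order_trans[OF _ abs_ge_self])
qed

lemma integrable_recip_gamma_integrand:
  assumes "2 \<le> \<mu>" "0 < c"
  shows "integrable lborel (\<lambda>t. recip_gamma_integrand \<mu> (Complex c t))"
  by (rule integrable_line[OF holomorphic_recip_gamma_integrand, where C = "exp c * c powr (2 - \<mu>) / min 1 (c\<^sup>2)"])
     (use assms recip_gamma_integrand_bound[of \<mu> c "Complex c t" c for t] in auto)

lemma recip_gamma_integral_line:
  assumes "2 \<le> \<mu>" "0 < c"
  shows "(\<integral>t. recip_gamma_integrand \<mu> (Complex c t) \<partial>lborel) = recip_gamma_integral \<mu>"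
proof -
  have "(\<integral>t. recip_gamma_integrand \<mu> (Complex (min c 1) t) \<partial>lborel) = (\<integral>t. recip_gamma_integrand \<mu> (Complex d t) \<partial>lborel)"
    if "min c 1 \<le> d" for d
    by (rule integral_line_shift[OF holomorphic_recip_gamma_integrand _ that recip_gamma_integrand_bound])
       (use assms in auto)
  from this[of c] this[of 1] show ?thesis by (simp add: recip_gamma_integral_def)
qed

text \<open>The integrand with parameter \<open>\<mu>\<close> has derivative equal to the integrand itself minus \<open>\<mu>\<close> times the one with parameter
\<open>\<mu> + 1\<close>, and it vanishes at both ends of the line. This is the functional equation of \<open>1 / Gamma\<close>.\<close>

lemma recip_gamma_integral_plus1:
  assumes "2 \<le> \<mu>"
  shows "recip_gamma_integral \<mu> = of_real \<mu> * recip_gamma_integral (\<mu> + 1)"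
proof -
  let ?F = "recip_gamma_integrand \<mu>"
  let ?f = "\<lambda>s. recip_gamma_integrand \<mu> s - of_real \<mu> * recip_gamma_integrand (\<mu> + 1) s"
  have "(\<lambda>k. ?F (Complex 1 (real k)) - ?F (Complex 1 (- real k))) \<longlonglongrightarrow> \<i> * (\<integral>t. ?f (Complex 1 t) \<partial>lborel)"
  proof (rule integral_line_primitive)
    fix t
    define a where "a = - complex_of_real \<mu>"
    have "Complex 1 t \<notin> \<real>\<^sub>\<le>\<^sub>0" by (rule Re_pos_nonneg_Reals) simp
    then have "((\<lambda>s. exp s * s powr a) has_field_derivative
        exp (Complex 1 t) * (a * Complex 1 t powr (a - 1)) + exp (Complex 1 t) * Complex 1 t powr a) (at (Complex 1 t))"
      by (intro DERIV_mult[OF DERIV_exp, THEN DERIV_cong] has_field_derivative_powr) (use \<open>Complex 1 t \<notin> \<real>\<^sub>\<le>\<^sub>0\<close> in \<open>auto simp: mult_ac add_ac intro: has_field_derivative_powr\<close>)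
    moreover have "a - 1 = - complex_of_real (\<mu> + 1)" by (simp add: a_def)
    ultimately show "(?F has_field_derivative ?f (Complex 1 t)) (at (Complex 1 t))"
      unfolding recip_gamma_integrand_def[abs_def] by (simp add: a_def mult_ac)
  next
    show "continuous_on UNIV (\<lambda>t. ?f (Complex 1 t))"
      by (intro continuous_intros continuous_on_line[OF holomorphic_recip_gamma_integrand]) auto
    show "integrable lborel (\<lambda>t. ?f (Complex 1 t))"
      using assms by (intro Bochner_Integration.integrable_diff integrable_mult_right integrable_recip_gamma_integrand) auto
  qed
  moreover have "(\<lambda>k. ?F (Complex 1 (u * real k))) \<longlonglongrightarrow> 0" if "u\<^sup>2 = 1" for u
  proof (rule Lim_null_comparison)
    show "eventually (\<lambda>k. norm (?F (Complex 1 (u * real k))) \<le> exp 1 / (1 + (real k)\<^sup>2)) sequentially"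
      using recip_gamma_integrand_bound[of \<mu> 1 "Complex 1 (u * real k)" 1 for k] assms that
      by (intro always_eventually) (auto simp: power_mult_distrib)
    show "(\<lambda>k. exp 1 / (1 + (real k)\<^sup>2)) \<longlonglongrightarrow> 0" by real_asymp
  qed
  from tendsto_diff[OF this[of 1] this[of "-1"]]
  have "(\<lambda>k. ?F (Complex 1 (real k)) - ?F (Complex 1 (- real k))) \<longlonglongrightarrow> 0" by simp
  ultimately have "(\<integral>t. ?f (Complex 1 t) \<partial>lborel) = 0" using LIMSEQ_unique by force
  also have "(\<integral>t. ?f (Complex 1 t) \<partial>lborel) = recip_gamma_integral \<mu> - of_real \<mu> * recip_gamma_integral (\<mu> + 1)"
    unfolding recip_gamma_integral_def using assms
    by (subst Bochner_Integration.integral_diff) (auto intro!: integrable_mult_right integrable_recip_gamma_integrand)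
  finally show ?thesis by simp
qed

lemma Gamma_recip_gamma_integral_shift:
  assumes "2 \<le> \<mu>"
  shows "of_real (Gamma (\<mu> + real N)) * recip_gamma_integral (\<mu> + real N) = of_real (Gamma \<mu>) * recip_gamma_integral \<mu>"
proof (induction N)
  case (Suc N)
  have "Gamma (\<mu> + real N + 1) = (\<mu> + real N) * Gamma (\<mu> + real N)"
    using assms by (intro Gamma_plus1) (auto elim!: nonpos_Ints_cases)
  moreover have "recip_gamma_integral (\<mu> + real N) = of_real (\<mu> + real N) * recip_gamma_integral (\<mu> + real N + 1)"
    using assms by (intro recip_gamma_integral_plus1) auto
  ultimately have "of_real (Gamma (\<mu> + real N + 1)) * recip_gamma_integral (\<mu> + real N + 1) = of_real (Gamma (\<mu> + real N)) * recip_gamma_integral (\<mu> + real N)"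
    by (simp only: of_real_mult mult_ac)
  also have "\<mu> + real N + 1 = \<mu> + real (Suc N)" by simp
  finally show ?case using Suc by simp
qed simp

lemma Ln_1_plus_quadratic:
  assumes "norm w \<le> 1/2"
  shows "norm (Ln (1 + w) - w + w\<^sup>2 / 2) \<le> 8 * norm w ^ 3"
proof -
  define f where "f = (\<lambda>(k::nat) z::complex. if k = 0 then Ln (1 + z) else if k = 1 then inverse (1 + z)
      else if k = 2 then - (inverse (1 + z) ^ 2) else 2 * inverse (1 + z) ^ 3)"
  have nz: "Re (1 + z) > 0 \<and> norm (1 + z) \<ge> 1/2" if "z \<in> cball 0 (1/2)" for z :: complex
    using that abs_Re_le_cmod[of z] norm_triangle_ineq4[of "1 + z" z] by (auto simp: dist_norm)
  have "norm (f 0 w - (\<Sum>i\<le>2. f i 0 * (w - 0) ^ i / fact i)) \<le> 16 * norm (w - 0) ^ Suc 2 / fact 2"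
  proof (rule field_Taylor[of "cball 0 (1/2)"])
    fix i :: nat and z :: complex assume z: "z \<in> cball 0 (1/2)" and i: "i \<le> 2"
    have "1 + z \<notin> \<real>\<^sub>\<le>\<^sub>0" "1 + z \<noteq> 0" using nz[OF z] Re_pos_nonneg_Reals[of "1 + z"] by auto
    moreover have "i = 0 \<or> i = 1 \<or> i = 2" using i by linarith
    moreover have "(Ln has_field_derivative inverse (1 + z)) (at (1 + z))" if "1 + z \<notin> \<real>\<^sub>\<le>\<^sub>0"
      using that by (rule has_field_derivative_Ln)
    moreover have "((\<lambda>z. inverse (1 + z)) has_field_derivative - (inverse (1 + z) ^ 2)) (at z)" if "1 + z \<noteq> 0"
      using that by (auto intro!: derivative_eq_intros simp: power2_eq_square)
    moreover from this have "((\<lambda>z. - (inverse (1 + z) ^ 2)) has_field_derivative 2 * inverse (1 + z) ^ 3) (at z)" if "1 + z \<noteq> 0"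
      using that by (auto intro!: derivative_eq_intros simp: power2_eq_square power3_eq_cube)
    ultimately have "(f i has_field_derivative f (Suc i) z) (at z)"
      unfolding f_def by (elim disjE) (auto intro!: derivative_eq_intros)
    then show "(f i has_field_derivative f (Suc i) z) (at z within cball 0 (1/2))"
      by (rule has_field_derivative_at_within)
  next
    fix z :: complex assume z: "z \<in> cball 0 (1/2)"
    have "inverse (norm (1 + z)) \<le> inverse (1/2)" using nz[OF z] by (intro le_imp_inverse_le) auto
    then have "inverse (norm (1 + z)) ^ 3 \<le> 2 ^ 3" by (intro power_mono) auto
    then show "norm (f (Suc 2) z) \<le> 16" by (simp add: f_def norm_mult norm_power norm_inverse)
  qed (use assms in auto)
  then show ?thesis by (simp add: f_def eval_nat_numeral algebra_simps)
qed

text \<open>The next three lemmas carry out the saddle point method on the line \<open>Re s = X\<close>, \<open>X = 2 * Suc N\<close>,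
with \<open>s = X + \<i> * sqrt X * v\<close>: the integrand tends to a Gaussian, uniformly dominated by Bernoulli's inequality.\<close>

lemma saddle_point_pointwise:
  "(\<lambda>N. exp (\<i> * of_real (v * sqrt (2 * real (Suc N)))) *
        (1 + \<i> * of_real (v / sqrt (2 * real (Suc N)))) powr (- of_real (\<mu> + 2 * real (Suc N))))
     \<longlonglongrightarrow> exp (- (of_real (v\<^sup>2 / 2) :: complex))"
proof -
  define r where "r N = sqrt (2 * real (Suc N))" for N
  define w where "w N = \<i> * complex_of_real (v / r N)" for N
  have r: "r N > 0" "r N ^ 2 = 2 * real (Suc N)" for N by (auto simp: r_def)
  have r_lim: "filterlim r at_top sequentially" unfolding r_def by real_asymp
  have w_lim: "w \<longlonglongrightarrow> 0"
  proof -
    have "(\<lambda>N. v / r N) \<longlonglongrightarrow> 0" unfolding r_def by real_asymp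
    then have "w \<longlonglongrightarrow> \<i> * of_real 0" unfolding w_def by (intro tendsto_intros)
    then show ?thesis by simp
  qed
  have Re1: "Re (1 + w N) > 0" for N by (simp add: w_def)
  have "(\<lambda>N. - of_real \<mu> * Ln (1 + w N)) \<longlonglongrightarrow> - of_real \<mu> * Ln (1 + 0)"
    by (intro tendsto_intros w_lim) auto
  then have A: "(\<lambda>N. - of_real \<mu> * Ln (1 + w N)) \<longlonglongrightarrow> 0" by simp
  have B: "(\<lambda>N. - of_real (r N ^ 2) * (Ln (1 + w N) - w N + (w N)\<^sup>2 / 2)) \<longlonglongrightarrow> 0"
  proof (rule Lim_null_comparison)
    have "eventually (\<lambda>N. norm (w N) < 1/2) sequentially"
      using w_lim[THEN tendsto_norm] by (rule order_tendstoD) simp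
    then show "eventually (\<lambda>N. norm (- of_real (r N ^ 2) * (Ln (1 + w N) - w N + (w N)\<^sup>2 / 2)) \<le> 8 * \<bar>v\<bar> ^ 3 / r N) sequentially"
    proof eventually_elim
      case (elim N)
      have "norm (- of_real (r N ^ 2) * (Ln (1 + w N) - w N + (w N)\<^sup>2 / 2)) \<le> r N ^ 2 * (8 * norm (w N) ^ 3)"
        unfolding norm_mult using Ln_1_plus_quadratic[of "w N"] elim by (intro mult_mono) (auto simp: norm_power)
      also have "norm (w N) = \<bar>v\<bar> / r N" using r[of N] by (simp add: w_def norm_mult norm_divide)
      also have "r N ^ 2 * (8 * (\<bar>v\<bar> / r N) ^ 3) = 8 * \<bar>v\<bar> ^ 3 / r N"
        using r(1)[of N] by (simp add: field_simps power2_eq_square power3_eq_cube)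
      finally show ?case .
    qed
    show "(\<lambda>N. 8 * \<bar>v\<bar> ^ 3 / r N) \<longlonglongrightarrow> 0" unfolding r_def by real_asymp
  qed
  have eq: "\<i> * of_real (v * r N) + - of_real (\<mu> + r N ^ 2) * Ln (1 + w N)
      = - of_real \<mu> * Ln (1 + w N) + - of_real (r N ^ 2) * (Ln (1 + w N) - w N + (w N)\<^sup>2 / 2) - of_real (v\<^sup>2 / 2)" for N
  proof -
    have "of_real (r N ^ 2) * w N = \<i> * of_real (v * r N)" "of_real (r N ^ 2) * (w N)\<^sup>2 = - of_real (v\<^sup>2)"
      using r(1)[of N] by (auto simp: w_def power2_eq_square field_simps)
    then have "\<i> * of_real (v * r N) = of_real (r N ^ 2) * (w N - (w N)\<^sup>2 / 2) - of_real (v\<^sup>2 / 2)"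
      by (simp add: right_diff_distrib)
    then show ?thesis by (simp add: algebra_simps)
  qed
  have "(\<lambda>N. exp (\<i> * of_real (v * r N) + - of_real (\<mu> + r N ^ 2) * Ln (1 + w N))) \<longlonglongrightarrow> exp (0 + 0 - of_real (v\<^sup>2/2))"
    unfolding eq by (intro tendsto_intros A B)
  moreover have "exp (\<i> * of_real (v * r N) + - of_real (\<mu> + r N ^ 2) * Ln (1 + w N))
      = exp (\<i> * of_real (v * r N)) * (1 + w N) powr (- of_real (\<mu> + r N ^ 2))" for N
  proof -
    have "1 + w N \<noteq> 0" using Re1[of N] by (metis less_irrefl zero_complex.simps(1))
    then show ?thesis by (simp only: powr_def exp_add if_False)
  qed
  ultimately show ?thesis unfolding r(2) w_def by (simp add: r_def)
qed

lemma saddle_point_norm: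
  assumes "\<mu> \<ge> 0"
  shows "norm (exp (\<i> * of_real (v * sqrt (2 * real (Suc N)))) *
        (1 + \<i> * of_real (v / sqrt (2 * real (Suc N)))) powr (- of_real (\<mu> + 2 * real (Suc N))))
    \<le> 2 * inverse (1 + v\<^sup>2)"
proof -
  define M where "M = Suc N"
  define x where "x = norm (1 + \<i> * complex_of_real (v / sqrt (2 * real M)))"
  have M: "real M > 0" by (simp add: M_def)
  have x2: "x\<^sup>2 = 1 + v\<^sup>2 / (2 * real M)"
    unfolding x_def cmod_power2 using M by (simp add: power_divide)
  have x1: "x \<ge> 1" using x2 M by (intro power2_le_imp_le[of 1 x]) (auto simp: x_def)
  have "norm (exp (\<i> * of_real (v * sqrt (2 * real M))) *
        (1 + \<i> * of_real (v / sqrt (2 * real M))) powr (- of_real (\<mu> + 2 * real M))) = x powr (- (\<mu> + 2 * real M))"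
    using norm_powr_real_powr'[of "- of_real (\<mu> + 2 * real M)" "1 + \<i> * complex_of_real (v / sqrt (2 * real M))"]
    by (simp add: norm_mult x_def)
  also have "\<dots> \<le> x powr (- real (2 * M))" using x1 assms by (intro powr_mono) auto
  also have "\<dots> = inverse (x ^ (2 * M))" using x1 by (subst powr_minus, subst powr_realpow) auto
  also have "x ^ (2 * M) = (1 + v\<^sup>2 / (2 * real M)) ^ M" by (simp add: power_mult x2)
  also have "inverse ((1 + v\<^sup>2 / (2 * real M)) ^ M) \<le> inverse (1 + v\<^sup>2 / 2)"
  proof (rule le_imp_inverse_le)
    have "1 + real M * (v\<^sup>2 / (2 * real M)) \<le> (1 + v\<^sup>2 / (2 * real M)) ^ M"
      by (rule Bernoulli_inequality) (use M in \<open>auto intro: order_trans[of _ 0]\<close>)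
    then show "1 + v\<^sup>2 / 2 \<le> (1 + v\<^sup>2 / (2 * real M)) ^ M" using M by simp
  qed (auto simp: add_pos_nonneg)
  also have "\<dots> \<le> 2 * inverse (1 + v\<^sup>2)" by (simp add: divide_simps add_pos_nonneg)
  finally show ?thesis by (simp add: M_def)
qed

lemma saddle_point_limit:
  assumes "\<mu> \<ge> 2"
  shows "(\<lambda>N. \<integral>v. exp (\<i> * of_real (v * sqrt (2 * real (Suc N)))) *
        (1 + \<i> * of_real (v / sqrt (2 * real (Suc N)))) powr (- of_real (\<mu> + 2 * real (Suc N))) \<partial>lborel)
    \<longlonglongrightarrow> (\<integral>v. exp (- (of_real (v\<^sup>2 / 2) :: complex)) \<partial>lborel)"
proof (rule integral_dominated_convergence)
  show "integrable lborel (\<lambda>v::real. 2 * inverse (1 + v\<^sup>2))"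
    by (intro integrable_mult_right integrable_inverse_1_plus_square_line)
  show "AE v in lborel. norm (exp (\<i> * of_real (v * sqrt (2 * real (Suc N)))) *
        (1 + \<i> * of_real (v / sqrt (2 * real (Suc N)))) powr (- of_real (\<mu> + 2 * real (Suc N)))) \<le> 2 * inverse (1 + v\<^sup>2)" for N
    using assms saddle_point_norm by (intro AE_I2) auto
  show "AE v in lborel. (\<lambda>N. exp (\<i> * of_real (v * sqrt (2 * real (Suc N)))) *
        (1 + \<i> * of_real (v / sqrt (2 * real (Suc N)))) powr (- of_real (\<mu> + 2 * real (Suc N))))
          \<longlonglongrightarrow> exp (- (of_real (v\<^sup>2 / 2) :: complex))"
    by (intro AE_I2 saddle_point_pointwise)
qed (auto intro!: borel_measurable_continuous_onI continuous_intros Re_pos_nonneg_Reals)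

lemma gauss_integral_nonzero: "(\<integral>v. exp (- (of_real (v\<^sup>2 / 2) :: complex)) \<partial>lborel) \<noteq> 0"
proof -
  have eq: "exp (- (of_real (v\<^sup>2 / 2) :: complex)) = of_real (exp (- (v\<^sup>2/2)))" for v :: real
    by (simp flip: exp_of_real)
  have int: "integrable lborel (\<lambda>v::real. exp (- (v\<^sup>2/2)))"
  proof (rule Bochner_Integration.integrable_bound)
    show "integrable lborel (\<lambda>v::real. 2 * inverse (1 + v\<^sup>2))"
      by (intro integrable_mult_right integrable_inverse_1_plus_square_line)
    have "exp (- (v\<^sup>2/2)) \<le> 2 * inverse (1 + v\<^sup>2)" for v :: real
    proof -
      have "1 + v\<^sup>2/2 \<le> exp (v\<^sup>2/2)" by simp
      then have "inverse (exp (v\<^sup>2/2)) \<le> inverse (1 + v\<^sup>2/2)" by (intro le_imp_inverse_le) (auto simp: add_pos_nonneg)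
      also have "\<dots> \<le> 2 * inverse (1 + v\<^sup>2)" by (simp add: divide_simps add_pos_nonneg)
      finally show ?thesis by (simp add: exp_minus)
    qed
    then show "AE v in lborel. norm (exp (- (v\<^sup>2/2)) :: real) \<le> norm (2 * inverse (1 + v\<^sup>2))"
      by (intro AE_I2) (auto intro: order_trans[OF _ abs_ge_self])
  qed auto
  have "(\<integral>v. exp (- ((v::real)\<^sup>2/2)) \<partial>lborel) \<noteq> 0"
  proof
    assume "(\<integral>v. exp (- ((v::real)\<^sup>2/2)) \<partial>lborel) = 0"
    then have "AE v::real in lborel. exp (- (v\<^sup>2/2)) = 0"
      using integral_nonneg_eq_0_iff_AE[OF int] by simp
    then show False by (simp add: eventually_False ae_filter_eq_bot_iff)
  qed
  then show ?thesis unfolding eq by simp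
qed

text \<open>The first factor tends to 1 by the definition of \<open>Gamma_series'\<close>, the second does not depend on \<open>\<mu>\<close>, and the third
has a limit independent of \<open>\<mu>\<close>; so the left-hand side, which is independent of \<open>N\<close>, is independent of \<open>\<mu>\<close>.\<close>

lemma recip_gamma_integral_saddle:
  assumes "\<mu> \<ge> 2"
  shows "of_real (Gamma \<mu>) * recip_gamma_integral \<mu> =
    of_real (Gamma \<mu> / Gamma_series' \<mu> (2 * Suc N)) *
    of_real (fact (2 * Suc N - 1) * sqrt (2 * real (Suc N)) * exp (2 * real (Suc N)) * (2 * real (Suc N)) powr (- (2 * real (Suc N)))) *
    (\<integral>v. exp (\<i> * of_real (v * sqrt (2 * real (Suc N)))) *
        (1 + \<i> * of_real (v / sqrt (2 * real (Suc N)))) powr (- of_real (\<mu> + 2 * real (Suc N))) \<partial>lborel)"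
    (is "_ = ?G * ?b * ?J")
proof -
  define M where "M = 2 * Suc N"
  define X where "X = real M"
  have X: "X > 0" "2 * real (Suc N) = X" by (auto simp: X_def M_def)
  define J where "J = (\<integral>v. exp (\<i> * of_real (v * sqrt X)) * (1 + \<i> * of_real (v / sqrt X)) powr (- of_real (\<mu> + X)) \<partial>lborel)"
  have "recip_gamma_integral (\<mu> + X) = (\<integral>t. recip_gamma_integrand (\<mu> + X) (Complex X t) \<partial>lborel)"
    using assms X by (subst recip_gamma_integral_line) auto
  also have "\<dots> = sqrt X *\<^sub>R (\<integral>v. recip_gamma_integrand (\<mu> + X) (Complex X (sqrt X * v)) \<partial>lborel)"
    using X lborel_integral_real_affine[of "sqrt X" "\<lambda>t. recip_gamma_integrand (\<mu> + X) (Complex X t)" 0] by simp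
  also have "(\<lambda>v. recip_gamma_integrand (\<mu> + X) (Complex X (sqrt X * v))) =
      (\<lambda>v. of_real (exp X * X powr (- (\<mu> + X))) * (exp (\<i> * of_real (v * sqrt X)) * (1 + \<i> * of_real (v / sqrt X)) powr (- of_real (\<mu> + X))))"
  proof
    fix v
    have "sqrt X * sqrt X = X" using X by simp
    then have c: "Complex X (sqrt X * v) = of_real X * (1 + \<i> * of_real (v / sqrt X))"
      using X by (simp add: complex_eq_iff field_simps)
    have "Complex X (sqrt X * v) powr (- of_real (\<mu> + X)) = of_real X powr (- of_real (\<mu> + X)) * (1 + \<i> * of_real (v / sqrt X)) powr (- of_real (\<mu> + X))"
      unfolding c using X by (intro powr_times_real_left) auto
    also have "complex_of_real X powr (- of_real (\<mu> + X)) = of_real (X powr (- (\<mu> + X)))"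
      using X powr_of_real[of X "- (\<mu> + X)"] by simp
    finally have p: "Complex X (sqrt X * v) powr (- of_real (\<mu> + X)) = of_real (X powr (- (\<mu> + X))) * (1 + \<i> * of_real (v / sqrt X)) powr (- of_real (\<mu> + X))" .
    have e: "exp (Complex X (sqrt X * v)) = of_real (exp X) * exp (\<i> * of_real (v * sqrt X))"
      by (simp add: Complex_eq exp_add mult_ac exp_of_real)
    show "recip_gamma_integrand (\<mu> + X) (Complex X (sqrt X * v)) = of_real (exp X * X powr (- (\<mu> + X))) * (exp (\<i> * of_real (v * sqrt X)) * (1 + \<i> * of_real (v / sqrt X)) powr (- of_real (\<mu> + X)))"
      unfolding recip_gamma_integrand_def p e by simp
  qed
  also have "(\<integral>v. of_real (exp X * X powr (- (\<mu> + X))) * (exp (\<i> * of_real (v * sqrt X)) * (1 + \<i> * of_real (v / sqrt X)) powr (- of_real (\<mu> + X))) \<partial>lborel) = of_real (exp X * X powr (- (\<mu> + X))) * J"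
    unfolding J_def by (rule integral_mult_right_zero)
  finally have I: "recip_gamma_integral (\<mu> + X) = of_real (sqrt X * exp X * X powr (- (\<mu> + X))) * J"
    by (simp add: scaleR_conv_of_real)
  have nz: "\<mu> \<notin> \<int>\<^sub>\<le>\<^sub>0" using assms by (auto elim!: nonpos_Ints_cases)
  have "pochhammer \<mu> M = Gamma (\<mu> + real M) / Gamma \<mu>" using nz by (rule pochhammer_Gamma)
  moreover have G: "Gamma \<mu> > 0" using assms by (intro Gamma_real_pos) auto
  moreover have P: "pochhammer \<mu> M > 0" using assms by (intro pochhammer_pos) auto
  ultimately have "Gamma (\<mu> + X) = Gamma \<mu> * pochhammer \<mu> M" by (simp add: X_def)
  also have "\<dots> = Gamma \<mu> / Gamma_series' \<mu> M * (fact (M - 1) * X powr \<mu>)"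
    using P X unfolding Gamma_series'_def by (simp add: powr_def X_def mult.commute)
  finally have "of_real (Gamma (\<mu> + X)) * recip_gamma_integral (\<mu> + X) =
     of_real (Gamma \<mu> / Gamma_series' \<mu> M * (fact (M - 1) * X powr \<mu>)) * (of_real (sqrt X * exp X * X powr (- (\<mu> + X))) * J)"
    using I by simp
  also have "\<dots> = of_real (Gamma \<mu> / Gamma_series' \<mu> M) * of_real (fact (M - 1) * sqrt X * exp X * (X powr \<mu> * X powr (- (\<mu> + X)))) * J"
    by simp
  also have "X powr \<mu> * X powr (- (\<mu> + X)) = X powr (- X)" by (simp flip: powr_add)
  finally show ?thesis
    using Gamma_recip_gamma_integral_shift[OF assms, of M] unfolding X(2) unfolding J_def M_def[symmetric] X_def[symmetric] by simp
qed

lemma recip_gamma_integral_const: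
  assumes "\<mu> \<ge> 2"
  shows "of_real (Gamma \<mu>) * recip_gamma_integral \<mu> = recip_gamma_integral 2"
    and "recip_gamma_integral 2 \<noteq> 0"
proof -
  define b :: "nat \<Rightarrow> complex" where "b N = of_real (fact (2 * Suc N - 1) * sqrt (2 * real (Suc N)) * exp (2 * real (Suc N)) * (2 * real (Suc N)) powr (- (2 * real (Suc N))))" for N
  define J where "J \<nu> N = (\<integral>v. exp (\<i> * of_real (v * sqrt (2 * real (Suc N)))) *
        (1 + \<i> * of_real (v / sqrt (2 * real (Suc N)))) powr (- of_real (\<nu> + 2 * real (Suc N))) \<partial>lborel)" for \<nu> N
  define L :: complex where "L = (\<integral>v. exp (- (of_real (v\<^sup>2 / 2) :: complex)) \<partial>lborel)"
  define q where "q \<nu> = of_real (Gamma \<nu>) * recip_gamma_integral \<nu>" for \<nu>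
  define r :: "real \<Rightarrow> nat \<Rightarrow> complex" where "r \<nu> N = of_real (Gamma \<nu> / Gamma_series' \<nu> (2 * Suc N)) * J \<nu> N" for \<nu> N
  have b: "b N \<noteq> 0" for N unfolding b_def of_real_eq_0_iff by simp
  have q: "q \<nu> = b N * r \<nu> N" if "\<nu> \<ge> 2" for \<nu> N
    using recip_gamma_integral_saddle[OF that, of N] by (simp add: q_def b_def J_def r_def mult_ac)
  have r: "r \<nu> \<longlonglongrightarrow> L" if "\<nu> \<ge> 2" for \<nu>
  proof -
    have G: "Gamma \<nu> > 0" using that by (intro Gamma_real_pos) auto
    have "(\<lambda>N. Gamma_series' \<nu> (2 * Suc N)) \<longlonglongrightarrow> Gamma \<nu>"
      using LIMSEQ_subseq_LIMSEQ[OF Gamma_series'_LIMSEQ[of \<nu>], of "\<lambda>N. 2 * Suc N"] by (simp add: strict_mono_def o_def)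
    then have "(\<lambda>N. of_real (Gamma \<nu> / Gamma_series' \<nu> (2 * Suc N)) * J \<nu> N) \<longlonglongrightarrow> of_real (Gamma \<nu> / Gamma \<nu>) * L"
      unfolding J_def L_def using G saddle_point_limit[OF that] by (intro tendsto_intros) auto
    then show ?thesis using G by (simp add: r_def[abs_def])
  qed
  have L: "L \<noteq> 0" unfolding L_def by (rule gauss_integral_nonzero)
  have ev: "eventually (\<lambda>N. r 2 N \<noteq> 0) sequentially" using r[of 2] L by (simp add: tendsto_imp_eventually_ne)
  then obtain N where "r 2 N \<noteq> 0" by (meson eventually_happens trivial_limit_sequentially)
  then have q2: "q 2 \<noteq> 0" using q[of 2 N] b by auto
  have "(\<lambda>N. r \<mu> N / r 2 N) \<longlonglongrightarrow> L / L" using L assms by (intro tendsto_divide r) auto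
  moreover have "eventually (\<lambda>N. r \<mu> N / r 2 N = q \<mu> / q 2) sequentially"
    using ev proof eventually_elim
      case (elim N)
      then show ?case using q[OF assms, of N] q[of 2 N] b[of N] by simp
    qed
  ultimately have "(\<lambda>N. q \<mu> / q 2) \<longlonglongrightarrow> L / L" by (rule Lim_transform_eventually)
  then have "(\<lambda>N. q \<mu> / q 2) \<longlonglongrightarrow> 1" using L by simp
  then have "q \<mu> / q 2 = 1" by (simp add: LIMSEQ_const_iff)
  then have "q \<mu> = q 2" using q2 by simp
  moreover have "Gamma 2 = (1::real)" using Gamma_fact[of 1, where 'a = real] by (simp add: numeral_2_eq_2)
  ultimately show "of_real (Gamma \<mu>) * recip_gamma_integral \<mu> = recip_gamma_integral 2" "recip_gamma_integral 2 \<noteq> 0"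
    using q2 by (auto simp: q_def)
qed

section \<open>The Mittag-Leffler function as a line integral\<close>

lemma complex_powr_power: "(s powr a) ^ n = s powr (of_nat n * a)" if "s \<noteq> 0" for s :: complex
  using that by (simp add: powr_def exp_of_nat_mult[symmetric] mult_ac)

text \<open>For exponents in \<open>{0<..1}\<close> the principal branch does not leave the right half-plane, so logarithms multiply.\<close>

lemma Ln_powr_of_real:
  assumes "Re s > 0" "0 < k" "k \<le> 1"
  shows "Ln (s powr (of_real k)) = of_real k * Ln s"
proof -
  have s: "s \<noteq> 0" using assms by auto
  have "\<bar>Im (Ln s)\<bar> < pi / 2" using Re_Ln_pos_lt[OF s] assms by simp
  moreover have "\<bar>k * Im (Ln s)\<bar> \<le> 1 * \<bar>Im (Ln s)\<bar>"
    unfolding abs_mult using assms by (intro mult_right_mono) auto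
  ultimately have "\<bar>k * Im (Ln s)\<bar> < pi" using pi_gt_zero by linarith
  then show ?thesis using s by (simp add: powr_def)
qed

lemma powr_inj_Re_pos:
  assumes "Re s > 0" "Re t > 0" "0 < k" "k \<le> 1" "s powr (of_real k) = t powr (of_real k)"
  shows "s = t"
proof -
  have "of_real k * Ln s = of_real k * Ln t"
    using Ln_powr_of_real[of s k] Ln_powr_of_real[of t k] assms by simp
  then have "Ln s = Ln t" using assms by simp
  then show ?thesis using assms by (metis exp_Ln zero_complex.simps(1) less_irrefl)
qed

definition mittag_leffler :: "real \<Rightarrow> real \<Rightarrow> complex \<Rightarrow> complex" where
  "mittag_leffler k \<mu> x = (\<Sum>m. x ^ m / of_real (Gamma (k * real m + \<mu>)))"

lemma recip_Gamma_eq: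
  assumes "\<nu> \<ge> 2"
  shows "1 / of_real (Gamma \<nu>) = recip_gamma_integral \<nu> / recip_gamma_integral 2"
proof -
  have "Gamma \<nu> > 0" using assms by (intro Gamma_real_pos) auto
  then show ?thesis using recip_gamma_integral_const[OF assms] by (simp add: field_simps)
qed

text \<open>Insert the integral for each reciprocal Gamma value and sum the geometric series, which converges uniformly
on the line because \<open>\<bar>s\<bar> \<ge> c\<close> there.\<close>

lemma mittag_leffler_line_integral:
  assumes k: "0 < k" and mu: "2 \<le> \<mu>" and c: "0 < c" and x: "norm x < c powr k"
  shows "(\<lambda>m. x ^ m / of_real (Gamma (k * real m + \<mu>))) sums
      ((\<integral>t. recip_gamma_integrand \<mu> (Complex c t) / (1 - x * Complex c t powr (- of_real k)) \<partial>lborel) / recip_gamma_integral 2)"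
    and "summable (\<lambda>m. norm (x ^ m / of_real (Gamma (k * real m + \<mu>))))"
proof -
  define q where "q = norm x / c powr k"
  have q: "0 \<le> q" "q < 1" using x c by (auto simp: q_def)
  define f where "f m t = x ^ m * recip_gamma_integrand (k * real m + \<mu>) (Complex c t)" for m t
  have mu': "k * real m + \<mu> \<ge> 2" for m using k mu by (simp add: add_nonneg_nonneg add.commute add_increasing2)
  have f_eq: "f m t = (x * Complex c t powr (- of_real k)) ^ m * recip_gamma_integrand \<mu> (Complex c t)" for m t
  proof -
    have nz: "Complex c t \<noteq> 0" using c by (auto simp: complex_eq_iff)
    have "Complex c t powr (- of_real (k * real m + \<mu>)) = (Complex c t powr (- of_real k)) ^ m * Complex c t powr (- of_real \<mu>)"
      unfolding complex_powr_power[OF nz] powr_add[symmetric] by (simp add: algebra_simps)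
    then show ?thesis by (simp add: f_def recip_gamma_integrand_def power_mult_distrib)
  qed
  have qn: "norm (x * Complex c t powr (- of_real k)) \<le> q" for t
  proof -
    have "c \<le> norm (Complex c t)" using complex_Re_le_cmod[of "Complex c t"] by simp
    then have "norm (Complex c t) powr (- k) \<le> c powr (- k)" using c k by (intro powr_mono2') auto
    then have "norm x * norm (Complex c t) powr (- k) \<le> norm x * c powr (- k)" by (rule mult_left_mono) simp
    then show ?thesis
      using norm_powr_real_powr'[of "- of_real k" "Complex c t"] by (simp add: norm_mult q_def powr_minus divide_inverse)
  qed
  have int: "integrable lborel (f m)" for m
    unfolding f_def using integrable_recip_gamma_integrand[OF mu' c] by (rule integrable_mult_right)
  have fn: "norm (f m t) \<le> q ^ m * norm (recip_gamma_integrand \<mu> (Complex c t))" for m t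
    unfolding f_eq norm_mult norm_power using power_mono[OF qn[of t] norm_ge_zero, of m] by (auto simp: norm_mult intro!: mult_right_mono)
  have geo: "summable (\<lambda>m. q ^ m * b)" for b using q by (intro summable_mult2 summable_geometric) auto
  have sm: "summable (\<lambda>m. norm (f m t))" for t
    by (rule summable_comparison_test'[OF geo]) (use fn in auto)
  define A where "A = (\<integral>t. norm (recip_gamma_integrand \<mu> (Complex c t)) \<partial>lborel)"
  have sI: "(\<integral>t. norm (f m t) \<partial>lborel) \<le> q ^ m * A" for m
    unfolding A_def using integrable_recip_gamma_integrand[OF mu c] int fn
    by (subst integral_mult_right_zero[symmetric], intro integral_mono) auto
  have sint: "summable (\<lambda>m. \<integral>t. norm (f m t) \<partial>lborel)"
    by (rule summable_comparison_test'[OF geo[of A]]) (use sI in auto)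
  have sums: "(\<lambda>m. integral\<^sup>L lborel (f m)) sums (\<integral>t. (\<Sum>m. f m t) \<partial>lborel)"
    using int sm sint by (intro sums_integral) auto
  have suminf: "(\<Sum>m. f m t) = recip_gamma_integrand \<mu> (Complex c t) / (1 - x * Complex c t powr (- of_real k))" for t
  proof -
    have "norm (x * Complex c t powr (- of_real k)) < 1" using qn[of t] q by linarith
    from sums_mult2[OF geometric_sums[OF this], of "recip_gamma_integrand \<mu> (Complex c t)"]
    show ?thesis unfolding f_eq by (simp add: sums_iff)
  qed
  have If: "integral\<^sup>L lborel (f m) = x ^ m * recip_gamma_integral (k * real m + \<mu>)" for m
    unfolding f_def using recip_gamma_integral_line[OF mu' c] by (subst integral_mult_right_zero) simp
  have coeff: "x ^ m / of_real (Gamma (k * real m + \<mu>)) = integral\<^sup>L lborel (f m) / recip_gamma_integral 2" for m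
    using recip_Gamma_eq[OF mu'[of m]] by (simp add: If divide_inverse mult_ac)
  show "(\<lambda>m. x ^ m / of_real (Gamma (k * real m + \<mu>))) sums
      ((\<integral>t. recip_gamma_integrand \<mu> (Complex c t) / (1 - x * Complex c t powr (- of_real k)) \<partial>lborel) / recip_gamma_integral 2)"
    unfolding coeff using sums_divide[OF sums] by (simp add: suminf)
  show "summable (\<lambda>m. norm (x ^ m / of_real (Gamma (k * real m + \<mu>))))"
    unfolding coeff norm_divide
    by (rule summable_divide, rule summable_comparison_test'[OF sint]) (use integral_norm_bound in auto)
qed

lemma mittag_leffler_summable_norm:
  assumes "k > 0" "\<mu> > 0"
  shows "summable (\<lambda>m. norm (x ^ m / of_real (Gamma (k * real m + \<mu>)) :: complex))"
proof -
  obtain N :: nat where N: "2 / k < real N" using reals_Archimedean2 by blast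
  have "norm x + 1 > 0" using norm_ge_zero[of x] by linarith
  define c where "c = (norm x + 1) powr (1 / k)"
  have "summable (\<lambda>m. norm (x ^ m / of_real (Gamma (k * real m + (\<mu> + k * real N)))))"
    by (rule mittag_leffler_line_integral(2)[where c = c])
       (use assms N \<open>norm x + 1 > 0\<close> in \<open>auto simp: c_def powr_powr field_simps\<close>)
  then have "summable (\<lambda>m. norm x ^ N * norm (x ^ m / of_real (Gamma (k * real m + (\<mu> + k * real N)))))"
    by (rule summable_mult)
  then have "summable (\<lambda>m. norm (x ^ (m + N) / of_real (Gamma (k * real (m + N) + \<mu>))))"
    by (simp add: norm_divide norm_mult norm_power power_add algebra_simps)
  then show ?thesis by (subst (asm) summable_iff_shift)
qed

lemma mittag_leffler_sums:
  assumes "k > 0" "\<mu> > 0"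
  shows "(\<lambda>m. x ^ m / of_real (Gamma (k * real m + \<mu>))) sums mittag_leffler k \<mu> x"
  unfolding mittag_leffler_def using summable_norm_cancel[OF mittag_leffler_summable_norm[OF assms]] by (rule summable_sums)

text \<open>Raises the second parameter, which reduces statements for all \<open>\<mu> > 0\<close> to the range \<open>\<mu> \<ge> 2\<close> of
absolutely convergent integrals.\<close>

lemma mittag_leffler_shift:
  assumes "k > 0" "\<mu> > 0"
  shows "mittag_leffler k \<mu> x = (\<Sum>m<N. x ^ m / of_real (Gamma (k * real m + \<mu>))) + x ^ N * mittag_leffler k (\<mu> + k * real N) x"
proof -
  have "mittag_leffler k \<mu> x = (\<Sum>m. x ^ (m + N) / of_real (Gamma (k * real (m + N) + \<mu>))) + (\<Sum>m<N. x ^ m / of_real (Gamma (k * real m + \<mu>)))"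
    unfolding mittag_leffler_def by (rule suminf_split_initial_segment[OF summable_norm_cancel[OF mittag_leffler_summable_norm[OF assms]]])
  also have "(\<lambda>m. x ^ (m + N) / of_real (Gamma (k * real (m + N) + \<mu>))) = (\<lambda>m. x ^ N * (x ^ m / of_real (Gamma (k * real m + (\<mu> + k * real N)))))"
    by (simp add: power_add algebra_simps)
  also have "suminf \<dots> = x ^ N * mittag_leffler k (\<mu> + k * real N) x"
    unfolding mittag_leffler_def using assms
    by (intro suminf_mult summable_norm_cancel[OF mittag_leffler_summable_norm]) (auto intro: add_pos_nonneg)
  finally show ?thesis by simp
qed

text \<open>An explicit instance; it serves below as the model for a pole whose contribution is known.\<close>

lemma mittag_leffler_1_2: "p * mittag_leffler 1 2 p = exp p - 1"
proof -
  have "Gamma (1 * real m + 1) = (fact m :: real)" for m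
    using Gamma_fact[of m, where 'a = real] by (simp add: add.commute)
  then have "mittag_leffler 1 1 p = exp p"
    unfolding mittag_leffler_def exp_def by (simp add: scaleR_conv_of_real divide_inverse mult.commute)
  moreover have "mittag_leffler 1 1 p = 1 + p * mittag_leffler 1 2 p"
    using mittag_leffler_shift[of 1 1 p 1] by (simp add: Gamma_fact[of 0, simplified])
  ultimately show ?thesis by (simp add: algebra_simps)
qed

section \<open>Asymptotics of the Mittag-Leffler function\<close>

text \<open>By compactness: for \<open>\<bar>s\<bar>\<close> large the second summand has modulus at most \<open>1/2\<close>, and the rest of
\<open>U \<times> V\<close> is compact.\<close>

lemma resolvent_denominator_bound:
  fixes U V :: "complex set"
  assumes U: "compact U" "U \<subseteq> sphere 0 1" and V: "closed V" "V \<subseteq> {s. Re s \<ge> c}" and c: "c > 0" and k: "0 < k"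
    and nz: "\<And>u s. u \<in> U \<Longrightarrow> s \<in> V \<Longrightarrow> u \<noteq> s powr (of_real k)"
  shows "\<exists>\<delta>>0. \<forall>u\<in>U. \<forall>s\<in>V. \<delta> \<le> norm (1 - u * s powr (- of_real k))"
proof -
  define R where "R = (2::real) powr (1 / k)"
  define T where "T = U \<times> (V \<inter> cball 0 R)"
  have T: "compact T" unfolding T_def using U V by (intro compact_Times) (auto intro: closed_Int_compact)
  define F where "F = (\<lambda>(u, s). norm (1 - u * s powr (- complex_of_real k)))"
  have pos: "s \<notin> \<real>\<^sub>\<le>\<^sub>0" "s \<noteq> 0" if "s \<in> V" for s using that V c by (auto intro!: Re_pos_nonneg_Reals)
  have cont: "continuous_on T F"
  proof -
    have pos': "Re s > 0" if "s \<in> V" for s using that V c by force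
    show ?thesis
      unfolding F_def case_prod_beta T_def by (intro continuous_intros) (use pos' in \<open>fastforce simp: complex_nonpos_Reals_iff\<close>)+
  qed
  have Fpos: "F z > 0" if "z \<in> T" for z
  proof -
    obtain u s where z: "z = (u, s)" "u \<in> U" "s \<in> V" using \<open>z \<in> T\<close> by (auto simp: T_def)
    have "1 - u * s powr (- of_real k) \<noteq> 0"
    proof
      assume "1 - u * s powr (- of_real k) = 0"
      then have "u = s powr (of_real k)" using pos[OF z(3)] by (simp add: powr_minus field_simps)
      then show False using nz z by blast
    qed
    then show ?thesis by (simp add: z F_def)
  qed
  have "\<exists>\<delta>>0. \<forall>z\<in>T. \<delta> \<le> F z"
  proof (cases "T = {}")
    case False
    then obtain z where "z \<in> T" "\<forall>y\<in>T. F z \<le> F y" using continuous_attains_inf[OF T _ cont] by blast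
    then show ?thesis using Fpos by blast
  qed (auto intro: exI[of _ 1])
  then obtain \<delta> where \<delta>: "\<delta> > 0" "\<forall>z\<in>T. \<delta> \<le> F z" by blast
  show ?thesis
  proof (intro exI[of _ "min \<delta> (1/2)"] conjI ballI)
    fix u s assume us: "u \<in> U" "s \<in> V"
    show "min \<delta> (1/2) \<le> norm (1 - u * s powr (- of_real k))"
    proof (cases "norm s \<le> R")
      case True
      then have "(u, s) \<in> T" using us by (auto simp: T_def)
      then show ?thesis using \<delta>(2) by (force simp: F_def)
    next
      case False
      have "norm s powr (- k) \<le> R powr (- k)" using False k by (intro powr_mono2') (auto simp: R_def)
      also have "\<dots> = 1/2" using k by (simp add: R_def powr_powr powr_minus)
      finally have "norm (u * s powr (- of_real k)) \<le> 1/2"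
        using us U norm_powr_real_powr'[of "- of_real k" s] by (auto simp: norm_mult)
      then show ?thesis using norm_triangle_ineq2[of 1 "u * s powr (- of_real k)"] by simp
    qed
  qed (use \<delta> in auto)
qed

lemma strip_decay:
  fixes g :: "complex \<Rightarrow> complex"
  assumes cont: "continuous_on {s. c1 \<le> Re s \<and> Re s \<le> c2} g" and c1: "0 < c1"
    and decay: "\<And>s. c1 \<le> Re s \<Longrightarrow> Re s \<le> c2 \<Longrightarrow> norm s \<ge> R \<Longrightarrow> norm (g s) \<le> A / (norm s)\<^sup>2" and "A \<ge> 0"
  shows "\<exists>C. \<forall>s. c1 \<le> Re s \<longrightarrow> Re s \<le> c2 \<longrightarrow> norm (g s) \<le> C / (1 + (Im s)\<^sup>2)"
proof -
  let ?K = "{s. c1 \<le> Re s \<and> Re s \<le> c2} \<inter> cball 0 R"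
  have "{s. c1 \<le> Re s \<and> Re s \<le> c2} = {s. Re s \<ge> c1} \<inter> {s. Re s \<le> c2}" by auto
  then have "closed {s. c1 \<le> Re s \<and> Re s \<le> c2}" by (simp add: closed_Int closed_halfspace_Re_ge closed_halfspace_Re_le)
  then have "compact ?K" by (intro closed_Int_compact) auto
  then have "compact (g ` ?K)" by (intro compact_continuous_image continuous_on_subset[OF cont]) auto
  then obtain B where B: "\<And>s. s \<in> ?K \<Longrightarrow> norm (g s) \<le> B" using compact_imp_bounded bounded_iff by (metis image_eqI)
  show ?thesis
  proof (intro exI allI impI)
    fix s assume s: "c1 \<le> Re s" "Re s \<le> c2"
    have p: "1 + (Im s)\<^sup>2 > 0" by (simp add: add_pos_nonneg)
    show "norm (g s) \<le> (max B 0 * (1 + R\<^sup>2) + A / min 1 (c1\<^sup>2)) / (1 + (Im s)\<^sup>2)"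
    proof (cases "norm s \<le> R")
      case True
      then have "norm (g s) \<le> max B 0" using B[of s] s by auto
      moreover have "(Im s)\<^sup>2 \<le> R\<^sup>2" using abs_Im_le_cmod[of s] True by (metis abs_ge_zero order_trans power2_abs power_mono)
      ultimately have "norm (g s) * (1 + (Im s)\<^sup>2) \<le> max B 0 * (1 + R\<^sup>2)" by (intro mult_mono) auto
      moreover have "A / min 1 (c1\<^sup>2) \<ge> 0" using \<open>A \<ge> 0\<close> by (intro divide_nonneg_nonneg) auto
      ultimately show ?thesis unfolding pos_le_divide_eq[OF p] by linarith
    next
      case False
      have "norm (g s) \<le> A * (1 / (norm s)\<^sup>2)" using decay[of s] s False by simp
      also have "\<dots> \<le> A * ((1 / min 1 (c1\<^sup>2)) / (1 + (Im s)\<^sup>2))"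
        by (intro mult_left_mono inverse_norm_power2_le) (use c1 s \<open>A \<ge> 0\<close> in auto)
      also have "\<dots> = A / min 1 (c1\<^sup>2) / (1 + (Im s)\<^sup>2)" by simp
      also have "\<dots> \<le> (max B 0 * (1 + R\<^sup>2) + A / min 1 (c1\<^sup>2)) / (1 + (Im s)\<^sup>2)"
        using p by (intro divide_right_mono) auto
      finally show ?thesis .
    qed
  qed
qed

text \<open>Describing the sector as an image under \<open>p \<mapsto> p powr k\<close> avoids any case distinction on the
argument of \<open>x\<close> and provides the point \<open>p\<close> at which the resolvent \<open>1 / (1 - x * s powr (- k))\<close> has its pole.\<close>

definition principal_sector :: "real \<Rightarrow> real \<Rightarrow> complex set" where
  "principal_sector k \<epsilon> = {p powr (of_real k) |p. Re p > \<epsilon> * norm p}"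

lemma powr_of_real_scale:
  fixes s :: complex
  assumes "0 < r" shows "(of_real r * s) powr (of_real a) = of_real (r powr a) * s powr (of_real a)"
  using assms powr_times_real_left[of "of_real r" s "of_real a"] powr_of_real[of r a] by simp

text \<open>Homogeneity reduces estimates of the resolvent to \<open>\<bar>x\<bar> = 1\<close>.\<close>

lemma scaled_resolvent:
  fixes x s :: complex
  assumes "0 < k" "x \<noteq> 0" "s \<noteq> 0"
  defines "r \<equiv> norm x powr (1 / k)"
  shows "x * s powr (- of_real k) = (x / of_real (norm x)) * (s / of_real r) powr (- of_real k)"
proof -
  have r: "r > 0" using assms by (simp add: r_def)
  have "r powr (- k) = 1 / norm x" using assms by (simp add: r_def powr_powr powr_minus_divide)
  moreover have "s = of_real r * (s / of_real r)" using r by simp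
  then have "s powr (of_real (- k)) = of_real (r powr (- k)) * (s / of_real r) powr (of_real (- k))"
    using powr_of_real_scale[OF r] by metis
  ultimately show ?thesis by simp
qed

text \<open>For \<open>x\<close> outside the sector the resolvent has no pole to the right of the line \<open>Re s = 2 * \<epsilon> * r\<close>,
where \<open>r = \<bar>x\<bar> powr (1 / k)\<close>. Shifting the line of integration there from \<open>Re s = 2 * r\<close> replaces
\<open>exp (2 * r)\<close> by \<open>exp (2 * \<epsilon> * r)\<close>.\<close>

lemma mittag_leffler_off_sector:
  assumes k: "0 < k" "k \<le> 1" and mu: "2 \<le> \<mu>" and eps: "0 < \<epsilon>" "\<epsilon> < 1/2"
  shows "\<exists>C. \<forall>x. norm x \<ge> 1 \<longrightarrow> x \<notin> principal_sector k (3/2 * \<epsilon>) \<longrightarrow>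
     norm (mittag_leffler k \<mu> x) \<le> C * exp (2 * \<epsilon> * norm x powr (1 / k))"
proof -
  define S where "S = (\<lambda>p. p powr (of_real k)) ` {p. Re p > 3/2 * \<epsilon>}"
  have Re_pos: "Re p > 0" if "Re p > 3/2 * \<epsilon>" for p using that eps by (auto intro: le_less_trans[rotated])
  have "open S" unfolding S_def
  proof (rule open_mapping_thm3)
    show "(\<lambda>p. p powr (of_real k)) holomorphic_on {p. Re p > 3/2 * \<epsilon>}"
      using Re_pos by (intro holomorphic_intros) (auto dest: Re_pos_nonneg_Reals)
    show "inj_on (\<lambda>p. p powr (of_real k)) {p. Re p > 3/2 * \<epsilon>}"
      using Re_pos powr_inj_Re_pos[OF _ _ k] by (auto intro!: inj_onI)
  qed (rule open_halfspace_Re_gt)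
  \<comment> \<open>\<open>S\<close> is open by the open mapping theorem, hence \<open>U\<close> is compact and a uniform bound for the denominator is available\<close>
  define U where "U = sphere 0 1 - S"
  have U: "compact U" unfolding U_def using \<open>open S\<close> by (intro compact_diff) auto
  have "\<exists>\<delta>>0. \<forall>u\<in>U. \<forall>s\<in>{s. Re s \<ge> 2 * \<epsilon>}. \<delta> \<le> norm (1 - u * s powr (- of_real k))"
  proof (rule resolvent_denominator_bound[OF U _ _ _ _ k(1)])
    fix u s assume us: "u \<in> U" "s \<in> {s. Re s \<ge> 2 * \<epsilon>}"
    then have "s powr (of_real k) \<in> S" unfolding S_def using eps by (intro imageI) auto
    then show "u \<noteq> s powr (of_real k)" using us by (auto simp: U_def)
  qed (use eps in \<open>auto simp: U_def closed_halfspace_Re_ge\<close>)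
  then obtain \<delta> where \<delta>: "\<delta> > 0" "\<And>u s. u \<in> U \<Longrightarrow> Re s \<ge> 2 * \<epsilon> \<Longrightarrow> \<delta> \<le> norm (1 - u * s powr (- of_real k))" by blast
  define A where "A = (\<integral>t. inverse (1 + (t::real)\<^sup>2) \<partial>lborel)"
  define B where "B = (2 * \<epsilon>) powr (2 - \<mu>) / min 1 ((2 * \<epsilon>)\<^sup>2) / \<delta>"
  have B0: "B \<ge> 0" unfolding B_def using \<delta> by (intro divide_nonneg_nonneg) auto
  show ?thesis
  proof (intro exI allI impI)
    fix x :: complex assume x: "norm x \<ge> 1" and xs: "x \<notin> principal_sector k (3/2 * \<epsilon>)"
    define r where "r = norm x powr (1 / k)"
    have r: "r \<ge> 1" unfolding r_def using x k by (intro ge_one_powr_ge_zero) auto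
    have er: "3/2 * \<epsilon> * r > 0" using eps r by simp
    have x0: "x \<noteq> 0" using x by auto
    have xr: "norm x = r powr k" using x k by (simp add: r_def powr_powr)
    define u where "u = x / of_real (norm x)"
    have u: "u \<in> U"
    proof -
      have "norm u = 1" using x0 by (simp add: u_def norm_divide)
      moreover have "u \<notin> S"
      proof
        assume "u \<in> S"
        then obtain p where p: "u = p powr (of_real k)" "Re p > 3/2 * \<epsilon>" by (auto simp: S_def)
        have "norm p powr k = 1" using p \<open>norm u = 1\<close> norm_powr_real_powr'[of "of_real k" p] by simp
        then have np: "norm p = 1" using k p Re_pos[of p] complex_Re_le_cmod[of p]
          by (metis less_le_trans powr_powr powr_one powr_one_eq_one norm_ge_zero less_irrefl mult.commute nonzero_divide_eq_eq powr_eq_one_iff_gen)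
        have "x = (of_real r * p) powr (of_real k)"
          using r p by (subst powr_of_real_scale) (use x0 in \<open>auto simp: xr[symmetric] u_def nonzero_divide_eq_eq mult.commute\<close>)
        moreover have "Re (of_real r * p) > 3/2 * \<epsilon> * norm (of_real r * p)"
          using r np p by (simp add: norm_mult)
        ultimately show False using xs unfolding principal_sector_def by blast
      qed
      ultimately show ?thesis by (simp add: U_def)
    qed
    have den: "\<delta> \<le> norm (1 - x * s powr (- of_real k))" if "Re s \<ge> 2 * \<epsilon> * r" for s
    proof -
      have "Re s > 0" using that eps r by (auto intro: less_le_trans[rotated])
      then have "s \<noteq> 0" by auto
      moreover have "x \<noteq> 0" using x by auto
      moreover have "Re (s / of_real r) \<ge> 2 * \<epsilon>" using that r by (simp add: Re_divide_of_real field_simps)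
      ultimately show ?thesis using \<delta>(2)[OF u, of "s / of_real r"] scaled_resolvent[OF k(1), of x s] by (simp add: r_def u_def)
    qed
    have den': "1 - x * s powr (- of_real k) \<noteq> 0" if s: "Re s > 3/2 * \<epsilon> * r" for s
    proof
      assume "1 - x * s powr (- of_real k) = 0"
      moreover have s0: "Re s > 0" using s er by linarith
      then have "s \<noteq> 0" by auto
      ultimately have "u = (s / of_real r) powr (of_real k)"
        using scaled_resolvent[OF k(1), of x s] x0
        by (simp add: r_def[symmetric] u_def[symmetric] powr_minus field_simps)
      moreover have "Re (s / of_real r) > 3/2 * \<epsilon>" using s r by (simp add: Re_divide_of_real field_simps)
      ultimately have "u \<in> S" unfolding S_def by blast
      then show False using u by (simp add: U_def)
    qed
    define g where "g s = recip_gamma_integrand \<mu> s / (1 - x * s powr (- of_real k))" for s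
    have c: "0 < 2 * \<epsilon> * r" "2 * \<epsilon> * r \<le> 2 * r" "3/2 * \<epsilon> * r < 2 * \<epsilon> * r" using eps r by auto
    have hol: "g holomorphic_on {s. Re s > 3/2 * \<epsilon> * r}" unfolding g_def
    proof (intro holomorphic_intros)
      have "{s. Re s > 3/2 * \<epsilon> * r} \<subseteq> {s. Re s > 0}" by (intro Collect_mono impI) (use er in linarith)
      then show "recip_gamma_integrand \<mu> holomorphic_on {s. Re s > 3/2 * \<epsilon> * r}"
        using holomorphic_recip_gamma_integrand holomorphic_on_subset by blast
    next
      fix s assume "s \<in> {s. Re s > 3/2 * \<epsilon> * r}"
      then have s: "Re s > 3/2 * \<epsilon> * r" by simp
      then have "Re s > 0" using er by linarith
      then show "s \<notin> \<real>\<^sub>\<le>\<^sub>0" by (rule Re_pos_nonneg_Reals)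
      show "1 - x * s powr (- of_real k) \<noteq> 0" using den' s by blast
    qed
    have bd: "norm (g s) \<le> (exp d * (2 * \<epsilon> * r) powr (2 - \<mu>) / min 1 ((2 * \<epsilon> * r)\<^sup>2) / \<delta>) / (1 + (Im s)\<^sup>2)"
      if "2 * \<epsilon> * r \<le> Re s" "Re s \<le> d" for s d
    proof -
      have "norm (g s) = norm (recip_gamma_integrand \<mu> s) / norm (1 - x * s powr (- of_real k))" by (simp add: g_def norm_divide)
      also have "\<dots> \<le> ((exp d * (2 * \<epsilon> * r) powr (2 - \<mu>) / min 1 ((2 * \<epsilon> * r)\<^sup>2)) / (1 + (Im s)\<^sup>2)) / \<delta>"
        using den[OF that(1)] \<delta>(1) recip_gamma_integrand_bound[OF mu c(1) that] by (intro frac_le) (auto intro: order_trans[OF norm_ge_zero])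
      finally show ?thesis by (simp add: mult_ac)
    qed
    have "(\<integral>t. g (Complex (2 * r) t) \<partial>lborel) = (\<integral>t. g (Complex (2 * \<epsilon> * r) t) \<partial>lborel)"
      by (rule integral_line_shift[OF hol c(3) c(2) bd, symmetric])
    moreover have "mittag_leffler k \<mu> x = (\<integral>t. g (Complex (2 * r) t) \<partial>lborel) / recip_gamma_integral 2"
    proof -
      have "norm x < (2 * r) powr k" unfolding xr using r k by (intro powr_less_mono2) auto
      from mittag_leffler_line_integral(1)[OF k(1) mu _ this] r show ?thesis
        unfolding mittag_leffler_def g_def by (simp add: sums_iff)
    qed
    moreover have "norm (\<integral>t. g (Complex (2 * \<epsilon> * r) t) \<partial>lborel) \<le> (B * A) * exp (2 * \<epsilon> * r)"
    proof -
      have nb: "norm (g (Complex (2 * \<epsilon> * r) t)) \<le> B * exp (2 * \<epsilon> * r) / (1 + t\<^sup>2)" for t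
      proof -
        have "norm (g (Complex (2 * \<epsilon> * r) t)) \<le> (exp (2 * \<epsilon> * r) * ((2 * \<epsilon> * r) powr (2 - \<mu>) / min 1 ((2 * \<epsilon> * r)\<^sup>2)) / \<delta>) / (1 + t\<^sup>2)"
          using bd[of "Complex (2 * \<epsilon> * r) t" "2 * \<epsilon> * r"] by simp
        also have "(2 * \<epsilon> * r) powr (2 - \<mu>) / min 1 ((2 * \<epsilon> * r)\<^sup>2) \<le> (2 * \<epsilon>) powr (2 - \<mu>) / min 1 ((2 * \<epsilon>)\<^sup>2)"
        proof (rule frac_le)
          show "(2 * \<epsilon> * r) powr (2 - \<mu>) \<le> (2 * \<epsilon>) powr (2 - \<mu>)" using mu eps r by (intro powr_mono2') auto
          have "(2 * \<epsilon>)\<^sup>2 \<le> (2 * \<epsilon> * r)\<^sup>2" using eps r by (intro power_mono) auto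
          then show "min 1 ((2 * \<epsilon>)\<^sup>2) \<le> min 1 ((2 * \<epsilon> * r)\<^sup>2)" by (auto simp: min_def)
        qed (use eps in auto)
        finally show ?thesis using \<delta>(1)
          by (simp add: B_def divide_inverse mult_ac divide_right_mono mult_left_mono mult_right_mono add_nonneg_nonneg)
      qed
      then have "(\<integral>t. norm (g (Complex (2 * \<epsilon> * r) t)) \<partial>lborel) \<le> (\<integral>t. B * exp (2 * \<epsilon> * r) * inverse (1 + t\<^sup>2) \<partial>lborel)"
        using integrable_line[OF hol c(3) nb] integrable_inverse_1_plus_square_line nb
        by (intro integral_mono integrable_mult_right integrable_norm) (auto simp: divide_inverse)
      then show ?thesis by (intro order_trans[OF integral_norm_bound]) (simp add: A_def mult_ac)
    qed
    ultimately show "norm (mittag_leffler k \<mu> x) \<le> (B * A / norm (recip_gamma_integral 2)) * exp (2 * \<epsilon> * norm x powr (1 / k))"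
      unfolding r_def[symmetric] by (simp add: norm_divide divide_right_mono)
  qed
qed

text \<open>For \<open>x = p powr k\<close> the resolvent has exactly one pole, at \<open>s = p\<close>. Instead of taking a residue, subtract the
multiple of \<open>1 / (s * (s - p))\<close> with the same principal part; the integral of that function over the line is known, because it is the
integral for \<^term>\<open>mittag_leffler 1 2 p\<close>, that is \<open>(exp p - 1) / p\<close>. The difference is holomorphic
in the half-plane and its line of integration can be shifted to \<open>Re s = \<epsilon> * r\<close>.\<close>

lemma mittag_leffler_on_sector:
  assumes k: "0 < k" "k \<le> 1" and mu: "2 \<le> \<mu>" and eps: "0 < \<epsilon>" "\<epsilon> < 1/2"
  shows "\<exists>C. \<forall>p. norm p \<ge> 1 \<longrightarrow> Re p > 3/2 * \<epsilon> * norm p \<longrightarrow>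
     norm (mittag_leffler k \<mu> (p powr (of_real k)) - of_real (1 / k) * p powr (1 - of_real \<mu>) * exp p) \<le> C * exp (\<epsilon> * norm p)"
proof -
  define U where "U = (\<lambda>p. p powr (of_real k)) ` (sphere 0 1 \<inter> {p. Re p \<ge> 3/2 * \<epsilon>})"
  have Re_pos: "Re p > 0" if "Re p \<ge> 3/2 * \<epsilon>" for p using that eps by (auto intro: less_le_trans[rotated])
  have "compact (sphere 0 1 \<inter> {p. Re p \<ge> 3/2 * \<epsilon>})"
    by (intro compact_Int_closed compact_sphere closed_halfspace_Re_ge)
  then have U: "compact U" unfolding U_def
    by (intro compact_continuous_image continuous_intros) (use eps in \<open>auto simp: complex_nonpos_Reals_iff\<close>)
  have "\<exists>\<delta>>0. \<forall>u\<in>U. \<forall>s\<in>{s. Re s = \<epsilon>}. \<delta> \<le> norm (1 - u * s powr (- of_real k))"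
  proof (rule resolvent_denominator_bound[OF U _ _ _ eps(1) k(1)])
    show "U \<subseteq> sphere 0 1" unfolding U_def using norm_powr_real_powr'[of "of_real k"] by auto
    show "closed {s. Re s = \<epsilon>}" by (simp add: closed_Collect_eq continuous_on_Re)
    fix u s assume us: "u \<in> U" "s \<in> {s. Re s = \<epsilon>}"
    then obtain p where p: "u = p powr (of_real k)" "Re p \<ge> 3/2 * \<epsilon>" by (auto simp: U_def)
    show "u \<noteq> s powr (of_real k)"
    proof
      assume "u = s powr (of_real k)"
      then have "p = s" using powr_inj_Re_pos[OF Re_pos[OF p(2)] _ k] us p eps by auto
      then show False using us p eps by auto
    qed
  qed auto
  then obtain \<delta> where \<delta>: "\<delta> > 0" "\<And>u s. u \<in> U \<Longrightarrow> Re s = \<epsilon> \<Longrightarrow> \<delta> \<le> norm (1 - u * s powr (- of_real k))" by blast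
  define A where "A = (\<integral>t. inverse (1 + (t::real)\<^sup>2) \<partial>lborel)"
  \<comment> \<open>the two summands bound the two terms of \<open>h\<close> on the line \<open>Re s = \<epsilon> * r\<close>\<close>
  define B where "B = (\<epsilon> powr (2 - \<mu>) / \<delta> + (1 / k) * (1 + 2 / \<epsilon>)) / min 1 (\<epsilon>\<^sup>2)"
  have A0: "A \<ge> 0" unfolding A_def by (intro integral_nonneg_AE) (auto simp: add_nonneg_nonneg)
  have B0: "B \<ge> 0" unfolding B_def using \<delta> k eps by (intro divide_nonneg_nonneg add_nonneg_nonneg mult_nonneg_nonneg) auto
  show ?thesis
  proof (intro exI allI impI)
    fix p :: complex assume p1: "norm p \<ge> 1" and pR: "Re p > 3/2 * \<epsilon> * norm p"
    define r where "r = norm p"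
    define x where "x = p powr (of_real k)"
    have p0: "p \<noteq> 0" using p1 by auto
    have r1: "r \<ge> 1" using p1 by (simp add: r_def)
    have epr: "\<epsilon> * r > 0" using eps r1 by simp
    have pR': "Re p > 3/2 * \<epsilon> * r" using pR by (simp add: r_def)
    have Rep: "Re p > 0" using pR' epr by simp
    have xr: "norm x = r powr k" using norm_powr_real_powr'[of "of_real k" p] by (simp add: x_def r_def)
    have x0: "x \<noteq> 0" using p0 by (simp add: x_def)
    have rx: "norm x powr (1 / k) = r" using k r1 by (simp add: xr powr_powr)
    define f where "f s = 1 - x * s powr (- of_real k)" for s
    have hp: "open {s. Re s > 0}" by (rule open_halfspace_Re_gt)
    have f_hol: "f holomorphic_on {s. Re s > 0}"
      unfolding f_def by (intro holomorphic_intros) (auto dest: Re_pos_nonneg_Reals)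
    have fp: "f p = 0" using p0 by (simp add: f_def x_def powr_minus)
    have f_nz: "f s \<noteq> 0" if "Re s > 0" "s \<noteq> p" for s
    proof
      assume "f s = 0"
      moreover have "s \<noteq> 0" using that by auto
      ultimately have "s powr (of_real k) = p powr (of_real k)" by (simp add: f_def x_def powr_minus field_simps)
      then show False using powr_inj_Re_pos[OF that(1) Rep k] that by auto
    qed
    have f_deriv: "deriv f p = of_real k / p"
    proof (rule DERIV_imp_deriv)
      have "((\<lambda>s. s powr (- of_real k)) has_field_derivative (- of_real k) * p powr (- of_real k - 1)) (at p)"
        by (rule has_field_derivative_powr) (rule Re_pos_nonneg_Reals[OF Rep])
      then have "(f has_field_derivative (0 - x * ((- of_real k) * p powr (- of_real k - 1)))) (at p)"
        unfolding f_def by (intro DERIV_diff DERIV_const DERIV_cmult)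
      moreover have "x * p powr (- of_real k - 1) = 1 / p"
        unfolding x_def powr_add[symmetric] using p0 by (simp add: powr_minus_divide)
      then have "0 - x * ((- of_real k) * p powr (- of_real k - 1)) = of_real k / p"
        by (metis (no_types, opaque_lifting) diff_0 minus_mult_left minus_mult_right minus_minus mult.left_commute mult.right_neutral times_divide_eq_right)
      ultimately show "(f has_field_derivative of_real k / p) (at p)" by simp
    qed
    \<comment> \<open>\<open>f\<close> divided by its simple zero\<close>
    define d where "d s = (if s = p then deriv f p else (f s - f p) / (s - p))" for s
    have d_hol: "d holomorphic_on {s. Re s > 0}"
      unfolding d_def by (rule pole_lemma_open[OF f_hol hp])
    have d_nz: "d s \<noteq> 0" if "Re s > 0" for s
      using f_nz[OF that] k p0 by (auto simp: d_def fp f_deriv)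
    \<comment> \<open>the difference of the two resolvents multiplied by \<open>s - p\<close>; it vanishes at \<open>p\<close>, so \<open>h\<close> below is that difference with its removable singularity filled in\<close>
    define N where "N s = s powr (- of_real \<mu>) / d s - of_real (1 / k) * p powr (2 - of_real \<mu>) / s" for s
    have N_hol: "N holomorphic_on {s. Re s > 0}"
      unfolding N_def using d_nz d_hol by (intro holomorphic_intros) (auto dest: Re_pos_nonneg_Reals)
    have Np: "N p = 0"
    proof -
      have "p powr (- of_real \<mu>) * p = p powr (1 - of_real \<mu>)" using p0 by (simp add: powr_diff powr_minus_divide)
      moreover have "p powr (2 - of_real \<mu>) / p = p powr (1 - of_real \<mu>)"
        using p0 by (simp add: powr_diff power2_eq_square)
      moreover have "d p = of_real k / p" by (simp add: d_def f_deriv)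
      then have "N p = p powr (- of_real \<mu>) * p / of_real k - of_real (1 / k) * (p powr (2 - of_real \<mu>) / p)"
        using k p0 by (simp add: N_def)
      ultimately show ?thesis by simp
    qed
    define h where "h s = (if s = p then deriv N p else (N s - N p) / (s - p))" for s
    have h_hol: "h holomorphic_on {s. Re s > 0}"
      unfolding h_def by (rule pole_lemma_open[OF N_hol hp])
    have h_eq: "h s = s powr (- of_real \<mu>) / f s - of_real (1 / k) * p powr (2 - of_real \<mu>) / (s * (s - p))"
      if "s \<noteq> p" for s
    proof -
      have "h s = N s / (s - p)" using that by (simp add: h_def Np)
      also have "N s = s powr (- of_real \<mu>) / f s * (s - p) - of_real (1 / k) * p powr (2 - of_real \<mu>) / s"
        using that by (simp add: N_def d_def fp)
      finally show ?thesis using that by (simp add: diff_divide_distrib)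
    qed
    have npmu: "norm (p powr (2 - of_real \<mu>)) \<le> 1" "norm (p powr (1 - of_real \<mu>)) \<le> 1"
      using norm_powr_real_powr'[of "of_real (2 - \<mu>)" p] norm_powr_real_powr'[of "of_real (1 - \<mu>)" p] mu p1
        powr_mono[of "2 - \<mu>" 0 "norm p"] powr_mono[of "1 - \<mu>" 0 "norm p"] p0 by auto
    \<comment> \<open>applied with \<open>a = \<epsilon> / 2\<close> on the left line and with \<open>a = 1\<close> for large \<open>s\<close>\<close>
    have second: "norm (of_real (1 / k) * p powr (2 - of_real \<mu>) / (s * (s - p))) \<le> (1 / k) * (1 + 1 / a) / (norm s)\<^sup>2"
      if a: "a > 0" "norm (s - p) \<ge> a * r" "Re s > 0" for s a
    proof -
      have s0: "norm s > 0" using a(3) by auto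
      have sp: "norm (s - p) > 0" using mult_pos_pos[OF a(1), of r] a(2) r1 by linarith
      have "norm s \<le> norm (s - p) + r" using norm_triangle_ineq[of "s - p" p] by (simp add: r_def)
      also have "\<dots> \<le> norm (s - p) + norm (s - p) / a" using a by (simp add: field_simps)
      finally have "norm s \<le> (1 + 1 / a) * norm (s - p)" by (simp add: algebra_simps)
      then have "1 / norm (s - p) \<le> (1 + 1 / a) / norm s" using s0 sp by (simp add: field_simps)
      then have "norm (p powr (2 - of_real \<mu>)) * (1 / norm s) * (1 / norm (s - p)) \<le> 1 * (1 / norm s) * ((1 + 1 / a) / norm s)"
        using npmu a by (intro mult_mono) auto
      then have "(1/k) * (norm (p powr (2 - of_real \<mu>)) * (1 / norm s) * (1 / norm (s - p))) \<le> (1/k) * (1 * (1 / norm s) * ((1 + 1 / a) / norm s))"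
        using k by (intro mult_left_mono) auto
      then show ?thesis using k by (simp add: norm_divide norm_mult power2_eq_square)
    qed
    have alg: "X / N / d + (1 / k) * Y / N = (X / d + (1 / k) * Y) * (1 / N)" for X Y N d :: real
      by (simp add: add_divide_distrib)
    define g where "g s = exp s * h s" for s
    have g_hol: "g holomorphic_on {s. Re s > 0}" unfolding g_def by (intro holomorphic_intros h_hol)
    have line_bd: "norm (g (Complex (\<epsilon> * r) t)) \<le> B * exp (\<epsilon> * r) / (1 + t\<^sup>2)" for t
    proof -
      define s where "s = Complex (\<epsilon> * r) t"
      have s: "Re s = \<epsilon> * r" "Re s > 0" "s \<noteq> 0" using epr by (auto simp: s_def complex_eq_iff)
      have "Re (p - s) \<ge> \<epsilon> / 2 * r" using pR' s by (simp add: field_simps)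
      then have far: "norm (s - p) \<ge> \<epsilon> / 2 * r" using complex_Re_le_cmod[of "p - s"] by (simp add: norm_minus_commute)
      then have "norm (s - p) > 0" using epr by (auto intro: less_le_trans[rotated])
      then have sp: "s \<noteq> p" by auto
      have "\<delta> \<le> norm (f s)"
      proof -
        have "x / of_real (norm x) = (p / of_real r) powr (of_real k)"
        proof -
          have "p = of_real r * (p / of_real r)" using r1 by simp
          then have "p powr (of_real k) = (of_real r * (p / of_real r)) powr (of_real k)" by (rule arg_cong)
          also have "\<dots> = of_real (r powr k) * (p / of_real r) powr (of_real k)" using r1 by (intro powr_of_real_scale) auto
          finally have "x = of_real (r powr k) * (p / of_real r) powr (of_real k)" by (simp only: x_def)
          then have "x / of_real (r powr k) = (p / of_real r) powr (of_real k)"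
            using r1 by (simp only: nonzero_mult_div_cancel_left of_real_eq_0_iff powr_eq_0_iff)
          then show ?thesis by (simp only: xr)
        qed
        moreover have "p / of_real r \<in> sphere 0 1 \<inter> {p. Re p \<ge> 3/2 * \<epsilon>}"
          using pR' r1 p0 by (simp add: norm_divide r_def Re_divide_of_real field_simps)
        ultimately have "x / of_real (norm x) \<in> U" unfolding U_def by blast
        from \<delta>(2)[OF this, of "s / of_real r"] show ?thesis
          using scaled_resolvent[OF k(1) x0 s(3)] r1 s by (simp add: f_def rx Re_divide_of_real)
      qed
      then have "norm (s powr (- of_real \<mu>) / f s) \<le> (\<epsilon> powr (2 - \<mu>) / (norm s)\<^sup>2) / \<delta>"
        unfolding norm_divide using \<delta>(1) norm_powr_minus_le[OF mu eps(1), of s] s r1 eps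
        by (intro frac_le) auto
      moreover have "norm (of_real (1 / k) * p powr (2 - of_real \<mu>) / (s * (s - p))) \<le> (1 / k) * (1 + 1 / (\<epsilon> / 2)) / (norm s)\<^sup>2"
        using far s eps by (intro second) auto
      ultimately have "norm (h s) \<le> (\<epsilon> powr (2 - \<mu>) / (norm s)\<^sup>2) / \<delta> + (1 / k) * (1 + 1 / (\<epsilon> / 2)) / (norm s)\<^sup>2"
        unfolding h_eq[OF sp] by (intro norm_triangle_le_diff add_mono)
      also have "\<dots> = (\<epsilon> powr (2 - \<mu>) / \<delta> + (1 / k) * (1 + 2 / \<epsilon>)) * (1 / (norm s)\<^sup>2)"
        unfolding alg by (simp only: divide_divide_eq_right mult_1)
      also have "\<dots> \<le> (\<epsilon> powr (2 - \<mu>) / \<delta> + (1 / k) * (1 + 2 / \<epsilon>)) * ((1 / min 1 (\<epsilon>\<^sup>2)) / (1 + (Im s)\<^sup>2))"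
        using \<delta> k eps s r1 by (intro mult_left_mono inverse_norm_power2_le add_nonneg_nonneg mult_nonneg_nonneg divide_nonneg_nonneg) auto
      finally have "norm (h s) \<le> B / (1 + t\<^sup>2)" by (simp add: B_def s_def)
      then have "exp (\<epsilon> * r) * norm (h s) \<le> exp (\<epsilon> * r) * (B / (1 + t\<^sup>2))" by (rule mult_left_mono) simp
      then show ?thesis by (simp add: g_def norm_mult s_def[symmetric] s mult_ac)
    qed
    have c12: "\<epsilon> * r \<le> 2 * r" "0 < 2 * r" using eps r1 by auto
    obtain C where C: "\<And>s. \<epsilon> * r \<le> Re s \<Longrightarrow> Re s \<le> 2 * r \<Longrightarrow> norm (g s) \<le> C / (1 + (Im s)\<^sup>2)"
    proof -
      define R where "R = 2 powr (1/k) * r + 2 * r"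
      define A' where "A' = exp (2 * r) * (2 * (\<epsilon> * r) powr (2 - \<mu>) + (1 / k) * (1 + 1 / 1))"
      have "\<exists>C. \<forall>s. \<epsilon> * r \<le> Re s \<longrightarrow> Re s \<le> 2 * r \<longrightarrow> norm (g s) \<le> C / (1 + (Im s)\<^sup>2)"
      proof (rule strip_decay[where R = R and A = A'])
        show "continuous_on {s. \<epsilon> * r \<le> Re s \<and> Re s \<le> 2 * r} g"
          by (rule continuous_on_subset[OF holomorphic_on_imp_continuous_on[OF g_hol]]) (use epr in auto)
        show "A' \<ge> 0" unfolding A'_def using k by (intro mult_nonneg_nonneg add_nonneg_nonneg) auto
        fix s assume s: "\<epsilon> * r \<le> Re s" "Re s \<le> 2 * r" "R \<le> norm s"
        have s0: "Re s > 0" using s epr by linarith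
        have R1: "2 powr (1/k) * r \<le> norm s" "2 * r \<le> norm s" using s(3) r1 by (auto simp: R_def intro: order_trans[rotated])
        have far: "norm (s - p) \<ge> 1 * r" using R1(2) norm_triangle_ineq2[of s p] by (simp add: r_def)
        have sp: "s \<noteq> p" using far r1 by auto
        have "norm s powr (- k) \<le> (2 powr (1/k) * r) powr (- k)" using R1 r1 k by (intro powr_mono2') auto
        also have "\<dots> = (1/2) * r powr (- k)" using r1 k by (simp add: powr_mult powr_powr powr_minus)
        finally have "norm x * norm s powr (- k) \<le> r powr k * ((1/2) * r powr (- k))"
          unfolding xr by (intro mult_left_mono) auto
        also have "\<dots> = 1/2" using r1 by (simp add: powr_minus)
        finally have "norm (x * s powr (- of_real k)) \<le> 1/2" using norm_powr_real_powr'[of "- of_real k" s] by (simp add: norm_mult)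
        then have "1/2 \<le> norm (f s)" unfolding f_def using norm_triangle_ineq2[of 1 "x * s powr (- of_real k)"] by simp
        then have "norm (s powr (- of_real \<mu>) / f s) \<le> ((\<epsilon> * r) powr (2 - \<mu>) / (norm s)\<^sup>2) / (1/2)"
          unfolding norm_divide using norm_powr_minus_le[OF mu epr s(1)] by (intro frac_le) auto
        moreover have "norm (of_real (1 / k) * p powr (2 - of_real \<mu>) / (s * (s - p))) \<le> (1 / k) * (1 + 1 / 1) / (norm s)\<^sup>2"
          using far s0 by (intro second) auto
        ultimately have "norm (h s) \<le> ((\<epsilon> * r) powr (2 - \<mu>) / (norm s)\<^sup>2) / (1/2) + (1 / k) * (1 + 1 / 1) / (norm s)\<^sup>2"
          unfolding h_eq[OF sp] by (intro norm_triangle_le_diff add_mono)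
        then have "exp (Re s) * norm (h s) \<le> exp (2 * r) * (((\<epsilon> * r) powr (2 - \<mu>) / (norm s)\<^sup>2) / (1/2) + (1 / k) * (1 + 1 / 1) / (norm s)\<^sup>2)"
          using s by (intro mult_mono) auto
        also have "\<dots> = A' / (norm s)\<^sup>2" by (simp add: A'_def add_divide_distrib distrib_left distrib_right)
        finally show "norm (g s) \<le> A' / (norm s)\<^sup>2" by (simp add: g_def norm_mult)
      qed (use epr in auto)
      then show ?thesis using that by blast
    qed
    have shift: "(\<integral>t. g (Complex (\<epsilon> * r) t) \<partial>lborel) = (\<integral>t. g (Complex (2 * r) t) \<partial>lborel)"
      by (rule integral_line_shift[OF g_hol epr c12(1) C])
    define C0 where "C0 = recip_gamma_integral 2"
    have C0: "C0 \<noteq> 0" unfolding C0_def by (rule recip_gamma_integral_const(2)[OF mu])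
    define F1 where "F1 t = recip_gamma_integrand \<mu> (Complex (2 * r) t) / (1 - x * Complex (2 * r) t powr (- of_real k))" for t
    define F2 where "F2 t = recip_gamma_integrand 2 (Complex (2 * r) t) / (1 - p * Complex (2 * r) t powr (- of_real 1))" for t
    define D where "D = of_real (1 / k) * p powr (2 - of_real \<mu>)"
    have I1: "mittag_leffler k \<mu> x = (\<integral>t. F1 t \<partial>lborel) / C0"
    proof -
      have "norm x < (2 * r) powr k" unfolding xr using r1 k by (intro powr_less_mono2) auto
      from mittag_leffler_line_integral(1)[OF k(1) mu c12(2) this] show ?thesis
        unfolding mittag_leffler_def F1_def C0_def by (simp add: sums_iff)
    qed
    have I2: "mittag_leffler 1 2 p = (\<integral>t. F2 t \<partial>lborel) / C0"
    proof -
      have "norm p < (2 * r) powr 1" using r1 p0 by (simp add: r_def)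
      from mittag_leffler_line_integral(1)[OF _ _ c12(2) this] show ?thesis
        unfolding mittag_leffler_def F2_def C0_def by (simp add: sums_iff)
    qed
    have g_split: "g (Complex (2 * r) t) = F1 t - D * F2 t" for t
    proof -
      define s where "s = Complex (2 * r) t"
      have "Re s = 2 * r" by (simp add: s_def)
      then have s: "s \<noteq> 0" "s \<noteq> p" using r1 complex_Re_le_cmod[of p] by (auto simp: r_def[symmetric])
      have "s powr (- of_real 2) / (1 - p * s powr (- of_real 1)) = 1 / (s * (s - p))"
        using s by (simp add: powr_minus_divide powr_numeral field_simps power2_eq_square)
      moreover have "F2 t = exp s * (s powr (- of_real 2) / (1 - p * s powr (- of_real 1)))"
        by (simp add: F2_def s_def recip_gamma_integrand_def)
      ultimately have "F2 t = exp s * (1 / (s * (s - p)))" by (simp only:)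
      moreover have "F1 t = exp s * (s powr (- of_real \<mu>) / f s)"
        by (simp add: F1_def s_def recip_gamma_integrand_def f_def)
      ultimately show ?thesis unfolding s_def[symmetric] g_def h_eq[OF s(2)] by (simp add: D_def right_diff_distrib)
    qed
    have intg: "integrable lborel (\<lambda>t. g (Complex (2 * r) t))"
      using C[of "Complex (2 * r) t" for t] c12 by (intro integrable_line[OF g_hol c12(2), where C = C]) auto
    have F2_hol: "(\<lambda>s. recip_gamma_integrand 2 s / (1 - p * s powr (- of_real 1))) holomorphic_on {s. Re s > r}"
    proof (intro holomorphic_intros)
      show "recip_gamma_integrand 2 holomorphic_on {s. Re s > r}"
        by (rule holomorphic_on_subset[OF holomorphic_recip_gamma_integrand]) (use r1 in auto)
      fix s assume "s \<in> {s. Re s > r}"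
      then have s: "Re s > r" by simp
      then show "s \<notin> \<real>\<^sub>\<le>\<^sub>0" using r1 by (intro Re_pos_nonneg_Reals) simp
      have "s \<noteq> p" "s \<noteq> 0" using s r1 complex_Re_le_cmod[of p] by (auto simp: r_def)
      then show "1 - p * s powr (- of_real 1) \<noteq> 0" by (simp add: powr_minus field_simps)
    qed
    have int2: "integrable lborel F2"
    proof -
      have "norm (F2 t) \<le> 2 * (exp (2 * r) * (2 * r) powr (2 - 2) / min 1 ((2 * r)\<^sup>2)) / (1 + t\<^sup>2)" for t
      proof -
        define s where "s = Complex (2 * r) t"
        have "norm s \<ge> 2 * r" using complex_Re_le_cmod[of s] by (simp add: s_def)
        moreover from this have "norm s > 0" using r1 by linarith
        moreover have "norm (p * s powr (- of_real 1)) = r * inverse (norm s)"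
          by (subst powr_minus) (simp add: norm_mult norm_inverse norm_divide r_def divide_inverse)
        moreover have "r * inverse (norm s) \<le> r * inverse (2 * r)"
          using r1 calculation by (intro mult_left_mono le_imp_inverse_le) auto
        ultimately have "norm (p * s powr (- of_real 1)) \<le> 1/2" using r1 by simp
        then have "1/2 \<le> norm (1 - p * s powr (- of_real 1))"
          using norm_triangle_ineq2[of 1 "p * s powr (- of_real 1)"] by simp
        then have "norm (F2 t) \<le> ((exp (2 * r) * (2 * r) powr (2 - 2) / min 1 ((2 * r)\<^sup>2)) / (1 + (Im s)\<^sup>2)) / (1/2)"
          unfolding F2_def s_def[symmetric] norm_divide using r1
          by (intro frac_le recip_gamma_integrand_bound) (auto simp: s_def)
        then show ?thesis unfolding s_def by (simp only: complex.sel) (simp add: mult_ac)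
      qed
      then have "integrable lborel (\<lambda>t. recip_gamma_integrand 2 (Complex (2 * r) t) / (1 - p * Complex (2 * r) t powr (- of_real 1)))"
        unfolding F2_def using r1 by (intro integrable_line[OF F2_hol]) simp
      then show ?thesis unfolding F2_def .
    qed
    have "F1 = (\<lambda>t. g (Complex (2 * r) t) + D * F2 t)" using g_split by (auto simp: fun_eq_iff)
    then have "(\<integral>t. F1 t \<partial>lborel) = (\<integral>t. g (Complex (\<epsilon> * r) t) \<partial>lborel) + D * (\<integral>t. F2 t \<partial>lborel)"
      unfolding shift using intg int2 by simp
    then have "mittag_leffler k \<mu> x = (\<integral>t. g (Complex (\<epsilon> * r) t) \<partial>lborel) / C0 + D * mittag_leffler 1 2 p"
      unfolding I1 I2 by (simp add: add_divide_distrib)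
    also have "D * mittag_leffler 1 2 p = of_real (1/k) * p powr (1 - of_real \<mu>) * (exp p - 1)"
    proof -
      have "p powr (2 - of_real \<mu>) = p powr (1 - of_real \<mu>) * p" using p0 by (simp add: powr_diff power2_eq_square)
      then show ?thesis by (simp add: D_def mittag_leffler_1_2[symmetric] mult_ac)
    qed
    finally have main: "mittag_leffler k \<mu> x - of_real (1/k) * p powr (1 - of_real \<mu>) * exp p =
       (\<integral>t. g (Complex (\<epsilon> * r) t) \<partial>lborel) / C0 - of_real (1/k) * p powr (1 - of_real \<mu>)"
      by (simp add: right_diff_distrib diff_divide_distrib)
    have "(\<integral>t. norm (g (Complex (\<epsilon> * r) t)) \<partial>lborel) \<le> (\<integral>t. B * exp (\<epsilon> * r) * inverse (1 + t\<^sup>2) \<partial>lborel)"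
      using integrable_line[OF g_hol epr line_bd] integrable_inverse_1_plus_square_line line_bd
      by (intro integral_mono integrable_mult_right integrable_norm) (auto simp: divide_inverse)
    then have "norm (\<integral>t. g (Complex (\<epsilon> * r) t) \<partial>lborel) \<le> B * A * exp (\<epsilon> * r)"
      by (intro order_trans[OF integral_norm_bound]) (simp add: A_def mult_ac)
    then have "norm ((\<integral>t. g (Complex (\<epsilon> * r) t) \<partial>lborel) / C0) \<le> B * A * exp (\<epsilon> * r) / norm C0"
      unfolding norm_divide by (rule divide_right_mono) simp
    moreover have "norm (of_real (1/k) * p powr (1 - of_real \<mu>)) \<le> (1/k) * exp (\<epsilon> * r)"
      unfolding norm_mult using npmu k epr by (intro mult_mono) (auto intro: order_trans simp: norm_divide)
    ultimately have "norm (mittag_leffler k \<mu> x - of_real (1/k) * p powr (1 - of_real \<mu>) * exp p) \<le> B * A * exp (\<epsilon> * r) / norm C0 + (1/k) * exp (\<epsilon> * r)"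
      unfolding main by (intro norm_triangle_le_diff add_mono)
    also have "\<dots> = (B * A / norm C0 + 1/k) * exp (\<epsilon> * norm p)" by (simp add: r_def algebra_simps)
    finally show "norm (mittag_leffler k \<mu> (p powr (of_real k)) - of_real (1 / k) * p powr (1 - of_real \<mu>) * exp p)
       \<le> (B * A / norm (recip_gamma_integral 2) + 1/k) * exp (\<epsilon> * norm p)" by (simp add: x_def C0_def)
  qed
qed

lemma power_le_exp_mult:
  assumes "0 < \<epsilon>" "0 \<le> y"
  shows "y ^ N \<le> (real (Suc N) / \<epsilon>) ^ Suc N * exp (\<epsilon> * y) + 1"
proof (cases "y \<le> 1")
  case True
  then have "y ^ N \<le> 1" using assms by (simp add: power_le_one)
  then show ?thesis using assms by (intro order_trans[OF _ le_add_same_cancel2[THEN iffD2]]) auto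
next
  case False
  have "y ^ N \<le> y ^ Suc N" using False by (intro power_increasing) auto
  also have "\<dots> = (real (Suc N) / \<epsilon>) ^ Suc N * ((\<epsilon> * y) / real (Suc N)) ^ Suc N"
    using assms by (simp add: power_mult_distrib[symmetric] del: power_Suc of_nat_Suc)
  also have "\<dots> \<le> (real (Suc N) / \<epsilon>) ^ Suc N * (1 + (\<epsilon> * y) / real (Suc N)) ^ Suc N"
    using assms by (intro mult_left_mono power_mono) auto
  also have "\<dots> \<le> (real (Suc N) / \<epsilon>) ^ Suc N * exp (\<epsilon> * y)"
    using assms by (intro mult_left_mono exp_ge_one_plus_x_over_n_power_n) (auto intro: order_trans[of _ 0])
  finally show ?thesis by simp
qed

lemma polynomial_le_exp:
  assumes "0 < (\<epsilon>::real)"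
  shows "\<exists>C>0. \<forall>y\<ge>0. y ^ N \<le> C * exp (\<epsilon> * y)"
proof (intro exI conjI allI impI)
  show "(real (Suc N) / \<epsilon>) ^ Suc N + 1 > 0" using assms by (intro add_nonneg_pos) auto
  fix y :: real assume y: "y \<ge> 0"
  have "1 \<le> exp (\<epsilon> * y)" using assms y by simp
  then show "y ^ N \<le> ((real (Suc N) / \<epsilon>) ^ Suc N + 1) * exp (\<epsilon> * y)"
    using power_le_exp_mult[OF assms y, of N] by (simp only: distrib_right mult_1)
qed

text \<open>The polynomial split off by \<open>mittag_leffler_shift\<close> and the factor \<open>x ^ N\<close> are absorbed into the additional
\<open>\<epsilon>\<close> in the exponent.\<close>

lemma mittag_leffler_asymptotics:
  assumes k: "0 < k" "k \<le> 1" and mu: "0 < \<mu>" and eps: "0 < \<epsilon>" "\<epsilon> < 1/2"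
  shows "\<exists>C>0. \<forall>x. norm x \<ge> 1 \<longrightarrow>
     (\<forall>p. x = p powr (of_real k) \<longrightarrow> Re p > 3/2 * \<epsilon> * norm p \<longrightarrow>
        norm (mittag_leffler k \<mu> x - of_real (1 / k) * p powr (1 - of_real \<mu>) * exp p) \<le> C * exp (3 * \<epsilon> * norm x powr (1 / k))) \<and>
     (x \<notin> principal_sector k (3/2 * \<epsilon>) \<longrightarrow> norm (mittag_leffler k \<mu> x) \<le> C * exp (3 * \<epsilon> * norm x powr (1 / k)))"
proof -
  obtain N :: nat where N: "2 / k < real N" using reals_Archimedean2 by blast
  define \<nu> where "\<nu> = \<mu> + k * real N"
  have nu: "2 \<le> \<nu>" using N k mu by (simp add: \<nu>_def field_simps)
  obtain C1 where C1: "\<And>x. norm x \<ge> 1 \<Longrightarrow> x \<notin> principal_sector k (3/2 * \<epsilon>) \<Longrightarrow>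
     norm (mittag_leffler k \<nu> x) \<le> C1 * exp (2 * \<epsilon> * norm x powr (1 / k))"
    using mittag_leffler_off_sector[OF k nu eps] by blast
  obtain C2 where C2: "\<And>p. norm p \<ge> 1 \<Longrightarrow> Re p > 3/2 * \<epsilon> * norm p \<Longrightarrow>
     norm (mittag_leffler k \<nu> (p powr (of_real k)) - of_real (1 / k) * p powr (1 - of_real \<nu>) * exp p) \<le> C2 * exp (\<epsilon> * norm p)"
    using mittag_leffler_on_sector[OF k nu eps] by blast
  obtain C3 where C3: "C3 > 0" "\<And>y. y \<ge> 0 \<Longrightarrow> y ^ N \<le> C3 * exp (\<epsilon> * y)" using polynomial_le_exp[OF eps(1), of N] by blast
  define P where "P x = (\<Sum>m<N. x ^ m / of_real (Gamma (k * real m + \<mu>)))" for x :: complex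
  define G where "G = (\<Sum>m<N. 1 / \<bar>Gamma (k * real m + \<mu>)\<bar>)"
  have G0: "G \<ge> 0" unfolding G_def by (intro sum_nonneg) auto
  define B where "B = \<bar>C1\<bar> + \<bar>C2\<bar>"
  have xN: "norm x ^ N \<le> C3 * exp (\<epsilon> * norm x powr (1 / k))" if "norm x \<ge> 1" for x :: complex
  proof -
    have "norm x powr 1 \<le> norm x powr (1 / k)" using that k by (intro powr_mono) auto
    then have "norm x ^ N \<le> (norm x powr (1 / k)) ^ N" using that by (intro power_mono) auto
    also have "\<dots> \<le> C3 * exp (\<epsilon> * norm x powr (1 / k))" by (rule C3(2)) simp
    finally show ?thesis .
  qed
  have Pb: "norm (P x) \<le> G * norm x ^ N" if "norm x \<ge> 1" for x
  proof -
    have "norm (P x) \<le> (\<Sum>m<N. norm x ^ m / \<bar>Gamma (k * real m + \<mu>)\<bar>)"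
      unfolding P_def by (rule sum_norm_le) (simp add: norm_divide norm_power)
    also have "\<dots> \<le> (\<Sum>m<N. norm x ^ N / \<bar>Gamma (k * real m + \<mu>)\<bar>)"
      using that by (intro sum_mono divide_right_mono power_increasing) auto
    also have "\<dots> = G * norm x ^ N" by (simp add: G_def sum_distrib_right)
    finally show ?thesis .
  qed
  have combine: "norm (P x + x ^ N * z) \<le> ((G + B) * C3) * exp (3 * \<epsilon> * norm x powr (1 / k))"
    if x: "norm x \<ge> 1" and z: "norm z \<le> B * exp (2 * \<epsilon> * norm x powr (1 / k))" for x z
  proof -
    let ?y = "norm x powr (1 / k)"
    have y: "?y \<ge> 0" by simp
    have B0: "B \<ge> 0" by (simp add: B_def)
    have "norm (P x + x ^ N * z) \<le> G * norm x ^ N + norm x ^ N * (B * exp (2 * \<epsilon> * ?y))"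
      using Pb[OF x] z by (intro norm_triangle_le add_mono) (auto simp: norm_mult norm_power intro!: mult_left_mono)
    also have "\<dots> \<le> norm x ^ N * ((G + B) * exp (2 * \<epsilon> * ?y))"
    proof -
      have "1 \<le> exp (2 * \<epsilon> * ?y)" using eps by simp
      then have "norm x ^ N * (G * 1) \<le> norm x ^ N * (G * exp (2 * \<epsilon> * ?y))" using G0 by (intro mult_left_mono) auto
      then show ?thesis by (simp add: algebra_simps)
    qed
    also have "\<dots> \<le> (C3 * exp (\<epsilon> * ?y)) * ((G + B) * exp (2 * \<epsilon> * ?y))"
      using xN[OF x] G0 B0 by (intro mult_right_mono) auto
    also have "\<dots> = ((G + B) * C3) * (exp (\<epsilon> * ?y) * exp (2 * \<epsilon> * ?y))" by simp
    also have "exp (\<epsilon> * ?y) * exp (2 * \<epsilon> * ?y) = exp (3 * \<epsilon> * ?y)" by (simp add: exp_add[symmetric])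
    finally show ?thesis .
  qed
  have split: "mittag_leffler k \<mu> x = P x + x ^ N * mittag_leffler k \<nu> x" for x
    unfolding P_def \<nu>_def using k mu by (intro mittag_leffler_shift) auto
  show ?thesis
  proof (intro exI[of _ "(G + B) * C3 + 1"] conjI allI impI)
    show "(G + B) * C3 + 1 > 0" using G0 C3(1) by (intro add_nonneg_pos mult_nonneg_nonneg) (auto simp: B_def)
    fix x :: complex assume x: "norm x \<ge> 1"
    let ?e = "exp (3 * \<epsilon> * norm x powr (1 / k))"
    have le: "((G + B) * C3) * ?e \<le> ((G + B) * C3 + 1) * ?e" by (intro mult_right_mono) auto
    {
      assume xs: "x \<notin> principal_sector k (3/2 * \<epsilon>)"
      have "norm (mittag_leffler k \<nu> x) \<le> C1 * exp (2 * \<epsilon> * norm x powr (1 / k))" by (rule C1[OF x xs])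
      also have "\<dots> \<le> B * exp (2 * \<epsilon> * norm x powr (1 / k))" by (intro mult_right_mono) (auto simp: B_def)
      finally show "norm (mittag_leffler k \<mu> x) \<le> ((G + B) * C3 + 1) * ?e"
        unfolding split using combine[OF x] le by (meson order_trans)
    }
    {
      fix p assume p: "x = p powr (of_real k)" "Re p > 3/2 * \<epsilon> * norm p"
      have p0: "p \<noteq> 0" using p by auto
      have np: "norm p = norm x powr (1 / k)" using norm_powr_real_powr'[of "of_real k" p] k by (simp add: p(1) powr_powr)
      have p1: "norm p \<ge> 1" unfolding np using x k by (intro ge_one_powr_ge_zero) auto
      have "norm (mittag_leffler k \<nu> x - of_real (1 / k) * p powr (1 - of_real \<nu>) * exp p) \<le> C2 * exp (\<epsilon> * norm p)"
        using C2[OF p1 p(2)] p(1) by simp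
      also have "\<dots> \<le> B * exp (2 * \<epsilon> * norm x powr (1 / k))"
        unfolding np using eps by (intro mult_mono) (auto simp: B_def)
      finally have *: "norm (P x + x ^ N * (mittag_leffler k \<nu> x - of_real (1 / k) * p powr (1 - of_real \<nu>) * exp p)) \<le> ((G + B) * C3 + 1) * ?e"
        using combine[OF x] le by (meson order_trans)
      have "x ^ N = p powr (of_real (k * real N))" unfolding p(1) complex_powr_power[OF p0] by (simp add: mult.commute)
      then have "x ^ N * p powr (1 - of_real \<nu>) = p powr (1 - of_real \<mu>)"
        by (simp add: powr_add[symmetric] \<nu>_def)
      then have eq: "x ^ N * (of_real (1 / k) * p powr (1 - of_real \<nu>) * exp p) = of_real (1 / k) * p powr (1 - of_real \<mu>) * exp p"
        by (metis (no_types, lifting) mult.assoc mult.left_commute)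
      show "norm (mittag_leffler k \<mu> x - of_real (1 / k) * p powr (1 - of_real \<mu>) * exp p) \<le> ((G + B) * C3 + 1) * ?e"
        using * unfolding split right_diff_distrib eq add_diff_eq .
    }
  qed
qed

lemma mittag_leffler_has_derivative:
  assumes k: "0 < k" and mu: "0 < \<mu>"
  shows "(mittag_leffler k \<mu> has_field_derivative (\<Sum>m. of_nat (Suc m) * x ^ m / of_real (Gamma (k * real (Suc m) + \<mu>)))) (at x)"
proof -
  let ?c = "\<lambda>m. 1 / complex_of_real (Gamma (k * real m + \<mu>))"
  have "((\<lambda>x. \<Sum>n. ?c n * x ^ n) has_field_derivative (\<Sum>n. diffs ?c n * x ^ n)) (at x)"
    using mittag_leffler_summable_norm[OF k mu, of "of_real (norm x + 1)"]
    by (intro termdiffs_strong[of _ "of_real (norm x + 1)"]) (auto dest: summable_norm_cancel)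
  then show ?thesis unfolding mittag_leffler_def[abs_def] diffs_def by (simp add: mult_ac)
qed

lemma mittag_leffler_holomorphic: "0 < k \<Longrightarrow> 0 < \<mu> \<Longrightarrow> mittag_leffler k \<mu> holomorphic_on A"
  using mittag_leffler_has_derivative unfolding holomorphic_on_def field_differentiable_def
  by (blast intro: has_field_derivative_at_within)

text \<open>Since \<open>Gamma (k * m + 1) = k * m * Gamma (k * m)\<close>, differentiation lowers the second parameter from 1 to \<open>k\<close>.\<close>

lemma deriv_mittag_leffler_1:
  assumes k: "0 < k"
  shows "(mittag_leffler k 1 has_field_derivative of_real (1 / k) * mittag_leffler k k x) (at x)"
proof -
  have "of_nat (Suc m) * x ^ m / of_real (Gamma (k * real (Suc m) + 1)) = of_real (1 / k) * (x ^ m / of_real (Gamma (k * real m + k)))" for m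
  proof -
    have "Gamma (k * real (Suc m) + 1) = (k * real (Suc m)) * Gamma (k * real (Suc m))"
    proof (rule Gamma_plus1)
      have "k * real (Suc m) > 0" using k by simp
      then show "k * real (Suc m) \<notin> \<int>\<^sub>\<le>\<^sub>0" by (auto dest: nonpos_Ints_nonpos simp del: of_nat_Suc)
    qed
    also have "k * real (Suc m) = k * real m + k" by (simp add: algebra_simps)
    finally have "Gamma (k * real (Suc m) + 1) = k * real (Suc m) * Gamma (k * real m + k)" by (simp add: algebra_simps)
    then show ?thesis using k by (simp del: of_nat_Suc)
  qed
  then have "(\<Sum>m. of_nat (Suc m) * x ^ m / of_real (Gamma (k * real (Suc m) + 1))) = (\<Sum>m. of_real (1 / k) * (x ^ m / of_real (Gamma (k * real m + k))))"
    by simp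
  also have "\<dots> = of_real (1 / k) * mittag_leffler k k x"
    unfolding mittag_leffler_def using k by (intro suminf_mult summable_norm_cancel[OF mittag_leffler_summable_norm]) auto
  finally show ?thesis using mittag_leffler_has_derivative[OF k, of 1 x] by simp
qed

section \<open>Growth of the rescaled Mittag-Leffler functions\<close>

text \<open>A majorant for the exponential growth of the Mittag-Leffler function that remembers the direction: it lies between half of
\<open>\<bar>x\<bar> powr l\<close> and \<open>\<bar>x\<bar> powr l\<close>, reaches the upper value on the positive axis only, and falls short of it by a quarter of
\<open>\<bar>x\<bar> powr (l - 1) * (\<bar>x\<bar> - Re x)\<close>. The deficit produces Gaussian decay in the directions transversal to
a ray, and there are no sector boundaries at which the function would jump.\<close>

definition angular_growth :: "real \<Rightarrow> complex \<Rightarrow> real" where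
  "angular_growth l x = 3/4 * norm x powr l + 1/4 * (norm x powr (l - 1) * Re x)"

lemma angular_growth_bounds:
  "1/2 * norm x powr l \<le> angular_growth l x" "angular_growth l x \<le> norm x powr l"
proof -
  have "norm x powr (l - 1) * norm x = norm x powr l" if "x \<noteq> 0" using that by (simp add: powr_diff)
  then have "norm x powr (l - 1) * \<bar>Re x\<bar> \<le> norm x powr l"
    using abs_Re_le_cmod[of x] by (cases "x = 0") (auto intro: order_trans[OF mult_left_mono])
  moreover have "\<bar>norm x powr (l - 1) * Re x\<bar> = norm x powr (l - 1) * \<bar>Re x\<bar>" by (simp add: abs_mult)
  ultimately have "norm x powr (l - 1) * Re x \<le> norm x powr l" "- (norm x powr l) \<le> norm x powr (l - 1) * Re x" by linarith+
  then show "1/2 * norm x powr l \<le> angular_growth l x" "angular_growth l x \<le> norm x powr l"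
    unfolding angular_growth_def by linarith+
qed

text \<open>In polar coordinates: the argument of \<open>x\<close> is \<open>k \<le> 1\<close> times that of \<open>p\<close>, and cosine decreases on \<open>{0..pi}\<close>.\<close>

lemma Re_le_of_powr:
  assumes p: "Re p > 0" and k: "0 < k" "k \<le> 1" and x: "x = p powr (of_real k)"
  shows "Re p \<le> norm x powr (1 / k - 1) * Re x" "norm p = norm x powr (1 / k)"
proof -
  have p0: "p \<noteq> 0" using p by auto
  show np: "norm p = norm x powr (1 / k)" using norm_powr_real_powr'[of "of_real k" p] k by (simp add: x powr_powr)
  have x0: "x \<noteq> 0" using p0 by (simp add: x)
  have polar: "Re z = norm z * cos (Im (Ln z))" if "z \<noteq> 0" for z
    using that by (metis Re_exp Re_Ln exp_Ln exp_ln zero_less_norm_iff)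
  have Ln: "Im (Ln x) = k * Im (Ln p)" using Ln_powr_of_real[OF p k] by (simp add: x)
  have arg: "\<bar>Im (Ln p)\<bar> < pi / 2" using Re_Ln_pos_lt[OF p0] p by simp
  have "cos \<bar>Im (Ln p)\<bar> \<le> cos \<bar>Im (Ln x)\<bar>"
  proof (rule cos_monotone_0_pi_le)
    show "\<bar>Im (Ln x)\<bar> \<le> \<bar>Im (Ln p)\<bar>" unfolding Ln abs_mult using k by (simp add: mult_left_le_one_le)
    show "\<bar>Im (Ln p)\<bar> \<le> pi" using arg pi_gt_zero by linarith
  qed auto
  then have "Re p \<le> norm p * cos (Im (Ln x))" unfolding polar[OF p0] by (intro mult_left_mono) auto
  also have "norm p = norm x powr (1 / k - 1) * norm x" using x0 by (simp add: np powr_diff)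
  also have "\<dots> * cos (Im (Ln x)) = norm x powr (1 / k - 1) * Re x" using polar[OF x0] by simp
  finally show "Re p \<le> norm x powr (1 / k - 1) * Re x" .
qed

text \<open>In the sector with parameter \<open>1/4\<close> use \<open>Re p\<close>, which is at most both \<open>\<bar>x\<bar> powr l\<close> and
\<open>\<bar>x\<bar> powr (l - 1) * Re x\<close>; outside, the type is \<open>1/2\<close>.\<close>

lemma mittag_leffler_bound:
  assumes l: "l \<ge> 1"
  shows "\<exists>C>0. \<forall>x. norm (mittag_leffler (1 / l) 1 x) \<le> C * exp (angular_growth l x)"
proof -
  define k where "k = 1 / l"
  have k: "0 < k" "k \<le> 1" "1 / k = l" using l by (auto simp: k_def)
  \<comment> \<open>\<open>\<epsilon> = 1/6\<close> makes the type \<open>3 * \<epsilon>\<close> of the error equal to the lower bound \<open>1/2\<close> in the growth function\<close>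
  obtain C where C: "C > 0" "\<And>x p. norm x \<ge> 1 \<Longrightarrow> x = p powr (of_real k) \<Longrightarrow> Re p > 3/2 * (1/6) * norm p \<Longrightarrow>
        norm (mittag_leffler k 1 x - of_real (1 / k) * p powr (1 - of_real 1) * exp p) \<le> C * exp (3 * (1/6) * norm x powr (1 / k))"
     "\<And>x. norm x \<ge> 1 \<Longrightarrow> x \<notin> principal_sector k (3/2 * (1/6)) \<Longrightarrow> norm (mittag_leffler k 1 x) \<le> C * exp (3 * (1/6) * norm x powr (1 / k))"
    using mittag_leffler_asymptotics[OF k(1,2), of 1 "1/6"] by auto
  have "compact (mittag_leffler k 1 ` cball 0 1)"
    by (intro compact_continuous_image holomorphic_on_imp_continuous_on mittag_leffler_holomorphic) (use k in auto)
  then obtain B where B: "\<And>x. norm x \<le> 1 \<Longrightarrow> norm (mittag_leffler k 1 x) \<le> B"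
    using compact_imp_bounded bounded_iff by (metis (no_types, lifting) imageI mem_cball_0)
  show ?thesis
  proof (intro exI[of _ "C + l + \<bar>B\<bar>"] conjI allI)
    show "C + l + \<bar>B\<bar> > 0" using C(1) l by simp
    fix x :: complex
    let ?g = "angular_growth l x"
    have g: "exp (1/2 * norm x powr l) \<le> exp ?g" "1 \<le> exp ?g"
      using angular_growth_bounds(1)[of x l] powr_ge_zero[of "norm x" l] by (auto simp del: powr_ge_zero)
    have "norm (mittag_leffler k 1 x) \<le> (C + l + \<bar>B\<bar>) * exp ?g"
    proof (cases "norm x \<le> 1")
      case True
      then have "norm (mittag_leffler k 1 x) \<le> \<bar>B\<bar> * 1" using B[of x] by simp
      also have "\<dots> \<le> (C + l + \<bar>B\<bar>) * exp ?g" using g C(1) l by (intro mult_mono) auto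
      finally show ?thesis .
    next
      case False
      then have x1: "norm x \<ge> 1" by simp
      show ?thesis
      proof (cases "x \<in> principal_sector k (3/2 * (1/6))")
        case False
        have "norm (mittag_leffler k 1 x) \<le> C * exp (3 * (1/6) * norm x powr (1 / k))" by (rule C(3)[OF x1 False])
        also have "\<dots> \<le> (C + l + \<bar>B\<bar>) * exp ?g" using g C(1) l unfolding k(3) by (intro mult_mono) auto
        finally show ?thesis .
      next
        case True
        then obtain p where p: "x = p powr (of_real k)" "Re p > 3/2 * (1/6) * norm p" by (auto simp: principal_sector_def)
        have Rp: "Re p > 0" using p(2) norm_ge_zero[of p] by linarith
        have "Re p \<le> ?g"
          using Re_le_of_powr[OF Rp k(1,2) p(1)] complex_Re_le_cmod[of p] unfolding k(3) angular_growth_def by linarith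
        then have e: "norm (exp p) \<le> exp ?g" by simp
        have "p \<noteq> 0" using Rp by auto
        then have "norm (mittag_leffler k 1 x) \<le> norm (mittag_leffler k 1 x - of_real (1 / k) * p powr (1 - of_real 1) * exp p) + norm (of_real l * exp p)"
          using norm_triangle_sub[of "mittag_leffler k 1 x" "of_real l * exp p"] k(3) by (simp add: add.commute)
        also have "\<dots> \<le> C * exp (3 * (1/6) * norm x powr (1 / k)) + l * exp ?g"
          using C(2)[OF x1 p] e l by (intro add_mono) (auto simp: norm_mult intro!: mult_left_mono)
        also have "\<dots> \<le> C * exp ?g + l * exp ?g + \<bar>B\<bar> * exp ?g"
        proof -
          have "C * exp (3 * (1/6) * norm x powr (1 / k)) \<le> C * exp ?g" using g C(1) unfolding k(3) by (intro mult_left_mono) auto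
          moreover have "0 \<le> \<bar>B\<bar> * exp ?g" by simp
          ultimately show ?thesis by linarith
        qed
        finally show ?thesis by (simp add: algebra_simps)
      qed
    qed
    then show "norm (mittag_leffler (1 / l) 1 x) \<le> (C + l + \<bar>B\<bar>) * exp ?g" by (simp add: k_def)
  qed
qed

definition scaled_ml :: "real \<Rightarrow> real \<Rightarrow> complex \<Rightarrow> complex" where
  "scaled_ml l c x = mittag_leffler (1 / l) 1 (of_real (c powr (1 / l)) * x)"

lemma scaled_ml_has_derivative:
  assumes "l \<ge> 1"
  shows "(scaled_ml l c has_field_derivative
     of_real (c powr (1 / l) * l) * mittag_leffler (1 / l) (1 / l) (of_real (c powr (1 / l)) * x)) (at x)"
proof -
  have "((\<lambda>x. mittag_leffler (1 / l) 1 (of_real (c powr (1 / l)) * x)) has_field_derivative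
     (of_real (1 / (1 / l)) * mittag_leffler (1 / l) (1 / l) (of_real (c powr (1 / l)) * x)) * of_real (c powr (1 / l))) (at x)"
    by (rule DERIV_chain2[OF deriv_mittag_leffler_1]) (use assms in \<open>auto intro!: derivative_eq_intros\<close>)
  then show ?thesis unfolding scaled_ml_def[abs_def] by (simp add: mult_ac)
qed

lemma scaled_ml_holomorphic: "l \<ge> 1 \<Longrightarrow> scaled_ml l c holomorphic_on A"
  using scaled_ml_has_derivative unfolding holomorphic_on_def field_differentiable_def
  by (blast intro: has_field_derivative_at_within)

lemma angular_growth_scale:
  assumes "l \<ge> 1" "c > 0"
  shows "angular_growth l (of_real (c powr (1 / l)) * x) = c * angular_growth l x"
proof -
  have "(c powr (1 / l)) powr (l - 1) * c powr (1 / l) = c powr 1"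
    using assms by (simp add: powr_powr powr_add[symmetric] field_simps)
  then show ?thesis using assms
    by (simp add: angular_growth_def norm_mult powr_mult powr_powr algebra_simps)
qed

lemma scaled_ml_bound:
  assumes "l \<ge> 1" "c > 0"
  shows "\<exists>C>0. \<forall>x. norm (scaled_ml l c x) \<le> C * exp (c * angular_growth l x)"
  using mittag_leffler_bound[OF assms(1)] unfolding scaled_ml_def angular_growth_scale[OF assms, symmetric] by blast

lemma scaled_mittag_leffler_asymptotics:
  assumes l: "l \<ge> 1" and c: "c > 0" and mu: "\<mu> > 0" and eps: "0 < \<epsilon>" "\<epsilon> < 1/2"
  shows "\<exists>C>0. \<exists>L. \<forall>x. norm x \<ge> L \<longrightarrow>
     (\<forall>p. x = p powr (of_real (1 / l)) \<longrightarrow> Re p > 3/2 * \<epsilon> * norm p \<longrightarrow>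
        norm (mittag_leffler (1 / l) \<mu> (of_real (c powr (1 / l)) * x) - of_real (l * c powr (1 - \<mu>)) * p powr (1 - of_real \<mu>) * exp (of_real c * p))
          \<le> C * exp (3 * \<epsilon> * c * norm x powr l)) \<and>
     (x \<notin> principal_sector (1 / l) (3/2 * \<epsilon>) \<longrightarrow>
        norm (mittag_leffler (1 / l) \<mu> (of_real (c powr (1 / l)) * x)) \<le> C * exp (3 * \<epsilon> * c * norm x powr l))"
proof -
  define k where "k = 1 / l"
  have k: "0 < k" "k \<le> 1" "1 / k = l" using l by (auto simp: k_def)
  obtain C where C: "C > 0" "\<And>x p. norm x \<ge> 1 \<Longrightarrow> x = p powr (of_real k) \<Longrightarrow> Re p > 3/2 * \<epsilon> * norm p \<Longrightarrow>
        norm (mittag_leffler k \<mu> x - of_real (1 / k) * p powr (1 - of_real \<mu>) * exp p) \<le> C * exp (3 * \<epsilon> * norm x powr (1 / k))"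
     "\<And>x. norm x \<ge> 1 \<Longrightarrow> x \<notin> principal_sector k (3/2 * \<epsilon>) \<Longrightarrow> norm (mittag_leffler k \<mu> x) \<le> C * exp (3 * \<epsilon> * norm x powr (1 / k))"
    using mittag_leffler_asymptotics[OF k(1,2) mu eps] by blast
  define d where "d = c powr k"
  have d: "d > 0" using c by (simp add: d_def)
  have dl: "d powr l = c" using c k l by (simp add: d_def powr_powr k_def)
  have nx: "norm (of_real d * x) powr l = c * norm x powr l" for x :: complex
    using d by (simp add: norm_mult powr_mult dl)
  show ?thesis unfolding k_def[symmetric] d_def[symmetric]
  proof (rule exI[of _ C], intro conjI C(1) exI[of _ "1 / d"] allI impI)
    fix x :: complex assume "norm x \<ge> 1 / d"
    then have x1: "norm (of_real d * x) \<ge> 1" using d by (simp add: norm_mult field_simps)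
    {
      fix p assume p: "x = p powr (of_real k)" "Re p > 3/2 * \<epsilon> * norm p"
      have e1: "of_real d * x = (of_real c * p) powr (of_real k)"
        unfolding p(1) d_def using c by (rule powr_of_real_scale[symmetric])
      have e2: "Re (of_real c * p) > 3/2 * \<epsilon> * norm (of_real c * p)"
        using p(2) c by (simp add: norm_mult mult.left_commute mult_less_cancel_left_pos)
      have e3: "(of_real c * p) powr (1 - of_real \<mu>) = of_real (c powr (1 - \<mu>)) * p powr (1 - of_real \<mu>)"
        using powr_of_real_scale[OF c, of p "1 - \<mu>"] by simp
      show "norm (mittag_leffler k \<mu> (of_real d * x) - of_real (l * c powr (1 - \<mu>)) * p powr (1 - of_real \<mu>) * exp (of_real c * p))
          \<le> C * exp (3 * \<epsilon> * c * norm x powr l)"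
        using C(2)[OF x1 e1 e2] unfolding k(3) nx e3 by (simp add: mult_ac)
    }
    assume xs: "x \<notin> principal_sector k (3/2 * \<epsilon>)"
    have "of_real d * x \<notin> principal_sector k (3/2 * \<epsilon>)"
    proof
      assume "of_real d * x \<in> principal_sector k (3/2 * \<epsilon>)"
      then obtain p where p: "of_real d * x = p powr (of_real k)" "Re p > 3/2 * \<epsilon> * norm p" by (auto simp: principal_sector_def)
      have "(of_real (1 / c) * p) powr (of_real k) = of_real ((1 / c) powr k) * p powr (of_real k)"
        using c by (intro powr_of_real_scale) simp
      also have "(1 / c) powr k = 1 / d" using c by (simp add: d_def powr_divide)
      also have "of_real (1 / d) * p powr (of_real k) = x" using d unfolding p(1)[symmetric] by simp
      finally have "x = (of_real (1 / c) * p) powr (of_real k)" by simp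
      moreover have "Re (of_real (1 / c) * p) > 3/2 * \<epsilon> * norm (of_real (1 / c) * p)"
        using divide_strict_right_mono[OF p(2) c] c by (simp add: norm_mult norm_divide)
      ultimately show False using xs unfolding principal_sector_def by blast
    qed
    from C(3)[OF x1 this] show "norm (mittag_leffler k \<mu> (of_real d * x)) \<le> C * exp (3 * \<epsilon> * c * norm x powr l)"
      unfolding k(3) nx by (simp add: mult_ac)
  qed
qed

lemma powr_increment_le:
  assumes "1 \<le> (l::real)" "0 \<le> t" "0 \<le> u"
  shows "\<bar>u powr l - t powr l\<bar> \<le> l * max t u powr (l - 1) * \<bar>u - t\<bar>"
proof -
  have *: "u powr l - t powr l \<le> l * u powr (l - 1) * (u - t)" if tu: "0 \<le> t" "t < u" for t u :: real
  proof -
    have "\<exists>x\<in>{t<..<u}. u powr l - t powr l = (\<lambda>h. h * (l * x powr (l - 1))) (u - t)"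
    proof (rule mvt[OF tu(2), of "\<lambda>x. x powr l" "\<lambda>x h. h * (l * x powr (l - 1))"])
      fix \<xi> assume "t < \<xi>" "\<xi> < u" "u powr l - t powr l = (u - t) * (l * \<xi> powr (l - 1))"
      then show "\<exists>x\<in>{t<..<u}. u powr l - t powr l = (\<lambda>h. h * (l * x powr (l - 1))) (u - t)"
        by (intro bexI[of _ \<xi>]) auto
    next
      show "continuous_on {t..u} (\<lambda>x. x powr l)"
        using tu assms by (intro continuous_on_powr' continuous_intros) auto
      fix x assume "t < x" "x < u"
      then have "((\<lambda>x. x powr l) has_real_derivative l * x powr (l - 1)) (at x)"
        using tu by (intro has_real_derivative_powr) auto
      then show "((\<lambda>x. x powr l) has_derivative (\<lambda>h. h * (l * x powr (l - 1)))) (at x)"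
        by (simp add: has_field_derivative_def mult_commute_abs)
    qed
    then obtain x where x: "t < x" "x < u" "u powr l - t powr l = (u - t) * (l * x powr (l - 1))" by auto
    have "x powr (l - 1) \<le> u powr (l - 1)" using x tu assms by (intro powr_mono2) auto
    then show ?thesis unfolding x(3) using tu assms by (simp add: mult_ac mult_left_mono)
  qed
  consider "t < u" | "t = u" | "u < t" by linarith
  then show ?thesis
  proof cases
    case 1
    then have "t powr l \<le> u powr l" using assms by (intro powr_mono2) auto
    then show ?thesis using *[of t u] 1 assms by (simp add: max_def)
  next
    case 3
    then have "u powr l \<le> t powr l" using assms by (intro powr_mono2) auto
    then show ?thesis using *[of u t] 3 assms by (simp add: max_def)
  qed simp
qed

text \<open>The functions \<open>\<bar>x\<bar> powr l\<close> and \<^term>\<open>angular_growth l\<close> have gradient of order \<open>\<bar>x\<bar> powr (l - 1)\<close>, so they vary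
by a bounded amount at distance \<open>(1 + \<bar>x\<bar>) powr (1 - l)\<close>.\<close>

lemma growth_increment:
  assumes l: "l \<ge> 1" and h: "norm h \<le> (1 + norm x) powr (1 - l)"
  shows "\<bar>norm (x + h) powr l - norm x powr l\<bar> \<le> l"
    and "\<bar>angular_growth l (x + h) - angular_growth l x\<bar> \<le> l + 1"
proof -
  define t u where "t = norm x" and "u = norm (x + h)"
  have t: "t \<ge> 0" "u \<ge> 0" by (auto simp: t_def u_def)
  have "(1 + t) powr (1 - l) \<le> (1 + t) powr 0" using l t by (intro powr_mono) auto
  then have h1: "norm h \<le> 1" using h t add_pos_nonneg[of 1 "norm x"] by (simp add: t_def)
  have tu: "\<bar>u - t\<bar> \<le> norm h" unfolding u_def t_def using norm_triangle_ineq3[of "x + h" x] by simp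
  have mx: "max t u \<le> 1 + t" using tu h1 by auto
  have prod: "(1 + t) powr (l - 1) * norm h \<le> 1"
  proof -
    have "(1 + t) powr (l - 1) * norm h \<le> (1 + t) powr (l - 1) * (1 + t) powr (1 - l)"
      using h by (intro mult_left_mono) (auto simp: t_def)
    also have "\<dots> = 1" using t by (simp add: powr_add[symmetric])
    finally show ?thesis .
  qed
  have pm: "max t u powr (l - 1) \<le> (1 + t) powr (l - 1)" using mx t l by (intro powr_mono2) auto
  have pu: "u powr (l - 1) \<le> (1 + t) powr (l - 1)" using mx t l by (intro powr_mono2) auto
  have "\<bar>u powr l - t powr l\<bar> \<le> l * max t u powr (l - 1) * \<bar>u - t\<bar>" using l t by (intro powr_increment_le)
  also have "\<dots> \<le> l * ((1 + t) powr (l - 1) * norm h)"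
    unfolding mult.assoc using l pm tu t by (intro mult_left_mono mult_mono) auto
  also have "\<dots> \<le> l * 1" using l prod by (intro mult_left_mono) auto
  finally have A: "\<bar>u powr l - t powr l\<bar> \<le> l" by simp
  then show "\<bar>norm (x + h) powr l - norm x powr l\<bar> \<le> l" by (simp add: u_def t_def)
  have u_tu: "u powr (l - 1) * \<bar>u - t\<bar> \<le> 1"
    using mult_mono[OF pu tu] prod by auto
  have Re_h: "\<bar>u powr (l - 1) * Re h\<bar> \<le> 1"
    unfolding abs_mult using mult_mono[OF pu abs_Re_le_cmod[of h]] prod by auto
  have pw: "v powr (l - 1) * v = v powr l" if "v \<ge> 0" for v :: real
    using that by (cases "v = 0") (auto simp: powr_diff)
  have "\<bar>(u powr (l - 1) - t powr (l - 1)) * Re x\<bar> \<le> \<bar>u powr (l - 1) - t powr (l - 1)\<bar> * t"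
    unfolding abs_mult t_def by (intro mult_left_mono abs_Re_le_cmod) auto
  also have "\<dots> = \<bar>(u powr (l - 1) - t powr (l - 1)) * t\<bar>" using t by (simp add: abs_mult)
  also have "(u powr (l - 1) - t powr (l - 1)) * t = (u powr l - t powr l) - u powr (l - 1) * (u - t)"
    using pw[OF t(1)] pw[OF t(2)] by (simp add: algebra_simps)
  also have "\<bar>\<dots>\<bar> \<le> l + 1" using A u_tu by (intro order_trans[OF abs_triangle_ineq4]) (auto simp: abs_mult)
  finally have B: "\<bar>(u powr (l - 1) - t powr (l - 1)) * Re x\<bar> \<le> l + 1" .
  have "angular_growth l (x + h) - angular_growth l x = 3/4 * (u powr l - t powr l)
      + 1/4 * (u powr (l - 1) * Re h + (u powr (l - 1) - t powr (l - 1)) * Re x)"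
    by (simp add: angular_growth_def u_def t_def algebra_simps)
  also have "\<bar>\<dots>\<bar> \<le> 3/4 * l + 1/4 * (1 + (l + 1))"
  proof -
    have "\<bar>3/4 * X + 1/4 * (Y + Z)\<bar> \<le> 3/4 * l + 1/4 * (1 + (l + 1))"
      if "\<bar>X\<bar> \<le> l" "\<bar>Y\<bar> \<le> 1" "\<bar>Z\<bar> \<le> l + 1" for X Y Z :: real
    proof -
      have "\<bar>3 * X + (Y + Z)\<bar> \<le> 3 * l + (1 + (l + 1))" using that by linarith
      then show ?thesis by (simp add: abs_le_iff field_simps)
    qed
    from this[OF A Re_h B] show ?thesis .
  qed
  also have "\<dots> \<le> l + 1" by (simp add: field_simps)
  finally show "\<bar>angular_growth l (x + h) - angular_growth l x\<bar> \<le> l + 1" .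
qed

text \<open>Cauchy's inequality on the circle of radius \<open>(1 + \<bar>x\<bar>) powr (1 - l)\<close>: every derivative costs a factor
\<open>(1 + \<bar>x\<bar>) powr (l - 1)\<close>.\<close>

lemma higher_deriv_growth:
  assumes l: "l \<ge> 1" and hol: "f holomorphic_on UNIV" and C: "C \<ge> 0" "\<And>x. norm (f x) \<le> C * exp (g x)"
    and g: "\<And>x h. norm h \<le> (1 + norm x) powr (1 - l) \<Longrightarrow> g (x + h) \<le> g x + d"
  shows "norm ((deriv ^^ j) f x) \<le> (fact j * C * exp d) * (1 + norm x) powr (real j * (l - 1)) * exp (g x)"
proof -
  define r where "r = (1 + norm x) powr (1 - l)"
  have x: "1 + norm x > 0" by (simp add: add_pos_nonneg)
  have r: "r > 0" using x by (simp add: r_def)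
  have "norm ((deriv ^^ j) f x) \<le> fact j * (C * exp (g x + d)) / r ^ j"
  proof (rule Cauchy_inequality)
    show "f holomorphic_on ball x r" "continuous_on (cball x r) f"
      using hol by (auto intro: holomorphic_on_subset holomorphic_on_imp_continuous_on)
    fix y assume "norm (x - y) = r"
    then have "g (x + (y - x)) \<le> g x + d" by (intro g) (auto simp: r_def norm_minus_commute)
    then show "norm (f y) \<le> C * exp (g x + d)" using C(2)[of y] C(1)
      by (auto intro: order_trans mult_left_mono)
  qed (use r in auto)
  also have "1 / r ^ j = (1 + norm x) powr (real j * (l - 1))"
  proof -
    have "r ^ j = (1 + norm x) powr (real j * (1 - l))" using x by (simp add: r_def powr_power mult.commute)
    then have "1 / r ^ j = (1 + norm x) powr (- (real j * (1 - l)))" by (simp only: powr_minus_divide)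
    then show ?thesis by (simp add: algebra_simps)
  qed
  then have "fact j * (C * exp (g x + d)) / r ^ j = fact j * (C * exp (g x + d)) * (1 + norm x) powr (real j * (l - 1))"
    by (metis times_divide_eq_right mult.right_neutral)
  finally show ?thesis by (simp add: exp_add mult_ac)
qed

lemma powr_shift_le_exp:
  fixes s :: real
  assumes l: "l \<ge> 1" and eps: "\<epsilon> > 0"
  shows "\<exists>C>0. \<forall>t\<ge>0. (1 + t) powr s \<le> C * exp (\<epsilon> * t powr l)"
proof -
  obtain N :: nat where N: "s \<le> real N" using real_arch_simple by blast
  obtain C where C: "C > 0" "\<And>y. y \<ge> 0 \<Longrightarrow> y ^ N \<le> C * exp (\<epsilon> / 2 * y)" using polynomial_le_exp[of "\<epsilon> / 2" N] eps by auto
  show ?thesis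
  proof (intro exI[of _ "C * exp \<epsilon>"] conjI allI impI)
    fix t :: real assume t: "t \<ge> 0"
    have tl: "t \<le> 1 + t powr l"
    proof (cases "t \<le> 1")
      case False
      then have "t powr 1 \<le> t powr l" using l by (intro powr_mono) auto
      then show ?thesis using False by simp
    qed (use powr_ge_zero[of t l] in linarith)
    have "(1 + t) powr s \<le> (1 + t) powr (real N)" using N t by (intro powr_mono) auto
    also have "\<dots> = (1 + t) ^ N" using t by (simp add: powr_realpow)
    also have "\<dots> \<le> C * exp (\<epsilon> / 2 * (1 + t))" using t by (intro C(2)) auto
    also have "\<dots> \<le> C * exp (\<epsilon> + \<epsilon> * t powr l)"
    proof -
      have "\<epsilon> / 2 * (1 + t) \<le> \<epsilon> / 2 * (2 + t powr l)" using tl eps by (intro mult_left_mono) auto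
      also have "\<dots> \<le> \<epsilon> + \<epsilon> * t powr l" using eps by (simp add: algebra_simps)
      finally show ?thesis using C(1) by (intro mult_left_mono) auto
    qed
    finally show "(1 + t) powr s \<le> C * exp \<epsilon> * exp (\<epsilon> * t powr l)" by (simp add: exp_add mult_ac)
  qed (use C in auto)
qed

lemma higher_deriv_scaled_ml_bound:
  assumes l: "l \<ge> 1" and c: "c > 0"
  shows "\<exists>C>0. \<forall>x. norm ((deriv ^^ j) (scaled_ml l c) x) \<le> C * (1 + norm x) powr (real j * (l - 1)) * exp (c * angular_growth l x)"
proof -
  obtain C where C: "C > 0" "\<And>x. norm (scaled_ml l c x) \<le> C * exp (c * angular_growth l x)"
    using scaled_ml_bound[OF assms] by blast
  have "c * angular_growth l (x + h) \<le> c * angular_growth l x + c * (l + 1)" if "norm h \<le> (1 + norm x) powr (1 - l)" for x h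
    using growth_increment(2)[OF l that] c mult_left_mono[of "angular_growth l (x + h)" "angular_growth l x + (l + 1)" c]
    by (simp add: algebra_simps)
  from higher_deriv_growth[OF l scaled_ml_holomorphic[OF l] less_imp_le[OF C(1)] C(2) this] C(1)
  show ?thesis by (intro exI[of _ "fact j * C * exp (c * (l + 1))"]) auto
qed

lemma higher_deriv_type_bound:
  assumes l: "l \<ge> 1" and hol: "f holomorphic_on UNIV" and C: "\<And>x. norm (f x) \<le> C * exp (\<tau> * norm x powr l)"
    and tau: "0 \<le> \<tau>" "\<tau> < \<tau>'"
  shows "\<exists>C>0. \<forall>x. norm ((deriv ^^ j) f x) \<le> C * exp (\<tau>' * norm x powr l)"
proof -
  have C0: "C \<ge> 0" using C[of 0] by (auto intro: order_trans[OF norm_ge_zero] simp: zero_le_mult_iff)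
  have inc: "\<tau> * norm (x + h) powr l \<le> \<tau> * norm x powr l + \<tau> * l" if "norm h \<le> (1 + norm x) powr (1 - l)" for x h :: complex
    using growth_increment(1)[OF l that] tau mult_left_mono[of "norm (x + h) powr l" "norm x powr l + l" \<tau>]
    by (simp add: algebra_simps)
  obtain D where D: "D > 0" "\<And>t. t \<ge> 0 \<Longrightarrow> (1 + t) powr (real j * (l - 1)) \<le> D * exp ((\<tau>' - \<tau>) * t powr l)"
    using powr_shift_le_exp[OF l, of "\<tau>' - \<tau>" "real j * (l - 1)"] tau by auto
  define K where "K = fact j * C * exp (\<tau> * l)"
  have K: "K \<ge> 0" using C0 by (simp add: K_def)
  show ?thesis
  proof (intro exI[of _ "K * D + 1"] conjI allI)
    show "K * D + 1 > 0" using K D by (intro add_nonneg_pos) auto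
    fix x
    have "norm ((deriv ^^ j) f x) \<le> K * (1 + norm x) powr (real j * (l - 1)) * exp (\<tau> * norm x powr l)"
      unfolding K_def by (rule higher_deriv_growth[OF l hol C0 C inc])
    also have "\<dots> \<le> K * (D * exp ((\<tau>' - \<tau>) * norm x powr l)) * exp (\<tau> * norm x powr l)"
      using K D(2)[of "norm x"] by (intro mult_right_mono mult_left_mono) auto
    also have "\<dots> = K * D * exp (\<tau>' * norm x powr l)" by (simp add: exp_add[symmetric] algebra_simps)
    also have "\<dots> \<le> (K * D + 1) * exp (\<tau>' * norm x powr l)" by (intro mult_right_mono) auto
    finally show "norm ((deriv ^^ j) f x) \<le> (K * D + 1) * exp (\<tau>' * norm x powr l)" .
  qed
qed

section \<open>Approximating a derivative by a product\<close>

text \<open>The constant is the quotient of the leading coefficients: \<open>deriv (scaled_ml l (a + b))\<close> behaves like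
\<open>l\<^sup>2 * (a + b) * p powr (1 - 1/l) * exp ((a + b) * p)\<close>, and the product like
\<open>l * exp (a * p)\<close> times \<open>l\<^sup>2 * b * p powr (1 - 1/l) * exp (b * p)\<close>.\<close>

definition factor_remainder :: "real \<Rightarrow> real \<Rightarrow> real \<Rightarrow> complex \<Rightarrow> complex" where
  "factor_remainder l a b x =
     deriv (scaled_ml l (a + b)) x - of_real ((a + b) / (l * b)) * (scaled_ml l a x * deriv (scaled_ml l b) x)"

lemma deriv_scaled_ml: "l \<ge> 1 \<Longrightarrow> deriv (scaled_ml l c) x =
   of_real (c powr (1 / l) * l) * mittag_leffler (1 / l) (1 / l) (of_real (c powr (1 / l)) * x)"
  by (rule DERIV_imp_deriv[OF scaled_ml_has_derivative])

lemma factor_remainder_holomorphic: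
  assumes "l \<ge> 1" shows "factor_remainder l a b holomorphic_on A"
proof -
  have "factor_remainder l a b holomorphic_on UNIV"
    unfolding factor_remainder_def by (intro holomorphic_intros scaled_ml_holomorphic assms open_UNIV)
  then show ?thesis by (rule holomorphic_on_subset) simp
qed

lemma scaled_ml_asymptotics:
  assumes l: "l \<ge> 1" and c: "c > 0" and eps: "0 < \<epsilon>" "\<epsilon> < 1/2"
  shows "\<exists>C>0. \<exists>L. \<forall>x. norm x \<ge> L \<longrightarrow>
     (\<forall>p. x = p powr (of_real (1 / l)) \<longrightarrow> Re p > 3/2 * \<epsilon> * norm p \<longrightarrow>
        norm (scaled_ml l c x - of_real l * exp (of_real c * p)) \<le> C * exp (3 * \<epsilon> * c * norm x powr l)) \<and>
     (x \<notin> principal_sector (1 / l) (3/2 * \<epsilon>) \<longrightarrow>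
        norm (scaled_ml l c x) \<le> C * exp (3 * \<epsilon> * c * norm x powr l))"
proof -
  obtain C L where C: "C > 0" "\<And>(x::complex) p. norm x \<ge> L \<Longrightarrow> x = p powr (of_real (1 / l)) \<Longrightarrow> Re p > 3/2 * \<epsilon> * norm p \<Longrightarrow>
        norm (mittag_leffler (1 / l) 1 (of_real (c powr (1 / l)) * x) - of_real (l * c powr (1 - 1)) * p powr (1 - of_real 1) * exp (of_real c * p))
          \<le> C * exp (3 * \<epsilon> * c * norm x powr l)"
     "\<And>x::complex. norm x \<ge> L \<Longrightarrow> x \<notin> principal_sector (1 / l) (3/2 * \<epsilon>) \<Longrightarrow>
        norm (mittag_leffler (1 / l) 1 (of_real (c powr (1 / l)) * x)) \<le> C * exp (3 * \<epsilon> * c * norm x powr l)"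
    using scaled_mittag_leffler_asymptotics[OF l c _ eps, of 1] by auto
  show ?thesis
  proof (rule exI[of _ C], intro conjI C(1) exI[of _ L] allI impI)
    fix x :: complex assume x: "norm x \<ge> L"
    {
      fix p assume p: "x = p powr (of_real (1 / l))" "Re p > 3/2 * \<epsilon> * norm p"
      then have "p \<noteq> 0" by auto
      then show "norm (scaled_ml l c x - of_real l * exp (of_real c * p)) \<le> C * exp (3 * \<epsilon> * c * norm x powr l)"
        using C(2)[OF x p] c by (simp add: scaled_ml_def)
    }
    assume "x \<notin> principal_sector (1 / l) (3/2 * \<epsilon>)"
    then show "norm (scaled_ml l c x) \<le> C * exp (3 * \<epsilon> * c * norm x powr l)"
      using C(3)[OF x] by (simp add: scaled_ml_def)
  qed
qed

lemma deriv_scaled_ml_asymptotics: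
  assumes l: "l \<ge> 1" and c: "c > 0" and eps: "0 < \<epsilon>" "\<epsilon> < 1/2"
  shows "\<exists>C>0. \<exists>L. \<forall>x. norm x \<ge> L \<longrightarrow>
     (\<forall>p. x = p powr (of_real (1 / l)) \<longrightarrow> Re p > 3/2 * \<epsilon> * norm p \<longrightarrow>
        norm (deriv (scaled_ml l c) x - of_real (l\<^sup>2 * c) * p powr (of_real (1 - 1 / l)) * exp (of_real c * p)) \<le> C * exp (3 * \<epsilon> * c * norm x powr l)) \<and>
     (x \<notin> principal_sector (1 / l) (3/2 * \<epsilon>) \<longrightarrow>
        norm (deriv (scaled_ml l c) x) \<le> C * exp (3 * \<epsilon> * c * norm x powr l))"
proof -
  define d where "d = c powr (1 / l) * l"
  have d: "d > 0" using c l by (simp add: d_def)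
  define E where "E x = mittag_leffler (1 / l) (1 / l) (of_real (c powr (1 / l)) * x)" for x
  have D: "deriv (scaled_ml l c) x = of_real d * E x" for x
    using deriv_scaled_ml[OF l] by (simp add: d_def E_def)
  have "1 / l > 0" using l by simp
  then obtain C L where C: "C > 0" "\<And>(x::complex) p. norm x \<ge> L \<Longrightarrow> x = p powr (of_real (1 / l)) \<Longrightarrow> Re p > 3/2 * \<epsilon> * norm p \<Longrightarrow>
        norm (E x - of_real (l * c powr (1 - 1 / l)) * p powr (1 - of_real (1 / l)) * exp (of_real c * p))
          \<le> C * exp (3 * \<epsilon> * c * norm x powr l)"
     "\<And>x::complex. norm x \<ge> L \<Longrightarrow> x \<notin> principal_sector (1 / l) (3/2 * \<epsilon>) \<Longrightarrow> norm (E x) \<le> C * exp (3 * \<epsilon> * c * norm x powr l)"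
    unfolding E_def using scaled_mittag_leffler_asymptotics[OF l c _ eps, of "1 / l"] by blast
  have dc: "d * (l * c powr (1 - 1 / l)) = l\<^sup>2 * c"
  proof -
    have "c powr (1 / l) * c powr (1 - 1 / l) = c" using c by (simp add: powr_add[symmetric])
    then show ?thesis by (simp add: d_def power2_eq_square)
  qed
  show ?thesis
  proof (rule exI[of _ "d * C"], intro conjI exI[of _ L] allI impI)
    show "d * C > 0" using d C(1) by simp
    fix x :: complex assume x: "norm x \<ge> L"
    {
      fix p assume p: "x = p powr (of_real (1 / l))" "Re p > 3/2 * \<epsilon> * norm p"
      let ?m = "p powr (of_real (1 - 1 / l)) * exp (of_real c * p)"
      have "of_real d * E x - of_real (l\<^sup>2 * c) * p powr (of_real (1 - 1 / l)) * exp (of_real c * p)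
          = of_real d * (E x - of_real (l * c powr (1 - 1 / l)) * p powr (1 - of_real (1 / l)) * exp (of_real c * p))"
        unfolding dc[symmetric] by (simp add: algebra_simps)
      also have "norm \<dots> = d * norm (E x - of_real (l * c powr (1 - 1 / l)) * p powr (1 - of_real (1 / l)) * exp (of_real c * p))"
        using d by (simp add: norm_mult)
      also have "\<dots> \<le> d * (C * exp (3 * \<epsilon> * c * norm x powr l))"
        using C(2)[OF x p] d by (intro mult_left_mono) auto
      finally show "norm (deriv (scaled_ml l c) x - of_real (l\<^sup>2 * c) * p powr (of_real (1 - 1 / l)) * exp (of_real c * p)) \<le> d * C * exp (3 * \<epsilon> * c * norm x powr l)"
        unfolding D by (simp add: mult_ac)
    }
    assume "x \<notin> principal_sector (1 / l) (3/2 * \<epsilon>)"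
    from mult_left_mono[OF C(3)[OF x this], of d] d
    show "norm (deriv (scaled_ml l c) x) \<le> d * C * exp (3 * \<epsilon> * c * norm x powr l)"
      unfolding D by (simp add: norm_mult mult_ac)
  qed
qed

text \<open>In the sector the leading terms cancel, and each remaining term contains one error of small type and at most one
factor of type \<open>a\<close> or \<open>b\<close>. Outside the sector all three functions are small.\<close>

lemma factor_remainder_bound:
  assumes l: "l \<ge> 1" and a: "a > 0" and b: "b > 0" and tau: "\<tau> > a" "\<tau> > b"
  shows "\<exists>C>0. \<forall>x. norm (factor_remainder l a b x) \<le> C * exp (\<tau> * norm x powr l)"
proof -
  define \<delta> where "\<delta> = min (\<tau> - a) (\<tau> - b) / 2"
  have delta: "\<delta> > 0" "a + 2 * \<delta> \<le> \<tau>" "b + 2 * \<delta> \<le> \<tau>" using tau by (auto simp: \<delta>_def min_def)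
  \<comment> \<open>all error terms then have type at most \<open>\<delta>\<close>, which leaves another \<open>\<delta>\<close> to absorb the factor \<open>p powr (1 - 1/l)\<close>\<close>
  define \<epsilon> where "\<epsilon> = min (1/4) (\<delta> / (3 * (a + b)))"
  have eps: "0 < \<epsilon>" "\<epsilon> < 1/2" using a b delta by (auto simp: \<epsilon>_def min_def)
  have "\<epsilon> \<le> \<delta> / (3 * (a + b))" by (simp add: \<epsilon>_def)
  then have eab: "3 * \<epsilon> * (a + b) \<le> \<delta>" using a b by (simp add: field_simps)
  have "0 < 3 * \<epsilon> * a" "0 < 3 * \<epsilon> * b" using eps a b by auto
  then have ea: "3 * \<epsilon> * a \<le> \<delta>" and ebb: "3 * \<epsilon> * b \<le> \<delta>" using eab by (auto simp: distrib_left)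
  define S where "S = principal_sector (1 / l) (3/2 * \<epsilon>)"
  obtain Ca La where A: "Ca > 0" "\<And>(x::complex) p. norm x \<ge> La \<Longrightarrow> x = p powr (of_real (1 / l)) \<Longrightarrow> Re p > 3/2 * \<epsilon> * norm p \<Longrightarrow>
        norm (scaled_ml l a x - of_real l * exp (of_real a * p)) \<le> Ca * exp (3 * \<epsilon> * a * norm x powr l)"
     "\<And>x::complex. norm x \<ge> La \<Longrightarrow> x \<notin> S \<Longrightarrow> norm (scaled_ml l a x) \<le> Ca * exp (3 * \<epsilon> * a * norm x powr l)"
    unfolding S_def using scaled_ml_asymptotics[OF l a eps] by blast
  obtain Cb Lb where B: "Cb > 0" "\<And>(x::complex) p. norm x \<ge> Lb \<Longrightarrow> x = p powr (of_real (1 / l)) \<Longrightarrow> Re p > 3/2 * \<epsilon> * norm p \<Longrightarrow>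
        norm (deriv (scaled_ml l b) x - of_real (l\<^sup>2 * b) * p powr (of_real (1 - 1 / l)) * exp (of_real b * p)) \<le> Cb * exp (3 * \<epsilon> * b * norm x powr l)"
     "\<And>x::complex. norm x \<ge> Lb \<Longrightarrow> x \<notin> S \<Longrightarrow> norm (deriv (scaled_ml l b) x) \<le> Cb * exp (3 * \<epsilon> * b * norm x powr l)"
    unfolding S_def using deriv_scaled_ml_asymptotics[OF l b eps] by blast
  have ab: "a + b > 0" using a b by simp
  obtain Cc Lc where C: "Cc > 0" "\<And>(x::complex) p. norm x \<ge> Lc \<Longrightarrow> x = p powr (of_real (1 / l)) \<Longrightarrow> Re p > 3/2 * \<epsilon> * norm p \<Longrightarrow>
        norm (deriv (scaled_ml l (a + b)) x - of_real (l\<^sup>2 * (a + b)) * p powr (of_real (1 - 1 / l)) * exp (of_real (a + b) * p)) \<le> Cc * exp (3 * \<epsilon> * (a + b) * norm x powr l)"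
     "\<And>x::complex. norm x \<ge> Lc \<Longrightarrow> x \<notin> S \<Longrightarrow> norm (deriv (scaled_ml l (a + b)) x) \<le> Cc * exp (3 * \<epsilon> * (a + b) * norm x powr l)"
    unfolding S_def using deriv_scaled_ml_asymptotics[OF l ab eps] by blast
  define L where "L = max 1 (max La (max Lb Lc))"
  define q where "q = (a + b) / (l * b)"
  have q: "q > 0" using a b l by (simp add: q_def)
  obtain P where P: "P > 0" "\<And>y. y \<ge> 0 \<Longrightarrow> y ^ 1 \<le> P * exp (\<delta> * y)" using polynomial_le_exp[OF delta(1), of 1] by blast
  have "compact (factor_remainder l a b ` cball 0 L)"
    by (intro compact_continuous_image holomorphic_on_imp_continuous_on factor_remainder_holomorphic l) auto
  then obtain K where K: "\<And>x::complex. norm x \<le> L \<Longrightarrow> norm (factor_remainder l a b x) \<le> K"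
    using compact_imp_bounded bounded_iff by (metis (no_types, lifting) imageI mem_cball_0)
  define M where "M = Cc + q * (l * Cb + Ca * (l\<^sup>2 * b * P + Cb))"
  have M: "M > 0" unfolding M_def using C(1) q l A(1) B(1) b P(1) by (intro add_pos_nonneg mult_nonneg_nonneg) (auto intro!: add_nonneg_nonneg mult_nonneg_nonneg)
  have tau0: "\<tau> > 0" using tau a by simp
  show ?thesis
  proof (intro exI[of _ "\<bar>K\<bar> + M"] conjI allI)
    show "\<bar>K\<bar> + M > 0" using M by simp
    fix x :: complex
    let ?y = "norm x powr l"
    have y: "?y \<ge> 0" by simp
    show "norm (factor_remainder l a b x) \<le> (\<bar>K\<bar> + M) * exp (\<tau> * ?y)"
    proof (cases "norm x \<le> L")
      case True
      then have "norm (factor_remainder l a b x) \<le> \<bar>K\<bar> * 1" using K[of x] by simp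
      also have "\<dots> \<le> (\<bar>K\<bar> + M) * exp (\<tau> * ?y)" using M tau0 y by (intro mult_mono) auto
      finally show ?thesis .
    next
      case False
      then have xL: "norm x \<ge> La" "norm x \<ge> Lb" "norm x \<ge> Lc" "norm x \<ge> 1" by (auto simp: L_def)
      define fa fb fc where "fa = scaled_ml l a x" and "fb = deriv (scaled_ml l b) x" and "fc = deriv (scaled_ml l (a + b)) x"
      have R: "factor_remainder l a b x = fc - of_real q * (fa * fb)"
        by (simp add: factor_remainder_def fa_def fb_def fc_def q_def)
      have ec: "exp (3 * \<epsilon> * (a + b) * ?y) \<le> exp (\<tau> * ?y)"
        using eab delta a b y by (intro iffD2[OF exp_le_cancel_iff] mult_right_mono) auto
      have "norm (factor_remainder l a b x) \<le> M * exp (\<tau> * ?y)"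
      proof (cases "x \<in> S")
        case False
        have "norm (fc - of_real q * (fa * fb)) \<le> norm fc + q * (norm fa * norm fb)"
          using norm_triangle_ineq4[of fc "of_real q * (fa * fb)"] q by (simp add: norm_mult)
        also have "\<dots> \<le> Cc * exp (3 * \<epsilon> * (a + b) * ?y) + q * ((Ca * exp (3 * \<epsilon> * a * ?y)) * (Cb * exp (3 * \<epsilon> * b * ?y)))"
          unfolding fa_def fb_def fc_def using A(1,3) B(1,3) C(1,3) xL False q by (intro add_mono mult_left_mono mult_mono) auto
        also have "\<dots> = (Cc + q * (Ca * Cb)) * exp (3 * \<epsilon> * (a + b) * ?y)"
          by (simp add: algebra_simps exp_add[symmetric])
        also have "\<dots> \<le> M * exp (\<tau> * ?y)"
        proof (rule mult_mono[OF _ ec])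
          have "0 \<le> q * (l * Cb)" "0 \<le> q * (Ca * (l\<^sup>2 * b * P))" using q l A(1) B(1) b P(1) by auto
          then show "Cc + q * (Ca * Cb) \<le> M" by (simp add: M_def algebra_simps)
        qed (use M in auto)
        finally show ?thesis unfolding R .
      next
        case True
        then obtain p where p: "x = p powr (of_real (1 / l))" "Re p > 3/2 * \<epsilon> * norm p" unfolding S_def principal_sector_def by auto
        have "0 \<le> 3/2 * \<epsilon> * norm p" using eps by simp
        then have Rp: "Re p > 0" using p(2) by linarith
        have np: "norm p = ?y" using Re_le_of_powr(2)[OF Rp _ _ p(1)] l by simp
        define w where "w = p powr (of_real (1 - 1 / l))"
        have y1: "?y \<ge> 1" using xL(4) l by (intro ge_one_powr_ge_zero) auto
        have w: "norm w \<le> ?y"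
        proof -
          have "norm w = norm p powr (1 - 1 / l)" using norm_powr_real_powr'[of "of_real (1 - 1/l)" p] by (simp add: w_def)
          also have "\<dots> \<le> norm p powr 1" using l y1 np by (intro powr_mono) auto
          finally show ?thesis using np y1 by simp
        qed
        define ra rb rc where "ra = fa - of_real l * exp (of_real a * p)"
          and "rb = fb - of_real (l\<^sup>2 * b) * w * exp (of_real b * p)"
          and "rc = fc - of_real (l\<^sup>2 * (a + b)) * w * exp (of_real (a + b) * p)"
        have ra: "norm ra \<le> Ca * exp (3 * \<epsilon> * a * ?y)" unfolding ra_def fa_def by (rule A(2)[OF xL(1) p])
        have rb: "norm rb \<le> Cb * exp (3 * \<epsilon> * b * ?y)" unfolding rb_def fb_def w_def by (rule B(2)[OF xL(2) p])
        have rc: "norm rc \<le> Cc * exp (3 * \<epsilon> * (a + b) * ?y)" unfolding rc_def fc_def w_def by (rule C(2)[OF xL(3) p])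
        have expb: "norm (exp (of_real c * p)) \<le> exp (c * ?y)" if "c > 0" for c
          using that complex_Re_le_cmod[of p] np by (simp add: mult_left_mono)
        \<comment> \<open>the cancellation that determines the constant \<open>q\<close>\<close>
        have "of_real q * ((of_real l * exp (of_real a * p)) * (of_real (l\<^sup>2 * b) * w * exp (of_real b * p)))
            = of_real (l\<^sup>2 * (a + b)) * w * exp (of_real (a + b) * p)"
        proof -
          have "q * (l * (l\<^sup>2 * b)) = l\<^sup>2 * (a + b)" using b l by (simp add: q_def)
          then have "of_real q * (of_real l * of_real (l\<^sup>2 * b)) = (of_real (l\<^sup>2 * (a + b)) :: complex)"
            by (metis of_real_mult)
          moreover have "exp (of_real (a + b) * p) = exp (of_real a * p) * exp (of_real b * p)"
            by (simp add: exp_add[symmetric] distrib_right)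
          ultimately show ?thesis by (metis (no_types, lifting) mult.assoc mult.left_commute)
        qed
        then have "fc - of_real q * (fa * fb) = rc - of_real q * ((of_real l * exp (of_real a * p)) * rb + ra * fb)"
          by (simp add: ra_def rb_def rc_def algebra_simps)
        then have "norm (factor_remainder l a b x) \<le> norm rc + q * (l * norm (exp (of_real a * p)) * norm rb + norm ra * norm fb)"
        proof -
          assume e: "fc - of_real q * (fa * fb) = rc - of_real q * ((of_real l * exp (of_real a * p)) * rb + ra * fb)"
          have "norm (factor_remainder l a b x) \<le> norm rc + q * norm ((of_real l * exp (of_real a * p)) * rb + ra * fb)"
            unfolding R e using norm_triangle_ineq4[of rc "of_real q * ((of_real l * exp (of_real a * p)) * rb + ra * fb)"] q by (simp add: norm_mult)
          also have "\<dots> \<le> norm rc + q * (l * norm (exp (of_real a * p)) * norm rb + norm ra * norm fb)"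
            using q l norm_triangle_ineq[of "(of_real l * exp (of_real a * p)) * rb" "ra * fb"]
            by (intro add_left_mono mult_left_mono) (auto simp: norm_mult)
          finally show ?thesis .
        qed
        moreover have "norm fb \<le> (l\<^sup>2 * b * P + Cb) * exp ((b + \<delta>) * ?y)"
        proof -
          have "fb = rb + of_real (l\<^sup>2 * b) * w * exp (of_real b * p)" by (simp add: rb_def)
          then have "norm fb \<le> norm rb + l\<^sup>2 * b * norm w * norm (exp (of_real b * p))"
            using norm_triangle_ineq[of rb "of_real (l\<^sup>2 * b) * w * exp (of_real b * p)"] b l by (simp add: norm_mult norm_power)
          also have "\<dots> \<le> Cb * exp ((b + \<delta>) * ?y) + l\<^sup>2 * b * (P * exp (\<delta> * ?y)) * exp (b * ?y)"
          proof (intro add_mono mult_mono)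
            have "exp (3 * \<epsilon> * b * ?y) \<le> exp ((b + \<delta>) * ?y)" using ebb b y by (intro iffD2[OF exp_le_cancel_iff] mult_right_mono) auto
            then show "norm rb \<le> Cb * exp ((b + \<delta>) * ?y)" using rb B(1) by (auto intro: order_trans mult_left_mono)
            show "norm w \<le> P * exp (\<delta> * ?y)" using w P(2)[OF y] by simp
          qed (use b l P expb in auto)
          also have "\<dots> = (l\<^sup>2 * b * P + Cb) * exp ((b + \<delta>) * ?y)" by (simp add: algebra_simps exp_add[symmetric])
          finally show ?thesis .
        qed
        ultimately have "norm (factor_remainder l a b x) \<le> Cc * exp (3 * \<epsilon> * (a + b) * ?y)
            + q * (l * exp (a * ?y) * (Cb * exp (3 * \<epsilon> * b * ?y)) + (Ca * exp (3 * \<epsilon> * a * ?y)) * ((l\<^sup>2 * b * P + Cb) * exp ((b + \<delta>) * ?y)))"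
          using ra rb rc expb[OF a] q l A(1) B(1) b P(1)
          by (elim order_trans) (intro add_mono mult_left_mono mult_mono, auto)
        also have "\<dots> \<le> Cc * exp (\<tau> * ?y) + q * (l * Cb * exp (\<tau> * ?y) + Ca * (l\<^sup>2 * b * P + Cb) * exp (\<tau> * ?y))"
        proof (intro add_mono mult_left_mono)
          have "a * ?y + 3 * \<epsilon> * b * ?y \<le> \<tau> * ?y"
            using mult_right_mono[of "a + 3 * \<epsilon> * b" \<tau> ?y] ebb delta y by (simp add: distrib_right)
          then have "exp (a * ?y) * exp (3 * \<epsilon> * b * ?y) \<le> exp (\<tau> * ?y)" by (simp add: exp_add[symmetric])
          from mult_left_mono[OF this, of "l * Cb"] l B(1)
          show "l * exp (a * ?y) * (Cb * exp (3 * \<epsilon> * b * ?y)) \<le> l * Cb * exp (\<tau> * ?y)" by (simp add: mult_ac)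
          have "3 * \<epsilon> * a * ?y + (b + \<delta>) * ?y \<le> \<tau> * ?y"
            using mult_right_mono[of "3 * \<epsilon> * a + (b + \<delta>)" \<tau> ?y] ea delta y by (simp add: distrib_right)
          then have "exp (3 * \<epsilon> * a * ?y) * exp ((b + \<delta>) * ?y) \<le> exp (\<tau> * ?y)" by (simp add: exp_add[symmetric])
          from mult_left_mono[OF this, of "Ca * (l\<^sup>2 * b * P + Cb)"] A(1) B(1) b P(1)
          show "(Ca * exp (3 * \<epsilon> * a * ?y)) * ((l\<^sup>2 * b * P + Cb) * exp ((b + \<delta>) * ?y)) \<le> Ca * (l\<^sup>2 * b * P + Cb) * exp (\<tau> * ?y)"
            by (simp add: mult_ac)
        qed (use ec C(1) q in auto)
        also have "\<dots> = M * exp (\<tau> * ?y)" by (simp add: M_def algebra_simps)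
        finally show ?thesis .
      qed
      also have "\<dots> \<le> (\<bar>K\<bar> + M) * exp (\<tau> * ?y)" by (intro mult_right_mono) auto
      finally show ?thesis .
    qed
  qed
qed

section \<open>Integrals over complex n-space\<close>

lemma lborel_affine_integral:
  fixes f :: "'a::euclidean_space \<Rightarrow> 'b::{banach, second_countable_topology}"
  assumes f: "f \<in> borel_measurable borel" and c: "c \<noteq> (0::real)"
  shows "integrable lborel (\<lambda>x. f (t + c *\<^sub>R x)) \<longleftrightarrow> integrable lborel f"
    and "(\<integral>x. f x \<partial>lborel) = \<bar>c\<bar> ^ DIM('a) *\<^sub>R (\<integral>x. f (t + c *\<^sub>R x) \<partial>lborel)"
proof -
  let ?T = "\<lambda>x::'a. t + c *\<^sub>R x"
  have eq: "lborel = density (distr lborel borel ?T) (\<lambda>_. ennreal (\<bar>c\<bar> ^ DIM('a)))"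
    using lborel_affine[OF c, of t] by (simp add: ennreal_power)
  have p: "\<bar>c\<bar> ^ DIM('a) > 0" using c by simp
  have "integrable lborel f \<longleftrightarrow> integrable (density (distr lborel borel ?T) (\<lambda>_. ennreal (\<bar>c\<bar> ^ DIM('a)))) f"
    using eq by simp
  also have "\<dots> \<longleftrightarrow> integrable (distr lborel borel ?T) (\<lambda>x. \<bar>c\<bar> ^ DIM('a) *\<^sub>R f x)"
    using f by (subst integrable_density) auto
  also have "\<dots> \<longleftrightarrow> integrable lborel (\<lambda>x. \<bar>c\<bar> ^ DIM('a) *\<^sub>R f (?T x))"
    using f by (subst integrable_distr_eq) auto
  finally show "integrable lborel (\<lambda>x. f (t + c *\<^sub>R x)) \<longleftrightarrow> integrable lborel f" 
  proof -
    assume e: "integrable lborel f \<longleftrightarrow> integrable lborel (\<lambda>x. \<bar>c\<bar> ^ DIM('a) *\<^sub>R f (?T x))"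
    have "integrable lborel (\<lambda>x. \<bar>c\<bar> ^ DIM('a) *\<^sub>R f (?T x)) \<Longrightarrow> integrable lborel (\<lambda>x. inverse (\<bar>c\<bar> ^ DIM('a)) *\<^sub>R (\<bar>c\<bar> ^ DIM('a) *\<^sub>R f (?T x)))"
      by (rule integrable_scaleR_right)
    then show ?thesis unfolding e using p by auto
  qed
  have "(\<integral>x. f x \<partial>lborel) = (\<integral>x. f x \<partial>density (distr lborel borel ?T) (\<lambda>_. ennreal (\<bar>c\<bar> ^ DIM('a))))"
    using eq by simp
  also have "\<dots> = (\<integral>x. \<bar>c\<bar> ^ DIM('a) *\<^sub>R f x \<partial>distr lborel borel ?T)"
    using f by (subst integral_density) auto
  also have "\<dots> = (\<integral>x. \<bar>c\<bar> ^ DIM('a) *\<^sub>R f (?T x) \<partial>lborel)"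
    using f by (subst integral_distr) auto
  finally show "(\<integral>x. f x \<partial>lborel) = \<bar>c\<bar> ^ DIM('a) *\<^sub>R (\<integral>x. f (t + c *\<^sub>R x) \<partial>lborel)" by simp
qed

lemma exp_tail_integral:
  fixes a :: real
  shows "integrable lborel (\<lambda>s. indicator {a..} s * exp (- s) :: real)"
    and "(\<integral>s. indicator {a..} s * exp (- s) \<partial>lborel) = exp (- a)"
proof -
  have nn: "(\<integral>\<^sup>+ s. ennreal (exp (- s)) * indicator {a..} s \<partial>lborel) = ennreal (0 - (- exp (- a)))"
  proof (rule nn_integral_FTC_atLeast)
    show "((\<lambda>s::real. - exp (- s)) \<longlongrightarrow> 0) at_top" by real_asymp
    fix x show "((\<lambda>s::real. - exp (- s)) has_real_derivative exp (- x)) (at x)"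
      by (auto intro!: derivative_eq_intros)
  qed auto
  have "(\<lambda>s. ennreal (exp (- s)) * indicator {a..} s) = (\<lambda>s::real. ennreal (indicator {a..} s * exp (- s)))"
    by (auto simp: indicator_def)
  with nn have nn': "(\<integral>\<^sup>+ s. ennreal (indicator {a..} s * exp (- s)) \<partial>lborel) = ennreal (exp (- a))" by simp
  have "integrable lborel (\<lambda>s. indicator {a..} s * exp (- s) :: real) \<and> (\<integral>s. indicator {a..} s * exp (- s) \<partial>lborel) = exp (- a)"
    by (rule nn_integral_eq_integrable[THEN iffD1, OF _ _ _ nn']) auto
  then show "integrable lborel (\<lambda>s. indicator {a..} s * exp (- s) :: real)"
    and "(\<integral>s. indicator {a..} s * exp (- s) \<partial>lborel) = exp (- a)" by auto
qed

lemma Gamma_bochner: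
  assumes "p > (-1::real)"
  shows "integrable lborel (\<lambda>s. indicator {0..} s * (s powr p * exp (- s)) :: real)"
    and "(\<integral>s. indicator {0..} s * (s powr p * exp (- s)) \<partial>lborel) = Gamma (p + 1)"
proof -
  have nn: "(\<integral>\<^sup>+ s. ennreal (indicator {0..} s * (s powr p * exp (- s))) \<partial>lborel) = ennreal (Gamma (p + 1))"
    using Gamma_conv_nn_integral_real[of "p + 1"] assms
    by (simp add: exp_minus divide_inverse mult_ac)
  have "Gamma (p + 1) \<ge> 0" using Gamma_real_pos[of "p + 1"] assms by simp
  then have "integrable lborel (\<lambda>s. indicator {0..} s * (s powr p * exp (- s)) :: real) \<and> (\<integral>s. indicator {0..} s * (s powr p * exp (- s)) \<partial>lborel) = Gamma (p + 1)"
    by (intro nn_integral_eq_integrable[THEN iffD1, OF _ _ _ nn]) auto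
  then show "integrable lborel (\<lambda>s. indicator {0..} s * (s powr p * exp (- s)) :: real)"
    and "(\<integral>s. indicator {0..} s * (s powr p * exp (- s)) \<partial>lborel) = Gamma (p + 1)" by auto
qed

lemma homogeneous_integral_cball:
  fixes F :: "'a::euclidean_space \<Rightarrow> 'b::{banach, second_countable_topology}"
  assumes meas: "F \<in> borel_measurable borel" and hom: "\<And>t w. t > 0 \<Longrightarrow> F (t *\<^sub>R w) = (t powr d) *\<^sub>R F w"
    and int: "integrable lborel (\<lambda>w. indicator (cball 0 1) w *\<^sub>R F w)" and r: "r > 0"
  shows "integrable lborel (\<lambda>w. indicator (cball 0 r) w *\<^sub>R F w)"
    and "(\<integral>w. indicator (cball 0 r) w *\<^sub>R F w \<partial>lborel) =
       (r powr (d + real DIM('a))) *\<^sub>R (\<integral>w. indicator (cball 0 1) w *\<^sub>R F w \<partial>lborel)"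
proof -
  have m: "(\<lambda>w. indicator (cball 0 r) w *\<^sub>R F w) \<in> borel_measurable borel" using meas by (intro borel_measurable_scaleR borel_measurable_indicator) auto
  have eq: "indicator (cball 0 r) (0 + r *\<^sub>R w) *\<^sub>R F (0 + r *\<^sub>R w) = (r powr d) *\<^sub>R (indicator (cball 0 1) w *\<^sub>R F w)" for w :: 'a
    using r hom[OF r, of w] by (auto simp: indicator_def field_simps)
  have "integrable lborel (\<lambda>w. (r powr d) *\<^sub>R (indicator (cball 0 1) w *\<^sub>R F w))"
    using int by (rule integrable_scaleR_right)
  then show "integrable lborel (\<lambda>w. indicator (cball 0 r) w *\<^sub>R F w)"
    using lborel_affine_integral(1)[OF m, of r 0] r unfolding eq by blast
  have "(\<integral>w. indicator (cball 0 r) w *\<^sub>R F w \<partial>lborel) = r ^ DIM('a) *\<^sub>R (r powr d) *\<^sub>R (\<integral>w. indicator (cball 0 1) w *\<^sub>R F w \<partial>lborel)"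
    using lborel_affine_integral(2)[OF m, of r 0] r unfolding eq integral_scaleR_right by simp
  also have "\<dots> = (r powr (d + real DIM('a))) *\<^sub>R (\<integral>w. indicator (cball 0 1) w *\<^sub>R F w \<partial>lborel)"
    using r by (simp add: powr_add powr_realpow mult.commute)
  finally show "(\<integral>w. indicator (cball 0 r) w *\<^sub>R F w \<partial>lborel) =
       (r powr (d + real DIM('a))) *\<^sub>R (\<integral>w. indicator (cball 0 1) w *\<^sub>R F w \<partial>lborel)" .
qed

text \<open>Polar coordinates without spheres: write the exponential as the integral of \<open>exp (- s)\<close> over
\<open>s \<ge> g * \<bar>w\<bar> powr q\<close> and interchange. The inner integral runs over a ball, whose radius is eliminated by homogeneity.\<close>

lemma homogeneous_integral_exp:
  fixes F :: "'a::euclidean_space \<Rightarrow> 'b::{banach, second_countable_topology}"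
  assumes meas: "F \<in> borel_measurable borel" and hom: "\<And>t w. t > 0 \<Longrightarrow> F (t *\<^sub>R w) = (t powr d) *\<^sub>R F w"
    and int: "integrable lborel (\<lambda>w. indicator (cball 0 1) w *\<^sub>R F w)"
    and d: "d \<ge> 0" and g: "g > 0" and q: "q > 0"
  shows "integrable lborel (\<lambda>w. exp (- g * norm w powr q) *\<^sub>R F w)"
    and "(\<integral>w. exp (- g * norm w powr q) *\<^sub>R F w \<partial>lborel) =
       (g powr (- ((d + real DIM('a)) / q)) * Gamma ((d + real DIM('a)) / q + 1)) *\<^sub>R (\<integral>w. indicator (cball 0 1) w *\<^sub>R F w \<partial>lborel)"
proof -
  define e where "e = (d + real DIM('a)) / q"
  have e: "e > 0" using d q by (simp add: e_def add_nonneg_pos)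
  define r where "r s = (s / g) powr (1 / q)" for s
  have r: "r s > 0" "r s powr (d + real DIM('a)) = (g powr (- e)) * s powr e" if "s > 0" for s
    using that g q by (auto simp: r_def powr_powr e_def powr_divide powr_minus_divide)
  have layer: "(g * norm w powr q \<le> s) \<longleftrightarrow> w \<in> cball 0 (r s)" if s: "s > 0" for s and w :: 'a
  proof -
    have "norm w \<le> r s \<longleftrightarrow> norm w powr q \<le> r s powr q"
      using q r(1)[OF s] by (meson linorder_not_less norm_ge_zero powr_less_mono2 powr_mono2 less_imp_le)
    also have "r s powr q = s / g" using s g q by (simp add: r_def powr_powr)
    finally show ?thesis using g by (simp add: field_simps)
  qed
  define G where "G s w = (indicator {g * norm w powr q..} s * exp (- s)) *\<^sub>R F w" for s w
  have G_eq: "G s w = (indicator {0..} s * exp (- s)) *\<^sub>R (indicator (cball 0 (r s)) w *\<^sub>R F w)" if "s \<noteq> 0" for s w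
  proof (cases "s > 0")
    case True
    then show ?thesis using layer[OF True, of w] by (auto simp: G_def indicator_def)
  next
    case False
    then have "s < g * norm w powr q" using that g by (smt (verit) mult_nonneg_nonneg powr_ge_zero)
    then show ?thesis using that False by (auto simp: G_def indicator_def)
  qed
  have AE0: "AE s in (lborel :: real measure). s \<noteq> 0" by (rule AE_lborel_singleton)
  have Gm: "case_prod G \<in> borel_measurable (lborel \<Otimes>\<^sub>M lborel)"
  proof -
    have "(\<lambda>x :: real \<times> 'a. indicator {x. g * norm (snd x) powr q \<le> fst x} x * exp (- fst x) :: real) \<in> borel_measurable (borel \<Otimes>\<^sub>M borel)"
      by measurable
    moreover have "(\<lambda>x :: real \<times> 'a. F (snd x)) \<in> borel_measurable (borel \<Otimes>\<^sub>M borel)" using meas by measurable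
    ultimately have "(\<lambda>x :: real \<times> 'a. (indicator {x. g * norm (snd x) powr q \<le> fst x} x * exp (- fst x)) *\<^sub>R F (snd x)) \<in> borel_measurable (borel \<Otimes>\<^sub>M borel)"
      by (rule borel_measurable_scaleR)
    also have "(\<lambda>x :: real \<times> 'a. (indicator {x. g * norm (snd x) powr q \<le> fst x} x * exp (- fst x)) *\<^sub>R F (snd x)) = case_prod G"
      by (auto simp: G_def indicator_def fun_eq_iff)
    finally show ?thesis by (simp cong: measurable_cong_sets)
  qed
  define J where "J = (\<integral>w. indicator (cball 0 1) w *\<^sub>R F w \<partial>lborel)"
  define Jn where "Jn = (\<integral>w. indicator (cball 0 1) w *\<^sub>R norm (F w) \<partial>lborel)"
  have homn: "norm (F (t *\<^sub>R w)) = (t powr d) *\<^sub>R norm (F w)" if "t > 0" for t w using hom[OF that] by simp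
  have intn: "integrable lborel (\<lambda>w. indicator (cball 0 1) w *\<^sub>R norm (F w))"
    using integrable_norm[OF int] by (simp add: indicator_def if_distrib cong: if_cong)
  have In: "(\<integral>w. norm (G s w) \<partial>lborel) = (Jn * g powr (- e)) * (indicator {0..} s * (s powr e * exp (- s)))" if "s \<noteq> 0" for s
  proof (cases "s > 0")
    case True
    have "norm (G s w) = exp (- s) * (indicator (cball 0 (r s)) w *\<^sub>R norm (F w))" for w
      using G_eq[OF that, of w] True by (simp add: indicator_def)
    then have "(\<integral>w. norm (G s w) \<partial>lborel) = exp (- s) * (r s powr (d + real DIM('a)) * Jn)"
      using homogeneous_integral_cball(2)[OF _ homn intn r(1)[OF True]] meas by (simp add: Jn_def)
    then show ?thesis using True by (simp add: r(2))
  next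
    case False then show ?thesis using that by (simp add: G_eq[OF that])
  qed
  have I: "(\<integral>w. G s w \<partial>lborel) = (indicator {0..} s * (s powr e * exp (- s)) * g powr (- e)) *\<^sub>R J" if "s \<noteq> 0" for s
  proof (cases "s > 0")
    case True
    then have "G s = (\<lambda>w. exp (- s) *\<^sub>R (indicator (cball 0 (r s)) w *\<^sub>R F w))" using G_eq[OF that] by (auto simp: fun_eq_iff)
    then have "(\<integral>w. G s w \<partial>lborel) = exp (- s) *\<^sub>R (r s powr (d + real DIM('a)) *\<^sub>R J)"
      by (simp only: integral_scaleR_right homogeneous_integral_cball(2)[OF meas hom int r(1)[OF True]] J_def)
    then show ?thesis using True by (simp add: r(2) mult_ac)
  next
    case False then show ?thesis using that by (simp add: G_eq[OF that])
  qed
  have Gint: "integrable (lborel \<Otimes>\<^sub>M lborel) (case_prod G)"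
  proof (rule lborel_pair.Fubini_integrable[OF Gm])
    show "integrable lborel (\<lambda>s. \<integral>w. norm (case (s, w) of (s, w) \<Rightarrow> G s w) \<partial>lborel)"
    proof (subst integrable_cong_AE)
      show "AE s in lborel. (\<integral>w. norm (case (s, w) of (s, w) \<Rightarrow> G s w) \<partial>lborel) = (Jn * g powr (- e)) * (indicator {0..} s * (s powr e * exp (- s)))"
        using AE0 by eventually_elim (simp add: In)
      show "integrable lborel (\<lambda>s. (Jn * g powr (- e)) * (indicator {0..} s * (s powr e * exp (- s))))"
        using e by (intro integrable_mult_right Gamma_bochner) auto
      show "(\<lambda>s. \<integral>w. norm (case (s, w) of (s, w) \<Rightarrow> G s w) \<partial>lborel) \<in> borel_measurable lborel"
        using Gm by measurable
    qed (auto intro: borel_measurable_integrable Gamma_bochner e)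
    show "AE s in lborel. integrable lborel (\<lambda>w. case (s, w) of (s, w) \<Rightarrow> G s w)"
      using AE0
    proof eventually_elim
      case (elim s)
      show ?case
      proof (cases "s > 0")
        case True
        then have "G s = (\<lambda>w. exp (- s) *\<^sub>R (indicator (cball 0 (r s)) w *\<^sub>R F w))" using G_eq[OF elim] by (auto simp: fun_eq_iff)
        then show ?thesis using homogeneous_integral_cball(1)[OF meas hom int r(1)[OF True]]
          by (simp only: prod.case integrable_scaleR_right)
      next
        case False then show ?thesis using elim by (simp add: G_eq[OF elim])
      qed
    qed
  qed
  have inner: "(\<integral>s. G s w \<partial>lborel) = exp (- g * norm w powr q) *\<^sub>R F w" for w
    unfolding G_def using exp_tail_integral[of "g * norm w powr q"] by (subst integral_scaleR_left) auto
  show "integrable lborel (\<lambda>w. exp (- g * norm w powr q) *\<^sub>R F w)"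
    using lborel_pair.integrable_snd[OF Gint] unfolding inner .
  have "(\<integral>w. exp (- g * norm w powr q) *\<^sub>R F w \<partial>lborel) = (\<integral>w. (\<integral>s. G s w \<partial>lborel) \<partial>lborel)"
    unfolding inner ..
  also have "\<dots> = (\<integral>s. (\<integral>w. G s w \<partial>lborel) \<partial>lborel)" by (rule lborel_pair.Fubini_integral[OF Gint])
  also have "\<dots> = (\<integral>s. (indicator {0..} s * (s powr e * exp (- s)) * g powr (- e)) *\<^sub>R J \<partial>lborel)"
  proof (rule integral_cong_AE)
    show "AE s in lborel. (\<integral>w. G s w \<partial>lborel) = (indicator {0..} s * (s powr e * exp (- s)) * g powr (- e)) *\<^sub>R J"
      using AE0 by eventually_elim (simp add: I)
    show "(\<lambda>s. \<integral>w. G s w \<partial>lborel) \<in> borel_measurable lborel" using lborel_pair.integrable_fst[OF Gint] by (rule borel_measurable_integrable)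
  qed auto
  also have "\<dots> = (\<integral>s. indicator {0..} s * (s powr e * exp (- s)) * g powr (- e) \<partial>lborel) *\<^sub>R J"
    using Gamma_bochner(1)[of e] e by (intro integral_scaleR_left) auto
  also have "(\<integral>s. indicator {0..} s * (s powr e * exp (- s)) * g powr (- e) \<partial>lborel) = Gamma (e + 1) * g powr (- e)"
    using Gamma_bochner(2)[of e] e by simp
  finally show "(\<integral>w. exp (- g * norm w powr q) *\<^sub>R F w \<partial>lborel) =
       (g powr (- ((d + real DIM('a)) / q)) * Gamma ((d + real DIM('a)) / q + 1)) *\<^sub>R (\<integral>w. indicator (cball 0 1) w *\<^sub>R F w \<partial>lborel)"
    by (simp add: e_def J_def mult.commute)
qed

definition ball_density :: "'n::finite itself \<Rightarrow> real" where
  "ball_density _ = 1 / measure lborel (ball (0 :: complex ^ 'n) 1)"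

lemma ball_density_pos: "ball_density TYPE('n::finite) > 0"
proof -
  have "unit_ball_vol (real DIM(complex ^ 'n)) > 0" by (rule unit_ball_vol_pos) simp
  then show ?thesis using content_ball[of 1 "0 :: complex ^ 'n"] by (simp add: ball_density_def)
qed

lemma sets_dV [simp, measurable_cong]: "sets dV = sets borel" by (simp add: dV_def)
lemma space_dV [simp]: "space dV = UNIV" by (simp add: dV_def)

lemma dV_integral:
  fixes f :: "complex ^ 'n \<Rightarrow> 'b::{banach, second_countable_topology}"
  assumes "f \<in> borel_measurable borel"
  shows "integrable dV f \<longleftrightarrow> integrable lborel f"
    and "(\<integral>x. f x \<partial>dV) = ball_density TYPE('n) *\<^sub>R (\<integral>x. f x \<partial>lborel)"
proof -
  have eq: "dV = density lborel (\<lambda>_ :: complex ^ 'n. ennreal (ball_density TYPE('n)))"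
    by (simp add: dV_def ball_density_def)
  have p: "ball_density TYPE('n) > 0" by (rule ball_density_pos)
  have *: "integrable dV f \<longleftrightarrow> integrable lborel (\<lambda>x. ball_density TYPE('n) *\<^sub>R f x)"
    unfolding eq using assms p by (subst integrable_density) auto
  have "integrable lborel (\<lambda>x. ball_density TYPE('n) *\<^sub>R f x) \<Longrightarrow> integrable lborel (\<lambda>x. inverse (ball_density TYPE('n)) *\<^sub>R (ball_density TYPE('n) *\<^sub>R f x))"
    by (rule integrable_scaleR_right)
  then show "integrable dV f \<longleftrightarrow> integrable lborel f" unfolding * using p by auto
  show "(\<integral>x. f x \<partial>dV) = ball_density TYPE('n) *\<^sub>R (\<integral>x. f x \<partial>lborel)"
    unfolding eq using assms p by (subst integral_density) auto
qed

lemma dV_cball: "(\<integral>w. indicator (cball 0 1) (w :: complex ^ 'n) \<partial>dV) = (1::real)"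
proof -
  have "measure lborel (cball (0 :: complex ^ 'n) 1) = measure lborel (ball (0 :: complex ^ 'n) 1)"
    using content_ball[of 1 "0 :: complex ^ 'n"] content_cball[of 1 "0 :: complex ^ 'n"] by simp
  moreover have "measure lborel (ball (0 :: complex ^ 'n) 1) \<noteq> 0"
    using ball_density_pos[where 'n = 'n] by (auto simp: ball_density_def)
  ultimately show ?thesis by (subst dV_integral(2)) (auto simp: ball_density_def intro!: borel_measurable_indicator)
qed

lemma integrable_dV_cball: "integrable dV (indicator (cball 0 1) :: complex ^ 'n \<Rightarrow> real)"
  by (subst dV_integral(1)) (use emeasure_lborel_cball_finite[of "0 :: complex ^ 'n" 1] in \<open>auto intro!: borel_measurable_indicator integrable_real_indicator\<close>)

lemma dV_affine_integral:
  fixes f :: "complex ^ 'n \<Rightarrow> 'b::{banach, second_countable_topology}"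
  assumes f: "f \<in> borel_measurable borel" and c: "c \<noteq> (0::real)"
  shows "integrable dV (\<lambda>x. f (t + c *\<^sub>R x)) \<longleftrightarrow> integrable dV f"
    and "(\<integral>x. f x \<partial>dV) = \<bar>c\<bar> ^ (2 * CARD('n)) *\<^sub>R (\<integral>x. f (t + c *\<^sub>R x) \<partial>dV)"
proof -
  have m: "(\<lambda>x. f (t + c *\<^sub>R x)) \<in> borel_measurable borel" using f by measurable
  show "integrable dV (\<lambda>x. f (t + c *\<^sub>R x)) \<longleftrightarrow> integrable dV f"
    unfolding dV_integral(1)[OF f] dV_integral(1)[OF m] by (rule lborel_affine_integral(1)[OF f c])
  show "(\<integral>x. f x \<partial>dV) = \<bar>c\<bar> ^ (2 * CARD('n)) *\<^sub>R (\<integral>x. f (t + c *\<^sub>R x) \<partial>dV)"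
    unfolding dV_integral(2)[OF f] dV_integral(2)[OF m] lborel_affine_integral(2)[OF f c, of t] by (simp add: mult.commute)
qed

lemma dV_homogeneous_integral_exp:
  fixes F :: "complex ^ 'n \<Rightarrow> 'b::{banach, second_countable_topology}"
  assumes meas: "F \<in> borel_measurable borel" and hom: "\<And>t w. t > 0 \<Longrightarrow> F (t *\<^sub>R w) = (t powr d) *\<^sub>R F w"
    and int: "integrable dV (\<lambda>w. indicator (cball 0 1) w *\<^sub>R F w)"
    and d: "d \<ge> 0" and g: "g > 0" and q: "q > 0"
  shows "integrable dV (\<lambda>w. exp (- g * norm w powr q) *\<^sub>R F w)"
    and "(\<integral>w. exp (- g * norm w powr q) *\<^sub>R F w \<partial>dV) =
       (g powr (- ((d + 2 * real CARD('n)) / q)) * Gamma ((d + 2 * real CARD('n)) / q + 1)) *\<^sub>R (\<integral>w. indicator (cball 0 1) w *\<^sub>R F w \<partial>dV)"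
proof -
  have m1: "(\<lambda>w. indicator (cball 0 1) w *\<^sub>R F w) \<in> borel_measurable borel"
    using meas by (intro borel_measurable_scaleR borel_measurable_indicator) auto
  have m2: "(\<lambda>w. exp (- g * norm w powr q) *\<^sub>R F w) \<in> borel_measurable borel" using meas by measurable
  note * = homogeneous_integral_exp[OF meas hom int[unfolded dV_integral(1)[OF m1]] d g q]
  show "integrable dV (\<lambda>w. exp (- g * norm w powr q) *\<^sub>R F w)" unfolding dV_integral(1)[OF m2] by (rule *(1))
  show "(\<integral>w. exp (- g * norm w powr q) *\<^sub>R F w \<partial>dV) =
       (g powr (- ((d + 2 * real CARD('n)) / q)) * Gamma ((d + 2 * real CARD('n)) / q + 1)) *\<^sub>R (\<integral>w. indicator (cball 0 1) w *\<^sub>R F w \<partial>dV)"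
    using *(2) dV_integral(2)[OF m1] dV_integral(2)[OF m2] by (simp add: mult.commute)
qed

lemma dV_gaussian:
  assumes "c > 0"
  shows "integrable dV (\<lambda>w :: complex ^ 'n. exp (- c * (norm w)\<^sup>2))"
    and "(\<integral>w. exp (- c * (norm (w :: complex ^ 'n))\<^sup>2) \<partial>dV) = c powr (- real CARD('n)) * fact CARD('n)"
proof -
  have int: "integrable dV (\<lambda>w :: complex ^ 'n. indicator (cball 0 1) w *\<^sub>R (1 :: real))"
    by (subst dV_integral(1)) (use emeasure_lborel_cball_finite[of "0 :: complex ^ 'n" 1] in \<open>auto intro!: borel_measurable_indicator integrable_real_indicator\<close>)
  have e: "norm w powr 2 = (norm w)\<^sup>2" for w :: "complex ^ 'n" by (cases "w = 0") (auto simp: powr_numeral)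
  note * = dV_homogeneous_integral_exp[where F = "\<lambda>w :: complex ^ 'n. 1 :: real" and d = 0 and g = c and q = 2, OF _ _ int]
  show "integrable dV (\<lambda>w :: complex ^ 'n. exp (- c * (norm w)\<^sup>2))" using *(1) assms by (simp add: e)
  have "Gamma (real CARD('n) + 1) = fact CARD('n)" using Gamma_fact[of "CARD('n)", where 'a = real] by (simp add: add.commute)
  then show "(\<integral>w. exp (- c * (norm (w :: complex ^ 'n))\<^sup>2) \<partial>dV) = c powr (- real CARD('n)) * fact CARD('n)"
    using *(2) assms dV_cball[where 'n = 'n] by (simp add: e)
qed

lemma dV_shifted_gaussian:
  fixes w0 :: "complex ^ 'n"
  assumes c: "c > 0" and S: "S > 0"
  shows "integrable dV (\<lambda>w. exp (- c * (S * norm (w - w0))\<^sup>2))"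
    and "(\<integral>w. exp (- c * (S * norm (w - w0))\<^sup>2) \<partial>dV) = S powr (- 2 * real CARD('n)) * (c powr (- real CARD('n)) * fact CARD('n))"
proof -
  define f :: "complex ^ 'n \<Rightarrow> real" where "f w = exp (- c * (S * norm (w - w0))\<^sup>2)" for w
  have f: "f \<in> borel_measurable borel" unfolding f_def by measurable
  have eq: "f (w0 + (1 / S) *\<^sub>R w) = exp (- c * (norm w)\<^sup>2)" for w using S by (simp add: f_def)
  show "integrable dV (\<lambda>w. exp (- c * (S * norm (w - w0))\<^sup>2))"
    using iffD1[OF dV_affine_integral(1)[OF f, of "1 / S" w0]] S dV_gaussian(1)[OF c] unfolding eq unfolding f_def by simp
  have "(\<integral>w. f w \<partial>dV) = (1 / S) ^ (2 * CARD('n)) * (c powr (- real CARD('n)) * fact CARD('n))"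
    using dV_affine_integral(2)[OF f, of "1 / S" w0] S dV_gaussian(2)[OF c, where 'n = 'n] unfolding eq by simp
  also have "(1 / S) ^ (2 * CARD('n)) = S powr (- 2 * real CARD('n))"
    using S by (simp add: powr_minus_divide powr_realpow[symmetric] power_one_over)
  finally show "(\<integral>w. exp (- c * (S * norm (w - w0))\<^sup>2) \<partial>dV) = S powr (- 2 * real CARD('n)) * (c powr (- real CARD('n)) * fact CARD('n))"
    by (simp add: f_def)
qed

section \<open>Fock norms of functions of the Hermitian product\<close>

definition inv_exponent :: "ennreal \<Rightarrow> real" where
  "inv_exponent p = (if p = \<infinity> then 0 else 1 / enn2real p)"

lemma entire_continuous: "entire f \<Longrightarrow> continuous_on UNIV f"
  unfolding entire_def by (metis continuous_at_imp_continuous_on has_derivative_continuous)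

lemma weighted_abs_nonneg [simp]: "weighted_abs l \<alpha> \<rho> f w \<ge> 0" by (simp add: weighted_abs_def)

lemma weighted_abs_measurable:
  "entire f \<Longrightarrow> weighted_abs l \<alpha> \<rho> f \<in> borel_measurable borel"
  unfolding weighted_abs_def[abs_def] using borel_measurable_continuous_onI[OF entire_continuous] by measurable

lemma ennreal_exponent_cases:
  assumes "1 \<le> (p :: ennreal)"
  obtains "p = \<infinity>" | P where "p = ennreal P" "P \<ge> 1" "enn2real p = P" "p \<noteq> \<infinity>"
proof (cases p)
  case (real P)
  then have "P \<ge> 1" using assms by (metis ennreal_1 ennreal_le_iff)
  with real that(2)[of P] show thesis by simp
qed (use that in auto)

text \<open>The \<open>p\<close>-norm of \<open>w \<mapsto> exp (- c * \<bar>w\<bar>\<^sup>2)\<close> with respect to \<^term>\<open>dV\<close>.\<close>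

definition gaussian_constant :: "'n::finite itself \<Rightarrow> ennreal \<Rightarrow> real \<Rightarrow> real" where
  "gaussian_constant _ p c = (if p = \<infinity> then 1 else ((enn2real p * c) powr (- real CARD('n)) * fact CARD('n)) powr (1 / enn2real p))"

lemma gaussian_constant_pos: "c > 0 \<Longrightarrow> p \<ge> 1 \<Longrightarrow> gaussian_constant TYPE('n::finite) p c > 0"
  by (cases p rule: ennreal_exponent_cases) (auto simp: gaussian_constant_def)

lemma Fock_norm_gaussian_bound:
  fixes F :: "complex ^ 'n \<Rightarrow> complex"
  assumes F: "entire F" and p: "1 \<le> p" and c: "c > 0" and S: "S > 0" and A: "A \<ge> 0"
    and bd: "\<And>w. weighted_abs l \<alpha> \<rho> F w \<le> A * exp (- c * (S * norm (w - w0))\<^sup>2)"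
  shows "F \<in> Fock_space l p \<alpha> \<rho>"
    and "Fock_norm l p \<alpha> \<rho> F \<le> A * S powr (- 2 * real CARD('n) * inv_exponent p) * gaussian_constant TYPE('n) p c"
proof -
  have le1: "weighted_abs l \<alpha> \<rho> F w \<le> A" for w
  proof -
    have "A * exp (- c * (S * norm (w - w0))\<^sup>2) \<le> A * 1" using A c by (intro mult_left_mono) auto
    then show ?thesis using bd[of w] by simp
  qed
  have "F \<in> Fock_space l p \<alpha> \<rho> \<and> Fock_norm l p \<alpha> \<rho> F \<le> A * S powr (- 2 * real CARD('n) * inv_exponent p) * gaussian_constant TYPE('n) p c"
    using p
  proof (cases p rule: ennreal_exponent_cases)
    case 1
    have "bdd_above (range (weighted_abs l \<alpha> \<rho> F))" using le1 by (auto intro!: bdd_aboveI[of _ A])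
    moreover have "(SUP z. weighted_abs l \<alpha> \<rho> F z) \<le> A" using le1 by (intro cSUP_least) auto
    ultimately show ?thesis using F 1 S by (simp add: Fock_space_def Fock_norm_def gaussian_constant_def inv_exponent_def)
  next
    case (2 P)
    have Pc: "P * c > 0" using 2 c by simp
    let ?w = "\<lambda>w. weighted_abs l \<alpha> \<rho> F w powr P"
    have m: "?w \<in> borel_measurable borel" using weighted_abs_measurable[OF F] by measurable
    have pt: "?w w \<le> A powr P * exp (- (P * c) * (S * norm (w - w0))\<^sup>2)" for w
    proof -
      have "?w w \<le> (A * exp (- c * (S * norm (w - w0))\<^sup>2)) powr P" using bd[of w] 2 by (intro powr_mono2) auto
      also have "\<dots> = A powr P * exp (- (P * c) * (S * norm (w - w0))\<^sup>2)"
        using A by (simp add: powr_mult exp_powr_real mult_ac)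
      finally show ?thesis .
    qed
    have ig: "integrable dV (\<lambda>w. A powr P * exp (- (P * c) * (S * norm (w - w0))\<^sup>2))"
      by (intro integrable_mult_right dV_shifted_gaussian Pc S)
    have int: "integrable dV ?w"
      by (rule Bochner_Integration.integrable_bound[OF ig]) (use m pt in \<open>auto intro!: AE_I2\<close>)
    have "(\<integral>w. ?w w \<partial>dV) \<le> (\<integral>w. A powr P * exp (- (P * c) * (S * norm (w - w0))\<^sup>2) \<partial>dV)"
      using int ig pt by (intro integral_mono) auto
    also have "\<dots> = A powr P * (S powr (- 2 * real CARD('n)) * ((P * c) powr (- real CARD('n)) * fact CARD('n)))"
      using dV_shifted_gaussian(2)[OF Pc S, of w0] by simp
    finally have "(\<integral>w. ?w w \<partial>dV) powr (1 / P) \<le> (A powr P * (S powr (- 2 * real CARD('n)) * ((P * c) powr (- real CARD('n)) * fact CARD('n)))) powr (1 / P)"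
      using 2 by (intro powr_mono2 integral_nonneg_AE) auto
    also have "\<dots> = A * S powr (- 2 * real CARD('n) * (1 / P)) * ((P * c) powr (- real CARD('n)) * fact CARD('n)) powr (1 / P)"
      using 2 A S Pc by (simp add: powr_mult powr_powr)
    finally show ?thesis using F 2 int by (simp add: Fock_space_def Fock_norm_def gaussian_constant_def inv_exponent_def)
  qed
  then show "F \<in> Fock_space l p \<alpha> \<rho>"
    and "Fock_norm l p \<alpha> \<rho> F \<le> A * S powr (- 2 * real CARD('n) * inv_exponent p) * gaussian_constant TYPE('n) p c" by auto
qed

lemma Re_cprod: "Re (cprod w z) = w \<bullet> z"
  by (simp add: cprod_def inner_vec_def inner_complex_def)

lemma norm_vector_smult: "norm (c *s (w :: complex ^ 'n)) = norm c * norm w"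
  by (simp add: norm_vec_def norm_mult L2_set_right_distrib)

lemma cprod_smult: "cprod (c *s w) z = c * cprod w z"
  by (simp add: cprod_def sum_distrib_left mult_ac)

lemma norm_cprod_le: "norm (cprod w z) \<le> norm w * norm z"
proof (cases "cprod w z = 0")
  case False
  define c where "c = cprod w z"
  define u where "u = cnj c / of_real (norm c)"
  have "cnj c * c = of_real ((norm c)\<^sup>2)" unfolding complex_norm_square by (rule mult.commute)
  then have "u * c = of_real (norm c)"
    using False by (simp add: u_def c_def[symmetric] power2_eq_square)
  then have "norm c = Re (cprod (u *s w) z)" by (simp add: cprod_smult c_def[symmetric])
  also have "\<dots> \<le> norm (u *s w) * norm z" unfolding Re_cprod by (rule norm_cauchy_schwarz)
  also have "norm u = 1" using False by (simp add: u_def norm_divide c_def[symmetric])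
  then have "norm (u *s w) = norm w" by (simp add: norm_vector_smult)
  finally show ?thesis by (simp add: c_def)
qed simp

text \<open>Splits the squared distance from \<open>t z\<close> into a radial and an angular part; the growth estimates produce exactly
these two parts.\<close>

lemma norm_minus_scaleR_cprod:
  "(norm (w - t *\<^sub>R z))\<^sup>2 = (norm w - t * norm z)\<^sup>2 + 2 * t * (norm w * norm z - Re (cprod w z))"
proof -
  have "(norm (w - t *\<^sub>R z))\<^sup>2 = (norm w)\<^sup>2 - 2 * t * (w \<bullet> z) + t\<^sup>2 * (norm z)\<^sup>2"
    unfolding power2_norm_eq_inner
    by (simp add: inner_diff_left inner_diff_right inner_commute[of z w] power2_eq_square algebra_simps)
  then show ?thesis unfolding Re_cprod by (simp add: power2_eq_square algebra_simps)
qed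

lemma bounded_linear_cprod: "bounded_linear (\<lambda>w. cprod w z)"
proof -
  have "linear (\<lambda>w. cprod w z)"
    by (rule linearI) (auto simp: cprod_def sum.distrib distrib_right scaleR_sum_right)
  then show ?thesis by (simp add: linear_conv_bounded_linear)
qed

text \<open>The Hermitian product is complex linear in its first argument.\<close>

lemma entire_cprod:
  assumes "G holomorphic_on UNIV"
  shows "entire (\<lambda>w. G (cprod w z))"
  unfolding entire_def
proof (intro allI exI conjI)
  fix w
  have "(G has_derivative (*) (deriv G (cprod w z))) (at (cprod w z))"
    using holomorphic_derivI[OF assms open_UNIV, of "cprod w z"] by (simp add: has_field_derivative_def)
  from has_derivative_compose[OF bounded_linear_imp_has_derivative[OF bounded_linear_cprod] this]
  show "((\<lambda>w. G (cprod w z)) has_derivative (\<lambda>v. deriv G (cprod w z) * cprod v z)) (at w)" .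
qed (simp add: cprod_smult)

lemma powr_diff_ge:
  assumes "1 \<le> (l::real)" "0 \<le> v" "v \<le> u"
  shows "(u - v) * u powr (l - 1) \<le> u powr l - v powr l"
proof -
  have e: "x * x powr (l - 1) = x powr l" if "x \<ge> 0" for x :: real
    using that by (cases "x = 0") (auto simp: powr_diff)
  have "v * v powr (l - 1) \<le> v * u powr (l - 1)" using assms by (intro mult_left_mono powr_mono2) auto
  then show ?thesis using e[of u] e[of v] assms by (simp add: left_diff_distrib)
qed

text \<open>If \<open>\<bar>x\<bar>\<close> is at least half of \<open>T\<close>, the deficit of the angular term dominates; otherwise the difference of the powers does.\<close>

lemma angular_growth_deficit:
  assumes l: "1 \<le> l" and x: "norm x \<le> T"
  shows "2 powr (1 - l) / 4 * (T powr (l - 1) * (T - Re x)) \<le> T powr l - angular_growth l x"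
proof -
  define t where "t = norm x"
  have t: "0 \<le> t" "t \<le> T" "\<bar>Re x\<bar> \<le> t" using x abs_Re_le_cmod[of x] by (auto simp: t_def)
  have e: "u powr (l - 1) * u = u powr l" if "u \<ge> 0" for u :: real
    using that by (cases "u = 0") (auto simp: powr_diff)
  have eq: "T powr l - angular_growth l x = (T powr l - t powr l) + 1/4 * (t powr (l - 1) * (t - Re x))"
    using e[OF t(1)] by (simp add: angular_growth_def t_def[symmetric] right_diff_distrib)
  have d: "(T - t) * T powr (l - 1) \<le> T powr l - t powr l" using l t by (intro powr_diff_ge) auto
  have k: "0 < 2 powr (1 - l) / (4::real)" by simp
  have k1: "2 powr (1 - l) / 4 \<le> (1/4 :: real)" using powr_mono[of "1 - l" 0 "2::real"] l by simp
  show ?thesis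
  proof (cases "T / 2 \<le> t")
    case True
    have "2 powr (1 - l) * T powr (l - 1) = (T / 2) powr (l - 1)"
      using t by (simp add: powr_divide powr_diff field_simps)
    also have "\<dots> \<le> t powr (l - 1)" using True t l by (intro powr_mono2) auto
    finally have "2 powr (1 - l) * T powr (l - 1) * (t - Re x) \<le> t powr (l - 1) * (t - Re x)"
      using t by (intro mult_right_mono) auto
    moreover have "2 powr (1 - l) / 4 * (T powr (l - 1) * (T - t)) \<le> 1 * (T powr (l - 1) * (T - t))"
      using k1 t by (intro mult_right_mono) auto
    ultimately have "2 powr (1 - l) / 4 * (T powr (l - 1) * (T - t)) + 2 powr (1 - l) / 4 * (T powr (l - 1) * (t - Re x))
       \<le> (T - t) * T powr (l - 1) + 1/4 * (t powr (l - 1) * (t - Re x))"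
      by (simp add: mult_ac)
    then show ?thesis unfolding eq using d by (simp add: algebra_simps)
  next
    case False
    have "T powr (l - 1) * (T - Re x) \<le> T powr (l - 1) * (4 * (T - t))"
      using False t by (intro mult_left_mono) auto
    then have "2 powr (1 - l) / 4 * (T powr (l - 1) * (T - Re x)) \<le> 1/4 * (T powr (l - 1) * (4 * (T - t)))"
      by (rule mult_mono[OF k1]) (use t in auto)
    also have "\<dots> = (T - t) * T powr (l - 1)" by simp
    also have "\<dots> \<le> T powr l - angular_growth l x"
    proof -
      have "0 \<le> 1/4 * (t powr (l - 1) * (t - Re x))" using t by simp
      then show ?thesis unfolding eq using d by linarith
    qed
    finally show ?thesis .
  qed
qed

text \<open>To be used with \<open>X = \<bar>w\<bar>\<close>, \<open>Z = \<bar>z\<bar>\<close> and \<open>x = cprod w z\<close>. Replacing the growth function by its maximum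
\<open>X powr l * Z powr l\<close> and completing the square in \<open>X powr l\<close> gives the main term and the radial decay around
\<open>X = \<tau> * Z\<close>; the deficit of the growth function gives the angular decay. The rest of the work is to bound both
from below by quadratic expressions at the scale \<open>(1 + Z) powr (l - 1)\<close>.\<close>

lemma growth_minus_weight:
  fixes l \<alpha> g :: real
  assumes l: "1 \<le> l" and al: "\<alpha> > 0" and g: "g > 0"
  defines "\<tau> \<equiv> (g / \<alpha>) powr (1 / l)"
  shows "\<exists>c>0. \<exists>C. \<forall>X\<ge>0. \<forall>Z\<ge>0. \<forall>x. norm x \<le> X * Z \<longrightarrow>
    g * angular_growth l x - \<alpha> / 2 * X powr (2 * l) \<le>
      g\<^sup>2 / (2 * \<alpha>) * Z powr (2 * l) + C - c * ((1 + Z) powr (2 * (l - 1)) * ((X - \<tau> * Z)\<^sup>2 + 2 * \<tau> * (X * Z - Re x)))"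
proof -
  define m where "m = l - 1"
  have m: "m \<ge> 0" using l by (simp add: m_def)
  have tau: "\<tau> > 0" using g al by (simp add: \<tau>_def)
  have taul: "\<tau> powr l = g / \<alpha>" using l g al by (simp add: \<tau>_def powr_powr)
  define K :: real where "K = 2 powr (2 * m)"
  have K: "K > 0" by (simp add: K_def)
  define \<kappa> :: real where "\<kappa> = 2 powr (1 - l) / 4"
  have kap: "\<kappa> > 0" by (simp add: \<kappa>_def)
  \<comment> \<open>the three bounds serve the radial part, the angular part, and the case \<open>Z < 1\<close>\<close>
  define c where "c = min (\<alpha> / 2 * \<tau> powr (2 * m) / (9 * K)) (min (g * \<kappa> * (\<tau> / 2) powr m / (2 * \<tau> * K)) (\<alpha> / (32 * K)))"
  have c: "c > 0" using al tau K g kap by (auto simp: c_def)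
  have c1: "9 * (c * K) \<le> \<alpha> / 2 * \<tau> powr (2 * m)"
  proof -
    have "c \<le> \<alpha> / 2 * \<tau> powr (2 * m) / (9 * K)" by (simp add: c_def)
    then show ?thesis using K by (simp add: field_simps)
  qed
  have c2: "c * K * (2 * \<tau>) \<le> g * \<kappa> * (\<tau> / 2) powr m"
  proof -
    have "c \<le> g * \<kappa> * (\<tau> / 2) powr m / (2 * \<tau> * K)" by (simp add: c_def)
    then show ?thesis using K tau by (simp add: field_simps)
  qed
  have c3: "c * K \<le> \<alpha> / 32"
  proof -
    have "c \<le> \<alpha> / (32 * K)" by (simp add: c_def)
    then show ?thesis using K by (simp add: field_simps)
  qed
  define X0 where "X0 = max 1 (2 * \<tau>)"
  define C where "C = c * K * (X0 + \<tau>)\<^sup>2"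
  have C: "C \<ge> 0" using c K by (simp add: C_def)
  show ?thesis
  proof (rule exI[of _ c], rule conjI[OF c], rule exI[of _ C], intro allI impI)
    fix X Z :: real and x :: complex
    assume X: "X \<ge> 0" and Z: "Z \<ge> 0" and x: "norm x \<le> X * Z"
    define T where "T = X * Z"
    define \<Delta> where "\<Delta> = (X - \<tau> * Z)\<^sup>2 + 2 * \<tau> * (T - Re x)"
    have xT: "\<bar>Re x\<bar> \<le> T" using x abs_Re_le_cmod[of x] by (simp add: T_def)
    have D_le: "\<Delta> \<le> (X + \<tau> * Z)\<^sup>2"
    proof -
      have "2 * \<tau> * (T - Re x) \<le> 2 * \<tau> * (2 * T)" using xT tau by (intro mult_left_mono) auto
      then show ?thesis by (simp add: \<Delta>_def T_def power2_eq_square algebra_simps)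
    qed
    have pw: "(u powr l)\<^sup>2 = u powr (2 * l)" for u :: real by (cases "u = 0") (auto simp: powr_power mult.commute)
    have square: "(\<alpha> / 2) * X powr (2 * l) = (\<alpha> / 2) * (X powr l - (\<tau> * Z) powr l)\<^sup>2 + g * T powr l - g\<^sup>2 / (2 * \<alpha>) * Z powr (2 * l)"
    proof -
      have tz: "(\<tau> * Z) powr l = g / \<alpha> * Z powr l" using tau Z by (simp add: powr_mult taul)
      have tl: "T powr l = X powr l * Z powr l" using X Z by (simp add: T_def powr_mult)
      have "h * u\<^sup>2 = h * (u - d * v)\<^sup>2 + (d * (2 * h)) * (u * v) - (d\<^sup>2 * h) * v\<^sup>2" for h d u v :: real
        by (simp add: power2_eq_square algebra_simps)
      from this[of "\<alpha> / 2" "X powr l" "g / \<alpha>" "Z powr l"] tz tl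
      have "(\<alpha> / 2) * (X powr l)\<^sup>2 = (\<alpha> / 2) * (X powr l - (\<tau> * Z) powr l)\<^sup>2 + (g / \<alpha> * (2 * (\<alpha> / 2))) * T powr l
          - ((g / \<alpha>)\<^sup>2 * (\<alpha> / 2)) * (Z powr l)\<^sup>2" by (simp only:)
      moreover have "g / \<alpha> * (2 * (\<alpha> / 2)) = g" "(g / \<alpha>)\<^sup>2 * (\<alpha> / 2) = g\<^sup>2 / (2 * \<alpha>)"
        using al by (simp_all add: power2_eq_square)
      ultimately show ?thesis by (simp only: pw)
    qed
    have deficit: "g * (\<kappa> * (T powr m * (T - Re x))) \<le> g * (T powr l - angular_growth l x)"
      using angular_growth_deficit[OF l, of x T] x g by (intro mult_left_mono) (auto simp: T_def \<kappa>_def m_def)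
    have def0: "0 \<le> g * (\<kappa> * (T powr m * (T - Re x)))" using g kap xT by auto
    have main: "c * ((1 + Z) powr (2 * m) * \<Delta>) \<le> C + (\<alpha> / 2) * (X powr l - (\<tau> * Z) powr l)\<^sup>2 + g * (\<kappa> * (T powr m * (T - Re x)))"
    proof (cases "Z \<ge> 1")
      case True
      define P where "P = Z powr (2 * m)"
      have P: "P > 0" using True by (simp add: P_def)
      have "(1 + Z) powr (2 * m) \<le> (2 * Z) powr (2 * m)" using True m by (intro powr_mono2) auto
      also have "\<dots> = K * P" using True by (simp add: powr_mult K_def P_def)
      finally have S: "(1 + Z) powr (2 * m) \<le> K * P" .
      have D0: "\<Delta> \<ge> 0" using xT tau by (simp add: \<Delta>_def)
      have le1: "c * ((1 + Z) powr (2 * m) * \<Delta>) \<le> c * K * P * \<Delta>"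
        using mult_left_mono[OF mult_right_mono[OF S D0], of c] c by (simp add: mult_ac)
      define M where "M = max X (\<tau> * Z)"
      have "\<tau> * Z > 0" using tau True by simp
      then have M: "M \<ge> \<tau> * Z" "M > 0" by (auto simp: M_def max_def)
      have "\<bar>X - \<tau> * Z\<bar> * M powr m \<le> \<bar>X powr l - (\<tau> * Z) powr l\<bar>"
      proof (cases "X \<ge> \<tau> * Z")
        case ge: True
        then have "(X - \<tau> * Z) * X powr m \<le> X powr l - (\<tau> * Z) powr l"
          unfolding m_def using l Z tau by (intro powr_diff_ge) auto
        then show ?thesis using ge by (auto simp: M_def max_def)
      next
        case lt: False
        then have "(\<tau> * Z - X) * (\<tau> * Z) powr m \<le> (\<tau> * Z) powr l - X powr l"
          unfolding m_def using l X by (intro powr_diff_ge) auto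
        then show ?thesis using lt by (auto simp: M_def max_def)
      qed
      then have "(\<bar>X - \<tau> * Z\<bar> * M powr m)\<^sup>2 \<le> \<bar>X powr l - (\<tau> * Z) powr l\<bar>\<^sup>2" by (intro power_mono) auto
      then have sq: "(X - \<tau> * Z)\<^sup>2 * M powr (2 * m) \<le> (X powr l - (\<tau> * Z) powr l)\<^sup>2"
        using M by (simp add: power_mult_distrib powr_power mult.commute)
      have "\<tau> powr (2 * m) * P = (\<tau> * Z) powr (2 * m)" using tau True by (simp add: P_def powr_mult)
      also have "\<dots> \<le> M powr (2 * m)" using M tau True m by (intro powr_mono2) auto
      finally have "(X - \<tau> * Z)\<^sup>2 * (\<tau> powr (2 * m) * P) \<le> (X - \<tau> * Z)\<^sup>2 * M powr (2 * m)" by (intro mult_left_mono) auto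
      then have "(X - \<tau> * Z)\<^sup>2 * (\<tau> powr (2 * m) * P) \<le> (X powr l - (\<tau> * Z) powr l)\<^sup>2" using sq by linarith
      then have "(\<alpha> / 2) * ((X - \<tau> * Z)\<^sup>2 * (\<tau> powr (2 * m) * P)) \<le> (\<alpha> / 2) * (X powr l - (\<tau> * Z) powr l)\<^sup>2"
        using al by (intro mult_left_mono) auto
      moreover have "9 * (c * K) * (P * (X - \<tau> * Z)\<^sup>2) \<le> \<alpha> / 2 * \<tau> powr (2 * m) * (P * (X - \<tau> * Z)\<^sup>2)"
        using c1 P by (intro mult_right_mono) auto
      ultimately have radial: "9 * (c * K) * (P * (X - \<tau> * Z)\<^sup>2) \<le> (\<alpha> / 2) * (X powr l - (\<tau> * Z) powr l)\<^sup>2"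
        by (simp add: mult_ac)
      have "c * K * P * \<Delta> \<le> (\<alpha> / 2) * (X powr l - (\<tau> * Z) powr l)\<^sup>2 + g * (\<kappa> * (T powr m * (T - Re x)))"
      proof (cases "\<tau> * Z / 2 \<le> X")
        case big: True
        have "(\<tau> / 2) powr m * P = (\<tau> / 2) powr m * (Z powr m * Z powr m)" by (simp add: P_def powr_add[symmetric])
        also have "\<dots> = (\<tau> * Z / 2 * Z) powr m" using tau True by (simp add: powr_mult[symmetric] mult_ac)
        also have "\<dots> \<le> T powr m" unfolding T_def using big tau True m by (intro powr_mono2 mult_right_mono) auto
        finally have tp: "(\<tau> / 2) powr m * P \<le> T powr m" .
        have "c * K * (2 * \<tau>) * (P * (T - Re x)) \<le> g * \<kappa> * (\<tau> / 2) powr m * (P * (T - Re x))"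
          using c2 P xT by (intro mult_right_mono) auto
        also have "\<dots> = g * \<kappa> * (((\<tau> / 2) powr m * P) * (T - Re x))" by simp
        also have "\<dots> \<le> g * \<kappa> * (T powr m * (T - Re x))" using tp g kap xT by (intro mult_left_mono mult_right_mono) auto
        finally have "c * K * (2 * \<tau>) * (P * (T - Re x)) \<le> g * (\<kappa> * (T powr m * (T - Re x)))" by simp
        moreover have "c * K * (P * (X - \<tau> * Z)\<^sup>2) \<le> 9 * (c * K) * (P * (X - \<tau> * Z)\<^sup>2)"
          using c K P by (intro mult_right_mono) auto
        ultimately show ?thesis using radial by (simp add: \<Delta>_def algebra_simps)
      next
        case False
        have "X + \<tau> * Z \<le> 3 * (\<tau> * Z - X)" using False by (simp add: not_le field_simps)
        then have "(X + \<tau> * Z)\<^sup>2 \<le> (3 * (\<tau> * Z - X))\<^sup>2" using X tau Z by (intro power_mono) auto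
        also have "\<dots> = 9 * (X - \<tau> * Z)\<^sup>2" by (simp add: power2_eq_square algebra_simps)
        finally have "\<Delta> \<le> 9 * (X - \<tau> * Z)\<^sup>2" using D_le by linarith
        then have "c * K * P * \<Delta> \<le> c * K * P * (9 * (X - \<tau> * Z)\<^sup>2)" using c K P by (intro mult_left_mono) auto
        then show ?thesis using radial def0 by (simp add: mult_ac)
      qed
      then show ?thesis using le1 C by linarith
    next
      case False
      then have Z1: "Z < 1" by simp
      have S: "(1 + Z) powr (2 * m) \<le> K" unfolding K_def using Z1 Z m by (intro powr_mono2) auto
      have "\<Delta> \<le> (X + \<tau>)\<^sup>2"
      proof -
        have "(X + \<tau> * Z)\<^sup>2 \<le> (X + \<tau>)\<^sup>2" using X Z Z1 tau by (intro power_mono) (auto simp: mult_left_le)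
        then show ?thesis using D_le by linarith
      qed
      then have "(1 + Z) powr (2 * m) * \<Delta> \<le> K * (X + \<tau>)\<^sup>2"
        using S K xT tau by (intro mult_mono) (auto simp: \<Delta>_def)
      then have le1: "c * ((1 + Z) powr (2 * m) * \<Delta>) \<le> c * K * (X + \<tau>)\<^sup>2"
        using c by (simp add: mult_left_mono mult.assoc)
      have "c * K * (X + \<tau>)\<^sup>2 \<le> C + (\<alpha> / 2) * (X powr l - (\<tau> * Z) powr l)\<^sup>2"
      proof (cases "X \<le> X0")
        case True
        then have "c * K * (X + \<tau>)\<^sup>2 \<le> C" unfolding C_def using X tau c K by (intro mult_left_mono power_mono) auto
        moreover have "0 \<le> (\<alpha> / 2) * (X powr l - (\<tau> * Z) powr l)\<^sup>2" using al by simp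
        ultimately show ?thesis by linarith
      next
        case False
        then have X1: "X \<ge> 1" "X \<ge> 2 * \<tau>" by (auto simp: X0_def)
        have tz: "\<tau> * Z \<le> \<tau>" using tau Z Z1 by (simp add: mult_left_le)
        have tzX: "\<tau> * Z \<le> X" using X1 tz tau by linarith
        have "X / 2 \<le> (X - \<tau> * Z) * 1" using X1 tz by simp
        also have "\<dots> \<le> (X - \<tau> * Z) * X powr (l - 1)"
          using X1 tzX l by (intro mult_left_mono ge_one_powr_ge_zero) auto
        also have "\<dots> \<le> X powr l - (\<tau> * Z) powr l" using l tzX tau Z by (intro powr_diff_ge) auto
        finally have "(X / 2)\<^sup>2 \<le> (X powr l - (\<tau> * Z) powr l)\<^sup>2" using X by (intro power_mono) auto
        then have "(\<alpha> / 2) * (X / 2)\<^sup>2 \<le> (\<alpha> / 2) * (X powr l - (\<tau> * Z) powr l)\<^sup>2" using al by (intro mult_left_mono) auto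
        moreover have "c * K * (X + \<tau>)\<^sup>2 \<le> \<alpha> / 32 * (2 * X)\<^sup>2"
          using c3 X1 X tau c K al by (intro mult_mono power_mono) auto
        moreover have "\<alpha> / 32 * (2 * X)\<^sup>2 = (\<alpha> / 2) * (X / 2)\<^sup>2" by (simp add: power2_eq_square)
        ultimately show ?thesis using C by linarith
      qed
      then show ?thesis using le1 def0 by linarith
    qed
    show "g * angular_growth l x - \<alpha> / 2 * X powr (2 * l) \<le>
      g\<^sup>2 / (2 * \<alpha>) * Z powr (2 * l) + C - c * ((1 + Z) powr (2 * (l - 1)) * ((X - \<tau> * Z)\<^sup>2 + 2 * \<tau> * (X * Z - Re x)))"
      using main deficit unfolding square unfolding m_def[symmetric] T_def[symmetric] \<Delta>_def[symmetric]
      by (simp add: right_diff_distrib)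
  qed
qed

lemma exp_diff_mult: "exp (a - b * y) = exp a * exp (- b * (y::real))"
  by (simp add: exp_diff exp_minus divide_inverse)

text \<open>Powers of \<open>1 + \<bar>w\<bar>\<close> and \<open>1 + \<bar>z\<bar>\<close> are comparable up to a power of the distance, which any Gaussian absorbs.\<close>

lemma weight_translation:
  fixes \<tau> e c :: real
  assumes tau: "\<tau> > 0" and c: "c > 0"
  shows "\<exists>C>0. \<forall>w z :: complex ^ 'n. (1 + norm w) powr e \<le> C * (1 + norm z) powr e * exp (c * (norm (w - \<tau> *\<^sub>R z))\<^sup>2)"
proof -
  obtain C where C: "C > 0" "\<And>t. t \<ge> 0 \<Longrightarrow> (1 + t) powr \<bar>e\<bar> \<le> C * exp (c * t powr 2)"
    using powr_shift_le_exp[OF _ c, of 2 "\<bar>e\<bar>"] by auto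
  define M where "M = max 1 (max \<tau> (1 / \<tau>))"
  have M: "M \<ge> 1" "M \<ge> \<tau>" "M \<ge> 1 / \<tau>" by (auto simp: M_def)
  show ?thesis
  proof (intro exI[of _ "M powr \<bar>e\<bar> * C"] conjI allI)
    show "M powr \<bar>e\<bar> * C > 0" using M(1) C(1) by simp
    fix w z :: "complex ^ 'n"
    define D where "D = norm (w - \<tau> *\<^sub>R z)"
    have D: "D \<ge> 0" by (simp add: D_def)
    have a: "1 + norm w \<le> M * (1 + norm z) * (1 + D)"
    proof -
      have "norm w \<le> \<tau> * norm z + D"
        using norm_triangle_ineq[of "\<tau> *\<^sub>R z" "w - \<tau> *\<^sub>R z"] tau by (simp add: D_def)
      also have "\<dots> \<le> M * norm z + M * D" using M D mult_right_mono[OF M(2), of "norm z"] mult_right_mono[OF M(1), of D] by simp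
      finally have "1 + norm w \<le> M * (1 + norm z + D)" using M(1) by (simp add: distrib_left)
      also have "\<dots> \<le> M * ((1 + norm z) * (1 + D))" using M D by (intro mult_left_mono) (auto simp: distrib_left distrib_right)
      finally show ?thesis by (simp add: mult.assoc)
    qed
    have b: "1 + norm z \<le> M * (1 + norm w) * (1 + D)"
    proof -
      have "\<tau> * norm z \<le> norm w + D"
        using norm_triangle_ineq4[of w "w - \<tau> *\<^sub>R z"] tau by (simp add: D_def)
      then have "norm z \<le> 1 / \<tau> * (norm w + D)" using tau by (simp add: field_simps)
      also have "\<dots> \<le> M * (norm w + D)" using M D by (intro mult_right_mono) auto
      finally have "1 + norm z \<le> M * (1 + norm w + D)" using M(1) by (simp add: distrib_left)
      also have "\<dots> \<le> M * ((1 + norm w) * (1 + D))" using M D by (intro mult_left_mono) (auto simp: distrib_left distrib_right)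
      finally show ?thesis by (simp add: mult.assoc)
    qed
    have w1: "1 + norm w > 0" and z1: "1 + norm z > 0" by (auto simp: add_pos_nonneg)
    have "(1 + norm w) powr e \<le> M powr \<bar>e\<bar> * (1 + norm z) powr e * (1 + D) powr \<bar>e\<bar>"
    proof (cases "e \<ge> 0")
      case True
      then have "(1 + norm w) powr e \<le> (M * (1 + norm z) * (1 + D)) powr e" using a by (intro powr_mono2) auto
      then show ?thesis using True M D by (simp add: powr_mult)
    next
      case False
      then have "(1 + norm z) powr (- e) \<le> (M * (1 + norm w) * (1 + D)) powr (- e)" using b by (intro powr_mono2) auto
      also have "\<dots> = M powr \<bar>e\<bar> * (1 + norm w) powr (- e) * (1 + D) powr \<bar>e\<bar>" using False M D by (simp add: powr_mult)
      finally have "(1 + norm w) powr e * (1 + norm z) powr e * (1 + norm z) powr (- e)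
          \<le> (1 + norm w) powr e * (1 + norm z) powr e * (M powr \<bar>e\<bar> * (1 + norm w) powr (- e) * (1 + D) powr \<bar>e\<bar>)"
        by (intro mult_left_mono) auto
      moreover have one: "(1 + norm z) powr e * (1 + norm z) powr (- e) = 1" "(1 + norm w) powr e * (1 + norm w) powr (- e) = 1"
        using w1 z1 by (simp_all add: powr_add[symmetric])
      have "(1 + norm w) powr e * (1 + norm z) powr e * (1 + norm z) powr (- e) = (1 + norm w) powr e"
        by (simp only: mult.assoc one mult_1_right)
      moreover have "(1 + norm w) powr e * (1 + norm z) powr e * (M powr \<bar>e\<bar> * (1 + norm w) powr (- e) * (1 + D) powr \<bar>e\<bar>)
          = ((1 + norm w) powr e * (1 + norm w) powr (- e)) * (M powr \<bar>e\<bar> * (1 + norm z) powr e * (1 + D) powr \<bar>e\<bar>)"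
        by (simp only: mult_ac)
      ultimately show ?thesis by (simp only: one mult_1)
    qed
    also have "\<dots> \<le> M powr \<bar>e\<bar> * (1 + norm z) powr e * (C * exp (c * D\<^sup>2))"
      using C(2)[OF D] D by (intro mult_left_mono) (auto simp: powr_numeral)
    finally show "(1 + norm w) powr e \<le> M powr \<bar>e\<bar> * C * (1 + norm z) powr e * exp (c * (norm (w - \<tau> *\<^sub>R z))\<^sup>2)"
      by (simp add: D_def mult_ac)
  qed
qed

lemma weighted_abs_cprod_growth:
  fixes l \<alpha> g s \<rho> C0 :: real
  assumes l: "1 \<le> l" and al: "\<alpha> > 0" and g: "g > 0" and s: "s \<ge> 0" and C0: "C0 \<ge> 0"
    and G: "\<And>x. norm (G x) \<le> C0 * (1 + norm x) powr s * exp (g * angular_growth l x)"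
  shows "\<exists>c>0. \<exists>C>0. \<forall>w z :: complex ^ 'n. weighted_abs l \<alpha> \<rho> (\<lambda>w. G (cprod w z)) w \<le>
     (C * (1 + norm z) powr (\<rho> + 2 * s) * exp (g\<^sup>2 / (2 * \<alpha>) * norm z powr (2 * l)))
       * exp (- c * ((1 + norm z) powr (l - 1) * norm (w - (g / \<alpha>) powr (1 / l) *\<^sub>R z))\<^sup>2)"
proof -
  define \<tau> where "\<tau> = (g / \<alpha>) powr (1 / l)"
  have tau: "\<tau> > 0" using g al by (simp add: \<tau>_def)
  obtain c C where c: "c > 0" and C: "\<And>X Z x. X \<ge> 0 \<Longrightarrow> Z \<ge> 0 \<Longrightarrow> norm x \<le> X * Z \<Longrightarrow>
    g * angular_growth l x - \<alpha> / 2 * X powr (2 * l) \<le>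
      g\<^sup>2 / (2 * \<alpha>) * Z powr (2 * l) + C - c * ((1 + Z) powr (2 * (l - 1)) * ((X - \<tau> * Z)\<^sup>2 + 2 * \<tau> * (X * Z - Re x)))"
    using growth_minus_weight[OF l al g] unfolding \<tau>_def by blast
  have c2: "c / 2 > 0" using c by simp
  obtain C1 where C1: "C1 > 0" "\<And>w z :: complex ^ 'n. (1 + norm w) powr (s + \<rho>) \<le> C1 * (1 + norm z) powr (s + \<rho>) * exp (c / 2 * (norm (w - \<tau> *\<^sub>R z))\<^sup>2)"
    using weight_translation[OF tau c2, of "s + \<rho>"] by blast
  show ?thesis unfolding \<tau>_def[symmetric]
  proof (rule exI[of _ "c / 2"], rule conjI[OF c2], rule exI[of _ "C0 * C1 * exp C + 1"], intro conjI allI)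
    show "C0 * C1 * exp C + 1 > 0" using C0 C1(1) by (intro add_nonneg_pos) auto
    fix w z :: "complex ^ 'n"
    define x X Z D where "x = cprod w z" and "X = norm w" and "Z = norm z" and "D = norm (w - \<tau> *\<^sub>R z)"
    define S where "S = (1 + Z) powr (l - 1)"
    have X: "X \<ge> 0" and Z: "Z \<ge> 0" by (auto simp: X_def Z_def)
    have xXZ: "norm x \<le> X * Z" using norm_cprod_le[of w z] by (simp add: x_def X_def Z_def)
    have S1: "S \<ge> 1" unfolding S_def using Z l by (intro ge_one_powr_ge_zero) auto
    have S2: "(1 + Z) powr (2 * (l - 1)) = S\<^sup>2" using Z by (simp add: S_def powr_power mult.commute)
    have D2: "(X - \<tau> * Z)\<^sup>2 + 2 * \<tau> * (X * Z - Re x) = D\<^sup>2"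
      by (simp add: D_def norm_minus_scaleR_cprod x_def X_def Z_def)
    have ex: "g * angular_growth l x - \<alpha> / 2 * X powr (2 * l) \<le> g\<^sup>2 / (2 * \<alpha>) * Z powr (2 * l) + C - c * (S * D)\<^sup>2"
      using C[OF X Z xXZ] unfolding S2 D2 by (simp add: power_mult_distrib)
    have "(1 + norm x) powr s \<le> ((1 + X) * (1 + Z)) powr s"
    proof (rule powr_mono2[OF s])
      have "1 + norm x \<le> 1 + X * Z" using xXZ by simp
      also have "\<dots> \<le> (1 + X) * (1 + Z)" using X Z by (simp add: distrib_left distrib_right)
      finally show "1 + norm x \<le> (1 + X) * (1 + Z)" .
    qed simp
    also have "\<dots> = (1 + X) powr s * (1 + Z) powr s" using X Z by (simp add: powr_mult)
    finally have ps: "(1 + norm x) powr s \<le> (1 + X) powr s * (1 + Z) powr s" .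
    have "weighted_abs l \<alpha> \<rho> (\<lambda>w. G (cprod w z)) w \<le> (C0 * (1 + norm x) powr s * exp (g * angular_growth l x)) * (1 + X) powr \<rho> * exp (- (\<alpha> / 2) * X powr (2 * l))"
      unfolding weighted_abs_def X_def[symmetric] x_def[symmetric] using G[of x] by (intro mult_right_mono) auto
    also have "\<dots> = C0 * ((1 + norm x) powr s * (1 + X) powr \<rho>) * exp (g * angular_growth l x - \<alpha> / 2 * X powr (2 * l))"
      unfolding exp_diff_mult by (simp only: mult_ac)
    also have "\<dots> \<le> C0 * (((1 + X) powr s * (1 + Z) powr s) * (1 + X) powr \<rho>) * exp (g\<^sup>2 / (2 * \<alpha>) * Z powr (2 * l) + C - c * (S * D)\<^sup>2)"
      using ps ex C0 by (intro mult_mono mult_left_mono mult_right_mono) auto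
    also have "\<dots> = C0 * (1 + Z) powr s * (1 + X) powr (s + \<rho>) * exp (g\<^sup>2 / (2 * \<alpha>) * Z powr (2 * l) + C - c * (S * D)\<^sup>2)"
      by (simp add: powr_add)
    also have "\<dots> \<le> C0 * (1 + Z) powr s * (C1 * (1 + Z) powr (s + \<rho>) * exp (c / 2 * (S * D)\<^sup>2)) * exp (g\<^sup>2 / (2 * \<alpha>) * Z powr (2 * l) + C - c * (S * D)\<^sup>2)"
    proof (intro mult_right_mono mult_left_mono)
      have "1 * D\<^sup>2 \<le> S\<^sup>2 * D\<^sup>2" using S1 by (intro mult_right_mono) (auto simp: one_le_power)
      then have "c / 2 * D\<^sup>2 \<le> c / 2 * (S * D)\<^sup>2" using c by (intro mult_left_mono) (auto simp: power_mult_distrib)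
      then have "C1 * (1 + Z) powr (s + \<rho>) * exp (c / 2 * D\<^sup>2) \<le> C1 * (1 + Z) powr (s + \<rho>) * exp (c / 2 * (S * D)\<^sup>2)"
        using C1(1) by (intro mult_left_mono) auto
      then show "(1 + X) powr (s + \<rho>) \<le> C1 * (1 + Z) powr (s + \<rho>) * exp (c / 2 * (S * D)\<^sup>2)"
        using C1(2)[of w z] by (simp add: X_def Z_def D_def)
    qed (use C0 in auto)
    also have "\<dots> = (C0 * C1 * exp C) * ((1 + Z) powr s * (1 + Z) powr (s + \<rho>)) * exp (g\<^sup>2 / (2 * \<alpha>) * Z powr (2 * l)) * (exp (c / 2 * (S * D)\<^sup>2) * exp (- c * (S * D)\<^sup>2))"
      unfolding exp_diff_mult exp_add by (simp only: mult_ac)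
    also have "exp (c / 2 * (S * D)\<^sup>2) * exp (- c * (S * D)\<^sup>2) = exp (- (c / 2) * (S * D)\<^sup>2)"
    proof -
      have "c / 2 * y + - c * y = - (c / 2) * y" for y :: real by (simp add: field_simps)
      then show ?thesis by (simp only: exp_add[symmetric])
    qed
    also have "(1 + Z) powr s * (1 + Z) powr (s + \<rho>) = (1 + Z) powr (\<rho> + 2 * s)"
      by (simp add: powr_add[symmetric] algebra_simps)
    also have "(C0 * C1 * exp C) * (1 + Z) powr (\<rho> + 2 * s) * exp (g\<^sup>2 / (2 * \<alpha>) * Z powr (2 * l)) * exp (- (c / 2) * (S * D)\<^sup>2)
       \<le> (C0 * C1 * exp C + 1) * (1 + Z) powr (\<rho> + 2 * s) * exp (g\<^sup>2 / (2 * \<alpha>) * Z powr (2 * l)) * exp (- (c / 2) * (S * D)\<^sup>2)"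
      by (intro mult_right_mono) auto
    finally show "weighted_abs l \<alpha> \<rho> (\<lambda>w. G (cprod w z)) w \<le>
     ((C0 * C1 * exp C + 1) * (1 + norm z) powr (\<rho> + 2 * s) * exp (g\<^sup>2 / (2 * \<alpha>) * norm z powr (2 * l)))
       * exp (- (c / 2) * ((1 + norm z) powr (l - 1) * norm (w - \<tau> *\<^sub>R z))\<^sup>2)"
      by (simp add: S_def Z_def D_def)
  qed
qed

text \<open>The pointwise Gaussian bound is integrated; the width of the Gaussian contributes the negative power of \<open>1 + \<bar>z\<bar>\<close>,
with exponent proportional to \<open>1/p\<close>.\<close>

lemma Fock_norm_cprod_growth:
  fixes l \<alpha> g s \<rho> C0 :: real
  assumes l: "1 \<le> l" and al: "\<alpha> > 0" and g: "g > 0" and s: "s \<ge> 0" and C0: "C0 \<ge> 0" and hol: "G holomorphic_on UNIV"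
    and G: "\<And>x. norm (G x) \<le> C0 * (1 + norm x) powr s * exp (g * angular_growth l x)" and p: "1 \<le> p"
  shows "\<exists>K>0. \<forall>z :: complex ^ 'n. (\<lambda>w. G (cprod w z)) \<in> Fock_space l p \<alpha> \<rho> \<and>
    Fock_norm l p \<alpha> \<rho> (\<lambda>w. G (cprod w z)) \<le>
      K * (1 + norm z) powr (\<rho> + 2 * s - 2 * real CARD('n) * (l - 1) * inv_exponent p) * exp (g\<^sup>2 / (2 * \<alpha>) * norm z powr (2 * l))"
proof -
  obtain c C where c: "c > 0" and C: "C > 0" and bd: "\<And>w z :: complex ^ 'n. weighted_abs l \<alpha> \<rho> (\<lambda>w. G (cprod w z)) w \<le>
     (C * (1 + norm z) powr (\<rho> + 2 * s) * exp (g\<^sup>2 / (2 * \<alpha>) * norm z powr (2 * l)))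
       * exp (- c * ((1 + norm z) powr (l - 1) * norm (w - (g / \<alpha>) powr (1 / l) *\<^sub>R z))\<^sup>2)"
    using weighted_abs_cprod_growth[OF l al g s C0 G, of \<rho>] by blast
  show ?thesis
  proof (intro exI[of _ "C * gaussian_constant TYPE('n) p c"] conjI allI)
    show "C * gaussian_constant TYPE('n) p c > 0" using C gaussian_constant_pos[OF c p, where 'n = 'n] by simp
    fix z :: "complex ^ 'n"
    have z: "1 + norm z > 0" by (simp add: add_pos_nonneg)
    then have S: "(1 + norm z) powr (l - 1) > 0" by simp
    have A: "0 \<le> C * (1 + norm z) powr (\<rho> + 2 * s) * exp (g\<^sup>2 / (2 * \<alpha>) * norm z powr (2 * l))" using C by simp
    note * = Fock_norm_gaussian_bound[OF entire_cprod[OF hol] p c S A bd]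
    show "(\<lambda>w. G (cprod w z)) \<in> Fock_space l p \<alpha> \<rho>" by (rule *(1))
    have "((1 + norm z) powr (l - 1)) powr (- 2 * real CARD('n) * inv_exponent p) = (1 + norm z) powr (- 2 * real CARD('n) * (l - 1) * inv_exponent p)"
      using z by (simp add: powr_powr mult_ac)
    then have "Fock_norm l p \<alpha> \<rho> (\<lambda>w. G (cprod w z)) \<le> (C * (1 + norm z) powr (\<rho> + 2 * s) * exp (g\<^sup>2 / (2 * \<alpha>) * norm z powr (2 * l))) *
        (1 + norm z) powr (- 2 * real CARD('n) * (l - 1) * inv_exponent p) * gaussian_constant TYPE('n) p c"
      using *(2) by (simp only:)
    also have "\<dots> = C * gaussian_constant TYPE('n) p c * ((1 + norm z) powr (\<rho> + 2 * s) * (1 + norm z) powr (- 2 * real CARD('n) * (l - 1) * inv_exponent p))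
        * exp (g\<^sup>2 / (2 * \<alpha>) * norm z powr (2 * l))" by (simp only: mult_ac)
    also have "(1 + norm z) powr (\<rho> + 2 * s) * (1 + norm z) powr (- 2 * real CARD('n) * (l - 1) * inv_exponent p)
       = (1 + norm z) powr (\<rho> + 2 * s - 2 * real CARD('n) * (l - 1) * inv_exponent p)"
      by (simp add: powr_add[symmetric])
    finally show "Fock_norm l p \<alpha> \<rho> (\<lambda>w. G (cprod w z)) \<le>
      C * gaussian_constant TYPE('n) p c * (1 + norm z) powr (\<rho> + 2 * s - 2 * real CARD('n) * (l - 1) * inv_exponent p) * exp (g\<^sup>2 / (2 * \<alpha>) * norm z powr (2 * l))" .
  qed
qed

text \<open>By the weighted inequality of arithmetic and geometric means, \<open>\<tau> * \<bar>w\<bar> powr l * \<bar>z\<bar> powr l\<close> is at most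
\<open>q * \<bar>z\<bar> powr (2 * l)\<close> plus a multiple of \<open>\<bar>w\<bar> powr (2 * l)\<close>. Since \<open>q\<close> exceeds the critical value, that multiple is smaller than
\<open>\<alpha> / 2\<close>, and the rest of the weight makes the function integrable.\<close>

lemma Fock_norm_cprod_type:
  fixes l \<alpha> \<tau> q \<rho> C0 :: real
  assumes l: "1 \<le> l" and al: "\<alpha> > 0" and tau: "\<tau> \<ge> 0" and C0: "C0 \<ge> 0" and hol: "G holomorphic_on UNIV"
    and G: "\<And>x. norm (G x) \<le> C0 * exp (\<tau> * norm x powr l)" and p: "1 \<le> p" and q: "q > \<tau>\<^sup>2 / (2 * \<alpha>)"
  shows "\<exists>K>0. \<forall>z :: complex ^ 'n. (\<lambda>w. G (cprod w z)) \<in> Fock_space l p \<alpha> \<rho> \<and>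
    Fock_norm l p \<alpha> \<rho> (\<lambda>w. G (cprod w z)) \<le> K * exp (q * norm z powr (2 * l))"
proof -
  have q0: "q > 0" using q al tau by (auto intro: le_less_trans[rotated])
  \<comment> \<open>half of the unused weight absorbs the power of \<open>1 + \<bar>w\<bar>\<close>, the other half gives a Gaussian\<close>
  define e where "e = (\<alpha> / 2 - \<tau>\<^sup>2 / (4 * q)) / 2"
  have e: "e > 0"
  proof -
    have "\<tau>\<^sup>2 < q * (2 * \<alpha>)" using q al by (simp add: pos_divide_less_eq)
    then show ?thesis using q0 by (simp add: e_def field_simps)
  qed
  have l2: "2 * l \<ge> 1" using l by simp
  obtain C where C: "C > 0" "\<And>t. t \<ge> 0 \<Longrightarrow> (1 + t) powr \<rho> \<le> C * exp (e * t powr (2 * l))"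
    using powr_shift_le_exp[OF l2 e, of \<rho>] by auto
  have bd: "weighted_abs l \<alpha> \<rho> (\<lambda>w. G (cprod w z)) w \<le> (C0 * C * exp e * exp (q * norm z powr (2 * l))) * exp (- e * (1 * norm (w - 0))\<^sup>2)"
    for w z :: "complex ^ 'n"
  proof -
    define X Z where "X = norm w" and "Z = norm z"
    have X: "X \<ge> 0" and Z: "Z \<ge> 0" by (auto simp: X_def Z_def)
    have "norm (cprod w z) powr l \<le> (X * Z) powr l"
      using norm_cprod_le[of w z] l by (intro powr_mono2) (auto simp: X_def Z_def)
    then have "\<tau> * norm (cprod w z) powr l \<le> \<tau> * (X powr l * Z powr l)" using tau X Z by (simp add: powr_mult mult_left_mono)
    also have "\<dots> \<le> q * (Z powr l)\<^sup>2 + \<tau>\<^sup>2 / (4 * q) * (X powr l)\<^sup>2"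
    proof -
      have "0 \<le> q * (Z powr l - \<tau> / (2 * q) * X powr l)\<^sup>2" using q0 by simp
      also have "\<dots> = q * (Z powr l)\<^sup>2 + q * (\<tau> / (2 * q))\<^sup>2 * (X powr l)\<^sup>2 - 2 * q * (\<tau> / (2 * q)) * (X powr l * Z powr l)"
      proof -
        have "q * (v - d * u)\<^sup>2 = q * v\<^sup>2 + q * d\<^sup>2 * u\<^sup>2 - 2 * q * d * (u * v)" for u v d :: real
          by (simp add: power2_eq_square algebra_simps)
        then show ?thesis .
      qed
      also have "q * (\<tau> / (2 * q))\<^sup>2 = \<tau>\<^sup>2 / (4 * q)" using q0 by (simp add: power_divide power2_eq_square)
      also have "2 * q * (\<tau> / (2 * q)) = \<tau>" using q0 by simp
      finally show ?thesis by simp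
    qed
    also have "(Z powr l)\<^sup>2 = Z powr (2 * l)" using powr_add[of Z l l] by (simp add: power2_eq_square)
    also have "(X powr l)\<^sup>2 = X powr (2 * l)" using powr_add[of X l l] by (simp add: power2_eq_square)
    finally have "\<tau> * norm (cprod w z) powr l \<le> q * Z powr (2 * l) + \<tau>\<^sup>2 / (4 * q) * X powr (2 * l)" .
    moreover have e2: "\<tau>\<^sup>2 / (4 * q) = \<alpha> / 2 - 2 * e" by (simp add: e_def diff_divide_distrib)
    ultimately have "\<tau> * norm (cprod w z) powr l - \<alpha> / 2 * X powr (2 * l) \<le> q * Z powr (2 * l) - 2 * e * X powr (2 * l)"
      unfolding e2 left_diff_distrib by linarith
    moreover have "X\<^sup>2 \<le> 1 + X powr (2 * l)"
    proof (cases "X \<le> 1")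
      case True
      then have "X\<^sup>2 \<le> 1" using X by (simp add: power_le_one)
      then show ?thesis using powr_ge_zero[of X "2 * l"] by linarith
    next
      case False
      then have "X powr 2 \<le> X powr (2 * l)" using l by (intro powr_mono) auto
      then show ?thesis using False by (simp add: powr_numeral)
    qed
    then have "e * X\<^sup>2 \<le> e * (1 + X powr (2 * l))" using e by (intro mult_left_mono) auto
    ultimately have ex: "\<tau> * norm (cprod w z) powr l - \<alpha> / 2 * X powr (2 * l) + e * X powr (2 * l) \<le> q * Z powr (2 * l) + e - e * X\<^sup>2"
      by (simp add: distrib_left)
    have "weighted_abs l \<alpha> \<rho> (\<lambda>w. G (cprod w z)) w \<le> (C0 * exp (\<tau> * norm (cprod w z) powr l)) * (C * exp (e * X powr (2 * l))) * exp (- (\<alpha> / 2) * X powr (2 * l))"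
      unfolding weighted_abs_def X_def[symmetric] using G[of "cprod w z"] C(2)[OF X] C0 C(1)
      by (intro mult_right_mono mult_mono) auto
    also have "\<dots> = C0 * C * exp (\<tau> * norm (cprod w z) powr l - \<alpha> / 2 * X powr (2 * l) + e * X powr (2 * l))"
      unfolding exp_add exp_diff_mult by (simp only: mult_ac)
    also have "\<dots> \<le> C0 * C * exp (q * Z powr (2 * l) + e - e * X\<^sup>2)" using ex C0 C(1) by (intro mult_left_mono) auto
    also have "\<dots> = (C0 * C * exp e * exp (q * Z powr (2 * l))) * exp (- e * X\<^sup>2)"
      unfolding exp_diff_mult exp_add by (simp only: mult_ac)
    finally show ?thesis by (simp add: X_def Z_def)
  qed
  show ?thesis
  proof (intro exI[of _ "C0 * C * exp e * gaussian_constant TYPE('n) p e + 1"] conjI allI)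
    show "C0 * C * exp e * gaussian_constant TYPE('n) p e + 1 > 0"
      using C C0 gaussian_constant_pos[OF e p, where 'n = 'n] by (intro add_nonneg_pos) auto
    fix z :: "complex ^ 'n"
    have A: "0 \<le> C0 * C * exp e * exp (q * norm z powr (2 * l))" using C C0 by simp
    note * = Fock_norm_gaussian_bound[OF entire_cprod[OF hol] p e zero_less_one A bd]
    show "(\<lambda>w. G (cprod w z)) \<in> Fock_space l p \<alpha> \<rho>" by (rule *(1))
    have "Fock_norm l p \<alpha> \<rho> (\<lambda>w. G (cprod w z)) \<le> (C0 * C * exp e * gaussian_constant TYPE('n) p e) * exp (q * norm z powr (2 * l))"
      using *(2) by (simp add: mult_ac)
    also have "\<dots> \<le> (C0 * C * exp e * gaussian_constant TYPE('n) p e + 1) * exp (q * norm z powr (2 * l))"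
      by (intro mult_right_mono) auto
    finally show "Fock_norm l p \<alpha> \<rho> (\<lambda>w. G (cprod w z)) \<le> (C0 * C * exp e * gaussian_constant TYPE('n) p e + 1) * exp (q * norm z powr (2 * l))" .
  qed
qed

section \<open>Hoelder's inequality in Fock spaces\<close>

lemma Hoelder_nonneg:
  fixes u v :: "'a \<Rightarrow> real"
  assumes PQ: "P > 1" "Q > 1" "1 / P + 1 / Q = 1" and u0: "\<And>x. u x \<ge> 0" and v0: "\<And>x. v x \<ge> 0"
    and um: "u \<in> borel_measurable M" and vm: "v \<in> borel_measurable M"
    and ui: "integrable M (\<lambda>x. u x powr P)" and vi: "integrable M (\<lambda>x. v x powr Q)"
  shows "integrable M (\<lambda>x. u x * v x)"
    and "(\<integral>x. u x * v x \<partial>M) \<le> (\<integral>x. u x powr P \<partial>M) powr (1 / P) * (\<integral>x. v x powr Q \<partial>M) powr (1 / Q)"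
proof -
  have young: "u x * v x \<le> u x powr P / P + v x powr Q / Q" for x
    using Youngs_inequality[OF PQ u0 v0] .
  show int: "integrable M (\<lambda>x. u x * v x)"
  proof (rule Bochner_Integration.integrable_bound)
    show "integrable M (\<lambda>x. u x powr P / P + v x powr Q / Q)" using ui vi by auto
    show "AE x in M. norm (u x * v x) \<le> norm (u x powr P / P + v x powr Q / Q)"
      using young u0 v0 by (intro AE_I2) (auto simp: abs_mult intro: order_trans[OF _ abs_ge_self])
  qed (use um vm in auto)
  define U V where "U = (\<integral>x. u x powr P \<partial>M)" and "V = (\<integral>x. v x powr Q \<partial>M)"
  have U0: "U \<ge> 0" and V0: "V \<ge> 0" unfolding U_def V_def by (auto intro: integral_nonneg_AE)
  have "(\<integral>x. u x * v x \<partial>M) \<le> U powr (1 / P) * V powr (1 / Q)"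
  proof (cases "U = 0 \<or> V = 0")
    case True
    have "AE x in M. u x * v x = 0"
    proof (cases "U = 0")
      case True
      then have "AE x in M. u x powr P = 0" using integral_nonneg_eq_0_iff_AE[OF ui] by (simp add: U_def)
      then show ?thesis by eventually_elim auto
    next
      case False
      then have "V = 0" using \<open>U = 0 \<or> V = 0\<close> by simp
      then have "AE x in M. v x powr Q = 0" using integral_nonneg_eq_0_iff_AE[OF vi] by (simp add: V_def)
      then show ?thesis by eventually_elim auto
    qed
    then have "(\<integral>x. u x * v x \<partial>M) = (\<integral>x. 0 \<partial>M)" using um vm by (intro integral_cong_AE) auto
    then show ?thesis using U0 V0 by simp
  next
    case False
    then have UV: "U > 0" "V > 0" using U0 V0 by auto
    define a b where "a = U powr (1 / P)" and "b = V powr (1 / Q)"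
    have ab: "a > 0" "b > 0" "a powr P = U" "b powr Q = V" using UV PQ by (auto simp: a_def b_def powr_powr)
    have "(u x / a) * (v x / b) \<le> (u x / a) powr P / P + (v x / b) powr Q / Q" for x
      using ab u0[of x] v0[of x] by (intro Youngs_inequality[OF PQ]) auto
    then have "u x * v x \<le> (a * b) * (u x powr P / U / P + v x powr Q / V / Q)" for x
      using ab u0[of x] v0[of x] by (simp add: powr_divide pos_divide_le_eq mult_ac)
    then have "(\<integral>x. u x * v x \<partial>M) \<le> (\<integral>x. (a * b) * (u x powr P / U / P + v x powr Q / V / Q) \<partial>M)"
      using int ui vi by (intro integral_mono) auto
    also have "\<dots> = (a * b) * (U / U / P + V / V / Q)" using ui vi by (simp add: U_def V_def)
    also have "\<dots> = a * b" using UV PQ by simp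
    finally show ?thesis by (simp add: a_def b_def)
  qed
  then show "(\<integral>x. u x * v x \<partial>M) \<le> (\<integral>x. u x powr P \<partial>M) powr (1 / P) * (\<integral>x. v x powr Q \<partial>M) powr (1 / Q)"
    by (simp add: U_def V_def)
qed

lemma conj_exponent_ge_1: "1 \<le> p \<Longrightarrow> 1 \<le> conj_exponent p"
  and inv_exponent_conj: "1 \<le> p \<Longrightarrow> inv_exponent p + inv_exponent (conj_exponent p) = 1"
  and conj_exponent_real: "P > 1 \<Longrightarrow> conj_exponent (ennreal P) = ennreal (P / (P - 1))"
proof -
  show *: "conj_exponent (ennreal P) = ennreal (P / (P - 1))" if "P > 1" for P
  proof -
    have "ennreal P - 1 = ennreal (P - 1)" using ennreal_minus[of 1 P] that by simp
    then have "ennreal P / (ennreal P - 1) = ennreal (P / (P - 1))" using that by (simp add: divide_ennreal)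
    then show ?thesis using that by (simp add: conj_exponent_def)
  qed
  assume "1 \<le> p"
  then have "1 \<le> conj_exponent p \<and> inv_exponent p + inv_exponent (conj_exponent p) = 1"
  proof (cases p rule: ennreal_exponent_cases)
    case 1 then show ?thesis by (simp add: conj_exponent_def inv_exponent_def)
  next
    case (2 P)
    show ?thesis
    proof (cases "P = 1")
      case True then show ?thesis using 2 by (simp add: conj_exponent_def inv_exponent_def)
    next
      case False
      then have P: "P > 1" using 2 by simp
      then have "P / (P - 1) \<ge> 1" by simp
      then show ?thesis using P 2 by (simp add: * inv_exponent_def field_simps)
    qed
  qed
  then show "1 \<le> conj_exponent p" "inv_exponent p + inv_exponent (conj_exponent p) = 1" by auto
qed

lemma Fock_product:
  fixes f g :: "complex ^ 'n \<Rightarrow> complex"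
  assumes p: "1 \<le> p" and f: "f \<in> Fock_space l p \<alpha> \<rho>" and g: "g \<in> Fock_space l (conj_exponent p) \<beta> \<eta>"
  shows "integrable dV (weighted_abs l (\<alpha> + \<beta>) (\<rho> + \<eta>) (\<lambda>w. f w * g w))"
    and "(\<integral>w. weighted_abs l (\<alpha> + \<beta>) (\<rho> + \<eta>) (\<lambda>w. f w * g w) w \<partial>dV) \<le> Fock_norm l p \<alpha> \<rho> f * Fock_norm l (conj_exponent p) \<beta> \<eta> g"
proof -
  define u v where "u = weighted_abs l \<alpha> \<rho> f" and "v = weighted_abs l \<beta> \<eta> g"
  have ent: "entire f" "entire g" using f g by (auto simp: Fock_space_def)
  have um: "u \<in> borel_measurable borel" and vm: "v \<in> borel_measurable borel"
    unfolding u_def v_def using weighted_abs_measurable ent by auto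
  have u0: "u x \<ge> 0" and v0: "v x \<ge> 0" for x by (auto simp: u_def v_def)
  have prod: "weighted_abs l (\<alpha> + \<beta>) (\<rho> + \<eta>) (\<lambda>w. f w * g w) = (\<lambda>w. u w * v w)"
  proof
    fix w :: "complex ^ 'n"
    have "exp (- ((\<alpha> + \<beta>) / 2) * norm w powr (2 * l)) = exp (- (\<alpha> / 2) * norm w powr (2 * l)) * exp (- (\<beta> / 2) * norm w powr (2 * l))"
      unfolding exp_add[symmetric] by (simp add: add_divide_distrib algebra_simps)
    then show "weighted_abs l (\<alpha> + \<beta>) (\<rho> + \<eta>) (\<lambda>w. f w * g w) w = u w * v w"
      unfolding weighted_abs_def u_def v_def norm_mult powr_add by (simp only: mult_ac)
  qed
  have bounded: "integrable dV (\<lambda>w. a w * b w) \<and> (\<integral>w. a w * b w \<partial>dV) \<le> (\<integral>w. a w \<partial>dV) * (SUP w. b w)"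
    if a: "integrable dV a" "\<And>w. a w \<ge> 0" and b: "bdd_above (range b)" "\<And>w. b w \<ge> 0" "b \<in> borel_measurable borel" for a b :: "complex ^ 'n \<Rightarrow> real"
  proof -
    have le: "b w \<le> (SUP w. b w)" for w using b(1) by (intro cSUP_upper) auto
    have le': "a w * b w \<le> a w * (SUP w. b w)" for w using le a(2) by (intro mult_left_mono) auto
    have i: "integrable dV (\<lambda>w. a w * (SUP w. b w))" using a(1) by simp
    have int: "integrable dV (\<lambda>w. a w * b w)"
    proof (rule Bochner_Integration.integrable_bound[OF i])
      show "(\<lambda>w. a w * b w) \<in> borel_measurable dV" using a(1) b(3) by (auto intro: borel_measurable_times)
      show "AE w in dV. norm (a w * b w) \<le> norm (a w * (SUP w. b w))"
      proof (intro AE_I2)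
        fix w
        have "norm (a w * b w) = a w * b w" using a(2)[of w] b(2)[of w] by simp
        also have "\<dots> \<le> norm (a w * (SUP w. b w))" unfolding real_norm_def by (rule order_trans[OF le' abs_ge_self])
        finally show "norm (a w * b w) \<le> norm (a w * (SUP w. b w))" .
      qed
    qed
    then show ?thesis using integral_mono[OF int i le'] by simp
  qed
  have "integrable dV (\<lambda>w. u w * v w) \<and> (\<integral>w. u w * v w \<partial>dV) \<le> Fock_norm l p \<alpha> \<rho> f * Fock_norm l (conj_exponent p) \<beta> \<eta> g"
    using p
  proof (cases p rule: ennreal_exponent_cases)
    case 1
    then have c: "conj_exponent p = 1" by (simp add: conj_exponent_def)
    have "integrable dV v" using g v0 unfolding c by (simp add: Fock_space_def v_def)
    moreover have "bdd_above (range u)" using f 1 by (simp add: Fock_space_def u_def)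
    moreover have "Fock_norm l p \<alpha> \<rho> f = (SUP w. u w)" using 1 by (simp add: Fock_norm_def u_def)
    moreover have "Fock_norm l (conj_exponent p) \<beta> \<eta> g = (\<integral>w. v w \<partial>dV)"
      unfolding c using v0 by (simp add: Fock_norm_def v_def integral_nonneg_AE)
    ultimately show ?thesis using bounded[of v u] u0 v0 um by (simp add: mult.commute)
  next
    case (2 P)
    show ?thesis
    proof (cases "P = 1")
      case True
      then have c: "p = 1" "conj_exponent p = \<infinity>" using 2 by (auto simp: conj_exponent_def)
      have "integrable dV u" using f u0 unfolding c by (simp add: Fock_space_def u_def)
      moreover have "bdd_above (range v)" using g c by (simp add: Fock_space_def v_def)
      moreover have "Fock_norm l (conj_exponent p) \<beta> \<eta> g = (SUP w. v w)" using c by (simp add: Fock_norm_def v_def)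
      moreover have "Fock_norm l p \<alpha> \<rho> f = (\<integral>w. u w \<partial>dV)"
        unfolding c using u0 by (simp add: Fock_norm_def u_def integral_nonneg_AE)
      ultimately show ?thesis using bounded[of u v] u0 v0 vm by simp
    next
      case False
      then have P: "P > 1" using 2 by simp
      define Q where "Q = P / (P - 1)"
      have Q: "Q > 1" "1 / P + 1 / Q = 1" using P by (auto simp: Q_def field_simps)
      have c: "conj_exponent p = ennreal Q" using 2 P by (simp add: conj_exponent_real Q_def)
      have cQ: "conj_exponent p \<noteq> \<infinity>" "enn2real (conj_exponent p) = Q" using Q unfolding c by auto
      have ui: "integrable dV (\<lambda>w. u w powr P)" using f 2 by (simp add: Fock_space_def u_def)
      have vi: "integrable dV (\<lambda>w. v w powr Q)" using g cQ by (simp add: Fock_space_def v_def)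
      have "u \<in> borel_measurable dV" "v \<in> borel_measurable dV" using um vm by (auto cong: measurable_cong_sets)
      from Hoelder_nonneg[OF P Q u0 v0 this ui vi] show ?thesis
        using 2 cQ by (simp add: Fock_norm_def u_def v_def)
    qed
  qed
  then show "integrable dV (weighted_abs l (\<alpha> + \<beta>) (\<rho> + \<eta>) (\<lambda>w. f w * g w))"
    and "(\<integral>w. weighted_abs l (\<alpha> + \<beta>) (\<rho> + \<eta>) (\<lambda>w. f w * g w) w \<partial>dV) \<le> Fock_norm l p \<alpha> \<rho> f * Fock_norm l (conj_exponent p) \<beta> \<eta> g"
    unfolding prod by auto
qed

lemma Fock_norm_1: "Fock_norm l 1 \<alpha> \<rho> f = (\<integral>w. weighted_abs l \<alpha> \<rho> f w \<partial>dV)"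
  by (simp add: Fock_norm_def integral_nonneg_AE)

lemma Fock_norm_nonneg: "f \<in> Fock_space l p \<alpha> \<rho> \<Longrightarrow> Fock_norm l p \<alpha> \<rho> f \<ge> 0"
  by (auto simp: Fock_norm_def Fock_space_def intro: cSUP_upper2)

lemma Fock_norm_sum_products:
  fixes f g :: "nat \<Rightarrow> complex ^ 'n \<Rightarrow> complex"
  assumes p: "1 \<le> p" and f: "\<And>k. k \<le> N \<Longrightarrow> f k \<in> Fock_space l p \<alpha> \<rho>" and g: "\<And>k. k \<le> N \<Longrightarrow> g k \<in> Fock_space l (conj_exponent p) \<beta> \<eta>"
    and K: "\<And>w. K w = (\<Sum>k = 0..N. f k w * g k w)" and Ki: "K \<in> Fock_space l 1 (\<alpha> + \<beta>) (\<rho> + \<eta>)"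
  shows "Fock_norm l 1 (\<alpha> + \<beta>) (\<rho> + \<eta>) K \<le> (\<Sum>k = 0..N. Fock_norm l p \<alpha> \<rho> (f k) * Fock_norm l (conj_exponent p) \<beta> \<eta> (g k))"
proof -
  let ?W = "weighted_abs l (\<alpha> + \<beta>) (\<rho> + \<eta>)"
  have "integrable dV (?W K)" using Ki by (simp add: Fock_space_def)
  then have "(\<integral>w. ?W K w \<partial>dV) \<le> (\<integral>w. (\<Sum>k = 0..N. ?W (\<lambda>w. f k w * g k w) w) \<partial>dV)"
  proof (rule integral_mono)
    show "integrable dV (\<lambda>w. \<Sum>k = 0..N. ?W (\<lambda>w. f k w * g k w) w)"
      using Fock_product(1)[OF p f g] by (intro Bochner_Integration.integrable_sum) auto
    show "?W K w \<le> (\<Sum>k = 0..N. ?W (\<lambda>w. f k w * g k w) w)" for w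
      unfolding weighted_abs_def K sum_distrib_right[symmetric] by (intro mult_right_mono norm_sum) auto
  qed
  also have "\<dots> = (\<Sum>k = 0..N. \<integral>w. ?W (\<lambda>w. f k w * g k w) w \<partial>dV)"
    using Fock_product(1)[OF p f g] by (intro Bochner_Integration.integral_sum) auto
  also have "\<dots> \<le> (\<Sum>k = 0..N. Fock_norm l p \<alpha> \<rho> (f k) * Fock_norm l (conj_exponent p) \<beta> \<eta> (g k))"
    using Fock_product(2)[OF p f g] by (intro sum_mono) auto
  finally show ?thesis by (simp add: Fock_norm_1)
qed

section \<open>Averages over rotations\<close>

text \<open>The argument for uniqueness of Haar measure: by Fubini and translation invariance, the integral of \<open>f \<circ> L\<close> and that of \<open>f\<close> have the
same product with the integral of any test function; the indicator of the unit ball is used because it is invariant under \<open>L\<close>.\<close>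

lemma lborel_isometry_distr:
  fixes L :: "'a::euclidean_space \<Rightarrow> 'a"
  assumes lin: "linear L" and iso: "\<And>x. norm (L x) = norm x" and surj: "surj L"
  shows "distr lborel borel L = lborel"
proof -
  have L: "L \<in> borel_measurable borel" using lin by (intro borel_measurable_continuous_onI linear_continuous_on) (simp add: linear_conv_bounded_linear)
  define g :: "'a \<Rightarrow> ennreal" where "g = indicator (cball 0 1)"
  have gm: "g \<in> borel_measurable borel" unfolding g_def by (intro borel_measurable_indicator) simp
  define V where "V = (\<integral>\<^sup>+ x. g x \<partial>lborel)"
  have V: "V = emeasure lborel (cball (0 :: 'a) 1)" unfolding V_def g_def by simp
  have "emeasure lborel (ball (0 :: 'a) 1) > 0"
    using content_ball_pos[of 1 "0 :: 'a"] by (simp add: measure_def enn2real_positive_iff)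
  moreover have "emeasure lborel (ball (0 :: 'a) 1) \<le> emeasure lborel (cball (0 :: 'a) 1)" by (intro emeasure_mono) auto
  ultimately have V0: "V \<noteq> 0" "V \<noteq> \<infinity>" unfolding V using emeasure_lborel_cball_finite[of "0 :: 'a" 1] by auto
  have shift: "(\<integral>\<^sup>+ x. h (t + x) \<partial>lborel) = (\<integral>\<^sup>+ x. h x \<partial>lborel)"
    if "h \<in> borel_measurable borel" for h :: "'a \<Rightarrow> ennreal" and t
    using that by (subst (2) lborel_distr_plus[of t, symmetric], subst nn_integral_distr) auto
  have reflect: "(\<integral>\<^sup>+ x. h (- x) \<partial>lborel) = (\<integral>\<^sup>+ x. h x \<partial>lborel)"
    if h: "h \<in> borel_measurable borel" for h :: "'a \<Rightarrow> ennreal"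
  proof -
    have "(lborel :: 'a measure) = distr lborel borel (\<lambda>x. 0 + (-1) *\<^sub>R x)"
      using lborel_affine[of "-1" "0 :: 'a"] by (simp add: density_1)
    then have "(\<integral>\<^sup>+ x. h x \<partial>lborel) = (\<integral>\<^sup>+ x. h x \<partial>distr lborel borel (\<lambda>x. 0 + (-1) *\<^sub>R x))" by simp
    also have "\<dots> = (\<integral>\<^sup>+ x. h (- x) \<partial>lborel)" using h by (subst nn_integral_distr) auto
    finally show ?thesis by simp
  qed
  have inv: "(\<integral>\<^sup>+ x. f (L x) \<partial>lborel) = (\<integral>\<^sup>+ x. f x \<partial>lborel)" if f: "f \<in> borel_measurable borel" for f :: "'a \<Rightarrow> ennreal"
  proof -
    note [measurable] = f L gm
    have shiftL: "(\<integral>\<^sup>+ x. h (L x - y) \<partial>lborel) = (\<integral>\<^sup>+ x. h (L x) \<partial>lborel)"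
      if h: "h \<in> borel_measurable borel" for h :: "'a \<Rightarrow> ennreal" and y
    proof -
      obtain t where t: "L t = - y" using surj by (metis surjD)
      have "(\<integral>\<^sup>+ x. h (L (t + x)) \<partial>lborel) = (\<integral>\<^sup>+ x. h (L x) \<partial>lborel)"
        using measurable_compose[OF L h] by (rule shift)
      then show ?thesis using t by (simp add: linear_add[OF lin])
    qed
    have gL: "g (L x) = g x" for x using iso by (simp add: g_def indicator_def)
    have "(\<integral>\<^sup>+ x. f (L x) \<partial>lborel) * V = (\<integral>\<^sup>+ x. (\<integral>\<^sup>+ y. f (L x) * g y \<partial>lborel) \<partial>lborel)"
      unfolding V_def using f L gm by (simp add: nn_integral_cmult nn_integral_multc)
    also have "\<dots> = (\<integral>\<^sup>+ x. (\<integral>\<^sup>+ y. f (L x) * g (L x + y) \<partial>lborel) \<partial>lborel)"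
      using f L gm shift[OF gm] by (simp add: nn_integral_cmult)
    also have "\<dots> = (\<integral>\<^sup>+ y. (\<integral>\<^sup>+ x. f (L x) * g (L x + y) \<partial>lborel) \<partial>lborel)"
      by (intro lborel_pair.Fubini') measurable
    also have "\<dots> = (\<integral>\<^sup>+ y. (\<integral>\<^sup>+ x. f (L x - y) * g (L x) \<partial>lborel) \<partial>lborel)"
    proof (rule nn_integral_cong)
      fix y
      have "(\<lambda>v. f v * g (v + y)) \<in> borel_measurable borel" using f gm by measurable
      from shiftL[OF this, of y] show "(\<integral>\<^sup>+ x. f (L x) * g (L x + y) \<partial>lborel) = (\<integral>\<^sup>+ x. f (L x - y) * g (L x) \<partial>lborel)" by simp
    qed
    also have "\<dots> = (\<integral>\<^sup>+ x. (\<integral>\<^sup>+ y. f (L x - y) * g (L x) \<partial>lborel) \<partial>lborel)"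
      by (intro lborel_pair.Fubini'[symmetric]) measurable
    also have "\<dots> = (\<integral>\<^sup>+ x. (\<integral>\<^sup>+ y. f y \<partial>lborel) * g x \<partial>lborel)"
    proof (rule nn_integral_cong)
      fix x
      have "(\<integral>\<^sup>+ y. f (L x - y) \<partial>lborel) = (\<integral>\<^sup>+ y. f (L x + y) \<partial>lborel)"
        using f reflect[of "\<lambda>y. f (L x + y)"] by simp
      also have "\<dots> = (\<integral>\<^sup>+ y. f y \<partial>lborel)" by (rule shift[OF f])
      finally show "(\<integral>\<^sup>+ y. f (L x - y) * g (L x) \<partial>lborel) = (\<integral>\<^sup>+ y. f y \<partial>lborel) * g x"
        using f by (simp add: nn_integral_multc gL)
    qed
    also have "\<dots> = (\<integral>\<^sup>+ y. f y \<partial>lborel) * V" unfolding V_def using gm by (simp add: nn_integral_cmult)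
    finally show ?thesis using V0 ennreal_mult_cancel_left[of V] by (simp add: mult.commute)
  qed
  show ?thesis
  proof (rule measure_eqI)
    fix A assume "A \<in> sets (distr lborel borel L)"
    then have A: "A \<in> sets borel" by simp
    have "emeasure (distr lborel borel L) A = (\<integral>\<^sup>+ x. indicator A x \<partial>distr lborel borel L)" using A by simp
    also have "\<dots> = (\<integral>\<^sup>+ x. indicator A (L x) \<partial>lborel)" using A L by (subst nn_integral_distr) auto
    also have "\<dots> = emeasure lborel A" using A by (subst inv) auto
    finally show "emeasure (distr lborel borel L) A = emeasure lborel A" .
  qed simp
qed

lemma dV_rotation:
  fixes f :: "complex ^ 'n \<Rightarrow> 'b::{banach, second_countable_topology}"
  assumes f: "f \<in> borel_measurable borel" and c: "norm c = 1"
  shows "integrable dV (\<lambda>w. f (c *s w)) \<longleftrightarrow> integrable dV f" and "(\<integral>w. f (c *s w) \<partial>dV) = (\<integral>w. f w \<partial>dV)"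
proof -
  let ?L = "\<lambda>w :: complex ^ 'n. c *s w"
  have lin: "linear ?L" by (rule linearI) (auto simp: vec_eq_iff distrib_left)
  have iso: "norm (?L w) = norm w" for w
    using c by (simp add: norm_vec_def norm_mult)
  have surj: "surj ?L"
    unfolding surj_def
  proof
    fix y :: "complex ^ 'n"
    have "c \<noteq> 0" using c by auto
    then have "y = c *s (inverse c *s y)" by (simp add: vec_eq_iff)
    then show "\<exists>x. y = c *s x" ..
  qed
  have L: "?L \<in> borel_measurable borel" using lin by (intro borel_measurable_continuous_onI linear_continuous_on) (simp add: linear_conv_bounded_linear)
  have d: "distr lborel borel ?L = lborel" by (rule lborel_isometry_distr[OF lin iso surj])
  have m: "(\<lambda>w. f (c *s w)) \<in> borel_measurable borel" using f L by (rule measurable_compose[rotated])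
  have "integrable (distr lborel borel ?L) f \<longleftrightarrow> integrable lborel (\<lambda>w. f (c *s w))"
    using f L by (subst integrable_distr_eq) auto
  then show "integrable dV (\<lambda>w. f (c *s w)) \<longleftrightarrow> integrable dV f" unfolding d dV_integral(1)[OF f] dV_integral(1)[OF m] by simp
  have "integral\<^sup>L (distr lborel borel ?L) f = (\<integral>w. f (c *s w) \<partial>lborel)"
    using f L by (subst integral_distr) auto
  then show "(\<integral>w. f (c *s w) \<partial>dV) = (\<integral>w. f w \<partial>dV)" unfolding d dV_integral(2)[OF f] dV_integral(2)[OF m] by simp
qed

definition circle_param :: "real \<Rightarrow> complex" where "circle_param t = exp (2 * of_real pi * \<i> * of_real t)"
text \<open>Circle averages are integrals with respect to a probability measure, so that Fubini's theorem applies to them and to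
integrals over \<^term>\<open>dV\<close> simultaneously.\<close>

definition unit_interval :: "real measure" where "unit_interval = density lborel (indicator {0..1})"

lemma norm_circle_param [simp]: "norm (circle_param t) = 1" by (simp add: circle_param_def)
lemma circle_param_nonzero [simp]: "circle_param t \<noteq> 0" by (simp add: circle_param_def)
lemma cnj_circle_param: "cnj (circle_param t) = inverse (circle_param t)"
  by (simp add: circle_param_def exp_cnj exp_minus[symmetric])
lemma continuous_circle_param: "continuous_on A circle_param"
  unfolding circle_param_def by (intro continuous_intros)
lemma measurable_circle_param [measurable]: "circle_param \<in> borel_measurable borel"
  by (intro borel_measurable_continuous_onI continuous_circle_param)
lemma sets_unit_interval [simp, measurable_cong]: "sets unit_interval = sets borel" by (simp add: unit_interval_def)

lemma prob_space_unit_interval: "prob_space unit_interval"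
  by (intro prob_spaceI) (simp add: unit_interval_def emeasure_density)

lemma unit_interval_has_integral:
  fixes h :: "real \<Rightarrow> complex"
  assumes cont: "continuous_on UNIV h" and I: "(h has_integral I) {0..1}"
  shows "(\<integral>t. h t \<partial>unit_interval) = I"
proof -
  have m: "h \<in> borel_measurable borel" using cont by (rule borel_measurable_continuous_onI)
  have "(\<integral>t. h t \<partial>unit_interval) = (\<integral>t. indicator {0..1} t *\<^sub>R h t \<partial>lborel)"
    unfolding unit_interval_def
    using m integral_density[of h lborel "indicator {0..1} :: real \<Rightarrow> real"] by (simp add: ennreal_indicator)
  also have "\<dots> = integral {0..1} h"
  proof -
    have "set_integrable lborel {0..1} h"
      using borel_integrable_atLeastAtMost'[OF continuous_on_subset[OF cont]] by simp
    from set_borel_integral_eq_integral(2)[OF this] show ?thesis by (simp add: set_lebesgue_integral_def)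
  qed
  finally show ?thesis using I by (simp add: integral_unique)
qed

text \<open>Cauchy's integral formula; for \<open>m = 0\<close> it is the mean value property.\<close>

lemma circle_taylor_coefficient:
  assumes hol: "\<phi> holomorphic_on UNIV"
  shows "(\<integral>t. \<phi> (circle_param t) * cnj (circle_param t) ^ m \<partial>unit_interval) = (deriv ^^ m) \<phi> 0 / fact m"
proof (rule unit_interval_has_integral)
  have cont: "continuous_on UNIV \<phi>" using hol by (rule holomorphic_on_imp_continuous_on)
  show "continuous_on UNIV (\<lambda>t. \<phi> (circle_param t) * cnj (circle_param t) ^ m)"
    by (intro continuous_intros continuous_on_compose2[OF cont] continuous_circle_param) auto
  have "((\<lambda>u. \<phi> u / (u - 0) ^ Suc m) has_contour_integral (2 * pi * \<i> / fact m * (deriv ^^ m) \<phi> 0)) (circlepath 0 1)"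
    by (rule Cauchy_has_contour_integral_higher_derivative_circlepath)
       (use hol cont in \<open>auto intro: holomorphic_on_subset continuous_on_subset\<close>)
  then have "((\<lambda>t. \<phi> (circlepath 0 1 t) / (circlepath 0 1 t) ^ Suc m * vector_derivative (circlepath 0 1) (at t within {0..1})) has_integral
     (2 * pi * \<i> / fact m * (deriv ^^ m) \<phi> 0)) {0..1}"
    by (simp add: has_contour_integral_def)
  then have "((\<lambda>t. (1 / (2 * pi * \<i>)) * (\<phi> (circlepath 0 1 t) / (circlepath 0 1 t) ^ Suc m * vector_derivative (circlepath 0 1) (at t within {0..1}))) has_integral
     (1 / (2 * pi * \<i>)) * (2 * pi * \<i> / fact m * (deriv ^^ m) \<phi> 0)) {0..1}"
    by (rule has_integral_mult_right)
  then have "((\<lambda>t. (1 / (2 * pi * \<i>)) * (\<phi> (circlepath 0 1 t) / (circlepath 0 1 t) ^ Suc m * vector_derivative (circlepath 0 1) (at t within {0..1}))) has_integral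
     (deriv ^^ m) \<phi> 0 / fact m) {0..1}" by simp
  then show "((\<lambda>t. \<phi> (circle_param t) * cnj (circle_param t) ^ m) has_integral (deriv ^^ m) \<phi> 0 / fact m) {0..1}"
  proof (rule has_integral_eq[rotated])
    fix t :: real assume t: "t \<in> {0..1}"
    have c: "circlepath 0 1 t = circle_param t" by (simp add: circlepath circle_param_def)
    have "vector_derivative (circlepath 0 1) (at t within {0..1}) = 2 * pi * \<i> * circle_param t"
      using t by (subst vector_derivative_circlepath01) (auto simp: circle_param_def)
    then show "(1 / (2 * pi * \<i>)) * (\<phi> (circlepath 0 1 t) / (circlepath 0 1 t) ^ Suc m * vector_derivative (circlepath 0 1) (at t within {0..1}))
        = \<phi> (circle_param t) * cnj (circle_param t) ^ m"
      unfolding c by (simp add: cnj_circle_param divide_simps power_inverse)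
  qed
qed

lemma continuous_smult: "continuous_on A g \<Longrightarrow> continuous_on A h \<Longrightarrow> continuous_on A (\<lambda>x. g x *s (h x :: complex ^ 'n))"
proof -
  assume "continuous_on A g" "continuous_on A h"
  then have "continuous_on A (\<lambda>x. \<chi> i. g x * (h x $ i))" by (intro continuous_intros)
  then show ?thesis by (simp add: vector_scalar_mult_def)
qed

lemma rotation_average:
  fixes F :: "complex ^ 'n \<Rightarrow> complex"
  assumes F: "integrable dV F" and m: "F \<in> borel_measurable borel"
  shows "integrable dV (\<lambda>w. \<integral>t. F (circle_param t *s w) \<partial>unit_interval)"
    and "(\<integral>w. F w \<partial>dV) = (\<integral>w. (\<integral>t. F (circle_param t *s w) \<partial>unit_interval) \<partial>dV)"
proof -
  interpret U: prob_space unit_interval by (rule prob_space_unit_interval)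
  interpret V: sigma_finite_measure "dV :: (complex ^ 'n) measure"
    unfolding dV_def by (subst sigma_finite_measure.sigma_finite_iff_density_finite[OF sigma_finite_lborel]) auto
  interpret P: pair_sigma_finite unit_interval "dV :: (complex ^ 'n) measure" ..
  have m2: "(\<lambda>(t, w). F (circle_param t *s w)) \<in> borel_measurable (unit_interval \<Otimes>\<^sub>M dV)"
  proof -
    have "(\<lambda>x :: real \<times> (complex ^ 'n). circle_param (fst x) *s snd x) \<in> borel_measurable borel"
      by (intro borel_measurable_continuous_onI continuous_smult continuous_intros continuous_on_compose2[OF continuous_circle_param[of UNIV]]) auto
    then have "(\<lambda>x :: real \<times> (complex ^ 'n). F (circle_param (fst x) *s snd x)) \<in> borel_measurable borel"
      using m by (rule measurable_compose)
    moreover have "sets (unit_interval \<Otimes>\<^sub>M (dV :: (complex ^ 'n) measure)) = sets (borel :: (real \<times> (complex ^ 'n)) measure)"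
      unfolding borel_prod[symmetric] by (intro sets_pair_measure_cong) auto
    ultimately show ?thesis unfolding split_beta' using measurable_cong_sets by blast
  qed
  have mn: "(\<lambda>w. norm (F w)) \<in> borel_measurable borel" using m by simp
  have int: "integrable (unit_interval \<Otimes>\<^sub>M dV) (\<lambda>(t, w). F (circle_param t *s w))"
    by (rule P.Fubini_integrable[OF m2])
       (use F dV_rotation(1)[OF m] dV_rotation(2)[OF mn] in auto)
  show "integrable dV (\<lambda>w. \<integral>t. F (circle_param t *s w) \<partial>unit_interval)"
    by (rule P.integrable_snd[OF int])
  have "(\<integral>w. (\<integral>t. F (circle_param t *s w) \<partial>unit_interval) \<partial>dV) = (\<integral>t. (\<integral>w. F (circle_param t *s w) \<partial>dV) \<partial>unit_interval)"
    by (rule P.Fubini_integral[OF int])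
  also have "\<dots> = (\<integral>t. (\<integral>w. F w \<partial>dV) \<partial>unit_interval)" by (simp add: dV_rotation(2)[OF m])
  also have "\<dots> = (\<integral>w. F w \<partial>dV)" by (simp add: U.prob_space)
  finally show "(\<integral>w. F w \<partial>dV) = (\<integral>w. (\<integral>t. F (circle_param t *s w) \<partial>unit_interval) \<partial>dV)" ..
qed

section \<open>Homogeneous expansion and moments\<close>

lemma entire_line_holomorphic:
  assumes "entire f"
  shows "(\<lambda>x. f (a + x *s b)) holomorphic_on A"
proof -
  have "\<exists>d. ((\<lambda>x. f (a + x *s b)) has_field_derivative d) (at x)" for x
  proof -
    obtain D where D: "(f has_derivative D) (at (a + x *s b))" "\<And>c v. D (c *s v) = c * D v"
      using assms unfolding entire_def by blast
    have "linear (\<lambda>x. x *s b)" by (rule linearI) (auto simp: vec_eq_iff distrib_right)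
    then have bl: "bounded_linear (\<lambda>x. x *s b)" by (simp add: linear_conv_bounded_linear)
    have "((\<lambda>x. a + x *s b) has_derivative (\<lambda>h. 0 + h *s b)) (at x)"
      by (intro has_derivative_add has_derivative_const bounded_linear_imp_has_derivative[OF bl])
    from has_derivative_compose[OF this D(1)]
    have "((\<lambda>x. f (a + x *s b)) has_derivative (\<lambda>h. D b * h)) (at x)" by (simp add: D(2) mult.commute)
    then show ?thesis by (auto simp: has_field_derivative_def)
  qed
  then show ?thesis unfolding holomorphic_on_def field_differentiable_def by (blast intro: has_field_derivative_at_within)
qed

text \<open>The homogeneous component of degree \<open>m\<close> of the Taylor expansion at the origin, as a Fourier coefficient along circles.\<close>

definition homog_part :: "nat \<Rightarrow> (complex ^ 'n \<Rightarrow> complex) \<Rightarrow> complex ^ 'n \<Rightarrow> complex" where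
  "homog_part m f w = (\<integral>t. f (circle_param t *s w) * cnj (circle_param t) ^ m \<partial>unit_interval)"

lemma homog_part_deriv:
  assumes "entire f"
  shows "homog_part m f w = (deriv ^^ m) (\<lambda>x. f (x *s w)) 0 / fact m"
  unfolding homog_part_def
  using circle_taylor_coefficient[OF entire_line_holomorphic[OF assms, of 0 w UNIV]] by simp

lemma homog_part_smult:
  assumes f: "entire f"
  shows "homog_part m f (c *s w) = c ^ m * homog_part m f w"
proof -
  have hol: "(\<lambda>x. f (x *s w)) holomorphic_on UNIV" using entire_line_holomorphic[OF f, of 0 w UNIV] by simp
  have "(deriv ^^ m) (\<lambda>x. (\<lambda>x. f (x *s w)) (c * x)) 0 = c ^ m * (deriv ^^ m) (\<lambda>x. f (x *s w)) (c * 0)"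
    by (rule higher_deriv_compose_linear[OF hol open_UNIV open_UNIV]) auto
  moreover have "(\<lambda>x. (\<lambda>x. f (x *s w)) (c * x)) = (\<lambda>x. f (x *s (c *s w)))"
    by (simp add: mult.commute)
  ultimately show ?thesis unfolding homog_part_deriv[OF f] by simp
qed

lemma homog_part_sums:
  assumes f: "entire f"
  shows "(\<lambda>m. homog_part m f w) sums f w"
proof -
  have "(\<lambda>x. f (x *s w)) holomorphic_on ball 0 2" using entire_line_holomorphic[OF f, of 0 w "ball 0 2"] by simp
  from holomorphic_power_series[OF this, of 1] show ?thesis by (simp add: homog_part_deriv[OF f])
qed

lemma entire_bounded:
  assumes "entire f" shows "\<exists>B\<ge>0. \<forall>w. norm w \<le> r \<longrightarrow> norm (f w) \<le> B"
proof -
  have "compact (f ` cball 0 r)"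
    by (intro compact_continuous_image continuous_on_subset[OF entire_continuous[OF assms]]) auto
  then obtain B where "\<And>w. norm w \<le> r \<Longrightarrow> norm (f w) \<le> B"
    using compact_imp_bounded bounded_iff by (metis (no_types, lifting) imageI mem_cball_0)
  then show ?thesis by (intro exI[of _ "\<bar>B\<bar>"]) (auto intro: order_trans[OF _ abs_ge_self])
qed

lemma norm_smult_circle: "norm (circle_param t *s (w :: complex ^ 'n)) = norm w"
  by (simp add: norm_vector_smult)

lemma homog_part_bound:
  assumes f: "entire (f :: complex ^ 'n \<Rightarrow> complex)"
  shows "\<exists>B\<ge>0. \<forall>w. norm (homog_part m f w) \<le> B * norm w ^ m"
proof -
  interpret U: prob_space unit_interval by (rule prob_space_unit_interval)
  obtain B where B: "B \<ge> 0" "\<And>w. norm w \<le> 1 \<Longrightarrow> norm (f w) \<le> B" using entire_bounded[OF f, of 1] by blast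
  have u: "norm (homog_part m f w) \<le> B" if w: "norm w \<le> 1" for w
  proof -
    have "norm (homog_part m f w) \<le> (\<integral>t. B \<partial>unit_interval)"
      unfolding homog_part_def
    proof (rule Bochner_Integration.integral_norm_bound_integral)
      have "(\<lambda>t. f (0 + circle_param t *s w) * cnj (circle_param t) ^ m) \<in> borel_measurable borel"
        by (intro borel_measurable_continuous_onI continuous_intros continuous_circle_param
            continuous_on_compose2[OF holomorphic_on_imp_continuous_on[OF entire_line_holomorphic[OF f, of 0 w UNIV]] continuous_circle_param]) auto
      then show "integrable unit_interval (\<lambda>t. f (circle_param t *s w) * cnj (circle_param t) ^ m)"
        using w B(2) by (intro U.integrable_const_bound[of _ B]) (auto simp: norm_mult norm_power norm_smult_circle)
      show "norm (f (circle_param t *s w) * cnj (circle_param t) ^ m) \<le> B" for t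
        using w B(2) by (auto simp: norm_mult norm_power norm_smult_circle)
    qed auto
    then show ?thesis by (simp add: U.prob_space)
  qed
  show ?thesis
  proof (intro exI[of _ B] conjI B(1) allI)
    fix w
    show "norm (homog_part m f w) \<le> B * norm w ^ m"
    proof (cases "w = 0")
      case True
      then have "homog_part m f w = 0 ^ m * homog_part m f w" using homog_part_smult[OF f, of m 0 w] by simp
      then show ?thesis using u[of w] True B(1) by (cases "m = 0") (auto simp: zero_power)
    next
      case False
      define v where "v = of_real (1 / norm w) *s w"
      have v: "norm v = 1" using False by (simp add: v_def norm_vector_smult norm_divide)
      have "w = of_real (norm w) *s v" using False by (simp add: v_def vec_eq_iff)
      then have "norm (homog_part m f w) = norm w ^ m * norm (homog_part m f v)"
        using homog_part_smult[OF f, of m "of_real (norm w)" v] by (simp add: norm_mult norm_power)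
      also have "\<dots> \<le> norm w ^ m * B" using u[of v] v by (intro mult_left_mono) auto
      finally show ?thesis by (simp add: mult.commute)
    qed
  qed
qed

lemma homog_part_measurable:
  assumes f: "entire (f :: complex ^ 'n \<Rightarrow> complex)"
  shows "homog_part m f \<in> borel_measurable borel"
proof -
  interpret U: prob_space unit_interval by (rule prob_space_unit_interval)
  have "(\<lambda>x :: (complex ^ 'n) \<times> real. f (circle_param (snd x) *s fst x) * cnj (circle_param (snd x)) ^ m) \<in> borel_measurable borel"
    by (intro borel_measurable_continuous_onI continuous_intros continuous_on_compose2[OF entire_continuous[OF f]] continuous_smult
        continuous_on_compose2[OF continuous_circle_param[of UNIV]]) auto
  moreover have "sets ((borel :: (complex ^ 'n) measure) \<Otimes>\<^sub>M unit_interval) = sets (borel :: ((complex ^ 'n) \<times> real) measure)"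
    unfolding borel_prod[symmetric] by (intro sets_pair_measure_cong) auto
  ultimately have "(\<lambda>(w, t). f (circle_param t *s w) * cnj (circle_param t) ^ m) \<in> borel_measurable ((borel :: (complex ^ 'n) measure) \<Otimes>\<^sub>M unit_interval)"
    unfolding split_beta' using measurable_cong_sets by blast
  from U.borel_measurable_lebesgue_integral[OF this] show ?thesis by (simp add: homog_part_def[abs_def])
qed

lemma cprod_add: "cprod (u + v) z = cprod u z + cprod v z"
  by (simp add: cprod_def sum.distrib distrib_right)

lemma cprod_self: "cprod z z = of_real ((norm z)\<^sup>2)"
proof (rule complex_eqI)
  show "Re (cprod z z) = Re (of_real ((norm z)\<^sup>2))" by (simp add: Re_cprod power2_norm_eq_inner)
  show "Im (cprod z z) = Im (of_real ((norm z)\<^sup>2))" by (simp add: cprod_def)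
qed

lemma cprod_measurable [measurable]: "(\<lambda>w. cprod w z) \<in> borel_measurable borel"
  by (intro borel_measurable_continuous_onI linear_continuous_on bounded_linear_cprod)

lemma cnj_cprod_measurable [measurable]: "(\<lambda>w. cnj (cprod w z)) \<in> borel_measurable borel"
  by (intro borel_measurable_continuous_onI continuous_on_cnj linear_continuous_on bounded_linear_cprod)

text \<open>The function under the integral is, for fixed rotation in the definition of \<^term>\<open>homog_part\<close>, holomorphic in the circle variable,
and the exponential equals 1 at the centre.\<close>

lemma homog_part_mean_value:
  assumes f: "entire (f :: complex ^ 'n \<Rightarrow> complex)"
  shows "(\<integral>s. homog_part m f (z + circle_param s *s u) * exp (- (circle_param s * c)) \<partial>unit_interval) = homog_part m f z"
proof -
  interpret U: prob_space unit_interval by (rule prob_space_unit_interval)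
  interpret P: pair_prob_space unit_interval unit_interval ..
  define H where "H s t = f (circle_param t *s (z + circle_param s *s u)) * cnj (circle_param t) ^ m * exp (- (circle_param s * c))" for s t
  obtain B where B: "B \<ge> 0" "\<And>w. norm w \<le> norm z + norm u \<Longrightarrow> norm (f w) \<le> B" using entire_bounded[OF f] by blast
  have "(\<lambda>x. H (fst x) (snd x)) \<in> borel_measurable borel"
    unfolding H_def
    by (intro borel_measurable_continuous_onI continuous_intros continuous_on_compose2[OF entire_continuous[OF f]] continuous_smult
        continuous_on_compose2[OF continuous_circle_param[of UNIV]]) auto
  moreover have "sets (unit_interval \<Otimes>\<^sub>M unit_interval) = sets (borel :: (real \<times> real) measure)"
    unfolding borel_prod[symmetric] by (intro sets_pair_measure_cong) auto
  ultimately have m2: "(\<lambda>(s, t). H s t) \<in> borel_measurable (unit_interval \<Otimes>\<^sub>M unit_interval)"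
    unfolding split_beta' using measurable_cong_sets by blast
  have bd: "norm (H s t) \<le> B * exp (norm c)" for s t
  proof -
    have "norm (z + circle_param s *s u) \<le> norm z + norm u"
      using norm_triangle_ineq[of z "circle_param s *s u"] by (simp add: norm_smult_circle)
    then have "norm (f (circle_param t *s (z + circle_param s *s u))) \<le> B" by (intro B(2)) (simp only: norm_smult_circle)
    moreover have "norm (exp (- (circle_param s * c))) \<le> exp (norm c)"
      using norm_exp[of "- (circle_param s * c)"] by (simp add: norm_mult)
    ultimately show ?thesis unfolding H_def using B(1) by (simp add: norm_mult norm_power mult_mono)
  qed
  have int: "integrable (unit_interval \<Otimes>\<^sub>M unit_interval) (\<lambda>(s, t). H s t)"
    using m2 bd by (intro P.integrable_const_bound[of _ "B * exp (norm c)"]) auto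
  have "(\<integral>s. homog_part m f (z + circle_param s *s u) * exp (- (circle_param s * c)) \<partial>unit_interval) = (\<integral>s. (\<integral>t. H s t \<partial>unit_interval) \<partial>unit_interval)"
    by (simp add: homog_part_def H_def)
  also have "\<dots> = (\<integral>t. (\<integral>s. H s t \<partial>unit_interval) \<partial>unit_interval)"
    by (rule P.Fubini_integral[OF int, symmetric])
  also have "\<dots> = (\<integral>t. f (circle_param t *s z) * cnj (circle_param t) ^ m \<partial>unit_interval)"
  proof (rule Bochner_Integration.integral_cong[OF refl])
    fix t
    define \<phi> where "\<phi> x = f (circle_param t *s z + x *s (circle_param t *s u)) * exp (- (x * c))" for x
    have hol: "\<phi> holomorphic_on UNIV" unfolding \<phi>_def by (intro holomorphic_intros entire_line_holomorphic[OF f])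
    have "(\<integral>s. H s t \<partial>unit_interval) = (\<integral>s. \<phi> (circle_param s) * cnj (circle_param t) ^ m \<partial>unit_interval)"
    proof (rule Bochner_Integration.integral_cong[OF refl])
      fix s
      have "circle_param t *s (z + circle_param s *s u) = circle_param t *s z + circle_param s *s (circle_param t *s u)"
        by (simp add: vector_add_ldistrib vector_smult_assoc mult.commute)
      then show "H s t = \<phi> (circle_param s) * cnj (circle_param t) ^ m" unfolding H_def \<phi>_def by (simp only: mult_ac)
    qed
    also have "\<dots> = (\<integral>s. \<phi> (circle_param s) \<partial>unit_interval) * cnj (circle_param t) ^ m"
      by (rule integral_mult_left_zero)
    also have "(\<integral>s. \<phi> (circle_param s) \<partial>unit_interval) = \<phi> 0" using circle_taylor_coefficient[OF hol, of 0] by simp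
    finally show "(\<integral>s. H s t \<partial>unit_interval) = f (circle_param t *s z) * cnj (circle_param t) ^ m" by (simp add: \<phi>_def)
  qed
  finally show ?thesis by (simp add: homog_part_def)
qed

lemma gaussian_dominated_integrable:
  fixes F :: "complex ^ 'n \<Rightarrow> complex"
  assumes m: "F \<in> borel_measurable borel" and B: "B \<ge> 0" and bd: "\<And>w. norm (F w) \<le> B * norm w ^ m * exp (b * norm w)" and b: "b \<ge> 0"
  shows "integrable dV (\<lambda>w. F w * of_real (exp (- (norm w)\<^sup>2)))"
proof -
  obtain C :: real where C: "C > 0" "\<And>y::real. y \<ge> 0 \<Longrightarrow> y ^ m \<le> C * exp (1 * y)" using polynomial_le_exp[of 1 m] by auto
  have pt: "norm (F w * of_real (exp (- (norm w)\<^sup>2))) \<le> B * C * exp ((b + 1)\<^sup>2 / 2) * exp (- (1/2) * (norm w)\<^sup>2)" for w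
  proof -
    define X where "X = norm w"
    have X: "X \<ge> 0" by (simp add: X_def)
    have "2 * ((b + 1) * X) \<le> (b + 1)\<^sup>2 + X\<^sup>2" using sum_squares_bound[of "b + 1" X] by (simp only: mult.assoc)
    then have "(b + 1) * X \<le> (b + 1)\<^sup>2 / 2 + X\<^sup>2 / 2" by (simp only: add_divide_distrib[symmetric] pos_le_divide_eq zero_less_numeral mult.commute[of _ 2])
    then have e: "(b * X + 1 * X) + - X\<^sup>2 \<le> (b + 1)\<^sup>2 / 2 + - (1/2) * X\<^sup>2" by (simp add: distrib_right)
    have "norm (F w * of_real (exp (- X\<^sup>2))) \<le> (B * X ^ m * exp (b * X)) * exp (- X\<^sup>2)"
      using bd[of w] by (simp add: norm_mult X_def mult_right_mono)
    also have "\<dots> \<le> (B * (C * exp (1 * X)) * exp (b * X)) * exp (- X\<^sup>2)"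
      using C(2)[OF X] B by (intro mult_right_mono mult_left_mono) auto
    also have "\<dots> = B * C * exp ((b * X + 1 * X) + - X\<^sup>2)" unfolding exp_add by simp
    also have "\<dots> \<le> B * C * exp ((b + 1)\<^sup>2 / 2 + - (1/2) * X\<^sup>2)" using e B C(1) by (intro mult_left_mono) auto
    also have "\<dots> = B * C * exp ((b + 1)\<^sup>2 / 2) * exp (- (1/2) * X\<^sup>2)" unfolding exp_add by simp
    finally show ?thesis by (simp add: X_def)
  qed
  show ?thesis
  proof (rule Bochner_Integration.integrable_bound)
    show "integrable dV (\<lambda>w :: complex ^ 'n. B * C * exp ((b + 1)\<^sup>2 / 2) * exp (- (1/2) * (norm w)\<^sup>2))"
      by (intro integrable_mult_right dV_gaussian) simp
    show "(\<lambda>w. F w * of_real (exp (- (norm w)\<^sup>2))) \<in> borel_measurable dV" using m by simp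
    show "AE w in dV. norm (F w * of_real (exp (- (norm w)\<^sup>2))) \<le> norm (B * C * exp ((b + 1)\<^sup>2 / 2) * exp (- (1/2) * (norm w)\<^sup>2))"
      using pt by (intro AE_I2) (auto intro: order_trans[OF _ abs_ge_self])
  qed
qed

lemma higher_deriv_exp_linear: "(deriv ^^ m) (\<lambda>x. exp (x * c)) 0 = (c :: complex) ^ m"
proof -
  have "deriv exp = (exp :: complex \<Rightarrow> complex)" by (intro ext DERIV_imp_deriv DERIV_exp)
  then have d: "(deriv ^^ m) exp = (exp :: complex \<Rightarrow> complex)" by (induction m) auto
  have "(deriv ^^ m) (\<lambda>x. exp (c * x)) 0 = c ^ m * (deriv ^^ m) exp (c * 0)"
    by (rule higher_deriv_compose_linear[of _ UNIV UNIV]) (auto intro: holomorphic_intros)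
  then show ?thesis by (simp add: d mult.commute)
qed

text \<open>The integral of \<open>h w * exp (cnj (cprod w z)) * exp (- \<bar>w\<bar>\<^sup>2)\<close>, with \<open>h\<close> the homogeneous part, is computed in
two ways; this is the reproducing property in the classical Fock space.\<close>

lemma gaussian_moment_homog_part:
  assumes f: "entire (f :: complex ^ 'n \<Rightarrow> complex)"
  shows "(\<integral>w. homog_part m f w * cnj (cprod w z) ^ m * of_real (exp (- (norm w)\<^sup>2)) \<partial>dV) = fact m * fact CARD('n) * homog_part m f z"
proof -
  define h where "h = homog_part m f"
  have hm [measurable]: "h \<in> borel_measurable borel" unfolding h_def by (rule homog_part_measurable[OF f])
  obtain B where B: "B \<ge> 0" "\<And>w. norm (h w) \<le> B * norm w ^ m" unfolding h_def using homog_part_bound[OF f] by blast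
  define P where "P w = h w * exp (cnj (cprod w z)) * of_real (exp (- (norm w)\<^sup>2))" for w
  have Pm: "P \<in> borel_measurable borel" unfolding P_def by measurable
  have Pint: "integrable dV P" unfolding P_def
  proof (rule gaussian_dominated_integrable[OF _ B(1)])
    fix w
    have "norm (exp (cnj (cprod w z))) \<le> exp (norm (cnj (cprod w z)))" by (rule norm_exp)
    also have "\<dots> \<le> exp (norm z * norm w)" using norm_cprod_le[of w z] by (simp add: mult.commute)
    finally have "norm (exp (cnj (cprod w z))) \<le> exp (norm z * norm w)" .
    then show "norm (h w * exp (cnj (cprod w z))) \<le> B * norm w ^ m * exp (norm z * norm w)"
      unfolding norm_mult using B by (intro mult_mono) auto
  qed auto
  \<comment> \<open>translating by \<open>z\<close> turns the exponents into those of a holomorphic function times a centred Gaussian\<close>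
  define Q where "Q u = h (z + u) * exp (- cprod u z) * of_real (exp (- (norm u)\<^sup>2))" for u
  have PQ: "P (z + 1 *\<^sub>R u) = Q u" for u
  proof -
    have "(norm (z + u))\<^sup>2 = (norm z)\<^sup>2 + (norm u)\<^sup>2 + 2 * (u \<bullet> z)"
      unfolding power2_norm_eq_inner by (simp add: inner_add_left inner_add_right inner_commute[of z u])
    then have n: "of_real ((norm (z + u))\<^sup>2) = (of_real ((norm z)\<^sup>2) + of_real ((norm u)\<^sup>2) + (cprod u z + cnj (cprod u z)) :: complex)"
      by (simp add: complex_add_cnj Re_cprod)
    have "cnj (cprod (z + u) z) + - of_real ((norm (z + u))\<^sup>2) = - cprod u z + - of_real ((norm u)\<^sup>2)"
      unfolding n cprod_add cprod_self by simp
    then have "exp (cnj (cprod (z + u) z)) * exp (- of_real ((norm (z + u))\<^sup>2)) = exp (- cprod u z) * exp (- of_real ((norm u)\<^sup>2))"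
      unfolding exp_add[symmetric] by simp
    moreover have "of_real (exp (- y)) = (exp (- of_real y) :: complex)" for y :: real
      using exp_of_real[of "- y", where 'a = complex] by (simp only: of_real_minus)
    ultimately show ?thesis by (simp only: P_def Q_def scaleR_one mult.assoc)
  qed
  have Qm: "Q \<in> borel_measurable borel" unfolding Q_def by measurable
  have Qint: "integrable dV Q" using iffD2[OF dV_affine_integral(1)[OF Pm, of 1 z] Pint] unfolding PQ by simp
  have "(\<integral>w. P w \<partial>dV) = (\<integral>u. Q u \<partial>dV)" using dV_affine_integral(2)[OF Pm, of 1 z] unfolding PQ by simp
  also have "\<dots> = (\<integral>u. (\<integral>s. Q (circle_param s *s u) \<partial>unit_interval) \<partial>dV)" by (rule rotation_average(2)[OF Qint Qm])
  also have "\<dots> = (\<integral>u. h z * of_real (exp (- (norm (u :: complex ^ 'n))\<^sup>2)) \<partial>dV)"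
  proof (rule Bochner_Integration.integral_cong[OF refl])
    fix u :: "complex ^ 'n"
    have "(\<integral>s. Q (circle_param s *s u) \<partial>unit_interval) = (\<integral>s. (h (z + circle_param s *s u) * exp (- (circle_param s * cprod u z))) * of_real (exp (- (norm u)\<^sup>2)) \<partial>unit_interval)"
      by (simp add: Q_def cprod_smult norm_smult_circle)
    also have "\<dots> = (\<integral>s. h (z + circle_param s *s u) * exp (- (circle_param s * cprod u z)) \<partial>unit_interval) * of_real (exp (- (norm u)\<^sup>2))"
      by (rule integral_mult_left_zero)
    also have "(\<integral>s. h (z + circle_param s *s u) * exp (- (circle_param s * cprod u z)) \<partial>unit_interval) = h z"
      unfolding h_def by (rule homog_part_mean_value[OF f])
    finally show "(\<integral>s. Q (circle_param s *s u) \<partial>unit_interval) = h z * of_real (exp (- (norm u)\<^sup>2))" .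
  qed
  also have "\<dots> = h z * of_real (\<integral>u. exp (- (norm (u :: complex ^ 'n))\<^sup>2) \<partial>dV)" by simp
  also have "(\<integral>u. exp (- (norm (u :: complex ^ 'n))\<^sup>2) \<partial>dV) = fact CARD('n)" using dV_gaussian(2)[of 1, where 'n = 'n] by simp
  finally have first: "(\<integral>w. P w \<partial>dV) = fact CARD('n) * h z" by (simp add: mult.commute)
  \<comment> \<open>averaging over rotations of \<open>w\<close> selects the term of degree \<open>m\<close> of the exponential series\<close>
  have "(\<integral>w. P w \<partial>dV) = (\<integral>w. (\<integral>s. P (circle_param s *s w) \<partial>unit_interval) \<partial>dV)" by (rule rotation_average(2)[OF Pint Pm])
  also have "\<dots> = (\<integral>w. (1 / fact m) * (h w * cnj (cprod w z) ^ m * of_real (exp (- (norm w)\<^sup>2))) \<partial>dV)"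
  proof (rule Bochner_Integration.integral_cong[OF refl])
    fix w :: "complex ^ 'n"
    define E where "E x = exp (x * cprod w z)" for x
    have "P (circle_param s *s w) = cnj (E (circle_param s) * cnj (circle_param s) ^ m) * (h w * of_real (exp (- (norm w)\<^sup>2)))" for s
      unfolding P_def E_def h_def homog_part_smult[OF f] cprod_smult norm_smult_circle by (simp add: exp_cnj)
    then have "(\<integral>s. P (circle_param s *s w) \<partial>unit_interval) = cnj (\<integral>s. E (circle_param s) * cnj (circle_param s) ^ m \<partial>unit_interval) * (h w * of_real (exp (- (norm w)\<^sup>2)))"
      by (simp only: integral_mult_left_zero Bochner_Integration.integral_cnj)
    also have "(\<integral>s. E (circle_param s) * cnj (circle_param s) ^ m \<partial>unit_interval) = cprod w z ^ m / fact m"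
    proof -
      have "E holomorphic_on UNIV" unfolding E_def by (intro holomorphic_intros)
      from circle_taylor_coefficient[OF this, of m] show ?thesis unfolding E_def higher_deriv_exp_linear .
    qed
    finally show "(\<integral>s. P (circle_param s *s w) \<partial>unit_interval) = (1 / fact m) * (h w * cnj (cprod w z) ^ m * of_real (exp (- (norm w)\<^sup>2)))"
      by simp
  qed
  also have "\<dots> = (1 / fact m) * (\<integral>w. h w * cnj (cprod w z) ^ m * of_real (exp (- (norm w)\<^sup>2)) \<partial>dV)" by (rule integral_mult_right_zero)
  finally show ?thesis using first by (simp add: h_def field_simps)
qed

text \<open>The integrand is homogeneous of degree \<open>2 * m\<close> apart from the weight, so its integral is an explicit multiple of
an integral over the unit ball. The latter is eliminated by comparison with the weight \<open>exp (- \<bar>w\<bar>\<^sup>2)\<close>, for which the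
value is known.\<close>

lemma homog_part_moment:
  assumes f: "entire (f :: complex ^ 'n \<Rightarrow> complex)" and l: "l > 0" and g: "\<gamma> > 0"
  shows "(\<integral>w. homog_part m f w * cnj (cprod w z) ^ m * of_real (exp (- \<gamma> * norm w powr (2 * l))) \<partial>dV)
    = of_real (\<gamma> powr (- (real (m + CARD('n)) / l)) * Gamma (real (m + CARD('n)) / l + 1) * (fact m * fact CARD('n) / fact (m + CARD('n)))) * homog_part m f z"
proof -
  define F where "F w = homog_part m f w * cnj (cprod w z) ^ m" for w
  have Fm: "F \<in> borel_measurable borel" unfolding F_def using homog_part_measurable[OF f, of m] by measurable
  have hom: "F (t *\<^sub>R w) = (t powr (2 * real m)) *\<^sub>R F w" if t: "t > 0" for t w
  proof -
    have e: "t *\<^sub>R w = of_real t *s w" unfolding vec_eq_iff vector_scaleR_component vector_smult_component by (simp add: scaleR_conv_of_real[where 'a = complex])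
    have "t powr (2 * real m) = t powr real m * t powr real m" by (simp only: powr_add[symmetric] mult_2)
    then have p: "t powr (2 * real m) = t ^ m * t ^ m" by (simp only: powr_realpow[OF t])
    show ?thesis
      unfolding F_def e homog_part_smult[OF f] cprod_smult p
      unfolding scaleR_conv_of_real complex_cnj_mult
        complex_cnj_complex_of_real power_mult_distrib of_real_mult of_real_power
      by (simp only: mult_ac)
  qed
  obtain B where B: "B \<ge> 0" "\<And>w. norm (homog_part m f w) \<le> B * norm w ^ m" using homog_part_bound[OF f] by blast
  have int1: "integrable dV (\<lambda>w :: complex ^ 'n. indicator (cball 0 1) w :: real)"
    by (rule integrable_dV_cball)
  have int: "integrable dV (\<lambda>w. indicator (cball 0 1) w *\<^sub>R F w)"
  proof (rule Bochner_Integration.integrable_bound)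
    show "integrable dV (\<lambda>w :: complex ^ 'n. (B * norm z ^ m) * indicator (cball 0 1) w)" using int1 by (rule integrable_mult_right)
    show "(\<lambda>w. indicator (cball 0 1) w *\<^sub>R F w) \<in> borel_measurable dV" using Fm by (auto intro!: borel_measurable_scaleR borel_measurable_indicator)
    have "norm (F w) \<le> B * norm z ^ m" if w: "norm w \<le> 1" for w
    proof -
      have "B * norm w ^ m \<le> B * 1" using w B(1) by (intro mult_left_mono power_le_one) auto
      then have a: "norm (homog_part m f w) \<le> B" using B(2)[of w] by simp
      have "norm w * norm z \<le> 1 * norm z" using w by (intro mult_right_mono) auto
      then have "norm (cprod w z) \<le> norm z" using norm_cprod_le[of w z] by simp
      then have "norm (cprod w z) ^ m \<le> norm z ^ m" by (intro power_mono) auto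
      then show ?thesis unfolding F_def norm_mult norm_power using a B(1) by (intro mult_mono) auto
    qed
    then show "AE w in dV. norm (indicator (cball 0 1) w *\<^sub>R F w) \<le> norm (B * norm z ^ m * indicator (cball 0 1) w)"
      using B(1) by (intro AE_I2) (auto simp: indicator_def abs_mult)
  qed
  define J where "J = (\<integral>w. indicator (cball 0 1) w *\<^sub>R F w \<partial>dV)"
  have d: "2 * real m \<ge> 0" by simp
  have e2: "norm w powr 2 = (norm w)\<^sup>2" for w :: "complex ^ 'n" by (cases "w = 0") (auto simp: powr_numeral)
  have "(\<integral>w. exp (- 1 * norm w powr 2) *\<^sub>R F w \<partial>dV) = (1 powr (- ((2 * real m + 2 * real CARD('n)) / 2)) * Gamma ((2 * real m + 2 * real CARD('n)) / 2 + 1)) *\<^sub>R J"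
    unfolding J_def by (rule dV_homogeneous_integral_exp(2)[OF Fm hom int d]) auto
  moreover have "Gamma ((2 * real m + 2 * real CARD('n)) / 2 + 1) = fact (m + CARD('n))"
  proof -
    have "(2 * real m + 2 * real CARD('n)) / 2 + 1 = 1 + real (m + CARD('n))" by simp
    then show ?thesis using Gamma_fact[of "m + CARD('n)", where 'a = real] by (simp only:)
  qed
  ultimately have "(\<integral>w. exp (- 1 * norm w powr 2) *\<^sub>R F w \<partial>dV) = (1 powr (- ((2 * real m + 2 * real CARD('n)) / 2)) * fact (m + CARD('n))) *\<^sub>R J"
    by (simp only:)
  then have "(\<integral>w. F w * of_real (exp (- (norm w)\<^sup>2)) \<partial>dV) = fact (m + CARD('n)) * J"
    by (simp add: e2 scaleR_conv_of_real mult.commute)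
  then have J: "fact (m + CARD('n)) * J = fact m * fact CARD('n) * homog_part m f z"
    using gaussian_moment_homog_part[OF f, of m z] by (simp add: F_def)
  have "(\<integral>w. exp (- \<gamma> * norm w powr (2 * l)) *\<^sub>R F w \<partial>dV) = (\<gamma> powr (- ((2 * real m + 2 * real CARD('n)) / (2 * l))) * Gamma ((2 * real m + 2 * real CARD('n)) / (2 * l) + 1)) *\<^sub>R J"
    unfolding J_def using l by (intro dV_homogeneous_integral_exp(2)[OF Fm hom int d g]) auto
  moreover have "(2 * real m + 2 * real CARD('n)) / (2 * l) = real (m + CARD('n)) / l" using l by (simp add: field_simps)
  ultimately have "(\<integral>w. F w * of_real (exp (- \<gamma> * norm w powr (2 * l))) \<partial>dV) = of_real (\<gamma> powr (- (real (m + CARD('n)) / l)) * Gamma (real (m + CARD('n)) / l + 1)) * J"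
    by (simp add: scaleR_conv_of_real mult.commute)
  also have "J = of_real (fact m * fact CARD('n) / fact (m + CARD('n))) * homog_part m f z"
  proof -
    have "J = fact (m + CARD('n)) * J / fact (m + CARD('n))" by simp
    also have "\<dots> = fact m * fact CARD('n) * homog_part m f z / fact (m + CARD('n))" by (simp only: J)
    finally show ?thesis by (simp only: of_real_divide of_real_mult of_real_fact times_divide_eq_left)
  qed
  finally show ?thesis by (simp add: F_def mult_ac)
qed

section \<open>The Bergman kernel\<close>

lemma higher_deriv_power_series_0:
  fixes a :: "nat \<Rightarrow> complex"
  assumes "\<And>x. (\<lambda>m. a m * x ^ m) sums f x"
  shows "(deriv ^^ k) f 0 = fact k * a k"
  using assms
proof (induction k arbitrary: f a)
  case 0
  have "f 0 = a 0" using sums_unique2[OF "0.prems"[of 0] powser_sums_zero[of a]] .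
  then show ?case by simp
next
  case (Suc k)
  have sm: "summable (\<lambda>m. a m * x ^ m)" for x using Suc.prems by (rule sums_summable)
  have f: "f = (\<lambda>x. \<Sum>m. a m * x ^ m)" using Suc.prems by (auto simp: fun_eq_iff sums_iff)
  have d: "deriv f x = (\<Sum>m. diffs a m * x ^ m)" for x
    unfolding f by (intro DERIV_imp_deriv termdiffs_strong_converges_everywhere sm)
  have "(\<lambda>m. diffs a m * x ^ m) sums deriv f x" for x
    unfolding d by (intro summable_sums termdiff_converges_all sm)
  then have "(deriv ^^ k) (deriv f) 0 = fact k * diffs a k" by (rule Suc.IH)
  then show ?case unfolding funpow_Suc_right o_def by (simp add: diffs_def)
qed

text \<open>The function of one variable whose composition with the Hermitian product is the kernel.\<close>

definition bergman_profile :: "real \<Rightarrow> real \<Rightarrow> nat \<Rightarrow> complex \<Rightarrow> complex" where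
  "bergman_profile l \<gamma> n x = (deriv ^^ n) (scaled_ml l \<gamma>) x / fact n"

text \<open>The reciprocals of the factors in \<open>homog_part_moment\<close>.\<close>

definition bergman_coeff :: "real \<Rightarrow> real \<Rightarrow> nat \<Rightarrow> nat \<Rightarrow> real" where
  "bergman_coeff l \<gamma> n m = fact (m + n) / (fact m * fact n) * (\<gamma> powr (real (m + n) / l) / Gamma (real (m + n) / l + 1))"

lemma scaled_ml_sums:
  assumes "l \<ge> 1" "\<gamma> > 0"
  shows "(\<lambda>k. of_real (\<gamma> powr (real k / l) / Gamma (real k / l + 1)) * x ^ k) sums scaled_ml l \<gamma> x"
proof -
  have "(\<lambda>k. (of_real (\<gamma> powr (1 / l)) * x) ^ k / of_real (Gamma (1 / l * real k + 1))) sums scaled_ml l \<gamma> x"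
    unfolding scaled_ml_def using assms by (intro mittag_leffler_sums) auto
  moreover have "(\<gamma> powr (1 / l)) ^ k = \<gamma> powr (real k / l)" for k
    using assms by (simp add: powr_power)
  ultimately show ?thesis by (simp add: power_mult_distrib flip: of_real_power)
qed

lemma bergman_profile_holomorphic: "l \<ge> 1 \<Longrightarrow> bergman_profile l \<gamma> n holomorphic_on UNIV"
  unfolding bergman_profile_def by (intro holomorphic_intros holomorphic_higher_deriv scaled_ml_holomorphic) auto

lemma bergman_profile_sums:
  assumes l: "l \<ge> 1" and g: "\<gamma> > 0"
  shows "(\<lambda>m. of_real (bergman_coeff l \<gamma> n m) * x ^ m) sums bergman_profile l \<gamma> n x"
proof -
  have "(deriv ^^ n) (scaled_ml l \<gamma>) holomorphic_on ball 0 (norm x + 1)"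
    using holomorphic_higher_deriv[OF scaled_ml_holomorphic[OF l, of \<gamma> UNIV] open_UNIV] by (rule holomorphic_on_subset) simp
  then have "(\<lambda>m. (deriv ^^ m) ((deriv ^^ n) (scaled_ml l \<gamma>)) 0 / fact m * (x - 0) ^ m) sums ((deriv ^^ n) (scaled_ml l \<gamma>) x)"
    by (rule holomorphic_power_series) simp
  moreover have "(deriv ^^ m) ((deriv ^^ n) (scaled_ml l \<gamma>)) 0 = fact (m + n) * of_real (\<gamma> powr (real (m + n) / l) / Gamma (real (m + n) / l + 1))" for m
    using higher_deriv_power_series_0[OF scaled_ml_sums[OF l g], of "m + n"] by (simp add: funpow_add)
  ultimately have "(\<lambda>m. fact (m + n) * of_real (\<gamma> powr (real (m + n) / l) / Gamma (real (m + n) / l + 1)) / fact m * x ^ m / fact n) sums ((deriv ^^ n) (scaled_ml l \<gamma>) x / fact n)"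
    by (intro sums_divide) simp
  moreover have "fact (m + n) * of_real (\<gamma> powr (real (m + n) / l) / Gamma (real (m + n) / l + 1)) / fact m * x ^ m / fact n
      = of_real (bergman_coeff l \<gamma> n m) * x ^ m" for m
    by (simp add: bergman_coeff_def mult_ac)
  ultimately show ?thesis by (simp add: bergman_profile_def)
qed

lemma bergman_coeff_pos: "l \<ge> 1 \<Longrightarrow> \<gamma> > 0 \<Longrightarrow> bergman_coeff l \<gamma> n m > 0"
  unfolding bergman_coeff_def by (intro mult_pos_pos divide_pos_pos Gamma_real_pos) (auto intro: add_nonneg_pos)

text \<open>A rough bound, sufficient for all questions of integrability.\<close>

lemma bergman_profile_type:
  assumes l: "l \<ge> 1" and g: "\<gamma> > 0"
  shows "\<exists>C>0. \<forall>x. norm (bergman_profile l \<gamma> n x) \<le> C * exp (2 * \<gamma> * norm x powr l)"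
proof -
  obtain C where C: "C > 0" "\<And>x. norm (scaled_ml l \<gamma> x) \<le> C * exp (\<gamma> * angular_growth l x)"
    using scaled_ml_bound[OF l g] by blast
  have C': "norm (scaled_ml l \<gamma> x) \<le> C * exp (\<gamma> * norm x powr l)" for x
    using C(2)[of x] angular_growth_bounds(2)[of l x] C(1) g
    by (elim order_trans) (auto intro!: mult_left_mono)
  obtain D where D: "D > 0" "\<And>x. norm ((deriv ^^ n) (scaled_ml l \<gamma>) x) \<le> D * exp (2 * \<gamma> * norm x powr l)"
    using higher_deriv_type_bound[OF l scaled_ml_holomorphic[OF l] C', of "2 * \<gamma>" n] g by auto
  show ?thesis
  proof (intro exI[of _ D] conjI D(1) allI)
    fix x
    have "norm (bergman_profile l \<gamma> n x) = norm ((deriv ^^ n) (scaled_ml l \<gamma>) x) / fact n"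
      by (simp add: bergman_profile_def norm_divide)
    also have "\<dots> \<le> norm ((deriv ^^ n) (scaled_ml l \<gamma>) x) / 1" by (intro divide_left_mono) auto
    finally show "norm (bergman_profile l \<gamma> n x) \<le> D * exp (2 * \<gamma> * norm x powr l)" using D(2)[of x] by simp
  qed
qed

text \<open>The weight is invariant under rotations of \<open>w\<close>, so averaging over them replaces \<open>f\<close> by its component of degree \<open>m\<close>.\<close>

lemma moment_homog_part:
  fixes f :: "complex ^ 'n \<Rightarrow> complex"
  assumes f: "entire f" and l: "l > 0" and g: "\<gamma> > 0"
    and int: "integrable dV (\<lambda>w. f w * cnj (cprod w z) ^ m * of_real (exp (- \<gamma> * norm w powr (2 * l))))"
  shows "(\<integral>w. f w * cnj (cprod w z) ^ m * of_real (exp (- \<gamma> * norm w powr (2 * l))) \<partial>dV)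
    = of_real (1 / bergman_coeff l \<gamma> CARD('n) m) * homog_part m f z"
proof -
  define F where "F w = f w * cnj (cprod w z) ^ m * of_real (exp (- \<gamma> * norm w powr (2 * l)))" for w
  have [measurable]: "f \<in> borel_measurable borel" using entire_continuous[OF f] by (rule borel_measurable_continuous_onI)
  have Fm: "F \<in> borel_measurable borel" unfolding F_def by measurable
  have "(\<integral>w. F w \<partial>dV) = (\<integral>w. (\<integral>t. F (circle_param t *s w) \<partial>unit_interval) \<partial>dV)"
    by (rule rotation_average(2)[OF int[folded F_def] Fm])
  also have "\<dots> = (\<integral>w. homog_part m f w * cnj (cprod w z) ^ m * of_real (exp (- \<gamma> * norm w powr (2 * l))) \<partial>dV)"
  proof (rule Bochner_Integration.integral_cong[OF refl])
    fix w :: "complex ^ 'n"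
    have "F (circle_param t *s w) = (f (circle_param t *s w) * cnj (circle_param t) ^ m) * (cnj (cprod w z) ^ m * of_real (exp (- \<gamma> * norm w powr (2 * l))))" for t
      unfolding F_def cprod_smult norm_smult_circle by (simp add: power_mult_distrib)
    then have "(\<integral>t. F (circle_param t *s w) \<partial>unit_interval) = (\<integral>t. f (circle_param t *s w) * cnj (circle_param t) ^ m \<partial>unit_interval) * (cnj (cprod w z) ^ m * of_real (exp (- \<gamma> * norm w powr (2 * l))))"
      by (simp only: integral_mult_left_zero)
    then show "(\<integral>t. F (circle_param t *s w) \<partial>unit_interval) = homog_part m f w * cnj (cprod w z) ^ m * of_real (exp (- \<gamma> * norm w powr (2 * l)))"
      by (simp only: homog_part_def mult.assoc)
  qed
  also have "\<dots> = of_real (\<gamma> powr (- (real (m + CARD('n)) / l)) * Gamma (real (m + CARD('n)) / l + 1) * (fact m * fact CARD('n) / fact (m + CARD('n)))) * homog_part m f z"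
    by (rule homog_part_moment[OF f l g])
  also have "\<gamma> powr (- (real (m + CARD('n)) / l)) * Gamma (real (m + CARD('n)) / l + 1) * (fact m * fact CARD('n) / fact (m + CARD('n))) = 1 / bergman_coeff l \<gamma> CARD('n) m"
    by (simp only: bergman_coeff_def powr_minus_divide) (simp add: mult_ac)
  finally show ?thesis by (simp only: F_def)
qed

text \<open>Integrate the power series of the kernel term by term: each term reproduces one homogeneous component of \<open>f\<close>.\<close>

lemma bergman_profile_reproducing:
  fixes f :: "complex ^ 'n \<Rightarrow> complex"
  assumes l: "l \<ge> 1" and g: "\<gamma> > 0" and f: "f \<in> Fock_space l 2 \<gamma> 0"
  shows "f z = Fock_inner l \<gamma> f (\<lambda>w. bergman_profile l \<gamma> CARD('n) (cprod w z))"
proof -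
  define n where "n = CARD('n)"
  define c where "c = bergman_coeff l \<gamma> n"
  have c: "c m > 0" for m unfolding c_def by (rule bergman_coeff_pos[OF l g])
  have ent: "entire f" using f by (simp add: Fock_space_def)
  have [measurable]: "f \<in> borel_measurable borel" using entire_continuous[OF ent] by (rule borel_measurable_continuous_onI)
  define W where "W w = exp (- \<gamma> * norm w powr (2 * l))" for w :: "complex ^ 'n"
  have Wm [measurable]: "W \<in> borel_measurable borel" unfolding W_def by measurable
  have W0: "W w > 0" for w by (simp add: W_def)
  obtain C where C: "C > 0" "\<And>x. norm (bergman_profile l \<gamma> n x) \<le> C * exp (2 * \<gamma> * norm x powr l)"
    using bergman_profile_type[OF l g] by blast
  define S where "S w = (\<Sum>m. c m * (norm w * norm z) ^ m)" for w :: "complex ^ 'n"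
  have Ssums: "(\<lambda>m. c m * (norm w * norm z) ^ m) sums S w" and Sle: "S w \<le> C * exp (2 * \<gamma> * (norm w * norm z) powr l)" for w
  proof -
    have s: "(\<lambda>m. complex_of_real (c m * (norm w * norm z) ^ m)) sums bergman_profile l \<gamma> n (of_real (norm w * norm z))"
      using bergman_profile_sums[OF l g, of n "of_real (norm w * norm z)"] by (simp add: c_def)
    then have "(\<lambda>m. Re (complex_of_real (c m * (norm w * norm z) ^ m))) sums Re (bergman_profile l \<gamma> n (of_real (norm w * norm z)))"
      by (rule sums_Re)
    then have s': "(\<lambda>m. c m * (norm w * norm z) ^ m) sums Re (bergman_profile l \<gamma> n (of_real (norm w * norm z)))"
      by (simp only: Re_complex_of_real)
    then show "(\<lambda>m. c m * (norm w * norm z) ^ m) sums S w" unfolding S_def by (rule sums_summable[THEN summable_sums])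
    have "S w = Re (bergman_profile l \<gamma> n (of_real (norm w * norm z)))" unfolding S_def using s' by (rule sums_unique[symmetric])
    also have "\<dots> \<le> norm (bergman_profile l \<gamma> n (of_real (norm w * norm z)))" by (rule complex_Re_le_cmod)
    also have "\<dots> \<le> C * exp (2 * \<gamma> * norm (complex_of_real (norm w * norm z)) powr l)" by (rule C(2))
    also have "norm (complex_of_real (norm w * norm z)) = norm w * norm z" by (simp only: norm_of_real abs_of_nonneg[OF mult_nonneg_nonneg[OF norm_ge_zero norm_ge_zero]])
    finally show "S w \<le> C * exp (2 * \<gamma> * (norm w * norm z) powr l)" .
  qed
  have S0: "S w \<ge> 0" for w unfolding S_def by (intro suminf_nonneg sums_summable[OF Ssums] mult_nonneg_nonneg[OF less_imp_le[OF c]]) simp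
  have Sm [measurable]: "S \<in> borel_measurable borel" unfolding S_def by measurable
  \<comment> \<open>\<open>S w\<close> dominates all partial sums of the kernel; its growth of order \<open>l\<close> is weaker than the weight\<close>
  have abs_int: "integrable dV (\<lambda>w. norm (f w) * S w * W w)"
  proof (rule Bochner_Integration.integrable_bound)
    define D where "D = C\<^sup>2 * exp (8 * \<gamma> * norm z powr (2 * l))"
    have e2: "enn2real 2 = 2" by simp
    have "integrable dV (\<lambda>w. weighted_abs l \<gamma> 0 f w powr 2)" using f by (simp add: Fock_space_def)
    moreover have "weighted_abs l \<gamma> 0 f w powr 2 = (norm (f w))\<^sup>2 * W w" for w
    proof -
      have p1: "(1 + norm w) powr 0 = 1" using add_pos_nonneg[of 1 "norm w"] by simp
      have "weighted_abs l \<gamma> 0 f w powr 2 = (norm (f w) * exp (- (\<gamma> / 2) * norm w powr (2 * l))) ^ 2"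
        unfolding weighted_abs_def p1 mult_1_right by (rule powr_numeral) simp
      also have "\<dots> = (norm (f w))\<^sup>2 * exp (- (\<gamma> / 2) * norm w powr (2 * l)) ^ 2" by (rule power_mult_distrib)
      also have "exp (- (\<gamma> / 2) * norm w powr (2 * l)) ^ 2 = W w"
        unfolding W_def exp_of_nat_mult[symmetric] by simp
      finally show ?thesis .
    qed
    ultimately have i1: "integrable dV (\<lambda>w. (norm (f w))\<^sup>2 * W w)" by simp
    have int1: "integrable dV (\<lambda>w :: complex ^ 'n. indicator (cball 0 1) w *\<^sub>R (1::real))"
      unfolding real_scaleR_def mult_1_right by (rule integrable_dV_cball)
    have i2: "integrable dV (\<lambda>w :: complex ^ 'n. exp (- (\<gamma> / 2) * norm w powr (2 * l)) *\<^sub>R (1::real))"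
      by (rule dV_homogeneous_integral_exp(1)[where d = 0, OF _ _ int1]) (use l g in auto)
    then have i2': "integrable dV (\<lambda>w :: complex ^ 'n. D * exp (- (\<gamma> / 2) * norm w powr (2 * l)))" by simp
    show "integrable dV (\<lambda>w. (norm (f w))\<^sup>2 * W w + D * exp (- (\<gamma> / 2) * norm w powr (2 * l)))"
      using i1 i2' by (rule Bochner_Integration.integrable_add)
    show "(\<lambda>w. norm (f w) * S w * W w) \<in> borel_measurable dV" by measurable
    have "norm (f w) * S w * W w \<le> (norm (f w))\<^sup>2 * W w + D * exp (- (\<gamma> / 2) * norm w powr (2 * l))" for w
    proof -
      have "2 * (norm (f w) * S w) \<le> (norm (f w))\<^sup>2 + (S w)\<^sup>2" using sum_squares_bound[of "norm (f w)" "S w"] by (simp only: mult.assoc)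
      moreover have "0 \<le> norm (f w) * S w" using S0[of w] by simp
      ultimately have "norm (f w) * S w \<le> (norm (f w))\<^sup>2 + (S w)\<^sup>2" by linarith
      then have "norm (f w) * S w * W w \<le> (norm (f w))\<^sup>2 * W w + (S w)\<^sup>2 * W w"
        using mult_right_mono[of "norm (f w) * S w" "(norm (f w))\<^sup>2 + (S w)\<^sup>2" "W w"] W0[of w] by (simp only: distrib_right)
      moreover have "(S w)\<^sup>2 * W w \<le> D * exp (- (\<gamma> / 2) * norm w powr (2 * l))"
      proof -
        define x y where "x = norm w powr l" and "y = norm z powr l"
        have x2: "norm w powr (2 * l) = x\<^sup>2" using powr_add[of "norm w" l l] by (simp add: x_def power2_eq_square)
        have y2: "norm z powr (2 * l) = y\<^sup>2" using powr_add[of "norm z" l l] by (simp add: y_def power2_eq_square)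
        have "(S w)\<^sup>2 \<le> (C * exp (2 * \<gamma> * (x * y)))\<^sup>2"
          using Sle[of w] S0[of w] by (intro power_mono) (auto simp: x_def y_def powr_mult)
        also have "\<dots> = C\<^sup>2 * exp (4 * \<gamma> * (x * y))"
          unfolding power_mult_distrib exp_of_nat_mult[symmetric] by simp
        finally have "(S w)\<^sup>2 * W w \<le> C\<^sup>2 * exp (4 * \<gamma> * (x * y)) * exp (- \<gamma> * x\<^sup>2)"
          unfolding W_def x2 by (rule mult_right_mono) simp
        also have "\<dots> = C\<^sup>2 * exp (4 * \<gamma> * (x * y) + - \<gamma> * x\<^sup>2)" unfolding exp_add by simp
        also have "4 * \<gamma> * (x * y) + - \<gamma> * x\<^sup>2 \<le> 8 * \<gamma> * y\<^sup>2 + - (\<gamma> / 2) * x\<^sup>2"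
        proof -
          have "0 \<le> \<gamma> / 2 * (x - 4 * y)\<^sup>2" using g by simp
          also have "\<dots> = \<gamma> / 2 * x\<^sup>2 - 4 * \<gamma> * (x * y) + 8 * \<gamma> * y\<^sup>2" by (simp add: power2_eq_square algebra_simps)
          finally show ?thesis by simp
        qed
        then have "C\<^sup>2 * exp (4 * \<gamma> * (x * y) + - \<gamma> * x\<^sup>2) \<le> C\<^sup>2 * exp (8 * \<gamma> * y\<^sup>2 + - (\<gamma> / 2) * x\<^sup>2)" by (intro mult_left_mono) auto
        also have "\<dots> = D * exp (- (\<gamma> / 2) * norm w powr (2 * l))" unfolding D_def x2 y2 exp_add by simp
        finally show ?thesis .
      qed
      ultimately show ?thesis by linarith
    qed
    then show "AE w in dV. norm (norm (f w) * S w * W w) \<le> norm ((norm (f w))\<^sup>2 * W w + D * exp (- (\<gamma> / 2) * norm w powr (2 * l)))"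
      using S0 W0 by (intro AE_I2) (auto simp: less_imp_le intro: order_trans[OF _ abs_ge_self])
  qed
  define T where "T m w = f w * cnj (of_real (c m) * cprod w z ^ m) * of_real (W w)" for m w
  have Tm: "T m \<in> borel_measurable borel" for m unfolding T_def by simp
  have Tn: "norm (T m w) \<le> norm (f w) * W w * (c m * (norm w * norm z) ^ m)" for m w
  proof -
    have "norm (cprod w z) ^ m \<le> (norm w * norm z) ^ m" by (intro power_mono norm_cprod_le) simp
    then have "norm (f w) * W w * (c m * norm (cprod w z) ^ m) \<le> norm (f w) * W w * (c m * (norm w * norm z) ^ m)"
      using W0[of w] c[of m] by (intro mult_left_mono) auto
    then show ?thesis using W0[of w] c[of m] by (simp add: T_def norm_mult norm_power mult_ac)
  qed
  have dom_sums: "(\<lambda>m. norm (f w) * W w * (c m * (norm w * norm z) ^ m)) sums (norm (f w) * W w * S w)" for w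
    by (rule sums_mult[OF Ssums])
  have Tsm: "summable (\<lambda>m. norm (T m w))" for w
    by (rule summable_comparison_test'[OF sums_summable[OF dom_sums[of w]]]) (use Tn in auto)
  have part: "(\<Sum>m<N. norm (T m w)) \<le> norm (f w) * S w * W w" for N w
  proof -
    have "(\<Sum>m<N. norm (T m w)) \<le> (\<Sum>m<N. norm (f w) * W w * (c m * (norm w * norm z) ^ m))" by (intro sum_mono Tn)
    also have "\<dots> \<le> norm (f w) * W w * S w"
      unfolding sums_unique[OF dom_sums[of w]] using W0[of w]
      by (intro sum_le_suminf sums_summable[OF dom_sums] mult_nonneg_nonneg less_imp_le[OF c]) auto
    finally show ?thesis by (simp add: mult_ac)
  qed
  have Tint: "integrable dV (T m)" for m
  proof (rule Bochner_Integration.integrable_bound[OF abs_int])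
    have "norm (T m w) \<le> norm (f w) * S w * W w" for w
    proof -
      have "norm (T m w) \<le> (\<Sum>i<Suc m. norm (T i w))" by (simp add: sum_nonneg)
      then show ?thesis using part[of w "Suc m"] by linarith
    qed
    then show "AE w in dV. norm (T m w) \<le> norm (norm (f w) * S w * W w)"
      by (intro AE_I2) (auto intro: order_trans[OF _ abs_ge_self])
  qed (use Tm in simp)
  have Tsum_int: "summable (\<lambda>m. \<integral>w. norm (T m w) \<partial>dV)"
  proof (rule summableI_nonneg_bounded)
    fix N
    have "(\<Sum>m<N. \<integral>w. norm (T m w) \<partial>dV) = (\<integral>w. (\<Sum>m<N. norm (T m w)) \<partial>dV)"
      using Tint by (intro Bochner_Integration.integral_sum[symmetric]) auto
    also have "\<dots> \<le> (\<integral>w. norm (f w) * S w * W w \<partial>dV)"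
      using Tint abs_int part by (intro integral_mono Bochner_Integration.integrable_sum) auto
    finally show "(\<Sum>m<N. \<integral>w. norm (T m w) \<partial>dV) \<le> (\<integral>w. norm (f w) * S w * W w \<partial>dV)" .
  qed auto
  have Tval: "(\<integral>w. T m w \<partial>dV) = homog_part m f z" for m
  proof -
    have eq: "T m w = of_real (c m) * (f w * cnj (cprod w z) ^ m * of_real (exp (- \<gamma> * norm w powr (2 * l))))" for w
      by (simp add: T_def W_def)
    have "integrable dV (\<lambda>w. of_real (1 / c m) * T m w)" using Tint by (rule integrable_mult_right)
    then have i: "integrable dV (\<lambda>w. f w * cnj (cprod w z) ^ m * of_real (exp (- \<gamma> * norm w powr (2 * l))))"
      unfolding eq using c[of m] by (simp add: mult.assoc[symmetric] flip: of_real_mult)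
    have "(\<integral>w. T m w \<partial>dV) = of_real (c m) * (\<integral>w. f w * cnj (cprod w z) ^ m * of_real (exp (- \<gamma> * norm w powr (2 * l))) \<partial>dV)"
      unfolding eq by (rule integral_mult_right_zero)
    also have "\<dots> = of_real (c m) * (of_real (1 / c m) * homog_part m f z)"
      using moment_homog_part[OF ent _ g i] l by (simp add: c_def n_def)
    finally show ?thesis using c[of m] by (simp add: mult.assoc[symmetric] flip: of_real_mult)
  qed
  have "(\<lambda>m. \<integral>w. T m w \<partial>dV) sums (\<integral>w. (\<Sum>m. T m w) \<partial>dV)"
    using Tint Tsm Tsum_int by (intro sums_integral) auto
  moreover have "(\<Sum>m. T m w) = f w * cnj (bergman_profile l \<gamma> n (cprod w z)) * of_real (exp (- \<gamma> * norm w powr (2 * l)))" for w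
  proof -
    have "(\<lambda>m. of_real (c m) * cprod w z ^ m) sums bergman_profile l \<gamma> n (cprod w z)"
      using bergman_profile_sums[OF l g] by (simp add: c_def)
    then have "(\<lambda>m. cnj (of_real (c m) * cprod w z ^ m)) sums cnj (bergman_profile l \<gamma> n (cprod w z))" by (simp only: sums_cnj)
    then have "(\<lambda>m. f w * cnj (of_real (c m) * cprod w z ^ m) * of_real (W w)) sums (f w * cnj (bergman_profile l \<gamma> n (cprod w z)) * of_real (W w))"
      by (intro sums_mult sums_mult2)
    then show ?thesis unfolding T_def W_def by (rule sums_unique[symmetric])
  qed
  ultimately have "(\<lambda>m. homog_part m f z) sums Fock_inner l \<gamma> f (\<lambda>w. bergman_profile l \<gamma> n (cprod w z))"
    by (simp add: Tval Fock_inner_def)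
  then show ?thesis using homog_part_sums[OF ent, of z] sums_unique2 unfolding n_def by blast
qed

lemma Fock_inner_cnj: "Fock_inner l \<gamma> g f = cnj (Fock_inner l \<gamma> f g)"
proof -
  have "cnj (Fock_inner l \<gamma> f g) = (\<integral>z. cnj (f z * cnj (g z) * of_real (exp (- \<gamma> * norm z powr (2 * l)))) \<partial>dV)"
    unfolding Fock_inner_def by (rule Bochner_Integration.integral_cnj[symmetric])
  then show ?thesis by (simp add: Fock_inner_def mult_ac)
qed

text \<open>Applying two reproducing kernels to each other shows that each is the conjugate transpose of the other.\<close>

lemma reproducing_kernel_unique:
  assumes "is_reproducing_kernel l \<gamma> K" "is_reproducing_kernel l \<gamma> K'"
  shows "K = K'"
proof -
  have *: "K1 w z = cnj (K2 z w)" if "is_reproducing_kernel l \<gamma> K1" "is_reproducing_kernel l \<gamma> K2" for K1 K2 w z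
  proof -
    have m: "(\<lambda>w. K1 w z) \<in> Fock_space l 2 \<gamma> 0" "(\<lambda>u. K2 u w) \<in> Fock_space l 2 \<gamma> 0"
      using that by (auto simp: is_reproducing_kernel_def)
    have "K1 w z = Fock_inner l \<gamma> (\<lambda>u. K1 u z) (\<lambda>u. K2 u w)" by (rule bspec[OF conjunct2[OF that(2)[unfolded is_reproducing_kernel_def, rule_format]] m(1)])
    also have "\<dots> = cnj (Fock_inner l \<gamma> (\<lambda>u. K2 u w) (\<lambda>u. K1 u z))" by (rule Fock_inner_cnj)
    also have "Fock_inner l \<gamma> (\<lambda>u. K2 u w) (\<lambda>u. K1 u z) = K2 z w" by (rule bspec[OF conjunct2[OF that(1)[unfolded is_reproducing_kernel_def, rule_format]] m(2), symmetric])
    finally show ?thesis .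
  qed
  show ?thesis
  proof (intro ext)
    fix w z
    show "K w z = K' w z" using *[OF assms, of w z] *[OF assms(2) assms(2), of w z] by simp
  qed
qed

lemma Bergman_kernel_eq:
  assumes l: "l \<ge> 1" and g: "\<gamma> > 0"
  shows "Bergman_kernel l \<gamma> (w :: complex ^ 'n) z = bergman_profile l \<gamma> CARD('n) (cprod w z)"
proof -
  let ?K = "\<lambda>w z :: complex ^ 'n. bergman_profile l \<gamma> CARD('n) (cprod w z)"
  obtain C where C: "C > 0" "\<And>x. norm (bergman_profile l \<gamma> CARD('n) x) \<le> C * exp (2 * \<gamma> * norm x powr l)"
    using bergman_profile_type[OF l g] by blast
  have "is_reproducing_kernel l \<gamma> ?K" unfolding is_reproducing_kernel_def
  proof (intro allI conjI ballI)
    fix z :: "complex ^ 'n"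
    have "1 \<le> (2 :: ennreal)" by simp
    from Fock_norm_cprod_type[OF l g _ _ bergman_profile_holomorphic[OF l] C(2) this, of "(2 * \<gamma>)\<^sup>2 / (2 * \<gamma>) + 1" 0] C(1) g
    show "(\<lambda>w. ?K w z) \<in> Fock_space l 2 \<gamma> 0" by auto
    fix f :: "complex ^ 'n \<Rightarrow> complex" assume "f \<in> Fock_space l 2 \<gamma> 0"
    then show "f z = Fock_inner l \<gamma> f (\<lambda>w. ?K w z)" by (rule bergman_profile_reproducing[OF l g])
  qed
  then have "Bergman_kernel l \<gamma> = ?K"
    unfolding Bergman_kernel_def using reproducing_kernel_unique by (intro the_equality)
  then show ?thesis by simp
qed

section \<open>The kernel on the positive axis\<close>

definition real_profile :: "real \<Rightarrow> real \<Rightarrow> nat \<Rightarrow> real \<Rightarrow> real" where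
  "real_profile l \<gamma> j x = Re (bergman_profile l \<gamma> j (of_real x))"

lemma real_profile_sums:
  assumes "l \<ge> 1" "\<gamma> > 0"
  shows "(\<lambda>m. bergman_coeff l \<gamma> j m * x ^ m) sums real_profile l \<gamma> j x"
proof -
  have "(\<lambda>m. complex_of_real (bergman_coeff l \<gamma> j m * x ^ m)) sums bergman_profile l \<gamma> j (of_real x)"
    using bergman_profile_sums[OF assms, of j "of_real x"] by simp
  then have "(\<lambda>m. Re (complex_of_real (bergman_coeff l \<gamma> j m * x ^ m))) sums real_profile l \<gamma> j x"
    unfolding real_profile_def by (rule sums_Re)
  then show ?thesis by (simp only: Re_complex_of_real)
qed

lemma real_profile_mono:
  assumes lg: "l \<ge> 1" "\<gamma> > 0" and x: "0 \<le> x" "x \<le> y"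
  shows "real_profile l \<gamma> j x \<le> real_profile l \<gamma> j y"
proof (rule sums_le[OF _ real_profile_sums[OF lg] real_profile_sums[OF lg]])
  show "bergman_coeff l \<gamma> j m * x ^ m \<le> bergman_coeff l \<gamma> j m * y ^ m" for m
    using x by (intro mult_left_mono power_mono less_imp_le[OF bergman_coeff_pos[OF lg]])
qed

lemma real_profile_pos:
  assumes lg: "l \<ge> 1" "\<gamma> > 0" and x: "0 \<le> x"
  shows "0 < real_profile l \<gamma> j x"
proof -
  have "real_profile l \<gamma> j 0 = bergman_coeff l \<gamma> j 0"
    using sums_unique2[OF real_profile_sums[OF lg, of j 0] powser_sums_zero] .
  then show ?thesis using real_profile_mono[OF lg order_refl x, of j] bergman_coeff_pos[OF lg, of j 0] by simp
qed

lemma real_profile_derivative: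
  assumes l: "l \<ge> 1"
  shows "(real_profile l \<gamma> j has_real_derivative real (Suc j) * real_profile l \<gamma> (Suc j) x) (at x)"
proof -
  have "(deriv ^^ j) (scaled_ml l \<gamma>) holomorphic_on UNIV"
    using holomorphic_higher_deriv[OF scaled_ml_holomorphic[OF l, of \<gamma> UNIV] open_UNIV] .
  then have "((deriv ^^ j) (scaled_ml l \<gamma>) has_field_derivative deriv ((deriv ^^ j) (scaled_ml l \<gamma>)) (of_real x)) (at (of_real x))"
    by (rule holomorphic_derivI) auto
  then have d: "(bergman_profile l \<gamma> j has_field_derivative deriv ((deriv ^^ j) (scaled_ml l \<gamma>)) (of_real x) / fact j) (at (of_real x))"
    unfolding bergman_profile_def by (rule DERIV_cdivide)
  have "deriv ((deriv ^^ j) (scaled_ml l \<gamma>)) (of_real x) / fact j = of_real (real (Suc j)) * bergman_profile l \<gamma> (Suc j) (of_real x)"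
    by (simp add: bergman_profile_def del: of_nat_Suc)
  with d have "((\<lambda>x. bergman_profile l \<gamma> j (of_real x)) has_vector_derivative of_real (real (Suc j)) * bergman_profile l \<gamma> (Suc j) (of_real x)) (at x)"
    by (metis has_vector_derivative_real_field)
  then have "((\<lambda>x. Re (bergman_profile l \<gamma> j (of_real x))) has_field_derivative Re (of_real (real (Suc j)) * bergman_profile l \<gamma> (Suc j) (of_real x))) (at x)"
    by (rule has_field_derivative_Re)
  then show ?thesis unfolding real_profile_def by (simp del: of_nat_Suc of_real_of_nat_eq)
qed

lemma real_profile_upper:
  assumes l: "l \<ge> 1" and g: "\<gamma> > 0"
  shows "\<exists>C>0. \<forall>x\<ge>0. real_profile l \<gamma> j x \<le> C * (1 + x) powr (real j * (l - 1)) * exp (\<gamma> * x powr l)"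
proof -
  obtain C where C: "C > 0" "\<And>x. norm ((deriv ^^ j) (scaled_ml l \<gamma>) x) \<le> C * (1 + norm x) powr (real j * (l - 1)) * exp (\<gamma> * angular_growth l x)"
    using higher_deriv_scaled_ml_bound[OF l g, of j] by blast
  show ?thesis
  proof (intro exI[of _ C] conjI C(1) allI impI)
    fix x :: real assume x: "x \<ge> 0"
    have "real_profile l \<gamma> j x \<le> norm (bergman_profile l \<gamma> j (of_real x))" unfolding real_profile_def by (rule complex_Re_le_cmod)
    also have "\<dots> = norm ((deriv ^^ j) (scaled_ml l \<gamma>) (of_real x)) / fact j" by (simp add: bergman_profile_def norm_divide)
    also have "\<dots> \<le> norm ((deriv ^^ j) (scaled_ml l \<gamma>) (of_real x)) / 1" by (intro divide_left_mono) auto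
    also have "\<dots> \<le> C * (1 + x) powr (real j * (l - 1)) * exp (\<gamma> * angular_growth l (of_real x))" using C(2)[of "of_real x"] x by simp
    also have "\<dots> \<le> C * (1 + x) powr (real j * (l - 1)) * exp (\<gamma> * x powr l)"
      using angular_growth_bounds(2)[of l "of_real x"] x C(1) g by (intro mult_left_mono) auto
    finally show "real_profile l \<gamma> j x \<le> C * (1 + x) powr (real j * (l - 1)) * exp (\<gamma> * x powr l)" .
  qed
qed

text \<open>Below any threshold the profile is bounded below by its positive value at 0, so only large \<open>x\<close> matter.\<close>

lemma real_profile_lower_extend:
  assumes lg: "l \<ge> 1" "\<gamma> > 0" and c: "c > 0" and L: "L \<ge> 0" and s: "s \<ge> 0"
    and ev: "\<And>x. x \<ge> L \<Longrightarrow> c * (1 + x) powr s * exp (\<gamma> * x powr l) \<le> real_profile l \<gamma> j x"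
  shows "\<exists>c>0. \<forall>x\<ge>0. c * (1 + x) powr s * exp (\<gamma> * x powr l) \<le> real_profile l \<gamma> j x"
proof -
  define B where "B = (1 + L) powr s * exp (\<gamma> * L powr l)"
  have B: "B > 0" using L by (simp add: B_def)
  define d where "d = min c (real_profile l \<gamma> j 0 / B)"
  have d: "d > 0" "d \<le> c" "d * B \<le> real_profile l \<gamma> j 0"
    using c B real_profile_pos[OF lg, of 0 j] by (auto simp: d_def min_def field_simps)
  show ?thesis
  proof (intro exI[of _ d] conjI d(1) allI impI)
    fix x :: real assume x: "x \<ge> 0"
    show "d * (1 + x) powr s * exp (\<gamma> * x powr l) \<le> real_profile l \<gamma> j x"
    proof (cases "x \<ge> L")
      case True
      have "d * (1 + x) powr s * exp (\<gamma> * x powr l) \<le> c * (1 + x) powr s * exp (\<gamma> * x powr l)"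
        using d by (intro mult_right_mono) auto
      then show ?thesis using ev[OF True] by linarith
    next
      case False
      have "(1 + x) powr s * exp (\<gamma> * x powr l) \<le> B"
        unfolding B_def using False x s lg by (intro mult_mono powr_mono2) (auto intro!: mult_left_mono powr_mono2)
      then have "d * ((1 + x) powr s * exp (\<gamma> * x powr l)) \<le> d * B" using d by (intro mult_left_mono) auto
      then show ?thesis using d(3) real_profile_mono[OF lg order_refl x, of j] by (simp only: mult.assoc)
    qed
  qed
qed

lemma real_profile_lower_0:
  assumes l: "l \<ge> 1" and g: "\<gamma> > 0"
  shows "\<exists>c>0. \<forall>x\<ge>0. c * (1 + x) powr 0 * exp (\<gamma> * x powr l) \<le> real_profile l \<gamma> 0 x"
proof -
  obtain C L where C: "C > 0" and CL: "\<And>x p. norm x \<ge> L \<Longrightarrow> x = p powr (of_real (1 / l)) \<Longrightarrow> Re p > 3/2 * (1/6) * norm p \<Longrightarrow>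
      norm (scaled_ml l \<gamma> x - of_real l * exp (of_real \<gamma> * p)) \<le> C * exp (3 * (1/6) * \<gamma> * norm x powr l)"
    using scaled_ml_asymptotics[OF l g, of "1/6"] by auto
  \<comment> \<open>beyond this threshold the error \<open>C * E\<close> is at most half of \<open>E * E\<close>\<close>
  define L' where "L' = max (max 1 L) (4 * C / \<gamma>)"
  show ?thesis
  proof (rule real_profile_lower_extend[OF l g, where c = "1/2" and L = L'])
    fix x assume x: "x \<ge> L'"
    have x1: "x \<ge> 1" "x \<ge> L" "x \<ge> 4 * C / \<gamma>" using x by (auto simp: L'_def)
    define E where "E = exp (\<gamma> / 2 * x powr l)"
    have EE: "exp (\<gamma> * x powr l) = E * E" unfolding E_def exp_add[symmetric] by simp
    have "complex_of_real x = of_real (x powr l) powr (of_real (1 / l))"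
      using l x1 by (simp only: powr_of_real powr_ge_zero) (simp add: powr_powr)
    then have "norm (scaled_ml l \<gamma> (of_real x) - of_real l * exp (of_real \<gamma> * of_real (x powr l))) \<le> C * exp (3 * (1/6) * \<gamma> * norm (complex_of_real x) powr l)"
      by (rule CL[rotated]) (use x1 in simp_all)
    moreover have "of_real l * exp (of_real \<gamma> * of_real (x powr l)) = complex_of_real (l * exp (\<gamma> * x powr l))"
      by (simp only: of_real_mult exp_of_real flip: of_real_mult)
    moreover have "3 * (1/6) * \<gamma> * norm (complex_of_real x) powr l = \<gamma> / 2 * x powr l" using x1 by simp
    ultimately have n: "norm (scaled_ml l \<gamma> (of_real x) - of_real (l * (E * E))) \<le> C * E" by (simp only: EE E_def)
    have "\<bar>Re (scaled_ml l \<gamma> (of_real x)) - l * (E * E)\<bar> \<le> norm (scaled_ml l \<gamma> (of_real x) - of_real (l * (E * E)))"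
      using abs_Re_le_cmod[of "scaled_ml l \<gamma> (of_real x) - of_real (l * (E * E))"] by (simp only: minus_complex.sel Re_complex_of_real)
    then have 1: "l * (E * E) - C * E \<le> Re (scaled_ml l \<gamma> (of_real x))" using n by linarith
    have "2 * C \<le> \<gamma> / 2 * x" using x1(3) g by (simp add: field_simps)
    also have "x \<le> x powr l" using powr_mono[of 1 l x] l x1 by simp
    then have "\<gamma> / 2 * x \<le> \<gamma> / 2 * x powr l" using g by (intro mult_left_mono) auto
    also have "\<dots> \<le> E" unfolding E_def using exp_ge_add_one_self[of "\<gamma> / 2 * x powr l"] by linarith
    finally have "2 * C * E \<le> E * E" by (intro mult_right_mono) (simp_all add: E_def)
    moreover have "1 * (E * E) \<le> l * (E * E)" using l by (intro mult_right_mono) auto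
    ultimately have "1/2 * (E * E) \<le> Re (scaled_ml l \<gamma> (of_real x))" using 1 by linarith
    moreover have "(1 + x) powr 0 = 1" using x1 by simp
    ultimately show "1/2 * (1 + x) powr 0 * exp (\<gamma> * x powr l) \<le> real_profile l \<gamma> 0 x"
      by (simp add: EE real_profile_def bergman_profile_def)
  qed (auto simp: L'_def)
qed

text \<open>Induction on the number of derivatives. Over an interval of length \<open>h = K * x powr (1 - l)\<close> ending at \<open>x\<close> the majorant drops by the
factor \<open>exp (- \<gamma> * K)\<close>, so for large \<open>K\<close> the increment is at least half of the lower bound at \<open>x\<close>. By the mean value theorem and monotonicity
the next derivative is at least the increment divided by \<open>h\<close>.\<close>

lemma real_profile_lower:
  assumes l: "l \<ge> 1" and g: "\<gamma> > 0"
  shows "\<exists>c>0. \<forall>x\<ge>0. c * (1 + x) powr (real j * (l - 1)) * exp (\<gamma> * x powr l) \<le> real_profile l \<gamma> j x"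
proof (induction j)
  case 0
  then show ?case using real_profile_lower_0[OF l g] by simp
next
  case (Suc j)
  define s where "s = real j * (l - 1)"
  have s: "s \<ge> 0" using l by (simp add: s_def)
  obtain c where c: "c > 0" "\<And>x. x \<ge> 0 \<Longrightarrow> c * (1 + x) powr s * exp (\<gamma> * x powr l) \<le> real_profile l \<gamma> j x"
    using Suc unfolding s_def by blast
  obtain C where C: "C > 0" "\<And>x. x \<ge> 0 \<Longrightarrow> real_profile l \<gamma> j x \<le> C * (1 + x) powr s * exp (\<gamma> * x powr l)"
    using real_profile_upper[OF l g, of j] unfolding s_def by blast
  define K where "K = max 1 (ln (2 * C / c) / \<gamma>)"
  have K: "K \<ge> 1" "ln (2 * C / c) \<le> \<gamma> * K" using g by (auto simp: K_def max_def field_simps)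
  have "2 * C / c = exp (ln (2 * C / c))" using C c by simp
  also have "\<dots> \<le> exp (\<gamma> * K)" using K(2) by simp
  finally have eK: "C * exp (- (\<gamma> * K)) \<le> c / 2" using c by (simp add: exp_minus field_simps)
  define d where "d = c / (2 * K * real (Suc j)) * (1/2) powr (l - 1)"
  have d: "d > 0" using c K by (simp add: d_def)
  have "\<exists>c>0. \<forall>x\<ge>0. c * (1 + x) powr (s + (l - 1)) * exp (\<gamma> * x powr l) \<le> real_profile l \<gamma> (Suc j) x"
  proof (rule real_profile_lower_extend[OF l g d, where L = K])
    fix x assume x: "x \<ge> K"
    have x1: "x \<ge> 1" using x K by linarith
    define h where "h = K * x powr (1 - l)"
    have "x powr (1 - l) \<le> x powr 0" using x1 l by (intro powr_mono) auto
    then have "h \<le> K * 1" unfolding h_def using K x1 by (intro mult_left_mono) auto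
    then have "h \<le> x" using x by linarith
    moreover have "0 < h" using K x1 by (simp add: h_def)
    ultimately have h: "0 < h" "h \<le> x" by auto
    have r: "0 \<le> 1 - h / x" "1 - h / x \<le> 1" using h x1 by (auto simp: field_simps)
    have hx: "h / x * x powr l = K" unfolding h_def using x1 by (simp add: powr_diff)
    have "(x - h) powr l = (x * (1 - h / x)) powr l" using x1 by (simp add: right_diff_distrib)
    also have "\<dots> = x powr l * (1 - h / x) powr l" using x1 r by (intro powr_mult)
    also have "\<dots> \<le> x powr l * (1 - h / x)"
    proof (intro mult_left_mono)
      show "(1 - h / x) powr l \<le> 1 - h / x" using powr_mono'[of 1 l "1 - h / x"] r l by simp
    qed simp
    also have "\<dots> = x powr l - K" using hx by (simp add: right_diff_distrib mult.commute)
    finally have pw: "(x - h) powr l \<le> x powr l - K" .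
    define P where "P = (1 + x) powr s * exp (\<gamma> * x powr l)"
    have P0: "P > 0" using x1 by (simp add: P_def)
    have "real_profile l \<gamma> j (x - h) \<le> C * (1 + (x - h)) powr s * exp (\<gamma> * (x - h) powr l)" using h by (intro C(2)) simp
    also have "\<dots> \<le> C * (1 + x) powr s * exp (\<gamma> * (x powr l - K))"
      using h x1 s C(1) g pw by (intro mult_mono powr_mono2) (auto intro!: mult_left_mono)
    also have "\<dots> = (C * exp (- (\<gamma> * K))) * P"
    proof -
      have "\<gamma> * (x powr l - K) = \<gamma> * x powr l + - (\<gamma> * K)" by (simp add: right_diff_distrib)
      then show ?thesis unfolding P_def by (simp only: exp_add mult_ac)
    qed
    also have "\<dots> \<le> c / 2 * P" using eK P0 by (intro mult_right_mono) auto
    finally have u: "real_profile l \<gamma> j (x - h) \<le> c / 2 * P" .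
    have lo: "c * P \<le> real_profile l \<gamma> j x" using c(2)[of x] x1 by (simp add: P_def mult.assoc)
    obtain \<xi> where xi: "x - h < \<xi>" "\<xi> < x" "real_profile l \<gamma> j x - real_profile l \<gamma> j (x - h) = (x - (x - h)) * (real (Suc j) * real_profile l \<gamma> (Suc j) \<xi>)"
      using MVT2[of "x - h" x "real_profile l \<gamma> j", OF _ real_profile_derivative[OF l]] h by auto
    have "c / 2 * P \<le> h * (real (Suc j) * real_profile l \<gamma> (Suc j) \<xi>)" using xi(3) u lo by simp
    also have "\<dots> \<le> h * (real (Suc j) * real_profile l \<gamma> (Suc j) x)"
      using xi h by (intro mult_left_mono real_profile_mono[OF l g]) auto
    finally have m: "c / 2 * P \<le> h * (real (Suc j) * real_profile l \<gamma> (Suc j) x)" .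
    have "(1 + x) powr (l - 1) * (1/2) powr (l - 1) = ((1 + x) * (1/2)) powr (l - 1)" by (rule powr_mult[symmetric])
    also have "\<dots> \<le> x powr (l - 1)" using x1 l by (intro powr_mono2) auto
    finally have half: "(1 + x) powr (l - 1) * (1/2) powr (l - 1) \<le> x powr (l - 1)" .
    have "d * (1 + x) powr (s + (l - 1)) * exp (\<gamma> * x powr l) = c / (2 * K * real (Suc j)) * P * ((1 + x) powr (l - 1) * (1/2) powr (l - 1))"
      unfolding d_def P_def powr_add by (simp only: mult_ac)
    also have "\<dots> \<le> c / (2 * K * real (Suc j)) * P * x powr (l - 1)"
      using half c K P0 by (intro mult_left_mono) auto
    also have "\<dots> = (c / 2 * P) * (x powr (l - 1) / (K * real (Suc j)))" by simp
    also have "\<dots> \<le> (h * (real (Suc j) * real_profile l \<gamma> (Suc j) x)) * (x powr (l - 1) / (K * real (Suc j)))"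
      using m K by (intro mult_right_mono) auto
    also have "\<dots> = (x powr (1 - l) * x powr (l - 1)) * real_profile l \<gamma> (Suc j) x" using K unfolding h_def by (simp del: of_nat_Suc add: divide_simps)
    also have "x powr (1 - l) * x powr (l - 1) = 1" using x1 by (simp flip: powr_add)
    finally show "d * (1 + x) powr (s + (l - 1)) * exp (\<gamma> * x powr l) \<le> real_profile l \<gamma> (Suc j) x" by simp
  qed (use K s l in auto)
  moreover have "s + (l - 1) = real (Suc j) * (l - 1)" by (simp add: s_def algebra_simps)
  ultimately show ?case by simp
qed

section \<open>A lower bound for norms by point values\<close>

text \<open>For negative \<open>x\<close> the product of the right-hand side with the quadratic lower bound for \<open>exp (- x)\<close> is at least 1.\<close>

lemma exp_le_quadratic:
  fixes x :: real
  assumes "x \<le> 1" shows "exp x \<le> 1 + x + x\<^sup>2"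
proof (cases "x \<ge> 0")
  case True
  then show ?thesis using exp_bound[of x] assms by simp
next
  case False
  define y where "y = - x"
  have y: "y > 0" using False by (simp add: y_def)
  have p: "1 - y + y\<^sup>2 = (y - 1/2)\<^sup>2 + 3/4" by (simp add: power2_eq_square field_simps)
  have p0: "1 - y + y\<^sup>2 \<ge> 0" unfolding p by simp
  have "1 \<le> 1 + y\<^sup>2 / 2 + y ^ 3 / 2 + y ^ 4 / 2" using y by simp
  also have "\<dots> = (1 - y + y\<^sup>2) * (1 + y + y\<^sup>2 / 2)" by (simp add: power2_eq_square power3_eq_cube power4_eq_xxxx field_simps)
  also have "\<dots> \<le> (1 - y + y\<^sup>2) * exp y" using p0 exp_lower_Taylor_quadratic[of y] y by (intro mult_left_mono) auto
  finally have "1 * exp (- y) \<le> (1 - y + y\<^sup>2) * exp y * exp (- y)" by (intro mult_right_mono) auto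
  also have "(1 - y + y\<^sup>2) * exp y * exp (- y) = 1 - y + y\<^sup>2" by (simp add: exp_minus)
  finally show ?thesis by (simp add: y_def)
qed

text \<open>The second derivative of \<open>\<bar>a\<bar> powr (2 * l)\<close> has order \<open>\<bar>a\<bar> powr (2 * l - 2)\<close>, the reciprocal of the square of the admitted
step, so the Taylor remainder is bounded. Far out this is the inequality \<open>ln (1 + t) \<le> t\<close>; near the origin all terms are bounded.\<close>

lemma norm_powr_second_order_upper:
  fixes a h :: "'a::real_inner"
  assumes l: "l \<ge> 1" and h: "norm h \<le> (1 + norm a) powr (1 - l)"
  shows "norm (a + h) powr (2 * l) \<le> norm a powr (2 * l) + 2 * l * norm a powr (2 * l - 2) * (a \<bullet> h)
    + (l + 9 * l\<^sup>2 + (8 * l + 1) powr (2 * l) + 2 * l * (8 * l) powr (2 * l - 2) * (8 * l))"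
proof -
  define r where "r = norm a"
  have r0: "r \<ge> 0" by (simp add: r_def)
  have "(1 + r) powr (1 - l) \<le> (1 + r) powr 0" using l r0 by (intro powr_mono) auto
  also have "\<dots> = 1" using r0 by simp
  finally have h1: "norm h \<le> 1" using h by (simp add: r_def)
  have ah: "\<bar>a \<bullet> h\<bar> \<le> r * norm h" unfolding r_def by (rule Cauchy_Schwarz_ineq2)
  have extra: "0 \<le> l + 9 * l\<^sup>2" "0 \<le> (8 * l + 1) powr (2 * l)" "0 \<le> 2 * l * (8 * l) powr (2 * l - 2) * (8 * l)" using l by auto
  \<comment> \<open>beyond this radius the relative change \<open>t\<close> of the squared norm satisfies \<open>l * t \<le> 1\<close>, as required for the quadratic bound of \<open>exp\<close>\<close>
  show ?thesis
  proof (cases "r \<le> 8 * l")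
    case True
    have "norm (a + h) \<le> 8 * l + 1" using norm_triangle_ineq[of a h] h1 True by (simp add: r_def)
    then have 1: "norm (a + h) powr (2 * l) \<le> (8 * l + 1) powr (2 * l)" using l by (intro powr_mono2) auto
    have "r powr (2 * l - 2) * \<bar>a \<bullet> h\<bar> \<le> (8 * l) powr (2 * l - 2) * (8 * l)"
    proof (intro mult_mono powr_mono2)
      have "r * norm h \<le> r * 1" using h1 r0 by (intro mult_left_mono)
      then show "\<bar>a \<bullet> h\<bar> \<le> 8 * l" using ah True by linarith
    qed (use True l r0 in auto)
    then have "2 * l * (r powr (2 * l - 2) * \<bar>a \<bullet> h\<bar>) \<le> 2 * l * ((8 * l) powr (2 * l - 2) * (8 * l))" using l by (intro mult_left_mono) auto
    moreover have "- (2 * l * (r powr (2 * l - 2) * \<bar>a \<bullet> h\<bar>)) \<le> 2 * l * r powr (2 * l - 2) * (a \<bullet> h)"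
    proof -
      have "2 * l * r powr (2 * l - 2) * (- \<bar>a \<bullet> h\<bar>) \<le> 2 * l * r powr (2 * l - 2) * (a \<bullet> h)" using l by (intro mult_left_mono) auto
      then show ?thesis by (simp add: mult.assoc)
    qed
    moreover have "0 \<le> r powr (2 * l)" by simp
    ultimately show ?thesis using 1 extra(1) unfolding r_def[symmetric] mult.assoc[symmetric] by linarith
  next
    case False
    then have r8: "r > 8 * l" by simp
    have r: "r > 8" using r8 l by linarith
    define k where "k = norm h"
    have k: "0 \<le> k" "k \<le> 1" using h1 by (auto simp: k_def)
    define d where "d = 2 * (a \<bullet> h) + k\<^sup>2"
    define t where "t = d / r\<^sup>2"
    have sq: "(norm (a + h))\<^sup>2 = r\<^sup>2 + d"
      unfolding d_def r_def k_def power2_norm_eq_inner by (simp add: inner_simps inner_commute[of h a])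
    have "k\<^sup>2 \<le> r * k" using k r by (simp add: power2_eq_square mult_right_mono)
    then have dk: "\<bar>d\<bar> \<le> 3 * (r * k)" using ah zero_le_power2[of k] unfolding d_def k_def[symmetric] abs_le_iff
      by (intro conjI) linarith+
    have "r * k \<le> r * 1" using k r by (intro mult_left_mono) auto
    then have "\<bar>d\<bar> \<le> 3 * r" using dk by linarith
    then have "\<bar>t\<bar> \<le> 3 * r / r\<^sup>2" unfolding t_def by (simp add: divide_right_mono)
    also have "\<dots> = 3 / r" using r by (simp add: power2_eq_square)
    finally have t3: "\<bar>t\<bar> \<le> 3 / r" .
    have "l * \<bar>t\<bar> \<le> l * (3 / r)" using t3 l by (intro mult_left_mono) auto
    also have "\<dots> \<le> 1" using r8 r l by (simp add: field_simps)
    finally have lt: "l * t \<le> 1" using l abs_ge_self[of t] by (meson mult_left_mono order_trans zero_le_one)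
    have "3 / r < 1" using r by simp
    then have t1: "1 + t > 0" using t3 by linarith
    have nn: "norm (a + h) powr (2 * l) = r powr (2 * l) * (1 + t) powr l"
    proof -
      have sqeq: "(norm (a + h))\<^sup>2 = r\<^sup>2 * (1 + t)" unfolding sq t_def using r by (simp add: distrib_left)
      have dbl: "y powr (2 * l) = (y\<^sup>2) powr l" if "y \<ge> 0" for y :: real
        using that powr_powr[of y 2 l] by (cases "y = 0") (auto simp: powr_numeral)
      show ?thesis unfolding dbl[OF norm_ge_zero] dbl[OF r0] sqeq by (rule powr_mult)
    qed
    have "(1 + t) powr l = exp (l * ln (1 + t))" using t1 by (simp add: powr_def)
    also have "\<dots> \<le> exp (l * t)" using l t1 ln_add_one_self_le_self2[of t] by (simp add: mult_left_mono)
    also have "\<dots> \<le> 1 + l * t + (l * t)\<^sup>2" by (rule exp_le_quadratic[OF lt])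
    finally have "norm (a + h) powr (2 * l) \<le> r powr (2 * l) * (1 + l * t + (l * t)\<^sup>2)" unfolding nn by (intro mult_left_mono) auto
    also have "\<dots> = r powr (2 * l) + l * (r powr (2 * l) * t) + l\<^sup>2 * (r powr (2 * l) * t\<^sup>2)"
      unfolding distrib_left power_mult_distrib mult_1_right by (simp only: mult_ac)
    finally have main: "norm (a + h) powr (2 * l) \<le> r powr (2 * l) + l * (r powr (2 * l) * t) + l\<^sup>2 * (r powr (2 * l) * t\<^sup>2)" .
    define R where "R = r powr (2 * l - 2)"
    have R0: "R \<ge> 0" by (simp add: R_def)
    have Rr: "r powr (2 * l) = R * r\<^sup>2" unfolding R_def using r by (simp add: powr_diff powr_numeral)
    have "k \<le> (1 + r) powr (1 - l)" using h by (simp add: k_def r_def)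
    also have "\<dots> \<le> r powr (1 - l)" using r l by (intro powr_mono2') auto
    finally have "k\<^sup>2 \<le> (r powr (1 - l))\<^sup>2" using k by (intro power_mono)
    then have "R * k\<^sup>2 \<le> R * (r powr (1 - l))\<^sup>2" using R0 by (intro mult_left_mono)
    also have "\<dots> = r powr ((2 * l - 2) + ((1 - l) + (1 - l)))" unfolding R_def power2_eq_square powr_add ..
    also have "\<dots> = 1" using r by simp
    finally have Rk: "R * k\<^sup>2 \<le> 1" .
    have "r powr (2 * l) * t = R * d" unfolding Rr t_def using r by simp
    also have "\<dots> = 2 * R * (a \<bullet> h) + R * k\<^sup>2" unfolding d_def by (simp add: distrib_left)
    finally have lin: "r powr (2 * l) * t \<le> 2 * R * (a \<bullet> h) + 1" using Rk by linarith
    have "d\<^sup>2 \<le> (3 * (r * k))\<^sup>2" using dk by (rule abs_le_square_iff[THEN iffD1, OF order_trans[OF _ abs_ge_self]])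
    then have "d\<^sup>2 / r\<^sup>2 \<le> (3 * (r * k))\<^sup>2 / r\<^sup>2" by (rule divide_right_mono) simp
    also have "\<dots> = 9 * k\<^sup>2" using r by (simp add: power_mult_distrib)
    finally have "R * (d\<^sup>2 / r\<^sup>2) \<le> R * (9 * k\<^sup>2)" using R0 by (intro mult_left_mono)
    moreover have "r powr (2 * l) * t\<^sup>2 = R * (d\<^sup>2 / r\<^sup>2)" unfolding Rr t_def power_divide using r by (simp add: power2_eq_square)
    ultimately have quad: "r powr (2 * l) * t\<^sup>2 \<le> 9" using Rk by linarith
    have "l * (r powr (2 * l) * t) \<le> l * (2 * R * (a \<bullet> h) + 1)" using lin l by (intro mult_left_mono) auto
    moreover have "l\<^sup>2 * (r powr (2 * l) * t\<^sup>2) \<le> l\<^sup>2 * 9" using quad by (intro mult_left_mono) auto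
    ultimately have "norm (a + h) powr (2 * l) \<le> r powr (2 * l) + l * (2 * R * (a \<bullet> h) + 1) + l\<^sup>2 * 9" using main by linarith
    also have "l * (2 * R * (a \<bullet> h) + 1) = 2 * l * R * (a \<bullet> h) + l" by (simp add: distrib_left)
    finally show ?thesis using extra(2,3) unfolding r_def[symmetric] R_def by linarith
  qed
qed

text \<open>The mean value property at the centre of a ball for the entire function \<open>f\<close> multiplied by the exponential of a
linear function that vanishes at the centre.\<close>

lemma entire_mean_value_bound:
  fixes f :: "complex ^ 'n \<Rightarrow> complex"
  assumes f: "entire f"
  shows "integrable dV (\<lambda>u. indicator (cball 0 1) u * norm (f (a + \<delta> *\<^sub>R u) * exp (- (q * cprod u z))))" (is "integrable dV ?N")
    and "norm (f a) \<le> (\<integral>u. indicator (cball 0 1) u * norm (f (a + \<delta> *\<^sub>R u) * exp (- (q * cprod u z))) \<partial>dV)"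
proof -
  interpret U: prob_space unit_interval by (rule prob_space_unit_interval)
  define F where "F u = f (a + \<delta> *\<^sub>R u) * exp (- (q * cprod u z))" for u
  define \<Phi> where "\<Phi> u = complex_of_real (indicator (cball 0 1) u) * F u" for u
  have Fc: "continuous_on UNIV F" unfolding F_def
    by (intro continuous_intros continuous_on_compose2[OF entire_continuous[OF f]] linear_continuous_on bounded_linear_cprod) auto
  have Fm0: "F \<in> borel_measurable borel" using Fc by (rule borel_measurable_continuous_onI)
  have Fm: "\<Phi> \<in> borel_measurable borel" unfolding \<Phi>_def
    by (intro borel_measurable_times borel_measurable_continuous_on[of complex_of_real] continuous_intros borel_measurable_indicator Fm0) simp
  have nF: "norm (\<Phi> u) = indicator (cball 0 1) u * norm (F u)" for u by (simp add: \<Phi>_def norm_mult)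
  have "compact (F ` cball 0 1)" by (intro compact_continuous_image continuous_on_subset[OF Fc]) auto
  then obtain B where B: "\<And>u. u \<in> cball 0 1 \<Longrightarrow> norm (F u) \<le> B" by (meson bounded_iff compact_imp_bounded imageI)
  have int: "integrable dV \<Phi>"
  proof (rule Bochner_Integration.integrable_bound)
    show "integrable dV (\<lambda>u :: complex ^ 'n. B * indicator (cball 0 1) u)" by (intro integrable_mult_right integrable_dV_cball)
    have "norm (\<Phi> u) \<le> norm (B * indicator (cball 0 1) u)" for u
      using B[of u] unfolding nF by (auto simp: indicator_def intro: order_trans[OF _ abs_ge_self])
    then show "AE u in dV. norm (\<Phi> u) \<le> norm (B * indicator (cball 0 1) u)" by simp
  qed (use Fm in simp)
  show N: "integrable dV ?N" using integrable_norm[OF int] unfolding nF F_def .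
  have "(\<integral>t. \<Phi> (circle_param t *s u) \<partial>unit_interval) = complex_of_real (indicator (cball 0 1) u) * f a" for u
  proof -
    have "F (x *s u) = f (a + x *s (\<delta> *\<^sub>R u)) * exp (- (q * (x * cprod u z)))" for x
    proof -
      have "\<delta> *\<^sub>R (x *s u) = x *s (\<delta> *\<^sub>R u)" by (simp add: vec_eq_iff)
      then show ?thesis unfolding F_def cprod_smult by simp
    qed
    moreover have "(\<lambda>x. f (a + x *s (\<delta> *\<^sub>R u)) * exp (- (q * (x * cprod u z)))) holomorphic_on UNIV"
      by (intro holomorphic_intros entire_line_holomorphic[OF f])
    ultimately have "(\<lambda>x. F (x *s u)) holomorphic_on UNIV" by simp
    from circle_taylor_coefficient[OF this, of 0] have "(\<integral>t. F (circle_param t *s u) \<partial>unit_interval) = F (0 *s u)" by simp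
    also have "F (0 *s u) = f a" by (simp add: F_def cprod_def)
    finally have m: "(\<integral>t. F (circle_param t *s u) \<partial>unit_interval) = f a" .
    have "\<Phi> (circle_param t *s u) = complex_of_real (indicator (cball 0 1) u) * F (circle_param t *s u)" for t
      unfolding \<Phi>_def by (simp add: indicator_def norm_smult_circle)
    then show ?thesis using m by simp
  qed
  then have "(\<integral>u. \<Phi> u \<partial>dV) = (\<integral>u. complex_of_real (indicator (cball 0 1) (u :: complex ^ 'n)) * f a \<partial>dV)"
    using rotation_average(2)[OF int Fm] by simp
  also have "\<dots> = (\<integral>u. complex_of_real (indicator (cball 0 1) (u :: complex ^ 'n)) \<partial>dV) * f a" by (rule integral_mult_left_zero)
  also have "(\<integral>u. complex_of_real (indicator (cball 0 1) (u :: complex ^ 'n)) \<partial>dV) = 1" unfolding integral_complex_of_real dV_cball by simp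
  finally have "f a = (\<integral>u. \<Phi> u \<partial>dV)" by simp
  then have "norm (f a) \<le> (\<integral>u. norm (\<Phi> u) \<partial>dV)" using integral_norm_bound[of dV \<Phi>] by simp
  then show "norm (f a) \<le> (\<integral>u. ?N u \<partial>dV)" unfolding nF F_def .
qed

lemma powr_comparable_lower:
  fixes s :: real
  assumes c: "0 < c1" "c1 \<le> c2" and Y: "0 < Y" "c1 * Y \<le> X" "X \<le> c2 * Y"
  shows "min (c1 powr s) (c2 powr s) * Y powr s \<le> X powr s"
proof -
  have c2: "c2 > 0" using c by linarith
  show ?thesis
  proof (cases "s \<ge> 0")
    case True
    have "min (c1 powr s) (c2 powr s) * Y powr s \<le> c1 powr s * Y powr s" by (intro mult_right_mono) auto
    also have "\<dots> = (c1 * Y) powr s" by (rule powr_mult[symmetric])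
    also have "\<dots> \<le> X powr s" using Y c True by (intro powr_mono2) auto
    finally show ?thesis .
  next
    case False
    have X: "X > 0" using Y c mult_pos_pos[of c1 Y] by linarith
    have "min (c1 powr s) (c2 powr s) * Y powr s \<le> c2 powr s * Y powr s" by (intro mult_right_mono) auto
    also have "\<dots> = (c2 * Y) powr s" by (rule powr_mult[symmetric])
    also have "\<dots> \<le> X powr s" using Y X False by (intro powr_mono2') auto
    finally show ?thesis .
  qed
qed

text \<open>The first order term of the exponent is the real part of a complex linear function of \<open>h\<close>.\<close>

lemma weight_lower:
  fixes l a \<rho> t :: real
  assumes l: "l \<ge> 1" and a: "a > 0" and t: "t > 0"
  shows "\<exists>c>0. \<forall>z h :: complex ^ 'n. norm h \<le> (1 + t * norm z) powr (1 - l) \<longrightarrow>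
    c * (1 + norm z) powr \<rho> * exp (- (a / 2) * (t * norm z) powr (2 * l)) * exp (- (a * l * t * (t * norm z) powr (2 * l - 2) * Re (cprod h z)))
      \<le> (1 + norm (t *\<^sub>R z + h)) powr \<rho> * exp (- (a / 2) * norm (t *\<^sub>R z + h) powr (2 * l))"
proof -
  define E where "E = l + 9 * l\<^sup>2 + (8 * l + 1) powr (2 * l) + 2 * l * (8 * l) powr (2 * l - 2) * (8 * l)"
  define m where "m = min ((min 1 t / 2) powr \<rho>) ((2 + t) powr \<rho>)"
  have m: "m > 0" using t by (simp add: m_def)
  show ?thesis
  proof (intro exI[of _ "m * exp (- (a / 2) * E)"] conjI allI impI)
    show "m * exp (- (a / 2) * E) > 0" using m by simp
    fix z h :: "complex ^ 'n"
    assume h: "norm h \<le> (1 + t * norm z) powr (1 - l)"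
    define Z where "Z = norm z"
    have Z0: "Z \<ge> 0" by (simp add: Z_def)
    have tz: "norm (t *\<^sub>R z) = t * Z" using t by (simp add: Z_def)
    have tZ0: "t * Z \<ge> 0" using t Z0 by simp
    have "(1 + t * Z) powr (1 - l) \<le> (1 + t * Z) powr 0" using l tZ0 by (intro powr_mono) auto
    also have "\<dots> = 1" using tZ0 by simp
    finally have h1: "norm h \<le> 1" using h by (simp add: Z_def)
    have poly: "m * (1 + Z) powr \<rho> \<le> (1 + norm (t *\<^sub>R z + h)) powr \<rho>" unfolding m_def
    proof (rule powr_comparable_lower)
      show "0 < min 1 t / 2" "min 1 t / 2 \<le> 2 + t" "0 < 1 + Z" using t Z0 by auto
      have "min 1 t * (1 + Z) = min 1 t + min 1 t * Z" by (simp add: distrib_left)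
      also have "\<dots> \<le> 1 + t * Z" using Z0 by (intro add_mono mult_right_mono) auto
      finally have 1: "min 1 t * (1 + Z) \<le> 1 + t * Z" .
      have aux: "1 + y \<le> 2 * (1 + x)" if "y \<le> x + k" "k \<le> 1" "0 \<le> x" for x y k :: real using that unfolding distrib_left by linarith
      have "t * Z \<le> norm (t *\<^sub>R z + h) + norm h" using norm_triangle_ineq4[of "t *\<^sub>R z + h" h] tz by simp
      then have "1 + t * Z \<le> 2 * (1 + norm (t *\<^sub>R z + h))" using aux[OF _ h1] by simp
      then show "min 1 t / 2 * (1 + Z) \<le> 1 + norm (t *\<^sub>R z + h)" using 1 by simp
      have "norm (t *\<^sub>R z + h) \<le> t * Z + 1" using norm_triangle_ineq[of "t *\<^sub>R z" h] tz h1 by linarith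
      moreover have "(2 + t) * (1 + Z) = 2 + t + 2 * Z + t * Z" by (simp add: algebra_simps)
      ultimately show "1 + norm (t *\<^sub>R z + h) \<le> (2 + t) * (1 + Z)" using t Z0 by linarith
    qed
    define Q where "Q = (t * Z) powr (2 * l - 2)"
    have "norm (t *\<^sub>R z + h) powr (2 * l) \<le> norm (t *\<^sub>R z) powr (2 * l) + 2 * l * norm (t *\<^sub>R z) powr (2 * l - 2) * (t *\<^sub>R z \<bullet> h) + E"
      unfolding E_def by (rule norm_powr_second_order_upper[OF l]) (use h in \<open>simp only: tz Z_def\<close>)
    also have "t *\<^sub>R z \<bullet> h = t * Re (cprod h z)" by (simp add: Re_cprod inner_commute)
    finally have q: "norm (t *\<^sub>R z + h) powr (2 * l) \<le> (t * Z) powr (2 * l) + 2 * l * Q * (t * Re (cprod h z)) + E"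
      unfolding tz Q_def .
    have "a / 2 * norm (t *\<^sub>R z + h) powr (2 * l) \<le> a / 2 * ((t * Z) powr (2 * l) + 2 * l * Q * (t * Re (cprod h z)) + E)"
      using q a by (intro mult_left_mono) auto
    also have "\<dots> = a / 2 * (t * Z) powr (2 * l) + a * l * t * Q * Re (cprod h z) + a / 2 * E" by (simp add: distrib_left)
    finally have e: "- (a / 2) * E + (- (a / 2) * (t * Z) powr (2 * l) + - (a * l * t * Q * Re (cprod h z))) \<le> - (a / 2) * norm (t *\<^sub>R z + h) powr (2 * l)"
      by (simp only: mult_minus_left)
    have "m * exp (- (a / 2) * E) * (1 + Z) powr \<rho> * exp (- (a / 2) * (t * Z) powr (2 * l)) * exp (- (a * l * t * Q * Re (cprod h z)))
      = m * (1 + Z) powr \<rho> * exp (- (a / 2) * E + (- (a / 2) * (t * Z) powr (2 * l) + - (a * l * t * Q * Re (cprod h z))))"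
      unfolding exp_add by (simp only: mult_ac)
    also have "\<dots> \<le> (1 + norm (t *\<^sub>R z + h)) powr \<rho> * exp (- (a / 2) * norm (t *\<^sub>R z + h) powr (2 * l))"
      using poly e m by (intro mult_mono) auto
    finally show "m * exp (- (a / 2) * E) * (1 + norm z) powr \<rho> * exp (- (a / 2) * (t * norm z) powr (2 * l)) * exp (- (a * l * t * (t * norm z) powr (2 * l - 2) * Re (cprod h z)))
      \<le> (1 + norm (t *\<^sub>R z + h)) powr \<rho> * exp (- (a / 2) * norm (t *\<^sub>R z + h) powr (2 * l))"
      unfolding Z_def Q_def .
  qed
qed

text \<open>Restrict the integral to the ball of radius \<open>(1 + t * \<bar>z\<bar>) powr (1 - l)\<close> about \<open>t z\<close>. The weight is there at least a
constant times its value at the centre times the modulus of a nowhere vanishing entire function, and the mean value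
property applies to the product of that function with \<open>f\<close>. The volume of the ball gives the power of \<open>1 + \<bar>z\<bar>\<close>.\<close>

lemma Fock_norm_1_point_lower:
  fixes l a \<rho> t :: real
  assumes l: "l \<ge> 1" and a: "a > 0" and t: "t > 0"
  shows "\<exists>c>0. \<forall>(z :: complex ^ 'n) f. f \<in> Fock_space l 1 a \<rho> \<longrightarrow>
    c * norm (f (t *\<^sub>R z)) * (1 + norm z) powr (\<rho> - 2 * real CARD('n) * (l - 1)) * exp (- (a / 2) * (t * norm z) powr (2 * l))
      \<le> Fock_norm l 1 a \<rho> f"
proof -
  obtain c where c: "c > 0" and wl: "\<And>z h :: complex ^ 'n. norm h \<le> (1 + t * norm z) powr (1 - l) \<Longrightarrow>
    c * (1 + norm z) powr \<rho> * exp (- (a / 2) * (t * norm z) powr (2 * l)) * exp (- (a * l * t * (t * norm z) powr (2 * l - 2) * Re (cprod h z)))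
      \<le> (1 + norm (t *\<^sub>R z + h)) powr \<rho> * exp (- (a / 2) * norm (t *\<^sub>R z + h) powr (2 * l))"
    using weight_lower[OF l a t, where 'n = 'n and \<rho> = \<rho>] by blast
  define n where "n = CARD('n)"
  define s where "s = - (2 * real n * (l - 1))"
  have s: "s \<le> 0" using l by (simp add: s_def)
  define b where "b = max 1 t powr s"
  have b: "b > 0" by (simp add: b_def)
  show ?thesis
  proof (intro exI[of _ "b * c"] conjI allI impI)
    show "b * c > 0" using b c by simp
    fix z :: "complex ^ 'n" and f :: "complex ^ 'n \<Rightarrow> complex" assume f: "f \<in> Fock_space l 1 a \<rho>"
    have ent: "entire f" and int: "integrable dV (weighted_abs l a \<rho> f)" using f by (auto simp: Fock_space_def)
    define \<delta> where "\<delta> = (1 + t * norm z) powr (1 - l)"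
    have base: "1 + t * norm z > 0" using t by (simp add: add_pos_nonneg)
    then have \<delta>: "\<delta> > 0" by (simp add: \<delta>_def)
    define q where "q = a * l * t * (t * norm z) powr (2 * l - 2) * \<delta>"
    define P where "P = c * (1 + norm z) powr \<rho> * exp (- (a / 2) * (t * norm z) powr (2 * l))"
    have P: "P > 0" unfolding P_def by (intro mult_pos_pos c exp_gt_zero) (simp add: add_pos_nonneg add_nonneg_eq_0_iff)
    define W where "W = weighted_abs l a \<rho> f"
    have Wm: "W \<in> borel_measurable borel" unfolding W_def by (rule weighted_abs_measurable[OF ent])
    define N where "N u = indicator (cball 0 1) u * norm (f (t *\<^sub>R z + \<delta> *\<^sub>R u) * exp (- (of_real q * cprod u z)))" for u
    have pt: "P * N u \<le> W (t *\<^sub>R z + \<delta> *\<^sub>R u)" for u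
    proof (cases "u \<in> cball 0 1")
      case True
      have "\<delta> * norm u \<le> \<delta> * 1" using True \<delta> by (intro mult_left_mono) auto
      then have "norm (\<delta> *\<^sub>R u) \<le> (1 + t * norm z) powr (1 - l)" using \<delta> by (simp add: \<delta>_def)
      note w = wl[OF this]
      have "Re (cprod (\<delta> *\<^sub>R u) z) = \<delta> * Re (cprod u z)" by (simp add: Re_cprod)
      then have "a * l * t * (t * norm z) powr (2 * l - 2) * Re (cprod (\<delta> *\<^sub>R u) z) = q * Re (cprod u z)"
        unfolding q_def by simp
      with w have w': "P * exp (- (q * Re (cprod u z))) \<le> (1 + norm (t *\<^sub>R z + \<delta> *\<^sub>R u)) powr \<rho> * exp (- (a / 2) * norm (t *\<^sub>R z + \<delta> *\<^sub>R u) powr (2 * l))"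
        unfolding P_def by (simp only:)
      have "P * N u = norm (f (t *\<^sub>R z + \<delta> *\<^sub>R u)) * (P * exp (- (q * Re (cprod u z))))"
        using True unfolding N_def by (simp add: norm_mult)
      also have "\<dots> \<le> norm (f (t *\<^sub>R z + \<delta> *\<^sub>R u)) * ((1 + norm (t *\<^sub>R z + \<delta> *\<^sub>R u)) powr \<rho> * exp (- (a / 2) * norm (t *\<^sub>R z + \<delta> *\<^sub>R u) powr (2 * l)))"
        using w' by (intro mult_left_mono) auto
      finally show ?thesis unfolding W_def weighted_abs_def by (simp only: mult.assoc)
    qed (simp add: N_def W_def)
    have Wi: "integrable dV (\<lambda>u. W (t *\<^sub>R z + \<delta> *\<^sub>R u))"
      using dV_affine_integral(1)[OF Wm, of \<delta> "t *\<^sub>R z"] \<delta> int by (simp add: W_def)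
    note Nb = entire_mean_value_bound[OF ent, of "t *\<^sub>R z" \<delta> "of_real q" z, folded N_def]
    have "P * norm (f (t *\<^sub>R z)) \<le> P * (\<integral>u. N u \<partial>dV)" using Nb(2) P by (intro mult_left_mono) auto
    also have "\<dots> = (\<integral>u. P * N u \<partial>dV)" by simp
    also have "\<dots> \<le> (\<integral>u. W (t *\<^sub>R z + \<delta> *\<^sub>R u) \<partial>dV)" using Nb(1) Wi pt by (intro integral_mono) auto
    finally have 1: "\<delta> ^ (2 * n) * (P * norm (f (t *\<^sub>R z))) \<le> \<delta> ^ (2 * n) * (\<integral>u. W (t *\<^sub>R z + \<delta> *\<^sub>R u) \<partial>dV)"
      using \<delta> by (intro mult_left_mono) auto
    also have "\<dots> = (\<integral>w. W w \<partial>dV)" using dV_affine_integral(2)[OF Wm, of \<delta> "t *\<^sub>R z"] \<delta> by (simp add: n_def)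
    also have "\<dots> = Fock_norm l 1 a \<rho> f" by (simp add: Fock_norm_1 W_def)
    finally have 1: "\<delta> ^ (2 * n) * (P * norm (f (t *\<^sub>R z))) \<le> Fock_norm l 1 a \<rho> f" .
    have "\<delta> ^ (2 * n) = \<delta> powr real (2 * n)" using \<delta> by (rule powr_realpow[symmetric])
    also have "\<dots> = (1 + t * norm z) powr s" unfolding \<delta>_def powr_powr s_def by (rule arg_cong[of _ _ "\<lambda>y. _ powr y"]) (simp add: algebra_simps)
    finally have d: "\<delta> ^ (2 * n) = (1 + t * norm z) powr s" .
    have "1 + t * norm z \<le> max 1 t * (1 + norm z)"
      unfolding distrib_left by (intro add_mono mult_right_mono) auto
    then have "(max 1 t * (1 + norm z)) powr s \<le> (1 + t * norm z) powr s" using base s by (intro powr_mono2') auto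
    then have d2: "b * (1 + norm z) powr s \<le> \<delta> ^ (2 * n)" unfolding d b_def powr_mult .
    have "b * c * norm (f (t *\<^sub>R z)) * (1 + norm z) powr (\<rho> + s) * exp (- (a / 2) * (t * norm z) powr (2 * l))
      = (b * (1 + norm z) powr s) * (P * norm (f (t *\<^sub>R z)))"
      unfolding P_def powr_add by (simp only: mult_ac)
    also have "\<dots> \<le> \<delta> ^ (2 * n) * (P * norm (f (t *\<^sub>R z)))" using d2 P by (intro mult_right_mono) auto
    also note 1
    finally show "b * c * norm (f (t *\<^sub>R z)) * (1 + norm z) powr (\<rho> - 2 * real CARD('n) * (l - 1)) * exp (- (a / 2) * (t * norm z) powr (2 * l))
      \<le> Fock_norm l 1 a \<rho> f" unfolding s_def n_def by simp
  qed
qed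

text \<open>The point evaluation is taken at \<open>t z\<close> with \<open>t powr l = \<gamma> / a\<close>, where the weighted kernel is largest.\<close>

lemma Fock_norm_bergman_profile_lower:
  fixes l a \<gamma> \<rho> :: real
  assumes l: "l \<ge> 1" and a: "a > 0" and g: "\<gamma> > 0"
    and mem: "\<And>z :: complex ^ 'n. (\<lambda>w. bergman_profile l \<gamma> CARD('n) (cprod w z)) \<in> Fock_space l 1 a \<rho>"
  shows "\<exists>c>0. \<forall>z :: complex ^ 'n. c * ((1 + norm z) powr \<rho> * exp (\<gamma>\<^sup>2 * norm z powr (2 * l) / (2 * a)))
    \<le> Fock_norm l 1 a \<rho> (\<lambda>w. bergman_profile l \<gamma> CARD('n) (cprod w z))"
proof -
  \<comment> \<open>maximizes \<open>\<gamma> * u - a / 2 * u\<^sup>2\<close> over \<open>u = t powr l\<close>\<close>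
  define t where "t = (\<gamma> / a) powr (1 / l)"
  have t: "t > 0" using g a by (simp add: t_def)
  have tl: "t powr l = \<gamma> / a" unfolding t_def powr_powr using l g a by simp
  define n where "n = CARD('n)"
  define s where "s = real n * (l - 1)"
  have s: "s \<ge> 0" using l by (simp add: s_def)
  obtain c1 where c1: "c1 > 0" "\<And>(z :: complex ^ 'n) f. f \<in> Fock_space l 1 a \<rho> \<Longrightarrow>
    c1 * norm (f (t *\<^sub>R z)) * (1 + norm z) powr (\<rho> - 2 * real CARD('n) * (l - 1)) * exp (- (a / 2) * (t * norm z) powr (2 * l))
      \<le> Fock_norm l 1 a \<rho> f"
    using Fock_norm_1_point_lower[OF l a t, where 'n = 'n and \<rho> = \<rho>] by blast
  obtain c2 where c2: "c2 > 0" "\<And>x. x \<ge> 0 \<Longrightarrow> c2 * (1 + x) powr s * exp (\<gamma> * x powr l) \<le> real_profile l \<gamma> n x"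
    using real_profile_lower[OF l g, of n] unfolding s_def by blast
  define b where "b = (min 1 t / 2) powr s"
  have b: "b > 0" using t by (simp add: b_def)
  show ?thesis
  proof (intro exI[of _ "c1 * (b * c2)"] conjI allI)
    show "c1 * (b * c2) > 0" using c1(1) c2(1) b by simp
    fix z :: "complex ^ 'n"
    define Z where "Z = norm z"
    have Z0: "Z \<ge> 0" by (simp add: Z_def)
    define x where "x = t * Z\<^sup>2"
    have x0: "x \<ge> 0" using t by (simp add: x_def)
    define T where "T = Z powr (2 * l)"
    have Z2l: "(Z\<^sup>2) powr l = T" unfolding T_def using Z0 powr_powr[of Z 2 l] by (cases "Z = 0") (auto simp: powr_numeral)
    have cp: "cprod (t *\<^sub>R z) z = of_real x"
    proof -
      have "t *\<^sub>R z = of_real t *s z" by (simp add: vec_eq_iff scaleR_conv_of_real[where 'a = complex])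
      then show ?thesis by (simp add: cprod_smult cprod_self x_def Z_def)
    qed
    have xl: "x powr l = \<gamma> / a * T" unfolding x_def powr_mult tl Z2l ..
    have t2l: "(t * Z) powr (2 * l) = (\<gamma> / a)\<^sup>2 * T"
    proof -
      have "t powr (2 * l) = (t powr l)\<^sup>2" using powr_add[of t l l] by (simp add: power2_eq_square)
      then show ?thesis unfolding powr_mult tl T_def by simp
    qed
    have "min 1 t / 2 * (1 + Z)\<^sup>2 \<le> 1 + x"
    proof -
      have "(1 + Z)\<^sup>2 \<le> 2 * (1 + Z\<^sup>2)" using zero_le_power2[of "1 - Z"] by (simp add: power2_eq_square algebra_simps)
      then have "min 1 t / 2 * (1 + Z)\<^sup>2 \<le> min 1 t / 2 * (2 * (1 + Z\<^sup>2))" using t by (intro mult_left_mono) auto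
      also have "\<dots> = min 1 t + min 1 t * Z\<^sup>2" by (simp add: distrib_left)
      also have "\<dots> \<le> 1 + x" unfolding x_def by (intro add_mono mult_right_mono) auto
      finally show ?thesis .
    qed
    then have "(min 1 t / 2 * (1 + Z)\<^sup>2) powr s \<le> (1 + x) powr s" using s t by (intro powr_mono2) auto
    moreover have "((1 + Z)\<^sup>2) powr s = (1 + Z) powr (2 * s)" using Z0 powr_powr[of "1 + Z" 2 s] by (simp add: powr_numeral)
    ultimately have xs: "b * (1 + Z) powr (2 * s) \<le> (1 + x) powr s" unfolding powr_mult b_def by (simp only:)
    have "c2 * (b * (1 + Z) powr (2 * s)) * exp (\<gamma> * (\<gamma> / a * T)) \<le> c2 * (1 + x) powr s * exp (\<gamma> * (\<gamma> / a * T))"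
      using xs c2(1) by (intro mult_right_mono mult_left_mono) auto
    also have "\<dots> \<le> real_profile l \<gamma> n x" using c2(2)[OF x0] by (simp only: xl)
    also have "\<dots> \<le> norm (bergman_profile l \<gamma> n (cprod (t *\<^sub>R z) z))"
      unfolding real_profile_def cp by (rule complex_Re_le_cmod)
    finally have K: "c2 * (b * (1 + Z) powr (2 * s)) * exp (\<gamma> * (\<gamma> / a * T)) \<le> norm (bergman_profile l \<gamma> n (cprod (t *\<^sub>R z) z))" .
    have ex: "\<gamma> * (\<gamma> / a * T) + - (a / 2) * ((\<gamma> / a)\<^sup>2 * T) = \<gamma>\<^sup>2 * T / (2 * a)"
      using a by (simp add: power2_eq_square field_simps)
    have "c1 * (b * c2) * ((1 + Z) powr \<rho> * exp (\<gamma>\<^sup>2 * T / (2 * a)))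
      = c1 * (b * c2) * ((1 + Z) powr (2 * s + (\<rho> - 2 * s)) * exp (\<gamma> * (\<gamma> / a * T) + - (a / 2) * ((\<gamma> / a)\<^sup>2 * T)))"
      unfolding ex by simp
    also have "\<dots> = c1 * (c2 * (b * (1 + Z) powr (2 * s)) * exp (\<gamma> * (\<gamma> / a * T))) * (1 + Z) powr (\<rho> - 2 * s) * exp (- (a / 2) * ((\<gamma> / a)\<^sup>2 * T))"
      unfolding powr_add exp_add by (simp only: mult_ac)
    also have "\<dots> \<le> c1 * norm (bergman_profile l \<gamma> n (cprod (t *\<^sub>R z) z)) * (1 + Z) powr (\<rho> - 2 * s) * exp (- (a / 2) * ((\<gamma> / a)\<^sup>2 * T))"
      using K c1(1) by (intro mult_right_mono mult_left_mono) auto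
    also have "\<dots> \<le> Fock_norm l 1 a \<rho> (\<lambda>w. bergman_profile l \<gamma> CARD('n) (cprod w z))"
      using c1(2)[OF mem[of z], of z] unfolding t2l[unfolded Z_def] Z_def s_def n_def by (simp only: mult.assoc)
    finally show "c1 * (b * c2) * ((1 + norm z) powr \<rho> * exp (\<gamma>\<^sup>2 * norm z powr (2 * l) / (2 * a)))
      \<le> Fock_norm l 1 a \<rho> (\<lambda>w. bergman_profile l \<gamma> CARD('n) (cprod w z))" unfolding T_def Z_def .
  qed
qed

section \<open>The factorization and its norms\<close>

lemma E_classI:
  assumes hol: "f holomorphic_on UNIV" and tau: "\<tau> \<ge> 0" and bd: "\<And>x. norm (f x) \<le> C * exp (\<tau> * norm x powr l)"
  shows "f \<in> E_class l"
proof -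
  have "norm (f x) \<le> \<bar>C\<bar> * exp ((\<tau> + 1) * norm x powr l)" for x
  proof -
    have "norm (f x) \<le> C * exp (\<tau> * norm x powr l)" by (rule bd)
    also have "\<dots> \<le> \<bar>C\<bar> * exp ((\<tau> + 1) * norm x powr l)" by (intro mult_mono) (auto simp: mult_right_mono)
    finally show ?thesis .
  qed
  then have "(\<lambda>x. norm (f x)) \<in> O[at_infinity](\<lambda>x. exp ((\<tau> + 1) * norm x powr l))"
    by (intro bigoI[of _ "\<bar>C\<bar>"] always_eventually) auto
  then show ?thesis unfolding E_class_def using hol tau by (auto intro!: exI[of _ "\<tau> + 1"])
qed

lemma E_class_growthI:
  assumes l: "l \<ge> 1" and g: "g > 0" and hol: "f holomorphic_on UNIV" and C: "C \<ge> 0"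
    and bd: "\<And>x. norm (f x) \<le> C * (1 + norm x) powr s * exp (g * angular_growth l x)"
  shows "f \<in> E_class l"
proof -
  obtain D where D: "D > 0" "\<And>t. t \<ge> 0 \<Longrightarrow> (1 + t) powr s \<le> D * exp (1 * t powr l)"
    using powr_shift_le_exp[OF l, of 1 s] by auto
  have "norm (f x) \<le> (C * D) * exp ((1 + g) * norm x powr l)" for x
  proof -
    have "norm (f x) \<le> C * (1 + norm x) powr s * exp (g * angular_growth l x)" by (rule bd)
    also have "\<dots> \<le> C * (D * exp (1 * norm x powr l)) * exp (g * norm x powr l)"
      using C D(1) D(2)[of "norm x"] g angular_growth_bounds(2)[of l x] by (intro mult_mono) auto
    also have "\<dots> = (C * D) * exp ((1 + g) * norm x powr l)" unfolding distrib_right exp_add by (simp only: mult_ac)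
    finally show ?thesis .
  qed
  from E_classI[OF hol _ this] g show ?thesis by simp
qed

text \<open>For conjugate exponents the powers of \<open>1 + \<bar>z\<bar>\<close> coming from the widths of the Gaussians add up to
\<open>- 2 * n * (l - 1)\<close>, which cancels the growth \<open>2 * (s + t)\<close> of the two factors.\<close>

lemma Fock_norm_product_growth:
  fixes l \<alpha> \<beta> \<gamma> \<rho> \<eta> :: real
  assumes l: "l \<ge> 1" and al: "\<alpha> > 0" and be: "\<beta> > 0" and ga: "\<gamma> > 0" and p: "1 \<le> p"
    and s: "s \<ge> 0" "t \<ge> 0" "s + t = real CARD('n) * (l - 1)"
    and G: "G holomorphic_on UNIV" "A \<ge> 0" "\<And>x. norm (G x) \<le> A * (1 + norm x) powr s * exp (\<alpha> * \<gamma> / (\<alpha> + \<beta>) * angular_growth l x)"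
    and H: "H holomorphic_on UNIV" "B \<ge> 0" "\<And>x. norm (H x) \<le> B * (1 + norm x) powr t * exp (\<beta> * \<gamma> / (\<alpha> + \<beta>) * angular_growth l x)"
  shows "\<exists>C>0. \<forall>z :: complex ^ 'n. (\<lambda>w. G (cprod w z)) \<in> Fock_space l p \<alpha> \<rho> \<and> (\<lambda>w. H (cprod w z)) \<in> Fock_space l (conj_exponent p) \<beta> \<eta> \<and>
    Fock_norm l p \<alpha> \<rho> (\<lambda>w. G (cprod w z)) * Fock_norm l (conj_exponent p) \<beta> \<eta> (\<lambda>w. H (cprod w z))
      \<le> C * ((1 + norm z) powr (\<rho> + \<eta>) * exp (\<gamma>\<^sup>2 * norm z powr (2 * l) / (2 * (\<alpha> + \<beta>))))"
proof -
  define m where "m = real CARD('n) * (l - 1)"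
  define a b where "a = \<alpha> * \<gamma> / (\<alpha> + \<beta>)" and "b = \<beta> * \<gamma> / (\<alpha> + \<beta>)"
  have ab: "a > 0" "b > 0" using al be ga by (auto simp: a_def b_def)
  define e1 e2 where "e1 = \<rho> + 2 * s - 2 * m * inv_exponent p" and "e2 = \<eta> + 2 * t - 2 * m * inv_exponent (conj_exponent p)"
  obtain K where K: "K > 0" "\<And>z :: complex ^ 'n. (\<lambda>w. G (cprod w z)) \<in> Fock_space l p \<alpha> \<rho>"
     "\<And>z :: complex ^ 'n. Fock_norm l p \<alpha> \<rho> (\<lambda>w. G (cprod w z)) \<le> K * (1 + norm z) powr e1 * exp (a\<^sup>2 / (2 * \<alpha>) * norm z powr (2 * l))"
    using Fock_norm_cprod_growth[OF l al ab(1) s(1) G(2,1) G(3)[folded a_def] p, where 'n = 'n and \<rho> = \<rho>] unfolding e1_def m_def mult.assoc by blast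
  obtain L where L: "L > 0" "\<And>z :: complex ^ 'n. (\<lambda>w. H (cprod w z)) \<in> Fock_space l (conj_exponent p) \<beta> \<eta>"
     "\<And>z :: complex ^ 'n. Fock_norm l (conj_exponent p) \<beta> \<eta> (\<lambda>w. H (cprod w z)) \<le> L * (1 + norm z) powr e2 * exp (b\<^sup>2 / (2 * \<beta>) * norm z powr (2 * l))"
    using Fock_norm_cprod_growth[OF l be ab(2) s(2) H(2,1) H(3)[folded b_def] conj_exponent_ge_1[OF p], where 'n = 'n and \<rho> = \<eta>] unfolding e2_def m_def mult.assoc by blast
  have "e1 + e2 = \<rho> + \<eta> + 2 * (s + t) - 2 * m * (inv_exponent p + inv_exponent (conj_exponent p))"
    unfolding e1_def e2_def distrib_left by linarith
  then have e: "e1 + e2 = \<rho> + \<eta>" unfolding inv_exponent_conj[OF p] s(3) m_def by simp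
  have abs: "a\<^sup>2 / (2 * \<alpha>) + b\<^sup>2 / (2 * \<beta>) = \<gamma>\<^sup>2 / (2 * (\<alpha> + \<beta>))"
  proof -
    have "a\<^sup>2 / (2 * \<alpha>) = \<alpha> * (\<gamma>\<^sup>2 / (2 * (\<alpha> + \<beta>)\<^sup>2))" unfolding a_def power_divide power_mult_distrib using al by (simp add: power2_eq_square)
    moreover have "b\<^sup>2 / (2 * \<beta>) = \<beta> * (\<gamma>\<^sup>2 / (2 * (\<alpha> + \<beta>)\<^sup>2))" unfolding b_def power_divide power_mult_distrib using be by (simp add: power2_eq_square)
    ultimately have "a\<^sup>2 / (2 * \<alpha>) + b\<^sup>2 / (2 * \<beta>) = (\<alpha> + \<beta>) * (\<gamma>\<^sup>2 / (2 * (\<alpha> + \<beta>)\<^sup>2))" by (simp only: distrib_right)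
    also have "\<dots> = \<gamma>\<^sup>2 / (2 * (\<alpha> + \<beta>))" using al be by (simp add: power2_eq_square)
    finally show ?thesis .
  qed
  show ?thesis
  proof (intro exI[of _ "K * L"] conjI allI K(2) L(2))
    show "K * L > 0" using K(1) L(1) by simp
    fix z :: "complex ^ 'n"
    define T where "T = norm z powr (2 * l)"
    have "Fock_norm l p \<alpha> \<rho> (\<lambda>w. G (cprod w z)) * Fock_norm l (conj_exponent p) \<beta> \<eta> (\<lambda>w. H (cprod w z))
      \<le> (K * (1 + norm z) powr e1 * exp (a\<^sup>2 / (2 * \<alpha>) * T)) * (L * (1 + norm z) powr e2 * exp (b\<^sup>2 / (2 * \<beta>) * T))"
      unfolding T_def using K L by (intro mult_mono K(3) L(3) Fock_norm_nonneg) auto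
    also have "\<dots> = K * L * ((1 + norm z) powr (e1 + e2) * exp ((a\<^sup>2 / (2 * \<alpha>) + b\<^sup>2 / (2 * \<beta>)) * T))"
      unfolding powr_add distrib_right[of _ _ T] exp_add by (simp only: mult_ac)
    finally show "Fock_norm l p \<alpha> \<rho> (\<lambda>w. G (cprod w z)) * Fock_norm l (conj_exponent p) \<beta> \<eta> (\<lambda>w. H (cprod w z))
      \<le> K * L * ((1 + norm z) powr (\<rho> + \<eta>) * exp (\<gamma>\<^sup>2 * norm z powr (2 * l) / (2 * (\<alpha> + \<beta>))))"
      unfolding e abs T_def by simp
  qed
qed

text \<open>The strict inequality for the types leaves an exponential factor that absorbs the power of \<open>1 + \<bar>z\<bar>\<close>, whatever its sign.\<close>

lemma Fock_norm_product_type: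
  fixes l \<alpha> \<beta> \<gamma> \<rho> \<eta> :: real
  assumes l: "l \<ge> 1" and al: "\<alpha> > 0" and be: "\<beta> > 0" and p: "1 \<le> p"
    and ts: "\<tau> \<ge> 0" "\<sigma> \<ge> 0" "\<tau>\<^sup>2 / (2 * \<alpha>) + \<sigma>\<^sup>2 / (2 * \<beta>) < Q"
    and G: "G holomorphic_on UNIV" "A \<ge> 0" "\<And>x. norm (G x) \<le> A * exp (\<tau> * norm x powr l)"
    and H: "H holomorphic_on UNIV" "B \<ge> 0" "\<And>x. norm (H x) \<le> B * exp (\<sigma> * norm x powr l)"
  shows "\<exists>C>0. \<forall>z :: complex ^ 'n. (\<lambda>w. G (cprod w z)) \<in> Fock_space l p \<alpha> \<rho> \<and> (\<lambda>w. H (cprod w z)) \<in> Fock_space l (conj_exponent p) \<beta> \<eta> \<and>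
    Fock_norm l p \<alpha> \<rho> (\<lambda>w. G (cprod w z)) * Fock_norm l (conj_exponent p) \<beta> \<eta> (\<lambda>w. H (cprod w z))
      \<le> C * ((1 + norm z) powr (\<rho> + \<eta>) * exp (Q * norm z powr (2 * l)))"
proof -
  define d where "d = (Q - (\<tau>\<^sup>2 / (2 * \<alpha>) + \<sigma>\<^sup>2 / (2 * \<beta>))) / 3"
  have d: "d > 0" using ts(3) by (simp add: d_def)
  define q1 q2 where "q1 = \<tau>\<^sup>2 / (2 * \<alpha>) + d" and "q2 = \<sigma>\<^sup>2 / (2 * \<beta>) + d"
  have q: "\<tau>\<^sup>2 / (2 * \<alpha>) < q1" "\<sigma>\<^sup>2 / (2 * \<beta>) < q2" "d + (q1 + q2) = Q"
  proof -
    have "3 * d = Q - (\<tau>\<^sup>2 / (2 * \<alpha>) + \<sigma>\<^sup>2 / (2 * \<beta>))" by (simp add: d_def)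
    then show "\<tau>\<^sup>2 / (2 * \<alpha>) < q1" "\<sigma>\<^sup>2 / (2 * \<beta>) < q2" "d + (q1 + q2) = Q" using d unfolding q1_def q2_def by linarith+
  qed
  obtain K where K: "K > 0" "\<And>z :: complex ^ 'n. (\<lambda>w. G (cprod w z)) \<in> Fock_space l p \<alpha> \<rho>"
     "\<And>z :: complex ^ 'n. Fock_norm l p \<alpha> \<rho> (\<lambda>w. G (cprod w z)) \<le> K * exp (q1 * norm z powr (2 * l))"
    using Fock_norm_cprod_type[OF l al ts(1) G(2,1,3) p q(1), where 'n = 'n and \<rho> = \<rho>] by blast
  obtain L where L: "L > 0" "\<And>z :: complex ^ 'n. (\<lambda>w. H (cprod w z)) \<in> Fock_space l (conj_exponent p) \<beta> \<eta>"
     "\<And>z :: complex ^ 'n. Fock_norm l (conj_exponent p) \<beta> \<eta> (\<lambda>w. H (cprod w z)) \<le> L * exp (q2 * norm z powr (2 * l))"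
    using Fock_norm_cprod_type[OF l be ts(2) H(2,1,3) conj_exponent_ge_1[OF p] q(2), where 'n = 'n and \<rho> = \<eta>] by blast
  obtain M where M: "M > 0" "\<And>t. t \<ge> 0 \<Longrightarrow> (1 + t) powr (- (\<rho> + \<eta>)) \<le> M * exp (d * t powr (2 * l))"
    using powr_shift_le_exp[of "2 * l" d "- (\<rho> + \<eta>)"] l d by auto
  show ?thesis
  proof (intro exI[of _ "K * L * M"] conjI allI K(2) L(2))
    show "K * L * M > 0" using K(1) L(1) M(1) by simp
    fix z :: "complex ^ 'n"
    define T where "T = norm z powr (2 * l)"
    define Y where "Y = (1 + norm z) powr (\<rho> + \<eta>)"
    have YY: "(1 + norm z) powr (- (\<rho> + \<eta>)) * Y = 1" unfolding Y_def using add_pos_nonneg[of 1 "norm z"] by (simp flip: powr_add)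
    have "(1 + norm z) powr (- (\<rho> + \<eta>)) * Y \<le> M * exp (d * T) * Y" unfolding T_def by (intro mult_right_mono M(2)) (auto simp: Y_def)
    then have one: "1 \<le> M * exp (d * T) * Y" unfolding YY .
    have "Fock_norm l p \<alpha> \<rho> (\<lambda>w. G (cprod w z)) * Fock_norm l (conj_exponent p) \<beta> \<eta> (\<lambda>w. H (cprod w z))
      \<le> (K * exp (q1 * T)) * (L * exp (q2 * T))"
      unfolding T_def using K L by (intro mult_mono K(3) L(3) Fock_norm_nonneg) auto
    also have "\<dots> = (K * exp (q1 * T)) * (L * exp (q2 * T)) * 1" by simp
    also have "\<dots> \<le> (K * exp (q1 * T)) * (L * exp (q2 * T)) * (M * exp (d * T) * Y)"
      using one K(1) L(1) by (intro mult_left_mono) auto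
    also have "\<dots> = K * L * M * (Y * exp ((d + (q1 + q2)) * T))"
      unfolding distrib_right[of _ _ T] exp_add by (simp only: mult_ac)
    finally show "Fock_norm l p \<alpha> \<rho> (\<lambda>w. G (cprod w z)) * Fock_norm l (conj_exponent p) \<beta> \<eta> (\<lambda>w. H (cprod w z))
      \<le> K * L * M * ((1 + norm z) powr (\<rho> + \<eta>) * exp (Q * norm z powr (2 * l)))"
      unfolding q(3) T_def Y_def .
  qed
qed

text \<open>Leibniz' rule applied to the product in the definition of \<^term>\<open>factor_remainder\<close>; one of the derivatives is
already present there, so \<open>N\<close> further ones give \<open>Suc N\<close> products.\<close>

lemma higher_deriv_ml_decomposition:
  assumes l: "l \<ge> 1"
  shows "(deriv ^^ Suc N) (scaled_ml l (a + b)) x =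
    (\<Sum>k<Suc N. (of_real ((a + b) / (l * b) * real (N choose k)) * (deriv ^^ k) (scaled_ml l a) x) * (deriv ^^ (Suc N - k)) (scaled_ml l b) x)
    + (deriv ^^ N) (factor_remainder l a b) x"
proof -
  let ?A = "scaled_ml l a" and ?B = "deriv (scaled_ml l b)" and ?R = "factor_remainder l a b"
  let ?k = "complex_of_real ((a + b) / (l * b))"
  have A: "?A holomorphic_on UNIV" by (rule scaled_ml_holomorphic[OF l])
  have B: "?B holomorphic_on UNIV" by (intro holomorphic_deriv scaled_ml_holomorphic[OF l] open_UNIV)
  have R: "?R holomorphic_on UNIV" by (rule factor_remainder_holomorphic[OF l])
  have AB: "(\<lambda>x. ?A x * ?B x) holomorphic_on UNIV" using A B by (rule holomorphic_on_mult)
  have kAB: "(\<lambda>x. ?k * (?A x * ?B x)) holomorphic_on UNIV" by (rule holomorphic_on_mult[OF holomorphic_on_const AB])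
  have "deriv (scaled_ml l (a + b)) = (\<lambda>x. ?k * (?A x * ?B x) + ?R x)" by (simp add: factor_remainder_def fun_eq_iff)
  then have "(deriv ^^ Suc N) (scaled_ml l (a + b)) x = (deriv ^^ N) (\<lambda>x. ?k * (?A x * ?B x) + ?R x) x"
    unfolding funpow_Suc_right o_def by simp
  also have "\<dots> = (deriv ^^ N) (\<lambda>x. ?k * (?A x * ?B x)) x + (deriv ^^ N) ?R x"
    by (rule higher_deriv_add[OF kAB R]) auto
  also have "(deriv ^^ N) (\<lambda>x. ?k * (?A x * ?B x)) x = ?k * (deriv ^^ N) (\<lambda>x. ?A x * ?B x) x"
    by (rule higher_deriv_cmult[OF AB]) auto
  also have "(deriv ^^ N) (\<lambda>x. ?A x * ?B x) x = (\<Sum>k = 0..N. of_nat (N choose k) * (deriv ^^ k) ?A x * (deriv ^^ (N - k)) ?B x)"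
    by (rule higher_deriv_mult[OF A B]) auto
  also have "?k * \<dots> = (\<Sum>k<Suc N. (of_real ((a + b) / (l * b) * real (N choose k)) * (deriv ^^ k) ?A x) * (deriv ^^ (Suc N - k)) (scaled_ml l b) x)"
    unfolding sum_distrib_left
  proof (rule sum.cong)
    fix k assume "k \<in> {..<Suc N}"
    then have k: "Suc N - k = Suc (N - k)" by auto
    show "?k * (of_nat (N choose k) * (deriv ^^ k) ?A x * (deriv ^^ (N - k)) ?B x)
      = (of_real ((a + b) / (l * b) * real (N choose k)) * (deriv ^^ k) ?A x) * (deriv ^^ (Suc N - k)) (scaled_ml l b) x"
      unfolding k funpow_Suc_right o_def of_real_mult of_real_of_nat_eq by (simp only: mult.assoc)
  qed auto
  finally show ?thesis .
qed

text \<open>The first \<open>n\<close> pairs come from Leibniz' rule. The last pair consists of the remainder and 1, in the order that puts the remainder into the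
space with the larger of \<open>\<alpha>\<close> and \<open>\<beta>\<close>, called \<open>m\<close>.\<close>

lemma bergman_profile_factorization:
  assumes l: "l \<ge> 1" and al: "\<alpha> > 0" and be: "\<beta> > 0" and ga: "\<gamma> > 0" and n: "n > 0"
  obtains G H \<tau> \<sigma> A B where
    "\<And>k. k \<le> n \<Longrightarrow> G k holomorphic_on UNIV" "\<And>k. k \<le> n \<Longrightarrow> H k holomorphic_on UNIV"
    "\<And>x. bergman_profile l \<gamma> n x = (\<Sum>k = 0..n. G k x * H k x)"
    "\<And>k. k < n \<Longrightarrow> \<exists>C\<ge>0. \<forall>x. norm (G k x) \<le> C * (1 + norm x) powr (real k * (l - 1)) * exp (\<alpha> * \<gamma> / (\<alpha> + \<beta>) * angular_growth l x)"
    "\<And>k. k < n \<Longrightarrow> \<exists>C\<ge>0. \<forall>x. norm (H k x) \<le> C * (1 + norm x) powr (real (n - k) * (l - 1)) * exp (\<beta> * \<gamma> / (\<alpha> + \<beta>) * angular_growth l x)"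
    "\<tau> \<ge> 0" "\<sigma> \<ge> 0" "A \<ge> 0" "B \<ge> 0" "\<tau>\<^sup>2 / (2 * \<alpha>) + \<sigma>\<^sup>2 / (2 * \<beta>) < \<gamma>\<^sup>2 / (2 * (\<alpha> + \<beta>))"
    "\<And>x. norm (G n x) \<le> A * exp (\<tau> * norm x powr l)" "\<And>x. norm (H n x) \<le> B * exp (\<sigma> * norm x powr l)"
proof -
  define a b where "a = \<alpha> * \<gamma> / (\<alpha> + \<beta>)" and "b = \<beta> * \<gamma> / (\<alpha> + \<beta>)"
  have ab: "a > 0" "b > 0" using al be ga by (auto simp: a_def b_def)
  have sumab: "a + b = \<gamma>" unfolding a_def b_def using al be by (simp add: add_divide_distrib[symmetric] distrib_right[symmetric])
  obtain N where N: "n = Suc N" using n by (cases n) auto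
  define m where "m = max \<alpha> \<beta>"
  have m: "m > 0" "m < \<alpha> + \<beta>" using al be by (auto simp: m_def)
  have abm: "max a b = \<gamma> * (m / (\<alpha> + \<beta>))"
    unfolding a_def b_def m_def max_def using al be ga by (auto simp: divide_simps mult_le_cancel_left)
  \<comment> \<open>types of the remainder must exceed \<open>max a b = \<gamma> * m / (\<alpha> + \<beta>)\<close>, and a type \<open>t\<close> is admissible if \<open>t\<^sup>2 / (2 * m) < \<gamma>\<^sup>2 / (2 * (\<alpha> + \<beta>))\<close>\<close>
  have "m / (\<alpha> + \<beta>) < sqrt (m / (\<alpha> + \<beta>))"
  proof (rule real_less_rsqrt)
    have "m / (\<alpha> + \<beta>) * (m / (\<alpha> + \<beta>)) < m / (\<alpha> + \<beta>) * 1" using m by (intro mult_strict_left_mono) auto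
    then show "(m / (\<alpha> + \<beta>))\<^sup>2 < m / (\<alpha> + \<beta>)" by (simp add: power2_eq_square)
  qed
  then have "max a b < \<gamma> * sqrt (m / (\<alpha> + \<beta>))" unfolding abm by (rule mult_strict_left_mono[OF _ ga])
  then obtain t where t: "max a b < t" "t < \<gamma> * sqrt (m / (\<alpha> + \<beta>))" using dense by blast
  \<comment> \<open>\<open>t0\<close> for the remainder itself, \<open>t\<close> for its derivatives\<close>
  obtain t0 where t0: "max a b < t0" "t0 < t" using dense[OF t(1)] by blast
  have tp: "0 \<le> t" "0 \<le> t0" using t t0 ab by auto
  have "t\<^sup>2 < (\<gamma> * sqrt (m / (\<alpha> + \<beta>)))\<^sup>2" using t tp by (intro power_strict_mono) auto
  also have "\<dots> = \<gamma>\<^sup>2 * (m / (\<alpha> + \<beta>))" using m by (simp add: power_mult_distrib)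
  finally have "t\<^sup>2 / (2 * m) < \<gamma>\<^sup>2 * (m / (\<alpha> + \<beta>)) / (2 * m)" using m by (intro divide_strict_right_mono) auto
  also have "\<dots> = \<gamma>\<^sup>2 / (2 * (\<alpha> + \<beta>))" using m by simp
  finally have tq: "t\<^sup>2 / (2 * m) < \<gamma>\<^sup>2 / (2 * (\<alpha> + \<beta>))" .
  define D where "D x = (deriv ^^ N) (factor_remainder l a b) x / fact n" for x
  have Dhol: "D holomorphic_on UNIV" unfolding D_def
    by (intro holomorphic_intros holomorphic_higher_deriv factor_remainder_holomorphic[OF l] open_UNIV) auto
  obtain E0 where E0: "E0 > 0" "\<And>x. norm (factor_remainder l a b x) \<le> E0 * exp (t0 * norm x powr l)"
    using factor_remainder_bound[OF l ab, of t0] t0 by auto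
  obtain E where E: "E > 0" "\<And>x. norm ((deriv ^^ N) (factor_remainder l a b) x) \<le> E * exp (t * norm x powr l)"
    using higher_deriv_type_bound[OF l factor_remainder_holomorphic[OF l] E0(2) tp(2) t0(2), of N] by blast
  have Dbd: "norm (D x) \<le> E * exp (t * norm x powr l)" for x
  proof -
    have "norm (D x) = norm ((deriv ^^ N) (factor_remainder l a b) x) / fact n" by (simp add: D_def norm_divide)
    also have "\<dots> \<le> norm ((deriv ^^ N) (factor_remainder l a b) x) / 1" by (intro divide_left_mono) auto
    finally show ?thesis using E(2)[of x] by simp
  qed
  define \<kappa> where "\<kappa> k = (a + b) / (l * b) * real (N choose k) / fact n" for k
  define G where "G k = (if k < n then (\<lambda>x. of_real (\<kappa> k) * (deriv ^^ k) (scaled_ml l a) x) else if \<alpha> \<ge> \<beta> then D else (\<lambda>x. 1))" for k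
  define H where "H k = (if k < n then (deriv ^^ (n - k)) (scaled_ml l b) else if \<alpha> \<ge> \<beta> then (\<lambda>x. 1) else D)" for k
  have Ghol: "G k holomorphic_on UNIV" for k
    unfolding G_def using Dhol by (auto intro!: holomorphic_intros holomorphic_higher_deriv scaled_ml_holomorphic[OF l])
  have Hhol: "H k holomorphic_on UNIV" for k
    unfolding H_def using Dhol by (auto intro!: holomorphic_intros holomorphic_higher_deriv scaled_ml_holomorphic[OF l])
  have fac: "bergman_profile l \<gamma> n x = (\<Sum>k = 0..n. G k x * H k x)" for x
  proof -
    have "bergman_profile l \<gamma> n x = (\<Sum>k<n. (of_real ((a + b) / (l * b) * real (N choose k)) * (deriv ^^ k) (scaled_ml l a) x) * (deriv ^^ (n - k)) (scaled_ml l b) x) / fact n + D x"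
      unfolding bergman_profile_def sumab[symmetric] N higher_deriv_ml_decomposition[OF l] D_def add_divide_distrib ..
    also have "(\<Sum>k<n. (of_real ((a + b) / (l * b) * real (N choose k)) * (deriv ^^ k) (scaled_ml l a) x) * (deriv ^^ (n - k)) (scaled_ml l b) x) / fact n = (\<Sum>k<n. G k x * H k x)"
      unfolding sum_divide_distrib by (intro sum.cong) (auto simp: G_def H_def \<kappa>_def)
    also have "D x = G n x * H n x" by (simp add: G_def H_def)
    finally show ?thesis by (simp add: atLeast0AtMost lessThan_Suc_atMost[symmetric])
  qed
  have Gb: "\<exists>C\<ge>0. \<forall>x. norm (G k x) \<le> C * (1 + norm x) powr (real k * (l - 1)) * exp (\<alpha> * \<gamma> / (\<alpha> + \<beta>) * angular_growth l x)" if k: "k < n" for k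
  proof -
    obtain C where C: "C > 0" "\<And>x. norm ((deriv ^^ k) (scaled_ml l a) x) \<le> C * (1 + norm x) powr (real k * (l - 1)) * exp (a * angular_growth l x)"
      using higher_deriv_scaled_ml_bound[OF l ab(1), of k] by blast
    show ?thesis
    proof (intro exI[of _ "\<bar>\<kappa> k\<bar> * C"] conjI allI)
      fix x
      have "norm (G k x) = \<bar>\<kappa> k\<bar> * norm ((deriv ^^ k) (scaled_ml l a) x)" using k by (simp add: G_def norm_mult)
      also have "\<dots> \<le> \<bar>\<kappa> k\<bar> * (C * (1 + norm x) powr (real k * (l - 1)) * exp (a * angular_growth l x))"
        by (intro mult_left_mono C(2)) simp
      finally show "norm (G k x) \<le> \<bar>\<kappa> k\<bar> * C * (1 + norm x) powr (real k * (l - 1)) * exp (\<alpha> * \<gamma> / (\<alpha> + \<beta>) * angular_growth l x)"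
        unfolding a_def by (simp only: mult.assoc)
    qed (use C in simp)
  qed
  have Hb: "\<exists>C\<ge>0. \<forall>x. norm (H k x) \<le> C * (1 + norm x) powr (real (n - k) * (l - 1)) * exp (\<beta> * \<gamma> / (\<alpha> + \<beta>) * angular_growth l x)" if k: "k < n" for k
    using higher_deriv_scaled_ml_bound[OF l ab(2), of "n - k"] k unfolding H_def b_def by (auto intro: less_imp_le)
  show thesis
  proof (cases "\<alpha> \<ge> \<beta>")
    case True
    then have "t\<^sup>2 / (2 * \<alpha>) + 0\<^sup>2 / (2 * \<beta>) < \<gamma>\<^sup>2 / (2 * (\<alpha> + \<beta>))" using tq by (simp add: m_def max_def split: if_splits)
    moreover have "norm (G n x) \<le> E * exp (t * norm x powr l)" "norm (H n x) \<le> 1 * exp (0 * norm x powr l)" for x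
      using True Dbd by (auto simp: G_def H_def)
    ultimately show thesis using that[OF Ghol Hhol fac Gb Hb, of t 0 E 1] tp E(1) by auto
  next
    case False
    then have "0\<^sup>2 / (2 * \<alpha>) + t\<^sup>2 / (2 * \<beta>) < \<gamma>\<^sup>2 / (2 * (\<alpha> + \<beta>))" using tq by (simp add: m_def max_def split: if_splits)
    moreover have "norm (G n x) \<le> 1 * exp (0 * norm x powr l)" "norm (H n x) \<le> E * exp (t * norm x powr l)" for x
      using False Dbd by (auto simp: G_def H_def)
    ultimately show thesis using that[OF Ghol Hhol fac Gb Hb, of 0 t 1 E] tp E(1) by auto
  qed
qed

lemma bergman_profile_mem_Fock_space_1:
  fixes z :: "complex ^ 'n"
  assumes l: "l \<ge> 1" and a: "a > 0" and g: "\<gamma> > 0"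
  shows "(\<lambda>w. bergman_profile l \<gamma> n (cprod w z)) \<in> Fock_space l 1 a \<rho>"
proof -
  obtain C where C: "C > 0" "\<And>x. norm (bergman_profile l \<gamma> n x) \<le> C * exp (2 * \<gamma> * norm x powr l)"
    using bergman_profile_type[OF l g] by blast
  from Fock_norm_cprod_type[OF l a _ _ bergman_profile_holomorphic[OF l] C(2), of 1 "(2 * \<gamma>)\<^sup>2 / (2 * a) + 1" \<rho>] C(1) g
  show ?thesis by auto
qed

lemma lesssim_trans: "lesssim \<Phi> \<Psi> \<Longrightarrow> lesssim \<Psi> \<Theta> \<Longrightarrow> lesssim \<Phi> \<Theta>"
proof -
  assume "lesssim \<Phi> \<Psi>" "lesssim \<Psi> \<Theta>"
  then obtain C D where C: "C > 0" "\<And>z. \<Phi> z \<le> C * \<Psi> z" and D: "D > 0" "\<And>z. \<Psi> z \<le> D * \<Theta> z"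
    unfolding lesssim_def by blast
  have "\<Phi> z \<le> C * D * \<Theta> z" for z
    using C(2)[of z] mult_left_mono[OF D(2)[of z] less_imp_le[OF C(1)]] by (simp add: mult.assoc)
  then show "lesssim \<Phi> \<Theta>" unfolding lesssim_def using C(1) D(1) by (intro exI[of _ "C * D"]) simp
qed

lemma simeq_cycle:
  assumes "lesssim \<Phi> \<Psi>" "lesssim \<Psi> \<Theta>" "lesssim \<Theta> \<Phi>"
  shows "\<Phi> \<simeq> \<Psi>" and "\<Psi> \<simeq> \<Theta>"
  using assms lesssim_trans unfolding simeq_def by blast+

theorem theorem1p3:
  fixes l \<alpha> \<beta> \<gamma> :: real
  assumes "l \<ge> 1" and "\<alpha> > 0" and "\<beta> > 0" and "\<gamma> > 0"
  shows "\<exists>G H :: nat \<Rightarrow> complex \<Rightarrow> complex.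
    (\<forall>k \<le> CARD('n). G k \<in> E_class l \<and> H k \<in> E_class l) \<and>
    (\<forall>w z :: complex ^ 'n.
       Bergman_kernel l \<gamma> w z = (\<Sum>k = 0..CARD('n). G k (cprod w z) * H k (cprod w z))) \<and>
    (\<forall>p \<rho> \<eta>. 1 \<le> p \<longrightarrow>
       (\<forall>z :: complex ^ 'n.
          (\<lambda>w. Bergman_kernel l \<gamma> w z) \<in> Fock_space l 1 (\<alpha> + \<beta>) (\<rho> + \<eta>) \<and>
          (\<forall>k \<le> CARD('n).
             (\<lambda>w. G k (cprod w z)) \<in> Fock_space l p \<alpha> \<rho> \<and>
             (\<lambda>w. H k (cprod w z)) \<in> Fock_space l (conj_exponent p) \<beta> \<eta>)) \<and>
       (\<lambda>z :: complex ^ 'n. Fock_norm l 1 (\<alpha> + \<beta>) (\<rho> + \<eta>) (\<lambda>w. Bergman_kernel l \<gamma> w z))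
         \<simeq> (\<lambda>z. \<Sum>k = 0..CARD('n).
               Fock_norm l p \<alpha> \<rho> (\<lambda>w. G k (cprod w z)) *
               Fock_norm l (conj_exponent p) \<beta> \<eta> (\<lambda>w. H k (cprod w z))) \<and>
       (\<lambda>z :: complex ^ 'n. \<Sum>k = 0..CARD('n).
               Fock_norm l p \<alpha> \<rho> (\<lambda>w. G k (cprod w z)) *
               Fock_norm l (conj_exponent p) \<beta> \<eta> (\<lambda>w. H k (cprod w z)))
         \<simeq> (\<lambda>z. (1 + norm z) powr (\<rho> + \<eta>) *
                  exp (\<gamma>\<^sup>2 * norm z powr (2 * l) / (2 * (\<alpha> + \<beta>)))))"
proof -
  define n where "n = CARD('n)"
  have n: "n > 0" by (simp add: n_def)
  have l: "l \<ge> 1" and al: "\<alpha> > 0" and be: "\<beta> > 0" and ga: "\<gamma> > 0" by fact+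
  obtain G H \<tau> \<sigma> A B where
    Ghol: "\<And>k. k \<le> n \<Longrightarrow> G k holomorphic_on UNIV" and Hhol: "\<And>k. k \<le> n \<Longrightarrow> H k holomorphic_on UNIV"
    and fac: "\<And>x. bergman_profile l \<gamma> n x = (\<Sum>k = 0..n. G k x * H k x)"
    and Gb: "\<And>k. k < n \<Longrightarrow> \<exists>C\<ge>0. \<forall>x. norm (G k x) \<le> C * (1 + norm x) powr (real k * (l - 1)) * exp (\<alpha> * \<gamma> / (\<alpha> + \<beta>) * angular_growth l x)"
    and Hb: "\<And>k. k < n \<Longrightarrow> \<exists>C\<ge>0. \<forall>x. norm (H k x) \<le> C * (1 + norm x) powr (real (n - k) * (l - 1)) * exp (\<beta> * \<gamma> / (\<alpha> + \<beta>) * angular_growth l x)"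
    and ts: "\<tau> \<ge> 0" "\<sigma> \<ge> 0" and AB: "A \<ge> 0" "B \<ge> 0"
    and Q: "\<tau>\<^sup>2 / (2 * \<alpha>) + \<sigma>\<^sup>2 / (2 * \<beta>) < \<gamma>\<^sup>2 / (2 * (\<alpha> + \<beta>))"
    and Gn: "\<And>x. norm (G n x) \<le> A * exp (\<tau> * norm x powr l)" and Hn: "\<And>x. norm (H n x) \<le> B * exp (\<sigma> * norm x powr l)"
    using bergman_profile_factorization[OF l al be ga n] by blast
  have kernel: "Bergman_kernel l \<gamma> w z = bergman_profile l \<gamma> CARD('n) (cprod w z)" for w z :: "complex ^ 'n"
    by (rule Bergman_kernel_eq[OF l ga])
  have ab: "\<alpha> * \<gamma> / (\<alpha> + \<beta>) > 0" "\<beta> * \<gamma> / (\<alpha> + \<beta>) > 0" "\<alpha> + \<beta> > 0" using al be ga by auto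
  have E: "G k \<in> E_class l \<and> H k \<in> E_class l" if k: "k \<le> n" for k
  proof (cases "k = n")
    case True
    then show ?thesis using E_classI[OF Ghol[OF k] ts(1)] E_classI[OF Hhol[OF k] ts(2)] Gn Hn by blast
  next
    case False
    then have k': "k < n" using k by simp
    show ?thesis
      using Gb[OF k'] Hb[OF k'] E_class_growthI[OF l ab(1) Ghol[OF k]] E_class_growthI[OF l ab(2) Hhol[OF k]] by blast
  qed
  have main: "(\<forall>z :: complex ^ 'n.
          (\<lambda>w. Bergman_kernel l \<gamma> w z) \<in> Fock_space l 1 (\<alpha> + \<beta>) (\<rho> + \<eta>) \<and>
          (\<forall>k \<le> CARD('n).
             (\<lambda>w. G k (cprod w z)) \<in> Fock_space l p \<alpha> \<rho> \<and>
             (\<lambda>w. H k (cprod w z)) \<in> Fock_space l (conj_exponent p) \<beta> \<eta>)) \<and>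
       (\<lambda>z :: complex ^ 'n. Fock_norm l 1 (\<alpha> + \<beta>) (\<rho> + \<eta>) (\<lambda>w. Bergman_kernel l \<gamma> w z))
         \<simeq> (\<lambda>z. \<Sum>k = 0..CARD('n).
               Fock_norm l p \<alpha> \<rho> (\<lambda>w. G k (cprod w z)) *
               Fock_norm l (conj_exponent p) \<beta> \<eta> (\<lambda>w. H k (cprod w z))) \<and>
       (\<lambda>z :: complex ^ 'n. \<Sum>k = 0..CARD('n).
               Fock_norm l p \<alpha> \<rho> (\<lambda>w. G k (cprod w z)) *
               Fock_norm l (conj_exponent p) \<beta> \<eta> (\<lambda>w. H k (cprod w z)))
         \<simeq> (\<lambda>z. (1 + norm z) powr (\<rho> + \<eta>) *
                  exp (\<gamma>\<^sup>2 * norm z powr (2 * l) / (2 * (\<alpha> + \<beta>))))" if p: "1 \<le> p" for p \<rho> \<eta>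
  proof -
    let ?N = "\<lambda>z :: complex ^ 'n. Fock_norm l 1 (\<alpha> + \<beta>) (\<rho> + \<eta>) (\<lambda>w. Bergman_kernel l \<gamma> w z)"
    let ?P = "\<lambda>k (z :: complex ^ 'n). Fock_norm l p \<alpha> \<rho> (\<lambda>w. G k (cprod w z)) * Fock_norm l (conj_exponent p) \<beta> \<eta> (\<lambda>w. H k (cprod w z))"
    let ?S = "\<lambda>z :: complex ^ 'n. \<Sum>k = 0..CARD('n). ?P k z"
    let ?M = "\<lambda>z :: complex ^ 'n. (1 + norm z) powr (\<rho> + \<eta>) * exp (\<gamma>\<^sup>2 * norm z powr (2 * l) / (2 * (\<alpha> + \<beta>)))"
    have product: "\<exists>C>0. \<forall>z :: complex ^ 'n. (\<lambda>w. G k (cprod w z)) \<in> Fock_space l p \<alpha> \<rho> \<and> (\<lambda>w. H k (cprod w z)) \<in> Fock_space l (conj_exponent p) \<beta> \<eta> \<and> ?P k z \<le> C * ?M z"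
      if k: "k \<le> n" for k
    proof (cases "k = n")
      case True
      show ?thesis unfolding True
        using Fock_norm_product_type[OF l al be p ts Q Ghol[OF order_refl] AB(1) Gn Hhol[OF order_refl] AB(2) Hn, where 'n = 'n and \<rho> = \<rho> and \<eta> = \<eta>]
        by simp
    next
      case False
      then have k': "k < n" using k by simp
      obtain C where C: "C \<ge> 0" "\<And>x. norm (G k x) \<le> C * (1 + norm x) powr (real k * (l - 1)) * exp (\<alpha> * \<gamma> / (\<alpha> + \<beta>) * angular_growth l x)"
        using Gb[OF k'] by blast
      obtain D where D: "D \<ge> 0" "\<And>x. norm (H k x) \<le> D * (1 + norm x) powr (real (n - k) * (l - 1)) * exp (\<beta> * \<gamma> / (\<alpha> + \<beta>) * angular_growth l x)"
        using Hb[OF k'] by blast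
      have st: "real k * (l - 1) \<ge> 0" "real (n - k) * (l - 1) \<ge> 0" "real k * (l - 1) + real (n - k) * (l - 1) = real CARD('n) * (l - 1)"
        using l k by (auto simp: n_def of_nat_diff distrib_right[symmetric])
      show ?thesis
        by (rule Fock_norm_product_growth[OF l al be ga p st Ghol[OF k] C Hhol[OF k] D])
    qed
    have mem1: "(\<lambda>w. Bergman_kernel l \<gamma> w z) \<in> Fock_space l 1 (\<alpha> + \<beta>) (\<rho> + \<eta>)" for z :: "complex ^ 'n"
      unfolding kernel by (rule bergman_profile_mem_Fock_space_1[OF l ab(3) ga])
    have mem: "(\<lambda>w. G k (cprod w z)) \<in> Fock_space l p \<alpha> \<rho>" "(\<lambda>w. H k (cprod w z)) \<in> Fock_space l (conj_exponent p) \<beta> \<eta>"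
      if "k \<le> CARD('n)" for k and z :: "complex ^ 'n"
      using product[of k] that by (auto simp: n_def)
    have "?N z \<le> ?S z" for z
      by (rule Fock_norm_sum_products[OF p _ _ _ mem1]) (use mem kernel fac in \<open>auto simp: n_def\<close>)
    then have "lesssim ?N ?S" unfolding lesssim_def by (intro exI[of _ 1]) simp
    moreover have "lesssim ?S ?M"
    proof -
      have "\<forall>k. \<exists>C. k \<le> n \<longrightarrow> C > 0 \<and> (\<forall>z. ?P k z \<le> C * ?M z)" using product by blast
      then obtain C where C: "\<And>k. k \<le> n \<Longrightarrow> C k > 0" "\<And>k z. k \<le> n \<Longrightarrow> ?P k z \<le> C k * ?M z" by metis
      have "?S z \<le> (\<Sum>k = 0..CARD('n). C k) * ?M z" for z
        unfolding sum_distrib_right by (intro sum_mono C(2)) (simp add: n_def)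
      moreover have "(\<Sum>k = 0..CARD('n). C k) > 0" by (intro sum_pos C(1)) (auto simp: n_def)
      ultimately show ?thesis unfolding lesssim_def by blast
    qed
    moreover have "lesssim ?M ?N"
    proof -
      obtain c where c: "c > 0" "\<And>z :: complex ^ 'n. c * ?M z \<le> ?N z"
        using Fock_norm_bergman_profile_lower[where 'n = 'n and \<rho> = "\<rho> + \<eta>", OF l ab(3) ga bergman_profile_mem_Fock_space_1[OF l ab(3) ga]]
        unfolding kernel by blast
      then have "?M z \<le> 1 / c * ?N z" for z by (simp add: pos_le_divide_eq mult.commute)
      then show ?thesis unfolding lesssim_def using c(1) by (intro exI[of _ "1 / c"]) simp
    qed
    ultimately have "?N \<simeq> ?S" "?S \<simeq> ?M" by (rule simeq_cycle)+
    with mem1 mem show ?thesis by blast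
  qed
  show ?thesis
    by (intro exI[of _ G] exI[of _ H] conjI allI impI main)
      (use E in \<open>auto simp: n_def kernel fac[unfolded n_def]\<close>)
qed

end
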